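(* Let $R$ be a ring, $M$ an $R$-bimodule, $n\ge1$, $X$ a left $R$-module, $Y$ a left $R\ltimes_n M$-module, $W$ a right $R\ltimes_n M$-module and $m\ge1$. (1) If $\mathrm{Tor}^R_j(M^{\otimes_R i},X)=0$ for any $i,j\ge1$, then $\mathrm{Ext}^m_{R\ltimes_n M}(\mathbf{T}(X),Y)\cong\mathrm{Ext}^m_R(X,\mathbf{U}(Y))$. (2) If $\mathrm{Ext}_R^j(M^{\otimes_R i},X)=0$ for any $i,j\ge1$, then $\mathrm{Ext}^m_{R\ltimes_n M}(Y,\mathbf{H}(X))\cong\mathrm{Ext}^m_R(\mathbf{U}(Y),X)$. (3) If $\mathrm{Tor}^R_j(M^{\otimes_R i},X)=0$ for any $i,j\ge1$, then $\mathrm{Tor}_m^{R\ltimes_n M}(W,\mathbf{T}(X))\cong\mathrm{Tor}_m^R(\mathbf{U}(W),X)$.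
   Context: All rings are nonzero, associative, with identity; all modules are unitary. $M^{\otimes_R 0}=R$, $M^{\otimes_R 1}=M$, $M^{\otimes_R (i+1)}=M\otimes_R M^{\otimes_R i}$. The $n$-trivial extension $R\ltimes_n M$ is the abelian group $\coprod_{i=0}^n M^{\otimes_R i}$ with multiplication $(m_0,\dots,m_n)(m_0',\dots,m_n')=\big(\sum_{i+j=k}m_i\otimes m_j'\big)_{0\le k\le n}$ (using the canonical identifications $R\otimes_R N=N=N\otimes_R R$). $\mathbf{U}$ sends a left (resp. right) $R\ltimes_n M$-module to its underlying left (resp. right) $R$-module, via the ring homomorphism $R\to R\ltimes_n M$, $r\mapsto(r,0,\dots,0)$. For a left $R$-module $X$, $\mathbf{T}(X)$ is the left $R\ltimes_n M$-module $(R\ltimes_n M)\otimes_R X$; that is, $\coprod_{i=0}^n(M^{\otimes_R i}\otimes_R X)$ on which $(0,m,0,\dots,0)$ acts by $(x_0,\dots,x_n)\mapsto(0,m\otimes x_0,\dots,m\otimes x_{n-1})$. For a left $R$-module $X$, $\mathbf{H}(X)$ is the left $R\ltimes_n M$-module $\mathrm{Hom}_R(R\ltimes_n M,X)$; that is, $\coprod_{i=0}^n\mathrm{Hom}_R^i(M,X)$ on which $(0,m,0,\dots,0)$ acts by $(x_0,\dots,x_n)\mapsto(x_1(m),\dots,x_n(m),0)$, where $\mathrm{Hom}^0_R(M,X)=X$ and $\mathrm{Hom}_R^i(M,X)=\mathrm{Hom}_R(M,\mathrm{Hom}_R^{i-1}(M,X))$. *)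

theory Defs
  imports "HOL-Algebra.Module" "HOL-Algebra.Generated_Groups" "HOL-Algebra.Free_Abelian_Groups"
begin

section \<open>Modules over noncommutative rings\<close>

text \<open>
  The library locale \<open>module\<close> requires a commutative ring of scalars, so only its record type
  is used here.  The record below adds a right scalar multiplication (the right scalars may have
  another type than the left ones).  It also serves for right modules: \<open>right_module\<close>
  ignores the field \<open>smult\<close>, just as modules ignore the fields \<open>mult\<close> and \<open>one\<close>.
\<close>

record ('a, 'b, 'c) bimodule = "('a, 'b) module" +
  rsmult :: "['b, 'c] \<Rightarrow> 'b"

locale left_module = R?: ring R + M?: abelian_group M
  for R :: "('a, 'z) ring_scheme" (structure) and M :: "('a, 'b, 'y) module_scheme" (structure) +
  assumes smult_closed:
      "\<lbrakk>a \<in> carrier R; x \<in> carrier M\<rbrakk> \<Longrightarrow> smult M a x \<in> carrier M"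
    and smult_l_distr:
      "\<lbrakk>a \<in> carrier R; b \<in> carrier R; x \<in> carrier M\<rbrakk> \<Longrightarrow>
       smult M (a \<oplus>\<^bsub>R\<^esub> b) x = smult M a x \<oplus>\<^bsub>M\<^esub> smult M b x"
    and smult_r_distr:
      "\<lbrakk>a \<in> carrier R; x \<in> carrier M; y \<in> carrier M\<rbrakk> \<Longrightarrow>
       smult M a (x \<oplus>\<^bsub>M\<^esub> y) = smult M a x \<oplus>\<^bsub>M\<^esub> smult M a y"
    and smult_assoc:
      "\<lbrakk>a \<in> carrier R; b \<in> carrier R; x \<in> carrier M\<rbrakk> \<Longrightarrow>
       smult M (a \<otimes>\<^bsub>R\<^esub> b) x = smult M a (smult M b x)"
    and smult_one:
      "x \<in> carrier M \<Longrightarrow> smult M \<one>\<^bsub>R\<^esub> x = x"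

locale right_module = R?: ring R + M?: abelian_group M
  for R :: "('a, 'z) ring_scheme" (structure)
    and M :: "('l, 'b, 'a, 'y) bimodule_scheme" (structure) +
  assumes rsmult_closed:
      "\<lbrakk>x \<in> carrier M; a \<in> carrier R\<rbrakk> \<Longrightarrow> rsmult M x a \<in> carrier M"
    and rsmult_l_distr:
      "\<lbrakk>x \<in> carrier M; y \<in> carrier M; a \<in> carrier R\<rbrakk> \<Longrightarrow>
       rsmult M (x \<oplus>\<^bsub>M\<^esub> y) a = rsmult M x a \<oplus>\<^bsub>M\<^esub> rsmult M y a"
    and rsmult_r_distr:
      "\<lbrakk>x \<in> carrier M; a \<in> carrier R; b \<in> carrier R\<rbrakk> \<Longrightarrow>
       rsmult M x (a \<oplus>\<^bsub>R\<^esub> b) = rsmult M x a \<oplus>\<^bsub>M\<^esub> rsmult M x b"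
    and rsmult_assoc:
      "\<lbrakk>x \<in> carrier M; a \<in> carrier R; b \<in> carrier R\<rbrakk> \<Longrightarrow>
       rsmult M x (a \<otimes>\<^bsub>R\<^esub> b) = rsmult M (rsmult M x a) b"
    and rsmult_one:
      "x \<in> carrier M \<Longrightarrow> rsmult M x \<one>\<^bsub>R\<^esub> = x"

locale bimodule = left: left_module L M + right: right_module R M
  for L :: "('l, 'x) ring_scheme" (structure) and R :: "('r, 'z) ring_scheme" (structure)
    and M :: "('l, 'b, 'r, 'y) bimodule_scheme" (structure) +
  assumes smult_rsmult:
      "\<lbrakk>a \<in> carrier L; x \<in> carrier M; b \<in> carrier R\<rbrakk> \<Longrightarrow>
       rsmult M (smult M a x) b = smult M a (rsmult M x b)"

definition regular_bimodule :: "('a, 'z) ring_scheme \<Rightarrow> ('a, 'a, 'a) bimodule" where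
  "regular_bimodule R = \<lparr>carrier = carrier R, monoid.mult = undefined, one = undefined,
     ring.zero = \<zero>\<^bsub>R\<^esub>, ring.add = ring.add R, smult = monoid.mult R, rsmult = monoid.mult R\<rparr>"

definition restrict_left ::
    "('r \<Rightarrow> 's) \<Rightarrow> ('s, 'y, 'z) module_scheme \<Rightarrow> ('r, 'y) module" where
  "restrict_left \<phi> Y = \<lparr>carrier = carrier Y, monoid.mult = undefined, one = undefined,
     ring.zero = \<zero>\<^bsub>Y\<^esub>, ring.add = ring.add Y, smult = (\<lambda>r y. smult Y (\<phi> r) y)\<rparr>"

definition restrict_right ::
    "('r \<Rightarrow> 's) \<Rightarrow> ('l, 'w, 's, 'z) bimodule_scheme \<Rightarrow> ('l, 'w, 'r) bimodule" where
  "restrict_right \<phi> W = \<lparr>carrier = carrier W, monoid.mult = undefined, one = undefined,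
     ring.zero = \<zero>\<^bsub>W\<^esub>, ring.add = ring.add W, smult = smult W, rsmult = (\<lambda>w r. rsmult W w (\<phi> r))\<rparr>"

definition linear_maps ::
    "('r, 'z) ring_scheme \<Rightarrow> ('r, 'a, 'y) module_scheme \<Rightarrow> ('r, 'b, 'x) module_scheme \<Rightarrow> ('a \<Rightarrow> 'b) set"
  where
  "linear_maps R A B = {f \<in> carrier A \<rightarrow>\<^sub>E carrier B.
     (\<forall>x\<in>carrier A. \<forall>y\<in>carrier A. f (x \<oplus>\<^bsub>A\<^esub> y) = f x \<oplus>\<^bsub>B\<^esub> f y) \<and>
     (\<forall>r\<in>carrier R. \<forall>x\<in>carrier A. f (smult A r x) = smult B r (f x))}"

definition Hom_group ::
    "('r, 'z) ring_scheme \<Rightarrow> ('r, 'a, 'y) module_scheme \<Rightarrow> ('r, 'b, 'x) module_scheme \<Rightarrow> ('a \<Rightarrow> 'b) ring"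
  where
  "Hom_group R A B = \<lparr>carrier = linear_maps R A B, monoid.mult = undefined, one = undefined,
     ring.zero = (\<lambda>x\<in>carrier A. \<zero>\<^bsub>B\<^esub>), ring.add = (\<lambda>f g. \<lambda>x\<in>carrier A. f x \<oplus>\<^bsub>B\<^esub> g x)\<rparr>"


section \<open>Tensor products\<close>

definition tensor_relators ::
    "('r, 'z) ring_scheme \<Rightarrow> ('l, 'a, 'r, 'y) bimodule_scheme \<Rightarrow> ('r, 'b, 'x) module_scheme
      \<Rightarrow> ('a \<times> 'b \<Rightarrow>\<^sub>0 int) set" where
  "tensor_relators R A B =
     {frag_of (a \<oplus>\<^bsub>A\<^esub> a', b) - frag_of (a, b) - frag_of (a', b) | a a' b.
        a \<in> carrier A \<and> a' \<in> carrier A \<and> b \<in> carrier B} \<union>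
     {frag_of (a, b \<oplus>\<^bsub>B\<^esub> b') - frag_of (a, b) - frag_of (a, b') | a b b'.
        a \<in> carrier A \<and> b \<in> carrier B \<and> b' \<in> carrier B} \<union>
     {frag_of (rsmult A a r, b) - frag_of (a, smult B r b) | a r b.
        a \<in> carrier A \<and> r \<in> carrier R \<and> b \<in> carrier B}"

definition tensor_null ::
    "('r, 'z) ring_scheme \<Rightarrow> ('l, 'a, 'r, 'y) bimodule_scheme \<Rightarrow> ('r, 'b, 'x) module_scheme
      \<Rightarrow> ('a \<times> 'b \<Rightarrow>\<^sub>0 int) set" where
  "tensor_null R A B =
     generate (free_Abelian_group (carrier A \<times> carrier B)) (tensor_relators R A B)"

definition tensor_quotient ::
    "('r, 'z) ring_scheme \<Rightarrow> ('l, 'a, 'r, 'y) bimodule_scheme \<Rightarrow> ('r, 'b, 'x) module_scheme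
      \<Rightarrow> ('a \<times> 'b \<Rightarrow>\<^sub>0 int) set monoid" where
  "tensor_quotient R A B = free_Abelian_group (carrier A \<times> carrier B) Mod tensor_null R A B"

definition tensor_group ::
    "('r, 'z) ring_scheme \<Rightarrow> ('l, 'a, 'r, 'y) bimodule_scheme \<Rightarrow> ('r, 'b, 'x) module_scheme
      \<Rightarrow> ('a \<times> 'b \<Rightarrow>\<^sub>0 int) set ring" where
  "tensor_group R A B = \<lparr>carrier = carrier (tensor_quotient R A B),
     monoid.mult = undefined, one = undefined,
     ring.zero = \<one>\<^bsub>tensor_quotient R A B\<^esub>, ring.add = monoid.mult (tensor_quotient R A B)\<rparr>"

definition pure_tensor ::
    "('r, 'z) ring_scheme \<Rightarrow> ('l, 'a, 'r, 'y) bimodule_scheme \<Rightarrow> ('r, 'b, 'x) module_scheme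
      \<Rightarrow> 'a \<Rightarrow> 'b \<Rightarrow> ('a \<times> 'b \<Rightarrow>\<^sub>0 int) set" where
  "pure_tensor R A B a b =
     tensor_null R A B #>\<^bsub>free_Abelian_group (carrier A \<times> carrier B)\<^esub> frag_of (a, b)"

text \<open>
  For a biadditive balanced \<open>\<phi>\<close>, \<open>tensor_lift G \<phi>\<close> is the homomorphism into \<open>G\<close> with
  \<open>a \<otimes> b \<mapsto> \<phi> a b\<close>: the linear extension of \<open>\<phi>\<close> is constant on each coset \<open>c\<close>.
\<close>

definition tensor_lift ::
    "('g, 'z) ring_scheme \<Rightarrow> ('a \<Rightarrow> 'b \<Rightarrow> 'g) \<Rightarrow> ('a \<times> 'b \<Rightarrow>\<^sub>0 int) set \<Rightarrow> 'g" where
  "tensor_lift G \<phi> c = the_elem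
     ((\<lambda>f. \<Oplus>\<^bsub>G\<^esub>p\<in>Poly_Mapping.keys f.
        add_pow G (Poly_Mapping.lookup f p) (\<phi> (fst p) (snd p))) ` c)"

definition tensor_module ::
    "('r, 'z) ring_scheme \<Rightarrow> ('l, 'a, 'r, 'y) bimodule_scheme \<Rightarrow> ('r, 'b, 'x) module_scheme
      \<Rightarrow> ('l, ('a \<times> 'b \<Rightarrow>\<^sub>0 int) set) module" where
  "tensor_module R A B = ring.extend (tensor_group R A B)
     \<lparr>smult = (\<lambda>l. tensor_lift (tensor_group R A B) (\<lambda>a b. pure_tensor R A B (smult A l a) b))\<rparr>"

definition tensor_bimodule ::
    "('r, 'z) ring_scheme \<Rightarrow> ('l, 'a, 'r, 'y) bimodule_scheme \<Rightarrow> ('r, 'b, 's, 'x) bimodule_scheme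
      \<Rightarrow> ('l, ('a \<times> 'b \<Rightarrow>\<^sub>0 int) set, 's) bimodule" where
  "tensor_bimodule R A B = module.extend (tensor_module R A B)
     \<lparr>rsmult = (\<lambda>c s. tensor_lift (tensor_group R A B) (\<lambda>a b. pure_tensor R A B a (rsmult B b s)) c)\<rparr>"


section \<open>Tensor powers of a bimodule\<close>

text \<open>
  The powers \<open>M\<^sup>\<otimes>\<^sup>0 = R\<close>, \<open>M\<^sup>\<otimes>\<^sup>1 = M\<close>, \<open>M\<^sup>\<otimes>\<^sup>(\<^sup>i\<^sup>+\<^sup>1\<^sup>) = M \<otimes> M\<^sup>\<otimes>\<^sup>i\<close> have to
  live in one type.  Therefore each is transported along an injection into the datatype
  below; the injection of a tensor product \<open>M \<otimes> B\<close> picks for every element some expression as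
  a sum of pure tensors.
\<close>

datatype ('r, 'm) tpow_el = Scal (the_scal: 'r) | Vect 'm | Tens "('m \<times> ('r, 'm) tpow_el) list"

definition transport_bimodule ::
    "('a \<Rightarrow> 'b) \<Rightarrow> ('l, 'a, 'r, 'z) bimodule_scheme \<Rightarrow> ('l, 'b, 'r) bimodule" where
  "transport_bimodule h A = (let g = inv_into (carrier A) h in
     \<lparr>carrier = h ` carrier A, monoid.mult = undefined, one = undefined,
      ring.zero = h \<zero>\<^bsub>A\<^esub>, ring.add = (\<lambda>x y. h (g x \<oplus>\<^bsub>A\<^esub> g y)),
      smult = (\<lambda>l x. h (smult A l (g x))), rsmult = (\<lambda>x r. h (rsmult A (g x) r))\<rparr>)"

definition tens_encode ::
    "('m \<times> ('r, 'm) tpow_el \<Rightarrow>\<^sub>0 int) set \<Rightarrow> ('r, 'm) tpow_el" where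
  "tens_encode c = Tens (SOME ps. sum_list (map frag_of ps) \<in> c)"

fun tpow ::
    "('r, 'z) ring_scheme \<Rightarrow> ('r, 'm, 'r, 'y) bimodule_scheme \<Rightarrow> nat
      \<Rightarrow> ('r, ('r, 'm) tpow_el, 'r) bimodule" where
  "tpow R M 0 = transport_bimodule Scal (regular_bimodule R)"
| "tpow R M (Suc 0) = transport_bimodule Vect M"
| "tpow R M (Suc (Suc i)) = transport_bimodule tens_encode (tensor_bimodule R M (tpow R M (Suc i)))"

text \<open>
  \<open>tpow_cons R M j m b\<close> is \<open>m \<otimes> b \<in> M\<^sup>\<otimes>\<^sup>(\<^sup>j\<^sup>+\<^sup>1\<^sup>)\<close> for \<open>m \<in> M\<close> and \<open>b \<in> M\<^sup>\<otimes>\<^sup>j\<close>, where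
  \<open>M \<otimes> R\<close> is identified with \<open>M\<close>.
\<close>

fun tpow_cons ::
    "('r, 'z) ring_scheme \<Rightarrow> ('r, 'm, 'r, 'y) bimodule_scheme \<Rightarrow> nat
      \<Rightarrow> 'm \<Rightarrow> ('r, 'm) tpow_el \<Rightarrow> ('r, 'm) tpow_el" where
  "tpow_cons R M 0 m b = Vect (rsmult M m (the_scal b))"
| "tpow_cons R M (Suc j) m b = tens_encode (pure_tensor R M (tpow R M (Suc j)) m b)"

text \<open>
  \<open>tpow_mult R M i j x y\<close> is \<open>x \<otimes> y \<in> M\<^sup>\<otimes>\<^sup>(\<^sup>i\<^sup>+\<^sup>j\<^sup>)\<close> for \<open>x \<in> M\<^sup>\<otimes>\<^sup>i\<close> and
  \<open>y \<in> M\<^sup>\<otimes>\<^sup>j\<close>, computed by \<open>(m \<otimes> a) \<otimes> y = m \<otimes> (a \<otimes> y)\<close>.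
\<close>

fun tpow_mult ::
    "('r, 'z) ring_scheme \<Rightarrow> ('r, 'm, 'r, 'y) bimodule_scheme \<Rightarrow> nat \<Rightarrow> nat
      \<Rightarrow> ('r, 'm) tpow_el \<Rightarrow> ('r, 'm) tpow_el \<Rightarrow> ('r, 'm) tpow_el" where
  "tpow_mult R M 0 j x y = smult (tpow R M j) (the_scal x) y"
| "tpow_mult R M (Suc 0) j x y = tpow_cons R M j (inv_into (carrier M) Vect x) y"
| "tpow_mult R M (Suc (Suc i)) j x y =
     tensor_lift (tpow R M (Suc (Suc i) + j))
       (\<lambda>m a. tpow_cons R M (Suc i + j) m (tpow_mult R M (Suc i) j a y))
       (inv_into (carrier (tensor_bimodule R M (tpow R M (Suc i)))) tens_encode x)"


section \<open>The \<open>n\<close>-trivial extension and the functors U, T, H\<close>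

type_synonym ('r, 'm) ntriv_el = "nat \<Rightarrow> ('r, 'm) tpow_el"

definition ntriv ::
    "nat \<Rightarrow> ('r, 'z) ring_scheme \<Rightarrow> ('r, 'm, 'r, 'y) bimodule_scheme \<Rightarrow> ('r, 'm) ntriv_el ring"
  where
  "ntriv n R M = \<lparr>
     carrier = (\<Pi>\<^sub>E k\<in>{..n}. carrier (tpow R M k)),
     monoid.mult = (\<lambda>s t. \<lambda>k\<in>{..n}. \<Oplus>\<^bsub>tpow R M k\<^esub>i\<in>{..k}. tpow_mult R M i (k - i) (s i) (t (k - i))),
     one = (\<lambda>k\<in>{..n}. if k = 0 then Scal \<one>\<^bsub>R\<^esub> else \<zero>\<^bsub>tpow R M k\<^esub>),
     ring.zero = (\<lambda>k\<in>{..n}. \<zero>\<^bsub>tpow R M k\<^esub>),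
     ring.add = (\<lambda>s t. \<lambda>k\<in>{..n}. s k \<oplus>\<^bsub>tpow R M k\<^esub> t k)\<rparr>"

definition ntriv_emb ::
    "nat \<Rightarrow> ('r, 'z) ring_scheme \<Rightarrow> ('r, 'm, 'r, 'y) bimodule_scheme \<Rightarrow> 'r \<Rightarrow> ('r, 'm) ntriv_el"
  where
  "ntriv_emb n R M r = (\<lambda>k\<in>{..n}. if k = 0 then Scal r else \<zero>\<^bsub>tpow R M k\<^esub>)"

definition U_left ::
    "nat \<Rightarrow> ('r, 'z) ring_scheme \<Rightarrow> ('r, 'm, 'r, 'w) bimodule_scheme
      \<Rightarrow> (('r, 'm) ntriv_el, 'y, 'v) module_scheme \<Rightarrow> ('r, 'y) module" where
  "U_left n R M Y = restrict_left (ntriv_emb n R M) Y"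

definition U_right ::
    "nat \<Rightarrow> ('r, 'z) ring_scheme \<Rightarrow> ('r, 'm, 'r, 'y) bimodule_scheme
      \<Rightarrow> ('l, 'w, ('r, 'm) ntriv_el, 'v) bimodule_scheme \<Rightarrow> ('l, 'w, 'r) bimodule" where
  "U_right n R M W = restrict_right (ntriv_emb n R M) W"

definition T_fun ::
    "nat \<Rightarrow> ('r, 'z) ring_scheme \<Rightarrow> ('r, 'm, 'r, 'y) bimodule_scheme \<Rightarrow> ('r, 'x, 'v) module_scheme
      \<Rightarrow> (('r, 'm) ntriv_el, (('r, 'm) ntriv_el \<times> 'x \<Rightarrow>\<^sub>0 int) set) module" where
  "T_fun n R M X =
     tensor_module R (restrict_right (ntriv_emb n R M) (regular_bimodule (ntriv n R M))) X"

definition H_fun ::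
    "nat \<Rightarrow> ('r, 'z) ring_scheme \<Rightarrow> ('r, 'm, 'r, 'y) bimodule_scheme \<Rightarrow> ('r, 'x, 'v) module_scheme
      \<Rightarrow> (('r, 'm) ntriv_el, ('r, 'm) ntriv_el \<Rightarrow> 'x) module" where
  "H_fun n R M X = ring.extend
     (Hom_group R (restrict_left (ntriv_emb n R M) (regular_bimodule (ntriv n R M))) X)
     \<lparr>smult = (\<lambda>s f. \<lambda>t\<in>carrier (ntriv n R M). f (t \<otimes>\<^bsub>ntriv n R M\<^esub> s))\<rparr>"


section \<open>The canonical free resolution\<close>

definition free_module ::
    "('r, 'z) ring_scheme \<Rightarrow> 'b set \<Rightarrow> ('r, 'b \<Rightarrow> 'r) module" where
  "free_module R B = \<lparr>
     carrier = {f. f ` B \<subseteq> carrier R \<and> (\<forall>b. b \<notin> B \<longrightarrow> f b = \<zero>\<^bsub>R\<^esub>) \<and> finite {b. f b \<noteq> \<zero>\<^bsub>R\<^esub>}},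
     monoid.mult = undefined, one = undefined,
     ring.zero = (\<lambda>_. \<zero>\<^bsub>R\<^esub>), ring.add = (\<lambda>f g b. f b \<oplus>\<^bsub>R\<^esub> g b), smult = (\<lambda>r f b. r \<otimes>\<^bsub>R\<^esub> f b)\<rparr>"

definition linear_extension ::
    "('r, 'z) ring_scheme \<Rightarrow> ('r, 'c, 'y) module_scheme \<Rightarrow> ('b \<Rightarrow> 'c) \<Rightarrow> ('b \<Rightarrow> 'r) \<Rightarrow> 'c" where
  "linear_extension R N \<phi> f = (\<Oplus>\<^bsub>N\<^esub>b\<in>{b. f b \<noteq> \<zero>\<^bsub>R\<^esub>}. smult N (f b) (\<phi> b))"

text \<open>
  \<open>\<dots> \<rightarrow> P\<^sub>1 \<rightarrow> P\<^sub>0 \<rightarrow> X\<close>: the module \<open>P\<^sub>0\<close> is free on the elements of \<open>X\<close>, and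
  \<open>P\<^bsub>k+1\<^esub>\<close> is free on the cycles of \<open>P\<^sub>k\<close>, i.e. on the kernel of \<open>P\<^sub>k \<rightarrow> P\<^bsub>k-1\<^esub>\<close>
  (of \<open>P\<^sub>0 \<rightarrow> X\<close> for \<open>k = 0\<close>).  So that all bases live in one type, a cycle is named by
  the lists of (basis element, coefficient) pairs describing it; a cycle then occurs once for
  each such list, which affects neither freeness nor exactness.
\<close>

datatype ('r, 'x) res_gen = Gen 'x | Syz "(('r, 'x) res_gen \<times> 'r) list"

definition coeff_fun :: "('r, 'z) ring_scheme \<Rightarrow> ('b \<times> 'r) list \<Rightarrow> 'b \<Rightarrow> 'r" where
  "coeff_fun R l b = (case map_of l b of None \<Rightarrow> \<zero>\<^bsub>R\<^esub> | Some r \<Rightarrow> r)"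

fun gen_val :: "('r, 'x) res_gen \<Rightarrow> 'x" where
  "gen_val (Gen x) = x"
| "gen_val (Syz l) = undefined"

fun syz_val :: "('r, 'z) ring_scheme \<Rightarrow> ('r, 'x) res_gen \<Rightarrow> ('r, 'x) res_gen \<Rightarrow> 'r" where
  "syz_val R (Gen x) = undefined"
| "syz_val R (Syz l) = coeff_fun R l"

fun res_basis ::
    "('r, 'z) ring_scheme \<Rightarrow> ('r, 'x, 'y) module_scheme \<Rightarrow> nat \<Rightarrow> ('r, 'x) res_gen set" where
  "res_basis R X 0 = Gen ` carrier X"
| "res_basis R X (Suc 0) = Syz ` {l. coeff_fun R l \<in> carrier (free_module R (res_basis R X 0)) \<and>
     linear_extension R X gen_val (coeff_fun R l) = \<zero>\<^bsub>X\<^esub>}"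
| "res_basis R X (Suc (Suc k)) =
     Syz ` {l. coeff_fun R l \<in> carrier (free_module R (res_basis R X (Suc k))) \<and>
       linear_extension R (free_module R (res_basis R X k)) (syz_val R) (coeff_fun R l) =
         \<zero>\<^bsub>free_module R (res_basis R X k)\<^esub>}"

definition res_mod ::
    "('r, 'z) ring_scheme \<Rightarrow> ('r, 'x, 'y) module_scheme \<Rightarrow> nat
      \<Rightarrow> ('r, ('r, 'x) res_gen \<Rightarrow> 'r) module" where
  "res_mod R X k = free_module R (res_basis R X k)"

text \<open>\<open>res_diff R X k\<close> is the differential \<open>P\<^bsub>k+1\<^esub> \<rightarrow> P\<^sub>k\<close>.\<close>

definition res_diff ::
    "('r, 'z) ring_scheme \<Rightarrow> ('r, 'x, 'y) module_scheme \<Rightarrow> nat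
      \<Rightarrow> (('r, 'x) res_gen \<Rightarrow> 'r) \<Rightarrow> (('r, 'x) res_gen \<Rightarrow> 'r)" where
  "res_diff R X k = linear_extension R (res_mod R X k) (syz_val R)"


section \<open>Ext and Tor\<close>

definition subquotient :: "('a, 'z) ring_scheme \<Rightarrow> 'a set \<Rightarrow> 'a set \<Rightarrow> 'a set monoid" where
  "subquotient G Z B = ((add_monoid G)\<lparr>carrier := Z\<rparr>) Mod B"

text \<open>The cohomology of \<open>Hom\<^sub>R(P, Y)\<close>, for the free resolution \<open>P\<close> of \<open>X\<close>.\<close>

definition ext_cocycles ::
    "('r, 'z) ring_scheme \<Rightarrow> nat \<Rightarrow> ('r, 'x, 'v) module_scheme \<Rightarrow> ('r, 'y, 'w) module_scheme
      \<Rightarrow> ((('r, 'x) res_gen \<Rightarrow> 'r) \<Rightarrow> 'y) set" where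
  "ext_cocycles R m X Y = {f \<in> linear_maps R (res_mod R X m) Y.
     \<forall>p\<in>carrier (res_mod R X (Suc m)). f (res_diff R X m p) = \<zero>\<^bsub>Y\<^esub>}"

fun ext_coboundaries ::
    "('r, 'z) ring_scheme \<Rightarrow> nat \<Rightarrow> ('r, 'x, 'v) module_scheme \<Rightarrow> ('r, 'y, 'w) module_scheme
      \<Rightarrow> ((('r, 'x) res_gen \<Rightarrow> 'r) \<Rightarrow> 'y) set" where
  "ext_coboundaries R 0 X Y = {\<zero>\<^bsub>Hom_group R (res_mod R X 0) Y\<^esub>}"
| "ext_coboundaries R (Suc m) X Y =
     (\<lambda>g. \<lambda>p\<in>carrier (res_mod R X (Suc m)). g (res_diff R X m p)) ` linear_maps R (res_mod R X m) Y"

definition Ext ::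
    "('r, 'z) ring_scheme \<Rightarrow> nat \<Rightarrow> ('r, 'x, 'v) module_scheme \<Rightarrow> ('r, 'y, 'w) module_scheme
      \<Rightarrow> ((('r, 'x) res_gen \<Rightarrow> 'r) \<Rightarrow> 'y) set monoid" where
  "Ext R m X Y =
     subquotient (Hom_group R (res_mod R X m) Y) (ext_cocycles R m X Y) (ext_coboundaries R m X Y)"

text \<open>The homology of \<open>A \<otimes>\<^sub>R P\<close>, for the free resolution \<open>P\<close> of \<open>X\<close>.\<close>

definition tor_chains ::
    "('r, 'z) ring_scheme \<Rightarrow> nat \<Rightarrow> ('l, 'a, 'r, 'w) bimodule_scheme \<Rightarrow> ('r, 'x, 'v) module_scheme
      \<Rightarrow> ('a \<times> (('r, 'x) res_gen \<Rightarrow> 'r) \<Rightarrow>\<^sub>0 int) set ring" where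
  "tor_chains R m A X = tensor_group R A (res_mod R X m)"

definition tor_diff ::
    "('r, 'z) ring_scheme \<Rightarrow> nat \<Rightarrow> ('l, 'a, 'r, 'w) bimodule_scheme \<Rightarrow> ('r, 'x, 'v) module_scheme
      \<Rightarrow> ('a \<times> (('r, 'x) res_gen \<Rightarrow> 'r) \<Rightarrow>\<^sub>0 int) set
      \<Rightarrow> ('a \<times> (('r, 'x) res_gen \<Rightarrow> 'r) \<Rightarrow>\<^sub>0 int) set" where
  "tor_diff R m A X =
     tensor_lift (tor_chains R m A X) (\<lambda>a p. pure_tensor R A (res_mod R X m) a (res_diff R X m p))"

fun tor_cycles ::
    "('r, 'z) ring_scheme \<Rightarrow> nat \<Rightarrow> ('l, 'a, 'r, 'w) bimodule_scheme \<Rightarrow> ('r, 'x, 'v) module_scheme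
      \<Rightarrow> ('a \<times> (('r, 'x) res_gen \<Rightarrow> 'r) \<Rightarrow>\<^sub>0 int) set set" where
  "tor_cycles R 0 A X = carrier (tor_chains R 0 A X)"
| "tor_cycles R (Suc m) A X =
     {c \<in> carrier (tor_chains R (Suc m) A X). tor_diff R m A X c = \<zero>\<^bsub>tor_chains R m A X\<^esub>}"

definition tor_boundaries ::
    "('r, 'z) ring_scheme \<Rightarrow> nat \<Rightarrow> ('l, 'a, 'r, 'w) bimodule_scheme \<Rightarrow> ('r, 'x, 'v) module_scheme
      \<Rightarrow> ('a \<times> (('r, 'x) res_gen \<Rightarrow> 'r) \<Rightarrow>\<^sub>0 int) set set" where
  "tor_boundaries R m A X = tor_diff R m A X ` carrier (tor_chains R (Suc m) A X)"

definition Tor ::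
    "('r, 'z) ring_scheme \<Rightarrow> nat \<Rightarrow> ('l, 'a, 'r, 'w) bimodule_scheme \<Rightarrow> ('r, 'x, 'v) module_scheme
      \<Rightarrow> ('a \<times> (('r, 'x) res_gen \<Rightarrow> 'r) \<Rightarrow>\<^sub>0 int) set set monoid" where
  "Tor R m A X = subquotient (tor_chains R m A X) (tor_cycles R m A X) (tor_boundaries R m A X)"

end

theory Submission
  imports Defs
begin

text \<open>
  Ext and Tor can be computed from any resolution by free modules with chosen bases.  Over \<open>R\<close>, the right
  module \<open>R \<ltimes>\<^sub>n M\<close> is the direct sum of the \<open>M\<^sup>\<otimes>\<^sup>i\<close>.  Hence, if the groups \<open>Tor\<^sub>j(M\<^sup>\<otimes>\<^sup>i, X)\<close> vanish, extending
  scalars turns the canonical resolution of \<open>X\<close> into a free resolution of \<open>T(X)\<close> on the same bases; its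
  complexes of homomorphisms into \<open>Y\<close> and of tensor products with \<open>W\<close> are those of the resolution of \<open>X\<close>
  with values in \<open>U(Y)\<close> and \<open>U(W)\<close>.  This gives (1) and (3).

  For (2), injective resolutions are avoided by dimension shifting.  Let \<open>K\<^sub>k\<close> be the cycles in degree \<open>k\<close> of
  the canonical resolution \<open>F\<close> of \<open>Y\<close> over \<open>R \<ltimes>\<^sub>n M\<close>.  As an \<open>R\<close>-module, each \<open>F\<^sub>k\<close> is a direct sum of
  modules \<open>M\<^sup>\<otimes>\<^sup>i\<close>, so \<open>Ext\<^sub>R(F\<^sub>k, X)\<close> vanishes in positive degrees and \<open>Ext\<^sub>R\<close> of \<open>U(Y)\<close> in degree \<open>k + 1\<close> is
  the cokernel of \<open>Hom\<^sub>R(F\<^sub>k, X) \<rightarrow> Hom\<^sub>R(K\<^sub>k, X)\<close>.  By the adjunction between \<open>U\<close> and \<open>H\<close> this cokernel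
  is also Ext of \<open>Y\<close> with values in \<open>H(X)\<close> over \<open>R \<ltimes>\<^sub>n M\<close>.
\<close>

section \<open>Additive maps and subquotients\<close>

text \<open>All maps between free modules are stored by their values on the bases: a resolution is a
  family of sets \<open>B k\<close> with vectors \<open>D k b\<close>, cochains are functions on
  \<open>B k\<close>, and chains with coefficients in a right module are finitely supported
  functions into it. In this form extension of scalars only applies \<open>ntriv_emb\<close> to the
  entries of the vectors, so the based complexes over the trivial extension and over
  \<open>R\<close> that compare the two sides of (1) and (3) are equal and not just isomorphic. What
  remains is exactness of the extended resolution. In positive degrees it splits into the components
  of degree \<open>i\<close>, and in degree 0 it is right exactness of the tensor product.

  Dimension shifting asks for a resolution of a quotient that fits those of the submodule and of the
  ambient module. It comes from the functoriality of the canonical resolution and not from the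
  horseshoe lemma: the canonical basis of a submodule is a subset of that of the ambient module, and
  the remaining basis elements, with the projected differential, resolve the quotient.\<close>

definition ahom :: "('a, 'p) ring_scheme \<Rightarrow> ('b, 'q) ring_scheme \<Rightarrow> ('a \<Rightarrow> 'b) set" where
  "ahom G H = {f \<in> carrier G \<rightarrow> carrier H.
     \<forall>x\<in>carrier G. \<forall>y\<in>carrier G. f (x \<oplus>\<^bsub>G\<^esub> y) = f x \<oplus>\<^bsub>H\<^esub> f y}"

lemma ahomI:
  assumes "\<And>x. x \<in> carrier G \<Longrightarrow> f x \<in> carrier H"
    and "\<And>x y. x \<in> carrier G \<Longrightarrow> y \<in> carrier G \<Longrightarrow> f (x \<oplus>\<^bsub>G\<^esub> y) = f x \<oplus>\<^bsub>H\<^esub> f y"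
  shows "f \<in> ahom G H"
  using assms by (auto simp: ahom_def)

lemma ahom_closed: "f \<in> ahom G H \<Longrightarrow> x \<in> carrier G \<Longrightarrow> f x \<in> carrier H"
  by (auto simp: ahom_def)

lemma ahom_add:
  "f \<in> ahom G H \<Longrightarrow> x \<in> carrier G \<Longrightarrow> y \<in> carrier G \<Longrightarrow> f (x \<oplus>\<^bsub>G\<^esub> y) = f x \<oplus>\<^bsub>H\<^esub> f y"
  by (auto simp: ahom_def)

lemma ahom_compose: "f \<in> ahom G H \<Longrightarrow> g \<in> ahom H K \<Longrightarrow> (\<lambda>x. g (f x)) \<in> ahom G K"
  by (auto simp: ahom_def Pi_iff)

text \<open>Membership in \<open>ahom\<close> constrains a map only on \<open>carrier G\<close>,
  whereas Hom groups consist of extensional functions; this passes from a map to its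
  restriction.\<close>

lemma ahom_cong:
  assumes "f \<in> ahom G H" "\<And>x. x \<in> carrier G \<Longrightarrow> f x = g x" "abelian_monoid G"
  shows "g \<in> ahom G H"
proof (rule ahomI)
  fix x y assume x: "x \<in> carrier G"
  show "g x \<in> carrier H" using ahom_closed[OF assms(1) x] assms(2)[OF x] by simp
  assume y: "y \<in> carrier G"
  show "g (x \<oplus>\<^bsub>G\<^esub> y) = g x \<oplus>\<^bsub>H\<^esub> g y"
    using ahom_add[OF assms(1) x y] assms(2)[OF x] assms(2)[OF y]
      assms(2)[OF abelian_monoidE(1)[OF assms(3) x y]] by simp
qed

lemma abelian_groupD: "abelian_group G \<Longrightarrow> abelian_monoid G"
  by (simp add: abelian_group_def)

lemma ahom_zero:
  assumes "abelian_group G" "abelian_group H" "f \<in> ahom G H"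
  shows "f \<zero>\<^bsub>G\<^esub> = \<zero>\<^bsub>H\<^esub>"
proof -
  interpret G: abelian_group G by fact
  interpret H: abelian_group H by fact
  have "f \<zero>\<^bsub>G\<^esub> \<oplus>\<^bsub>H\<^esub> f \<zero>\<^bsub>G\<^esub> = f \<zero>\<^bsub>G\<^esub>"
    using ahom_add[OF assms(3), of "\<zero>\<^bsub>G\<^esub>" "\<zero>\<^bsub>G\<^esub>"] by simp
  then show ?thesis
    using ahom_closed[OF assms(3), of "\<zero>\<^bsub>G\<^esub>"] by (simp add: H.add.r_cancel_one')
qed

lemma ahom_uminus:
  assumes "abelian_group G" "abelian_group H" "f \<in> ahom G H" "x \<in> carrier G"
  shows "f (\<ominus>\<^bsub>G\<^esub> x) = \<ominus>\<^bsub>H\<^esub> f x"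
proof -
  interpret G: abelian_group G by fact
  interpret H: abelian_group H by fact
  have "f (\<ominus>\<^bsub>G\<^esub> x) \<oplus>\<^bsub>H\<^esub> f x = \<zero>\<^bsub>H\<^esub>"
    using ahom_add[OF assms(3), of "\<ominus>\<^bsub>G\<^esub> x" x] ahom_zero[OF assms(1-3)] assms(4)
    by (simp add: G.l_neg)
  then show ?thesis
    using assms ahom_closed by (metis G.a_inv_closed H.minus_equality)
qed

lemma ahom_minus:
  assumes "abelian_group G" "abelian_group H" "f \<in> ahom G H" "x \<in> carrier G" "y \<in> carrier G"
  shows "f (x \<ominus>\<^bsub>G\<^esub> y) = f x \<ominus>\<^bsub>H\<^esub> f y"
  using assms by (simp add: a_minus_def ahom_add ahom_uminus abelian_group.a_inv_closed)

lemma ahom_finsum: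
  assumes "abelian_group G" "abelian_group H" "f \<in> ahom G H" "g \<in> J \<rightarrow> carrier G"
  shows "f (finsum G g J) = finsum H (\<lambda>j. f (g j)) J"
proof -
  interpret G: abelian_group G by fact
  interpret H: abelian_group H by fact
  show ?thesis using assms(4)
  proof (induction J rule: infinite_finite_induct)
    case (insert j J)
    have "(\<lambda>j. f (g j)) \<in> J \<rightarrow> carrier H" "f (g j) \<in> carrier H"
      using insert.prems by (auto intro!: ahom_closed[OF assms(3)])
    then show ?case
      using insert by (simp add: ahom_add[OF assms(3)])
  qed (simp_all add: ahom_zero[OF assms(1-3)])
qed

lemma ahom_zero_map: "abelian_group H \<Longrightarrow> (\<lambda>x. \<zero>\<^bsub>H\<^esub>) \<in> ahom G H"
  by (rule ahomI) (auto simp: abelian_groupE abelian_monoidE(4) abelian_groupD)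

lemma ahom_add_map:
  assumes "abelian_group H" "f \<in> ahom G H" "g \<in> ahom G H"
  shows "(\<lambda>x. f x \<oplus>\<^bsub>H\<^esub> g x) \<in> ahom G H"
proof -
  interpret H: abelian_group H by fact
  show ?thesis
    by (rule ahomI) (auto simp: ahom_closed[OF assms(2)] ahom_closed[OF assms(3)]
      ahom_add[OF assms(2)] ahom_add[OF assms(3)] H.a_ac)
qed

lemma abelian_add4:
  assumes "abelian_group H" "a \<in> carrier H" "b \<in> carrier H" "c \<in> carrier H" "d \<in> carrier H"
  shows "(a \<oplus>\<^bsub>H\<^esub> b) \<oplus>\<^bsub>H\<^esub> (c \<oplus>\<^bsub>H\<^esub> d) = (a \<oplus>\<^bsub>H\<^esub> c) \<oplus>\<^bsub>H\<^esub> (b \<oplus>\<^bsub>H\<^esub> d)"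
proof -
  interpret H: abelian_group H by fact
  show ?thesis using assms(2-) by (simp add: H.a_ac)
qed

text \<open>A subgroup of the additive group, phrased without \<open>add_monoid\<close>; kernels,
  images and the cocycles of a complex are handled in this form.\<close>

definition asub :: "'a set \<Rightarrow> ('a, 'p) ring_scheme \<Rightarrow> bool" where
  "asub Z G \<longleftrightarrow> Z \<subseteq> carrier G \<and> \<zero>\<^bsub>G\<^esub> \<in> Z \<and> (\<forall>x\<in>Z. \<forall>y\<in>Z. x \<oplus>\<^bsub>G\<^esub> y \<in> Z) \<and> (\<forall>x\<in>Z. \<ominus>\<^bsub>G\<^esub> x \<in> Z)"

lemma asubD:
  assumes "asub Z G"
  shows "x \<in> Z \<Longrightarrow> x \<in> carrier G" "\<zero>\<^bsub>G\<^esub> \<in> Z" "x \<in> Z \<Longrightarrow> y \<in> Z \<Longrightarrow> x \<oplus>\<^bsub>G\<^esub> y \<in> Z" "x \<in> Z \<Longrightarrow> \<ominus>\<^bsub>G\<^esub> x \<in> Z"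
  using assms by (auto simp: asub_def)

lemma asub_carrier: "abelian_group G \<Longrightarrow> asub (carrier G) G"
  by (auto simp: asub_def abelian_group.a_inv_closed abelian_groupE)

lemma asub_kernel:
  assumes "abelian_group G" "abelian_group H" "asub Z G" "f \<in> ahom G H"
  shows "asub {x \<in> Z. f x = \<zero>\<^bsub>H\<^esub>} G"
proof -
  interpret G: abelian_group G by fact
  interpret H: abelian_group H by fact
  show ?thesis
    using asubD[OF assms(3)]
    by (auto simp: asub_def ahom_add[OF assms(4)] ahom_zero[OF assms(1,2,4)] ahom_uminus[OF assms(1,2,4)])
qed

lemma asub_image:
  assumes "abelian_group G" "abelian_group H" "asub Z G" "f \<in> ahom G H"
  shows "asub (f ` Z) H"
  unfolding asub_def
proof (intro conjI ballI)
  interpret G: abelian_group G by fact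
  interpret H: abelian_group H by fact
  show "f ` Z \<subseteq> carrier H" using asubD[OF assms(3)] ahom_closed[OF assms(4)] by auto
  show "\<zero>\<^bsub>H\<^esub> \<in> f ` Z" using ahom_zero[OF assms(1,2,4)] asubD(2)[OF assms(3)] by (metis imageI)
  fix x assume "x \<in> f ` Z"
  then obtain a where a: "a \<in> Z" "x = f a" by auto
  show "\<ominus>\<^bsub>H\<^esub> x \<in> f ` Z"
    using a asubD[OF assms(3)] ahom_uminus[OF assms(1,2,4)] by (metis imageI)
  fix y assume "y \<in> f ` Z"
  then obtain b where b: "b \<in> Z" "y = f b" by auto
  show "x \<oplus>\<^bsub>H\<^esub> y \<in> f ` Z"
    using a b asubD[OF assms(3)] ahom_add[OF assms(4)] by (metis imageI)
qed

lemma asub_comm_group: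
  assumes "abelian_group G" "asub Z G"
  shows "comm_group ((add_monoid G)\<lparr>carrier := Z\<rparr>)"
proof (rule comm_groupI)
  interpret G: abelian_group G by fact
  note Z = asubD[OF assms(2)]
  show "\<exists>y\<in>carrier (add_monoid G\<lparr>carrier := Z\<rparr>). y \<otimes>\<^bsub>add_monoid G\<lparr>carrier := Z\<rparr>\<^esub> x = \<one>\<^bsub>add_monoid G\<lparr>carrier := Z\<rparr>\<^esub>"
    if "x \<in> carrier (add_monoid G\<lparr>carrier := Z\<rparr>)" for x
    using Z(1,4) that by (auto intro!: bexI[of _ "\<ominus>\<^bsub>G\<^esub> x"] simp: G.l_neg)
  fix x y z
  assume "x \<in> carrier (add_monoid G\<lparr>carrier := Z\<rparr>)" "y \<in> carrier (add_monoid G\<lparr>carrier := Z\<rparr>)"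
    "z \<in> carrier (add_monoid G\<lparr>carrier := Z\<rparr>)"
  then show "x \<otimes>\<^bsub>add_monoid G\<lparr>carrier := Z\<rparr>\<^esub> y \<otimes>\<^bsub>add_monoid G\<lparr>carrier := Z\<rparr>\<^esub> z
     = x \<otimes>\<^bsub>add_monoid G\<lparr>carrier := Z\<rparr>\<^esub> (y \<otimes>\<^bsub>add_monoid G\<lparr>carrier := Z\<rparr>\<^esub> z)"
    using Z(1) by (simp add: G.a_assoc)
  show "x \<otimes>\<^bsub>add_monoid G\<lparr>carrier := Z\<rparr>\<^esub> y = y \<otimes>\<^bsub>add_monoid G\<lparr>carrier := Z\<rparr>\<^esub> x"
    using Z(1) \<open>x \<in> _\<close> \<open>y \<in> _\<close> by (simp add: G.a_comm)
  show "\<one>\<^bsub>add_monoid G\<lparr>carrier := Z\<rparr>\<^esub> \<otimes>\<^bsub>add_monoid G\<lparr>carrier := Z\<rparr>\<^esub> x = x"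
    using Z(1) \<open>x \<in> _\<close> by simp
qed (use asubD[OF assms(2)] in auto)

lemma asub_normal:
  assumes "abelian_group G" "asub Z G" "asub B G" "B \<subseteq> Z"
  shows "normal B ((add_monoid G)\<lparr>carrier := Z\<rparr>)"
proof -
  interpret Z: comm_group "(add_monoid G)\<lparr>carrier := Z\<rparr>" by (rule asub_comm_group[OF assms(1,2)])
  interpret G: abelian_group G by fact
  have inv: "inv\<^bsub>(add_monoid G)\<lparr>carrier := Z\<rparr>\<^esub> x = \<ominus>\<^bsub>G\<^esub> x" if "x \<in> B" for x
  proof (rule Z.inv_equality)
    show "(\<ominus>\<^bsub>G\<^esub> x) \<otimes>\<^bsub>add_monoid G\<lparr>carrier := Z\<rparr>\<^esub> x = \<one>\<^bsub>add_monoid G\<lparr>carrier := Z\<rparr>\<^esub>"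
      using asubD[OF assms(2)] that assms(4) by (auto simp: G.l_neg)
  qed (use that asubD[OF assms(2)] assms(4) in auto)
  show ?thesis
  proof (rule Z.subgroup_imp_normal, rule Z.subgroupI)
    show "inv\<^bsub>add_monoid G\<lparr>carrier := Z\<rparr>\<^esub> a \<in> B" if "a \<in> B" for a
      unfolding inv[OF that] using asubD(4)[OF assms(3) that] .
  qed (use asubD[OF assms(3)] assms(4) in auto)
qed

lemma subquotient_group:
  assumes "abelian_group G" "asub Z G" "asub B G" "B \<subseteq> Z"
  shows "group (subquotient G Z B)"
  unfolding subquotient_def using asub_normal[OF assms] normal.factorgroup_is_group by blast

text \<open>The first isomorphism theorem for \<open>u\<close> followed by the projection onto
  \<open>Z'\<close> modulo \<open>B'\<close>. As \<open>u\<close> has to be additive on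
  \<open>Z\<close> only and to reach \<open>Z'\<close> only up to \<open>B'\<close>, the lemma also
  applies to connecting homomorphisms, which make sense on cocycles only.\<close>

lemma subquotient_iso:
  assumes G: "abelian_group G" "asub Z G" "asub B G" "B \<subseteq> Z"
    and H: "abelian_group H" "asub Z' H" "asub B' H" "B' \<subseteq> Z'"
    and u: "\<And>z. z \<in> Z \<Longrightarrow> u z \<in> Z'"
    and add: "\<And>x y. x \<in> Z \<Longrightarrow> y \<in> Z \<Longrightarrow> u (x \<oplus>\<^bsub>G\<^esub> y) = u x \<oplus>\<^bsub>H\<^esub> u y"
    and ker: "\<And>z. z \<in> Z \<Longrightarrow> u z \<in> B' \<longleftrightarrow> z \<in> B"
    and sur: "\<And>z'. z' \<in> Z' \<Longrightarrow> \<exists>z\<in>Z. \<exists>b\<in>B'. z' = b \<oplus>\<^bsub>H\<^esub> u z"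
  shows "subquotient G Z B \<cong> subquotient H Z' B'"
proof -
  let ?Z = "(add_monoid G)\<lparr>carrier := Z\<rparr>" and ?Z' = "(add_monoid H)\<lparr>carrier := Z'\<rparr>"
  interpret H: abelian_group H by fact
  interpret Z: comm_group ?Z by (rule asub_comm_group[OF G(1,2)])
  interpret Z': comm_group ?Z' by (rule asub_comm_group[OF H(1,2)])
  interpret N: normal B' ?Z' by (rule asub_normal[OF H])
  have uhom: "u \<in> hom ?Z ?Z'" using u add by (auto simp: hom_def)
  let ?q = "\<lambda>a. B' #>\<^bsub>?Z'\<^esub> a"
  have q: "?q \<in> hom ?Z' (?Z' Mod B')" by (rule N.r_coset_hom_Mod)
  have h: "(\<lambda>z. ?q (u z)) \<in> hom ?Z (?Z' Mod B')"
    using Group.hom_compose[OF uhom q] by (simp add: comp_def)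
  interpret h: group_hom ?Z "?Z' Mod B'" "\<lambda>z. ?q (u z)"
    by (unfold_locales) (use h N.factorgroup_is_group in \<open>auto simp: group_def group_axioms_def monoid_def\<close>)
  have sg: "subgroup B' ?Z'" by (rule N.subgroup_axioms)
  have "kernel ?Z (?Z' Mod B') (\<lambda>z. ?q (u z)) = B"
  proof -
    have "?q (u z) = B' \<longleftrightarrow> z \<in> B" if "z \<in> Z" for z
      using ker[OF that] u[OF that] Z'.rcos_self[OF _ sg, of "u z"] Z'.coset_join2[of "u z" B'] sg by auto
    then show ?thesis using G(4) by (auto simp: kernel_def)
  qed
  moreover have "(\<lambda>z. ?q (u z)) ` carrier ?Z = carrier (?Z' Mod B')"
  proof
    show "carrier (?Z' Mod B') \<subseteq> (\<lambda>z. ?q (u z)) ` carrier ?Z"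
    proof
      fix c assume "c \<in> carrier (?Z' Mod B')"
      then obtain z' where z': "z' \<in> Z'" "c = ?q z'" by (auto simp: carrier_FactGroup)
      obtain z b where zb: "z \<in> Z" "b \<in> B'" "z' = b \<oplus>\<^bsub>H\<^esub> u z" using sur[OF z'(1)] by auto
      have "z' \<in> ?q (u z)" using zb by (auto simp: r_coset_def)
      then have "?q (u z) = ?q z'" using Z'.repr_independence[of z' B' "u z"] sg u[OF zb(1)] by simp
      then show "c \<in> (\<lambda>z. ?q (u z)) ` carrier ?Z" using z' zb by auto
    qed
  qed (use h.hom_closed in auto)
  ultimately show ?thesis
    using h.FactGroup_iso unfolding subquotient_def by simp
qed

section \<open>Homology at the middle of a three-term complex\<close>

definition homology ::
    "('a, 'p) ring_scheme \<Rightarrow> ('a \<Rightarrow> 'b) \<Rightarrow> ('b, 'q) ring_scheme \<Rightarrow> ('b \<Rightarrow> 'c) \<Rightarrow> ('c, 's) ring_scheme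
      \<Rightarrow> 'b set monoid" where
  "homology G0 d0 G1 d1 G2 = subquotient G1 {x \<in> carrier G1. d1 x = \<zero>\<^bsub>G2\<^esub>} (d0 ` carrier G0)"

definition complex3 ::
    "('a, 'p) ring_scheme \<Rightarrow> ('a \<Rightarrow> 'b) \<Rightarrow> ('b, 'q) ring_scheme \<Rightarrow> ('b \<Rightarrow> 'c) \<Rightarrow> ('c, 's) ring_scheme
      \<Rightarrow> bool" where
  "complex3 G0 d0 G1 d1 G2 \<longleftrightarrow> abelian_group G0 \<and> abelian_group G1 \<and> abelian_group G2 \<and>
     d0 \<in> ahom G0 G1 \<and> d1 \<in> ahom G1 G2 \<and> (\<forall>x\<in>carrier G0. d1 (d0 x) = \<zero>\<^bsub>G2\<^esub>)"

lemma complex3_asub: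
  assumes "complex3 G0 d0 G1 d1 G2"
  shows "asub {x \<in> carrier G1. d1 x = \<zero>\<^bsub>G2\<^esub>} G1" "asub (d0 ` carrier G0) G1"
    "d0 ` carrier G0 \<subseteq> {x \<in> carrier G1. d1 x = \<zero>\<^bsub>G2\<^esub>}"
  using assms asub_kernel[of G1 G2 "carrier G1" d1] asub_image[of G0 G1 "carrier G0" d0]
  by (auto simp: complex3_def asub_carrier ahom_closed)

lemma homology_group: "complex3 G0 d0 G1 d1 G2 \<Longrightarrow> group (homology G0 d0 G1 d1 G2)"
  unfolding homology_def using complex3_asub[of G0 d0 G1 d1 G2] by (intro subquotient_group) (auto simp: complex3_def)

text \<open>A homotopy equivalence seen at one spot: \<open>u\<close> and \<open>v\<close> live in
  the middle degree only, respect cycles and boundaries, and are inverse to each other up to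
  boundaries.\<close>

lemma homology_iso:
  assumes G: "complex3 G0 d0 G1 d1 G2" and H: "complex3 H0 e0 H1 e1 H2"
    and u: "u \<in> ahom G1 H1" and v: "v \<in> ahom H1 G1"
    and uZ: "\<And>x. x \<in> carrier G1 \<Longrightarrow> d1 x = \<zero>\<^bsub>G2\<^esub> \<Longrightarrow> e1 (u x) = \<zero>\<^bsub>H2\<^esub>"
    and vZ: "\<And>x. x \<in> carrier H1 \<Longrightarrow> e1 x = \<zero>\<^bsub>H2\<^esub> \<Longrightarrow> d1 (v x) = \<zero>\<^bsub>G2\<^esub>"
    and uB: "\<And>x. x \<in> carrier G0 \<Longrightarrow> u (d0 x) \<in> e0 ` carrier H0"
    and vB: "\<And>x. x \<in> carrier H0 \<Longrightarrow> v (e0 x) \<in> d0 ` carrier G0"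
    and vu: "\<And>x. x \<in> carrier G1 \<Longrightarrow> d1 x = \<zero>\<^bsub>G2\<^esub> \<Longrightarrow> \<exists>y\<in>carrier G0. v (u x) = d0 y \<oplus>\<^bsub>G1\<^esub> x"
    and uv: "\<And>x. x \<in> carrier H1 \<Longrightarrow> e1 x = \<zero>\<^bsub>H2\<^esub> \<Longrightarrow> \<exists>y\<in>carrier H0. u (v x) = e0 y \<oplus>\<^bsub>H1\<^esub> x"
  shows "homology G0 d0 G1 d1 G2 \<cong> homology H0 e0 H1 e1 H2"
  unfolding homology_def
proof (rule subquotient_iso[where u = u])
  interpret G1: abelian_group G1 using G by (simp add: complex3_def)
  interpret H1: abelian_group H1 using H by (simp add: complex3_def)
  note sG = complex3_asub[OF G] and sH = complex3_asub[OF H]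
  show "asub {x \<in> carrier G1. d1 x = \<zero>\<^bsub>G2\<^esub>} G1" "asub (d0 ` carrier G0) G1"
    "d0 ` carrier G0 \<subseteq> {x \<in> carrier G1. d1 x = \<zero>\<^bsub>G2\<^esub>}"
    "asub {x \<in> carrier H1. e1 x = \<zero>\<^bsub>H2\<^esub>} H1" "asub (e0 ` carrier H0) H1"
    "e0 ` carrier H0 \<subseteq> {x \<in> carrier H1. e1 x = \<zero>\<^bsub>H2\<^esub>}"
    using sG sH by auto
  show "u z \<in> {x \<in> carrier H1. e1 x = \<zero>\<^bsub>H2\<^esub>}" if "z \<in> {x \<in> carrier G1. d1 x = \<zero>\<^bsub>G2\<^esub>}" for z
    using that uZ ahom_closed[OF u] by auto
  show "u (x \<oplus>\<^bsub>G1\<^esub> y) = u x \<oplus>\<^bsub>H1\<^esub> u y"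
    if "x \<in> {x \<in> carrier G1. d1 x = \<zero>\<^bsub>G2\<^esub>}" "y \<in> {x \<in> carrier G1. d1 x = \<zero>\<^bsub>G2\<^esub>}" for x y
    using that by (simp add: ahom_add[OF u])
  show "u z \<in> e0 ` carrier H0 \<longleftrightarrow> z \<in> d0 ` carrier G0" if z: "z \<in> {x \<in> carrier G1. d1 x = \<zero>\<^bsub>G2\<^esub>}" for z
  proof
    assume "u z \<in> e0 ` carrier H0"
    \<comment> \<open>Both \<open>v (u z)\<close> and its difference from \<open>z\<close> are
      boundaries, hence so is \<open>z\<close>.\<close>
    then have 1: "v (u z) \<in> d0 ` carrier G0" using vB by auto
    obtain y where y: "y \<in> carrier G0" "v (u z) = d0 y \<oplus>\<^bsub>G1\<^esub> z" using vu z by auto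
    have c: "d0 y \<in> carrier G1" "z \<in> carrier G1" using y z sG(3) by auto
    have "(\<ominus>\<^bsub>G1\<^esub> d0 y) \<oplus>\<^bsub>G1\<^esub> v (u z) = z"
      using c by (simp add: y(2) G1.a_assoc[symmetric] G1.l_neg)
    then show "z \<in> d0 ` carrier G0" using 1 y(1) asubD[OF sG(2)] by (metis imageI)
  next
    assume "z \<in> d0 ` carrier G0" then show "u z \<in> e0 ` carrier H0" using uB by auto
  qed
  show "\<exists>z\<in>{x \<in> carrier G1. d1 x = \<zero>\<^bsub>G2\<^esub>}. \<exists>b\<in>e0 ` carrier H0. z' = b \<oplus>\<^bsub>H1\<^esub> u z"
    if z': "z' \<in> {x \<in> carrier H1. e1 x = \<zero>\<^bsub>H2\<^esub>}" for z'
  proof -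
    obtain y where y: "y \<in> carrier H0" "u (v z') = e0 y \<oplus>\<^bsub>H1\<^esub> z'" using uv z' by auto
    have c: "e0 y \<in> carrier H1" "z' \<in> carrier H1" using y z' sH(3) by auto
    have "z' = (\<ominus>\<^bsub>H1\<^esub> e0 y) \<oplus>\<^bsub>H1\<^esub> u (v z')"
      using c by (simp add: y(2) H1.a_assoc[symmetric] H1.l_neg)
    moreover have "v z' \<in> carrier G1" "d1 (v z') = \<zero>\<^bsub>G2\<^esub>" using z' vZ ahom_closed[OF v] by auto
    ultimately show ?thesis using asubD(4)[OF sH(2)] y(1) by blast
  qed
qed (use G H in \<open>auto simp: complex3_def\<close>)

text \<open>Turns the vanishing of a Tor or Ext group into exactness: the only coset is
  \<open>B\<close> itself, and \<open>x\<close> lies in its own coset.\<close>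

lemma trivial_subquotient_imp:
  assumes "trivial_group (subquotient G Z B)" "abelian_group G" "Z \<subseteq> carrier G" "\<zero>\<^bsub>G\<^esub> \<in> B" "x \<in> Z"
  shows "x \<in> B"
proof -
  interpret G: abelian_group G by fact
  have "B #>\<^bsub>(add_monoid G)\<lparr>carrier := Z\<rparr>\<^esub> x = B"
    using assms(1,5) unfolding trivial_group_def subquotient_def by (auto simp: carrier_FactGroup)
  moreover have "x \<in> B #>\<^bsub>(add_monoid G)\<lparr>carrier := Z\<rparr>\<^esub> x"
    using assms(3-5) by (force simp: r_coset_def)
  ultimately show ?thesis by simp
qed

section \<open>Finitely supported functions\<close>

definition fsupp :: "('a, 'p) ring_scheme \<Rightarrow> 'b set \<Rightarrow> ('b \<Rightarrow> 'a) set" where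
  "fsupp A B = {f. f ` B \<subseteq> carrier A \<and> (\<forall>b. b \<notin> B \<longrightarrow> f b = \<zero>\<^bsub>A\<^esub>) \<and> finite {b. f b \<noteq> \<zero>\<^bsub>A\<^esub>}}"

text \<open>The direct sum of copies of \<open>A\<close> indexed by \<open>B\<close>. For a right
  module \<open>A\<close> this is the tensor product of \<open>A\<close> with the free module on
  \<open>B\<close>, which is how chains with coefficients are represented.\<close>

definition fs_group :: "('a, 'p) ring_scheme \<Rightarrow> 'b set \<Rightarrow> ('b \<Rightarrow> 'a) ring" where
  "fs_group A B = \<lparr>carrier = fsupp A B, monoid.mult = undefined, one = undefined,
     ring.zero = (\<lambda>_. \<zero>\<^bsub>A\<^esub>), ring.add = (\<lambda>f g b. f b \<oplus>\<^bsub>A\<^esub> g b)\<rparr>"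

text \<open>\<open>fs_group\<close> and \<open>free_module\<close> are records of different types
  with the same additive structure; the predicate lets the facts below serve both.\<close>

definition is_fs :: "('a, 'p) ring_scheme \<Rightarrow> 'b set \<Rightarrow> ('b \<Rightarrow> 'a, 'q) ring_scheme \<Rightarrow> bool" where
  "is_fs A B C \<longleftrightarrow> abelian_group A \<and> carrier C = fsupp A B \<and> \<zero>\<^bsub>C\<^esub> = (\<lambda>_. \<zero>\<^bsub>A\<^esub>) \<and>
     ring.add C = (\<lambda>f g b. f b \<oplus>\<^bsub>A\<^esub> g b)"

definition single :: "('a, 'p) ring_scheme \<Rightarrow> 'b \<Rightarrow> 'a \<Rightarrow> 'b \<Rightarrow> 'a" where
  "single A b a = (\<lambda>c. if c = b then a else \<zero>\<^bsub>A\<^esub>)"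

text \<open>The map out of the direct sum that is induced by the additive maps
  \<open>\<lambda>a. \<Phi> a b\<close>, one for each \<open>b\<close>.\<close>

definition fext ::
    "('a, 'p) ring_scheme \<Rightarrow> ('g, 'q) ring_scheme \<Rightarrow> ('a \<Rightarrow> 'b \<Rightarrow> 'g) \<Rightarrow> ('b \<Rightarrow> 'a) \<Rightarrow> 'g" where
  "fext A G \<Phi> f = (\<Oplus>\<^bsub>G\<^esub>b\<in>{b. f b \<noteq> \<zero>\<^bsub>A\<^esub>}. \<Phi> (f b) b)"

definition biadd ::
    "('a, 'p) ring_scheme \<Rightarrow> 'b set \<Rightarrow> ('g, 'q) ring_scheme \<Rightarrow> ('a \<Rightarrow> 'b \<Rightarrow> 'g) \<Rightarrow> bool" where
  "biadd A B G \<Phi> \<longleftrightarrow> (\<forall>b\<in>B. (\<lambda>a. \<Phi> a b) \<in> ahom A G)"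

lemma fsuppD:
  assumes "f \<in> fsupp A B"
  shows "b \<in> B \<Longrightarrow> f b \<in> carrier A" "b \<notin> B \<Longrightarrow> f b = \<zero>\<^bsub>A\<^esub>" "finite {b. f b \<noteq> \<zero>\<^bsub>A\<^esub>}"
    "{b. f b \<noteq> \<zero>\<^bsub>A\<^esub>} \<subseteq> B"
  using assms by (auto simp: fsupp_def)

lemma fsupp_closed: "f \<in> fsupp A B \<Longrightarrow> abelian_group A \<Longrightarrow> f b \<in> carrier A"
  using fsuppD(1,2)[of f A B b] abelian_groupE(2)[of A] by (cases "b \<in> B") auto

lemma fsuppI:
  assumes "\<And>b. b \<in> B \<Longrightarrow> f b \<in> carrier A" "\<And>b. b \<notin> B \<Longrightarrow> f b = \<zero>\<^bsub>A\<^esub>" "finite J" "{b. f b \<noteq> \<zero>\<^bsub>A\<^esub>} \<subseteq> J"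
  shows "f \<in> fsupp A B"
  using assms by (auto simp: fsupp_def finite_subset)

lemma fsupp_mono:
  assumes "abelian_group A" "B \<subseteq> B'"
  shows "fsupp A B \<subseteq> fsupp A B'"
proof
  fix f assume f: "f \<in> fsupp A B"
  show "f \<in> fsupp A B'"
    by (rule fsuppI[OF fsupp_closed[OF f assms(1)] _ fsuppD(3)[OF f]]) (use assms(2) fsuppD(2)[OF f] in auto)
qed

lemma is_fs_fs_group: "abelian_group A \<Longrightarrow> is_fs A B (fs_group A B)"
  by (simp add: is_fs_def fs_group_def)

lemma is_fs_free_module: "ring R \<Longrightarrow> is_fs R B (free_module R B)"
  by (simp add: is_fs_def free_module_def fsupp_def ring.is_abelian_group)

lemma is_fsD:
  assumes "is_fs A B C"
  shows "abelian_group A" "carrier C = fsupp A B" "\<zero>\<^bsub>C\<^esub> = (\<lambda>_. \<zero>\<^bsub>A\<^esub>)"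
    "f \<oplus>\<^bsub>C\<^esub> g = (\<lambda>b. f b \<oplus>\<^bsub>A\<^esub> g b)"
  using assms by (auto simp: is_fs_def)

lemma is_fs_group:
  assumes "is_fs A B C"
  shows "abelian_group C"
proof (rule abelian_groupI)
  interpret A: abelian_group A using assms by (simp add: is_fs_def)
  note C = is_fsD(2-4)[OF assms]
  show "\<zero>\<^bsub>C\<^esub> \<in> carrier C" by (auto simp: C fsupp_def)
  fix x assume "x \<in> carrier C"
  then have x: "x \<in> fsupp A B" by (simp add: C)
  note xc [simp] = fsupp_closed[OF x A.abelian_group_axioms]
  show "\<zero>\<^bsub>C\<^esub> \<oplus>\<^bsub>C\<^esub> x = x" by (auto simp: C)
  have "(\<lambda>b. \<ominus>\<^bsub>A\<^esub> x b) \<in> fsupp A B"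
    by (rule fsuppI[OF _ _ fsuppD(3)[OF x]]) (auto simp: fsuppD(2)[OF x])
  then show "\<exists>y\<in>carrier C. y \<oplus>\<^bsub>C\<^esub> x = \<zero>\<^bsub>C\<^esub>"
    by (intro bexI[of _ "\<lambda>b. \<ominus>\<^bsub>A\<^esub> x b"]) (auto simp: C A.l_neg)
  fix y assume "y \<in> carrier C"
  then have y: "y \<in> fsupp A B" by (simp add: C)
  note yc [simp] = fsupp_closed[OF y A.abelian_group_axioms]
  show "x \<oplus>\<^bsub>C\<^esub> y = y \<oplus>\<^bsub>C\<^esub> x" by (auto simp: C A.a_comm)
  have "(\<lambda>b. x b \<oplus>\<^bsub>A\<^esub> y b) \<in> fsupp A B"
    by (rule fsuppI[where J = "{b. x b \<noteq> \<zero>\<^bsub>A\<^esub>} \<union> {b. y b \<noteq> \<zero>\<^bsub>A\<^esub>}"])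
      (auto simp: fsuppD(2,3)[OF x] fsuppD(2,3)[OF y])
  then show "x \<oplus>\<^bsub>C\<^esub> y \<in> carrier C" by (auto simp: C)
  fix z assume "z \<in> carrier C"
  then have z: "z \<in> fsupp A B" by (simp add: C)
  note zc [simp] = fsupp_closed[OF z A.abelian_group_axioms]
  show "x \<oplus>\<^bsub>C\<^esub> y \<oplus>\<^bsub>C\<^esub> z = x \<oplus>\<^bsub>C\<^esub> (y \<oplus>\<^bsub>C\<^esub> z)" by (auto simp: C A.a_assoc)
qed

lemma is_fs_eval:
  assumes "is_fs A B C"
  shows "(\<lambda>f. f b) \<in> ahom C A"
proof (rule ahomI)
  show "x b \<in> carrier A" if "x \<in> carrier C" for x
    by (rule fsupp_closed[OF _ is_fsD(1)[OF assms]]) (use that in \<open>simp add: is_fsD(2)[OF assms]\<close>)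
qed (simp add: is_fsD(4)[OF assms])

lemma single_closed: "abelian_group A \<Longrightarrow> b \<in> B \<Longrightarrow> a \<in> carrier A \<Longrightarrow> single A b a \<in> fsupp A B"
  by (rule fsuppI[where J = "{b}"]) (auto simp: single_def abelian_groupE(2))

lemma single_same [simp]: "single A b a b = a"
  by (simp add: single_def)

lemma single_ahom:
  assumes C: "is_fs A B C" and "b \<in> B"
  shows "single A b \<in> ahom A C"
proof (rule ahomI)
  interpret A: abelian_group A using C by (rule is_fsD)
  show "single A b x \<in> carrier C" if "x \<in> carrier A" for x
    using that assms by (simp add: is_fsD[OF C] single_closed)
  show "single A b (x \<oplus>\<^bsub>A\<^esub> y) = single A b x \<oplus>\<^bsub>C\<^esub> single A b y" for x y
    by (simp add: single_def fun_eq_iff is_fsD[OF C])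
qed

lemma biaddD:
  assumes "biadd A B G \<Phi>" "b \<in> B"
  shows "a \<in> carrier A \<Longrightarrow> \<Phi> a b \<in> carrier G"
    "a \<in> carrier A \<Longrightarrow> a' \<in> carrier A \<Longrightarrow> \<Phi> (a \<oplus>\<^bsub>A\<^esub> a') b = \<Phi> a b \<oplus>\<^bsub>G\<^esub> \<Phi> a' b"
    "abelian_group A \<Longrightarrow> abelian_group G \<Longrightarrow> \<Phi> \<zero>\<^bsub>A\<^esub> b = \<zero>\<^bsub>G\<^esub>"
  using assms ahom_closed[of "\<lambda>a. \<Phi> a b" A G] ahom_add[of "\<lambda>a. \<Phi> a b" A G] ahom_zero[of A G "\<lambda>a. \<Phi> a b"]
  by (auto simp: biadd_def)

lemma biaddI:
  assumes "\<And>a b. a \<in> carrier A \<Longrightarrow> b \<in> B \<Longrightarrow> \<Phi> a b \<in> carrier G"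
    "\<And>a a' b. a \<in> carrier A \<Longrightarrow> a' \<in> carrier A \<Longrightarrow> b \<in> B \<Longrightarrow> \<Phi> (a \<oplus>\<^bsub>A\<^esub> a') b = \<Phi> a b \<oplus>\<^bsub>G\<^esub> \<Phi> a' b"
  shows "biadd A B G \<Phi>"
  using assms by (auto simp: biadd_def intro!: ahomI)

text \<open>Terms outside the support vanish because \<open>\<Phi>\<close> maps zero to zero. A
  common index set is what allows sums over different supports to be compared, as in
  \<open>fext_ahom\<close>.\<close>

lemma fext_superset:
  assumes "abelian_group A" "abelian_group G" "biadd A B G \<Phi>" "f \<in> fsupp A B"
    and "finite J" "{b. f b \<noteq> \<zero>\<^bsub>A\<^esub>} \<subseteq> J" "J \<subseteq> B"
  shows "fext A G \<Phi> f = (\<Oplus>\<^bsub>G\<^esub>b\<in>J. \<Phi> (f b) b)"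
proof -
  interpret G: abelian_group G by fact
  have zero: "\<Phi> (f i) i = \<zero>\<^bsub>G\<^esub>" if "i \<in> J - {b. f b \<noteq> \<zero>\<^bsub>A\<^esub>}" for i
    using that assms(7) biaddD(3)[OF assms(3) _ assms(1,2), of i] by auto
  have cl: "(\<lambda>b. \<Phi> (f b) b) \<in> J \<rightarrow> carrier G"
    using assms(7) by (auto intro!: biaddD(1)[OF assms(3)] fsupp_closed[OF assms(4,1)])
  show ?thesis unfolding fext_def
    by (rule G.add.finprod_mono_neutral_cong_left) (use assms(5,6) zero cl in auto)
qed

lemma fext_closed:
  assumes "abelian_group A" "abelian_group G" "biadd A B G \<Phi>" "f \<in> fsupp A B"
  shows "fext A G \<Phi> f \<in> carrier G"
proof -
  interpret G: abelian_group G by fact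
  show ?thesis unfolding fext_def
    by (rule G.finsum_closed)
      (use fsuppD(4)[OF assms(4)] in \<open>auto intro!: biaddD(1)[OF assms(3)] fsupp_closed[OF assms(4,1)]\<close>)
qed

lemma fext_ahom:
  assumes C: "is_fs A B C" and G: "abelian_group G" and \<Phi>: "biadd A B G \<Phi>"
  shows "fext A G \<Phi> \<in> ahom C G"
proof (rule ahomI)
  interpret G: abelian_group G by fact
  interpret A: abelian_group A using C by (rule is_fsD)
  note A = A.abelian_group_axioms
  fix f assume "f \<in> carrier C"
  then have f: "f \<in> fsupp A B" by (simp add: is_fsD[OF C])
  show "fext A G \<Phi> f \<in> carrier G" by (rule fext_closed[OF A G \<Phi> f])
  fix g assume "g \<in> carrier C"
  then have g: "g \<in> fsupp A B" by (simp add: is_fsD[OF C])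
  let ?J = "{b. f b \<noteq> \<zero>\<^bsub>A\<^esub>} \<union> {b. g b \<noteq> \<zero>\<^bsub>A\<^esub>}"
  have J: "finite ?J" "?J \<subseteq> B" using fsuppD(3,4)[OF f] fsuppD(3,4)[OF g] by auto
  have fg: "f \<oplus>\<^bsub>C\<^esub> g \<in> fsupp A B"
    using abelian_groupE(1)[OF is_fs_group[OF C]] f g by (simp add: is_fsD(2)[OF C])
  have sup: "{b. (f \<oplus>\<^bsub>C\<^esub> g) b \<noteq> \<zero>\<^bsub>A\<^esub>} \<subseteq> ?J" by (auto simp: is_fsD[OF C])
  note fc = fsupp_closed[OF f A] and gc = fsupp_closed[OF g A]
  have "fext A G \<Phi> (f \<oplus>\<^bsub>C\<^esub> g) = (\<Oplus>\<^bsub>G\<^esub>b\<in>?J. \<Phi> ((f \<oplus>\<^bsub>C\<^esub> g) b) b)"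
    by (rule fext_superset[OF A G \<Phi> fg J(1) sup J(2)])
  also have "\<dots> = (\<Oplus>\<^bsub>G\<^esub>b\<in>?J. \<Phi> (f b) b \<oplus>\<^bsub>G\<^esub> \<Phi> (g b) b)"
    by (rule G.finsum_cong') (use J in \<open>auto simp: is_fsD[OF C] fc gc biaddD[OF \<Phi>]\<close>)
  also have "\<dots> = (\<Oplus>\<^bsub>G\<^esub>b\<in>?J. \<Phi> (f b) b) \<oplus>\<^bsub>G\<^esub> (\<Oplus>\<^bsub>G\<^esub>b\<in>?J. \<Phi> (g b) b)"
    by (rule G.finsum_addf) (use J(2) in \<open>auto intro!: fc gc biaddD[OF \<Phi>]\<close>)
  also have "\<dots> = fext A G \<Phi> f \<oplus>\<^bsub>G\<^esub> fext A G \<Phi> g"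
    using fext_superset[OF A G \<Phi> f J(1) _ J(2)] fext_superset[OF A G \<Phi> g J(1) _ J(2)] by auto
  finally show "fext A G \<Phi> (f \<oplus>\<^bsub>C\<^esub> g) = fext A G \<Phi> f \<oplus>\<^bsub>G\<^esub> fext A G \<Phi> g" .
qed

lemma fext_single:
  assumes "abelian_group A" "abelian_group G" "biadd A B G \<Phi>" "b \<in> B" "a \<in> carrier A"
  shows "fext A G \<Phi> (single A b a) = \<Phi> a b"
proof -
  interpret G: abelian_group G by fact
  have "fext A G \<Phi> (single A b a) = (\<Oplus>\<^bsub>G\<^esub>c\<in>{b}. \<Phi> (single A b a c) c)"
    by (rule fext_superset[OF assms(1-3) single_closed]) (use assms in \<open>auto simp: single_def\<close>)
  then show ?thesis using biaddD(1)[OF assms(3-5)] by simp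
qed

lemma ahom_fext:
  assumes "abelian_group A" "abelian_group G" "abelian_group H" "h \<in> ahom G H" "biadd A B G \<Phi>" "f \<in> fsupp A B"
  shows "h (fext A G \<Phi> f) = fext A H (\<lambda>a b. h (\<Phi> a b)) f"
  unfolding fext_def
  by (rule ahom_finsum[OF assms(2-4)])
    (use fsuppD(4)[OF assms(6)] in \<open>auto intro!: biaddD(1)[OF assms(5)] fsupp_closed[OF assms(6,1)]\<close>)

lemma biadd_ahom: "biadd A B G \<Phi> \<Longrightarrow> h \<in> ahom G H \<Longrightarrow> biadd A B H (\<lambda>a b. h (\<Phi> a b))"
  by (auto simp: biadd_def intro: ahom_compose)

lemma biadd_single: "is_fs A B C \<Longrightarrow> biadd A B C (\<lambda>a b. single A b a)"
  by (simp add: biadd_def single_ahom)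

lemma fext_cong:
  assumes "abelian_group A" "abelian_group G" "biadd A B G \<Psi>" "f \<in> fsupp A B"
    and "\<And>a b. a \<in> carrier A \<Longrightarrow> b \<in> B \<Longrightarrow> \<Phi> a b = \<Psi> a b"
  shows "fext A G \<Phi> f = fext A G \<Psi> f"
proof -
  interpret G: abelian_group G by fact
  show ?thesis unfolding fext_def
    by (rule G.finsum_cong') (use fsuppD(4)[OF assms(4)] in
      \<open>auto intro!: assms(5) biaddD(1)[OF assms(3)] fsupp_closed[OF assms(4,1)]\<close>)
qed

text \<open>Evaluation at \<open>c\<close> is additive and can be moved into the sum, where only the
  term for \<open>b = c\<close> survives.\<close>

lemma fext_expand:
  assumes C: "is_fs A B C" and f: "f \<in> fsupp A B"
  shows "fext A C (\<lambda>a b. single A b a) f = f"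
proof
  fix c
  interpret A: abelian_group A using C by (rule is_fsD)
  note A = A.abelian_group_axioms
  have "fext A C (\<lambda>a b. single A b a) f c = fext A A (\<lambda>a b. single A b a c) f"
    by (rule ahom_fext[OF A is_fs_group[OF C] A is_fs_eval[OF C] biadd_single[OF C] f])
  also have "\<dots> = f c"
  \<comment> \<open>\<open>finsum_singleton\<close> wants \<open>c\<close> in the index set, which
    is the support of \<open>f\<close>; off the support all terms vanish.\<close>
  proof (cases "f c = \<zero>\<^bsub>A\<^esub>")
    case True
    then have "fext A A (\<lambda>a b. single A b a c) f = (\<Oplus>\<^bsub>A\<^esub>b\<in>{b. f b \<noteq> \<zero>\<^bsub>A\<^esub>}. \<zero>\<^bsub>A\<^esub>)"
      unfolding fext_def by (intro A.finsum_cong') (auto simp: single_def)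
    then show ?thesis using True by simp
  next
    case False
    have "fext A A (\<lambda>a b. single A b a c) f = (\<Oplus>\<^bsub>A\<^esub>b\<in>{b. f b \<noteq> \<zero>\<^bsub>A\<^esub>}. if c = b then f b else \<zero>\<^bsub>A\<^esub>)"
      unfolding fext_def by (intro A.finsum_cong') (auto simp: single_def fsupp_closed[OF f A])
    also have "\<dots> = f c"
      by (rule A.finsum_singleton) (use False fsuppD(3)[OF f] fsupp_closed[OF f A] in auto)
    finally show ?thesis .
  qed
  finally show "fext A C (\<lambda>a b. single A b a) f c = f c" .
qed

lemma ahom_eq_fext:
  assumes C: "is_fs A B C" and G: "abelian_group G" and h: "h \<in> ahom C G" and f: "f \<in> fsupp A B"
  shows "h f = fext A G (\<lambda>a b. h (single A b a)) f"
  using ahom_fext[OF is_fsD(1)[OF C] is_fs_group[OF C] G h biadd_single[OF C] f] fext_expand[OF C f] by simp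

text \<open>Functions supported at one point generate the direct sum. Most identities between maps
  on free modules below are reduced to single basis elements this way.\<close>

lemma fs_ahom_eqI:
  assumes C: "is_fs A B C" and G: "abelian_group G" and h: "h \<in> ahom C G" "h' \<in> ahom C G"
    and f: "f \<in> fsupp A B"
    and eq: "\<And>a b. a \<in> carrier A \<Longrightarrow> b \<in> B \<Longrightarrow> h (single A b a) = h' (single A b a)"
  shows "h f = h' f"
  unfolding ahom_eq_fext[OF C G h(1) f] ahom_eq_fext[OF C G h(2) f]
  by (rule fext_cong[OF is_fsD(1)[OF C] G biadd_ahom[OF biadd_single[OF C] h(2)] f eq])

lemma fext_add:
  assumes "abelian_group A" "abelian_group G" "biadd A B G \<Phi>" "biadd A B G \<Psi>" "f \<in> fsupp A B"
  shows "fext A G (\<lambda>a b. \<Phi> a b \<oplus>\<^bsub>G\<^esub> \<Psi> a b) f = fext A G \<Phi> f \<oplus>\<^bsub>G\<^esub> fext A G \<Psi> f"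
proof -
  interpret G: abelian_group G by fact
  show ?thesis unfolding fext_def
    by (rule G.finsum_addf) (use fsuppD(4)[OF assms(5)] in
      \<open>auto intro!: biaddD(1)[OF assms(3)] biaddD(1)[OF assms(4)] fsupp_closed[OF assms(5,1)]\<close>)
qed

lemma fext_zero:
  assumes "abelian_group G" "\<And>b. f b \<noteq> \<zero>\<^bsub>A\<^esub> \<Longrightarrow> \<Phi> (f b) b = \<zero>\<^bsub>G\<^esub>"
  shows "fext A G \<Phi> f = \<zero>\<^bsub>G\<^esub>"
proof -
  interpret G: abelian_group G by fact
  show ?thesis unfolding fext_def using assms(2) by (intro G.add.finprod_one_eqI) auto
qed

section \<open>Linear maps on free modules\<close>

lemma left_moduleD: "left_module R N \<Longrightarrow> ring R" "left_module R N \<Longrightarrow> abelian_group N"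
  by (auto simp: left_module_def)

lemma right_moduleD: "right_module R N \<Longrightarrow> ring R" "right_module R N \<Longrightarrow> abelian_group N"
  by (auto simp: right_module_def)

lemma bimoduleD: "bimodule L R N \<Longrightarrow> left_module L N" "bimodule L R N \<Longrightarrow> right_module R N"
  by (auto simp: bimodule_def)

lemma smult_ahom: "left_module R N \<Longrightarrow> r \<in> carrier R \<Longrightarrow> smult N r \<in> ahom N N"
  by (rule ahomI) (auto simp: left_module.smult_closed left_module.smult_r_distr)

lemma smult_ahom_left: "left_module R N \<Longrightarrow> x \<in> carrier N \<Longrightarrow> (\<lambda>r. smult N r x) \<in> ahom R N"
  by (rule ahomI) (auto simp: left_module.smult_closed left_module.smult_l_distr)

lemma rsmult_ahom_right: "right_module R N \<Longrightarrow> x \<in> carrier N \<Longrightarrow> rsmult N x \<in> ahom R N"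
  by (rule ahomI) (auto simp: right_module.rsmult_closed right_module.rsmult_r_distr)

lemma smult_zero: "left_module R N \<Longrightarrow> r \<in> carrier R \<Longrightarrow> smult N r \<zero>\<^bsub>N\<^esub> = \<zero>\<^bsub>N\<^esub>"
  by (rule ahom_zero[OF left_moduleD(2) left_moduleD(2) smult_ahom])

lemma rsmult_zero: "right_module R N \<Longrightarrow> x \<in> carrier N \<Longrightarrow> rsmult N x \<zero>\<^bsub>R\<^esub> = \<zero>\<^bsub>N\<^esub>"
  by (rule ahom_zero[OF ring.is_abelian_group[OF right_moduleD(1)] right_moduleD(2) rsmult_ahom_right])

lemma carrier_free_module: "carrier (free_module R B) = fsupp R B"
  by (simp add: free_module_def fsupp_def)

lemma smult_free_module: "smult (free_module R B) r f = (\<lambda>b. r \<otimes>\<^bsub>R\<^esub> f b)"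
  by (simp add: free_module_def)

lemma add_free_module: "f \<oplus>\<^bsub>free_module R B\<^esub> g = (\<lambda>b. f b \<oplus>\<^bsub>R\<^esub> g b)"
  by (simp add: free_module_def)

lemma zero_free_module: "\<zero>\<^bsub>free_module R B\<^esub> = (\<lambda>_. \<zero>\<^bsub>R\<^esub>)"
  by (simp add: free_module_def)

lemma free_left_module:
  assumes "ring R"
  shows "left_module R (free_module R B)"
proof -
  interpret R: ring R by fact
  interpret F: abelian_group "free_module R B" by (rule is_fs_group[OF is_fs_free_module[OF assms]])
  have sm: "(\<lambda>b. r \<otimes>\<^bsub>R\<^esub> f b) \<in> fsupp R B" if "r \<in> carrier R" "f \<in> fsupp R B" for r f
    by (rule fsuppI[OF _ _ fsuppD(3)[OF that(2)]])
      (use that(1) fsupp_closed[OF that(2) R.is_abelian_group] in \<open>auto simp: fsuppD(2)[OF that(2)]\<close>)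
  show ?thesis
  proof unfold_locales
    fix a x assume a: "a \<in> carrier R" and x: "x \<in> carrier (free_module R B)"
    have xf: "x \<in> fsupp R B" using x by (simp add: carrier_free_module)
    note xc = fsupp_closed[OF xf R.is_abelian_group]
    show "smult (free_module R B) a x \<in> carrier (free_module R B)"
      using sm[OF a xf] by (simp add: carrier_free_module smult_free_module)
    fix b assume b: "b \<in> carrier R"
    show "smult (free_module R B) (a \<oplus>\<^bsub>R\<^esub> b) x
      = smult (free_module R B) a x \<oplus>\<^bsub>free_module R B\<^esub> smult (free_module R B) b x"
      using a b by (simp add: smult_free_module add_free_module R.l_distr xc)
    show "smult (free_module R B) (a \<otimes>\<^bsub>R\<^esub> b) x = smult (free_module R B) a (smult (free_module R B) b x)"
      using a b by (simp add: smult_free_module R.m_assoc xc)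
  next
    fix a x y assume a: "a \<in> carrier R" and x: "x \<in> carrier (free_module R B)" "y \<in> carrier (free_module R B)"
    have xf: "x \<in> fsupp R B" "y \<in> fsupp R B" using x by (simp_all add: carrier_free_module)
    note xc = fsupp_closed[OF xf(1) R.is_abelian_group] fsupp_closed[OF xf(2) R.is_abelian_group]
    show "smult (free_module R B) a (x \<oplus>\<^bsub>free_module R B\<^esub> y)
      = smult (free_module R B) a x \<oplus>\<^bsub>free_module R B\<^esub> smult (free_module R B) a y"
      using a by (simp add: smult_free_module add_free_module R.r_distr xc)
  next
    fix x assume "x \<in> carrier (free_module R B)"
    then have xf: "x \<in> fsupp R B" by (simp add: carrier_free_module)
    show "smult (free_module R B) \<one>\<^bsub>R\<^esub> x = x"
      using fsupp_closed[OF xf R.is_abelian_group] by (simp add: smult_free_module)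
  qed
qed

lemma linear_extension_fext:
  "linear_extension R N g f = fext R N (\<lambda>r b. smult N r (g b)) f"
  by (simp add: linear_extension_def fext_def)

lemma biadd_smult: "left_module R N \<Longrightarrow> (\<And>b. b \<in> B \<Longrightarrow> g b \<in> carrier N) \<Longrightarrow> biadd R B N (\<lambda>r b. smult N r (g b))"
  by (auto simp: biadd_def smult_ahom_left)

lemma lin_ahom:
  assumes "left_module R N" "\<And>b. b \<in> B \<Longrightarrow> g b \<in> carrier N"
  shows "linear_extension R N g \<in> ahom (free_module R B) N"
proof -
  have "fext R N (\<lambda>r b. smult N r (g b)) \<in> ahom (free_module R B) N"
    by (rule fext_ahom[OF is_fs_free_module[OF left_moduleD(1)[OF assms(1)]] left_moduleD(2)[OF assms(1)]
      biadd_smult[OF assms]])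
  then show ?thesis by (simp add: linear_extension_fext[abs_def])
qed

lemma lin_closed:
  assumes "left_module R N" "\<And>b. b \<in> B \<Longrightarrow> g b \<in> carrier N" "f \<in> fsupp R B"
  shows "linear_extension R N g f \<in> carrier N"
  using ahom_closed[OF lin_ahom[OF assms(1,2)]] assms(3) by (simp add: carrier_free_module)

lemma lin_single:
  assumes "left_module R N" "\<And>b. b \<in> B \<Longrightarrow> g b \<in> carrier N" "b \<in> B" "r \<in> carrier R"
  shows "linear_extension R N g (single R b r) = smult N r (g b)"
  unfolding linear_extension_fext
  by (rule fext_single[OF ring.is_abelian_group[OF left_moduleD(1)[OF assms(1)]] left_moduleD(2)[OF assms(1)]
      biadd_smult[OF assms(1,2)] assms(3,4)])

lemma lin_cong:
  assumes "left_module R N" "\<And>b. b \<in> B \<Longrightarrow> g b \<in> carrier N" "f \<in> fsupp R B" "\<And>b. b \<in> B \<Longrightarrow> g b = g' b"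
  shows "linear_extension R N g f = linear_extension R N g' f"
  unfolding linear_extension_fext
  by (rule fext_cong[OF ring.is_abelian_group[OF left_moduleD(1)[OF assms(1)]] left_moduleD(2)[OF assms(1)]
      biadd_smult[OF assms(1)] assms(3)]) (use assms(2,4) in auto)

lemma lin_linear_hom:
  assumes N: "left_module R N" and N': "left_module R N'" and g: "\<And>b. b \<in> B \<Longrightarrow> g b \<in> carrier N"
    and f: "f \<in> fsupp R B" and h: "h \<in> ahom N N'"
    and lin: "\<And>r x. r \<in> carrier R \<Longrightarrow> x \<in> carrier N \<Longrightarrow> h (smult N r x) = smult N' r (h x)"
  shows "h (linear_extension R N g f) = linear_extension R N' (\<lambda>b. h (g b)) f"
proof -
  note A = ring.is_abelian_group[OF left_moduleD(1)[OF N]]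
  have "h (fext R N (\<lambda>r b. smult N r (g b)) f) = fext R N' (\<lambda>r b. h (smult N r (g b))) f"
    by (rule ahom_fext[OF A left_moduleD(2)[OF N] left_moduleD(2)[OF N'] h biadd_smult[OF N g] f])
  also have "\<dots> = fext R N' (\<lambda>r b. smult N' r (h (g b))) f"
    by (rule fext_cong[OF A left_moduleD(2)[OF N'] biadd_smult[OF N'] f]) (use lin g ahom_closed[OF h] in auto)
  finally show ?thesis by (simp add: linear_extension_fext)
qed

lemma smult_single:
  assumes "ring R" "r \<in> carrier R"
  shows "smult (free_module R B) r (single R b a) = single R b (r \<otimes>\<^bsub>R\<^esub> a)"
proof -
  interpret R: ring R by fact
  show ?thesis using assms(2) by (auto simp: smult_free_module single_def fun_eq_iff)
qed

lemma lin_smult: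
  assumes N: "left_module R N" and g: "\<And>b. b \<in> B \<Longrightarrow> g b \<in> carrier N" and f: "f \<in> fsupp R B"
    and r: "r \<in> carrier R"
  shows "linear_extension R N g (smult (free_module R B) r f) = smult N r (linear_extension R N g f)"
proof -
  interpret R: ring R using N by (rule left_moduleD)
  have R: "ring R" by (rule R.ring_axioms)
  show ?thesis
  proof (rule fs_ahom_eqI[OF is_fs_free_module[OF R] left_moduleD(2)[OF N] _ _ f, of "\<lambda>f. linear_extension R N g (smult (free_module R B) r f)" "\<lambda>f. smult N r (linear_extension R N g f)"])
    show "(\<lambda>f. linear_extension R N g (smult (free_module R B) r f)) \<in> ahom (free_module R B) N"
      by (rule ahom_compose[OF smult_ahom[OF free_left_module[OF R] r] lin_ahom[OF N g]])
    show "(\<lambda>f. smult N r (linear_extension R N g f)) \<in> ahom (free_module R B) N"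
      by (rule ahom_compose[OF lin_ahom[OF N g] smult_ahom[OF N r]])
    show "linear_extension R N g (smult (free_module R B) r (single R b a)) = smult N r (linear_extension R N g (single R b a))"
      if "a \<in> carrier R" "b \<in> B" for a b
      using that r g by (simp add: smult_single[OF R] lin_single[OF N g] left_module.smult_assoc[OF N])
  qed
qed

text \<open>\<open>linear_extension R N g\<close> is itself linear, so it can be moved into the
  extension of \<open>\<alpha>\<close>. This is how compositions of maps given on bases are
  computed.\<close>

lemma lin_assoc:
  assumes N: "left_module R N" and \<alpha>: "\<And>b. b \<in> B \<Longrightarrow> \<alpha> b \<in> fsupp R B'" and g: "\<And>b. b \<in> B' \<Longrightarrow> g b \<in> carrier N"
    and f: "f \<in> fsupp R B"
  shows "linear_extension R N g (linear_extension R (free_module R B') \<alpha> f)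
    = linear_extension R N (\<lambda>b. linear_extension R N g (\<alpha> b)) f"
proof (rule lin_linear_hom[OF free_left_module[OF left_moduleD(1)[OF N]] N _ f lin_ahom[OF N g]])
  show "linear_extension R N g (smult (free_module R B') r x) = smult N r (linear_extension R N g x)"
    if "r \<in> carrier R" "x \<in> carrier (free_module R B')" for r x
    using that by (intro lin_smult[OF N g]) (auto simp: carrier_free_module)
qed (use \<alpha> g in \<open>auto simp: carrier_free_module\<close>)

lemma lin_add_fun:
  assumes N: "left_module R N" and g: "\<And>b. b \<in> B \<Longrightarrow> g b \<in> carrier N" and g': "\<And>b. b \<in> B \<Longrightarrow> g' b \<in> carrier N"
    and f: "f \<in> fsupp R B"
  shows "linear_extension R N (\<lambda>b. g b \<oplus>\<^bsub>N\<^esub> g' b) f = linear_extension R N g f \<oplus>\<^bsub>N\<^esub> linear_extension R N g' f"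
proof -
  interpret N: abelian_group N using N by (rule left_moduleD)
  note A = ring.is_abelian_group[OF left_moduleD(1)[OF N]]
  have "fext R N (\<lambda>r b. smult N r (g b \<oplus>\<^bsub>N\<^esub> g' b)) f = fext R N (\<lambda>r b. smult N r (g b) \<oplus>\<^bsub>N\<^esub> smult N r (g' b)) f"
    by (rule fext_cong[OF A N.abelian_group_axioms _ f])
      (auto intro!: biaddI simp: g g' left_module.smult_closed[OF N] left_module.smult_r_distr[OF N]
        left_module.smult_l_distr[OF N] abelian_add4[OF N.abelian_group_axioms])
  also have "\<dots> = fext R N (\<lambda>r b. smult N r (g b)) f \<oplus>\<^bsub>N\<^esub> fext R N (\<lambda>r b. smult N r (g' b)) f"
    by (rule fext_add[OF A N.abelian_group_axioms biadd_smult[OF N g] biadd_smult[OF N g'] f])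
  finally show ?thesis by (simp add: linear_extension_fext)
qed

lemma lin_unit:
  assumes "ring R" "f \<in> fsupp R B"
  shows "linear_extension R (free_module R B) (\<lambda>b. single R b \<one>\<^bsub>R\<^esub>) f = f"
proof -
  interpret R: ring R by fact
  have "fext R (free_module R B) (\<lambda>r b. smult (free_module R B) r (single R b \<one>\<^bsub>R\<^esub>)) f
    = fext R (free_module R B) (\<lambda>r b. single R b r) f"
    by (rule fext_cong[OF R.is_abelian_group is_fs_group[OF is_fs_free_module] biadd_single[OF is_fs_free_module]])
      (use assms in \<open>auto simp: smult_single\<close>)
  then show ?thesis using fext_expand[OF is_fs_free_module] assms by (simp add: linear_extension_fext)
qed

lemma lin_zero_fun:
  assumes "left_module R N" "f \<in> fsupp R B" "\<And>b. b \<in> B \<Longrightarrow> g b = \<zero>\<^bsub>N\<^esub>"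
  shows "linear_extension R N g f = \<zero>\<^bsub>N\<^esub>"
  unfolding linear_extension_fext
  by (rule fext_zero[OF left_moduleD(2)[OF assms(1)]])
    (use assms fsuppD(4)[OF assms(2)] fsuppD(1)[OF assms(2)] smult_zero[OF assms(1)] in auto)

text \<open>With direct sums of copies of \<open>A\<close> in the role of tensor products of
  \<open>A\<close> with free modules, this is the identity of \<open>A\<close> tensored with the
  linear map \<open>b \<mapsto> \<alpha> b\<close>.\<close>

definition rext ::
    "('l, 'a, 'r, 'w) bimodule_scheme \<Rightarrow> 'c set \<Rightarrow> ('b \<Rightarrow> 'c \<Rightarrow> 'r) \<Rightarrow> ('b \<Rightarrow> 'a) \<Rightarrow> 'c \<Rightarrow> 'a" where
  "rext A B' \<alpha> \<phi> = fext A (fs_group A B') (\<lambda>a b c. rsmult A a (\<alpha> b c)) \<phi>"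

lemma rsmult_fsupp:
  assumes A: "right_module R A" and a: "a \<in> carrier A" and p: "p \<in> fsupp R B"
  shows "(\<lambda>c. rsmult A a (p c)) \<in> fsupp A B"
proof -
  interpret R: ring R using A by (rule right_moduleD)
  note cl = fsupp_closed[OF p R.is_abelian_group]
  show ?thesis
    by (rule fsuppI[OF _ _ fsuppD(3)[OF p]])
      (auto simp: fsuppD(2)[OF p] rsmult_zero[OF A a] right_module.rsmult_closed[OF A a] cl)
qed

lemma carrier_fs_group: "carrier (fs_group A B) = fsupp A B"
  by (simp add: fs_group_def)

lemma zero_fs_group: "\<zero>\<^bsub>fs_group A B\<^esub> = (\<lambda>_. \<zero>\<^bsub>A\<^esub>)"
  by (simp add: fs_group_def)

lemma add_fs_group: "f \<oplus>\<^bsub>fs_group A B\<^esub> g = (\<lambda>b. f b \<oplus>\<^bsub>A\<^esub> g b)"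
  by (simp add: fs_group_def)

lemma fs_group_group: "abelian_group A \<Longrightarrow> abelian_group (fs_group A B)"
  by (rule is_fs_group[OF is_fs_fs_group])

lemma biadd_rsmult:
  assumes A: "right_module R A" and \<alpha>: "\<And>b. b \<in> B \<Longrightarrow> \<alpha> b \<in> fsupp R B'"
  shows "biadd A B (fs_group A B') (\<lambda>a b c. rsmult A a (\<alpha> b c))"
proof (rule biaddI)
  interpret R: ring R using A by (rule right_moduleD)
  show "(\<lambda>c. rsmult A a (\<alpha> b c)) \<in> carrier (fs_group A B')" if "a \<in> carrier A" "b \<in> B" for a b
    using rsmult_fsupp[OF A that(1) \<alpha>[OF that(2)]] by (simp add: carrier_fs_group)
  show "(\<lambda>c. rsmult A (a \<oplus>\<^bsub>A\<^esub> a') (\<alpha> b c)) = (\<lambda>c. rsmult A a (\<alpha> b c)) \<oplus>\<^bsub>fs_group A B'\<^esub> (\<lambda>c. rsmult A a' (\<alpha> b c))"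
    if "a \<in> carrier A" "a' \<in> carrier A" "b \<in> B" for a a' b
    using that fsupp_closed[OF \<alpha>[OF that(3)] R.is_abelian_group]
    by (simp add: add_fs_group right_module.rsmult_l_distr[OF A])
qed

lemma rext_ahom:
  assumes A: "right_module R A" and \<alpha>: "\<And>b. b \<in> B \<Longrightarrow> \<alpha> b \<in> fsupp R B'"
  shows "rext A B' \<alpha> \<in> ahom (fs_group A B) (fs_group A B')"
  using fext_ahom[OF is_fs_fs_group fs_group_group biadd_rsmult[OF A \<alpha>]] right_moduleD(2)[OF A]
  by (simp add: rext_def[abs_def])

lemma rext_closed:
  assumes "right_module R A" "\<And>b. b \<in> B \<Longrightarrow> \<alpha> b \<in> fsupp R B'" "\<phi> \<in> fsupp A B"
  shows "rext A B' \<alpha> \<phi> \<in> fsupp A B'"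
  using ahom_closed[OF rext_ahom[OF assms(1,2)]] assms(3) by (simp add: carrier_fs_group)

lemma rext_single:
  assumes A: "right_module R A" and \<alpha>: "\<And>b. b \<in> B \<Longrightarrow> \<alpha> b \<in> fsupp R B'" and "b \<in> B" "a \<in> carrier A"
  shows "rext A B' \<alpha> (single A b a) = (\<lambda>c. rsmult A a (\<alpha> b c))"
  unfolding rext_def
  by (rule fext_single[OF right_moduleD(2)[OF A] fs_group_group[OF right_moduleD(2)[OF A]] biadd_rsmult[OF A \<alpha>] assms(3,4)])

text \<open>The function \<open>\<lambda>c. rsmult A a (p c)\<close> stands for the pure tensor of
  \<open>a\<close> and \<open>p\<close>; on it the map changes the second factor only. Both sides
  are additive in \<open>p\<close>, and on \<open>single R b r\<close> they agree by associativity
  of the action on \<open>A\<close>.\<close>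

lemma rext_rsmult:
  assumes A: "right_module R A" and \<beta>: "\<And>b. b \<in> B \<Longrightarrow> \<beta> b \<in> fsupp R B'" and a: "a \<in> carrier A"
    and p: "p \<in> fsupp R B"
  shows "rext A B' \<beta> (\<lambda>c. rsmult A a (p c)) = (\<lambda>c. rsmult A a (linear_extension R (free_module R B') \<beta> p c))"
proof -
  interpret R: ring R using A by (rule right_moduleD)
  note R = R.ring_axioms and AA = right_moduleD(2)[OF A]
  note fsA = is_fs_fs_group[OF AA] and fsR = is_fs_free_module[OF R]
  have act: "(\<lambda>p c. rsmult A a (p c)) \<in> ahom (free_module R X) (fs_group A X)" for X :: "'x set"
  proof (rule ahomI)
    fix x y assume "x \<in> carrier (free_module R X)"
    then have x: "x \<in> fsupp R X" by (simp add: carrier_free_module)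
    show "(\<lambda>c. rsmult A a (x c)) \<in> carrier (fs_group A X)"
      using rsmult_fsupp[OF A a x] by (simp add: carrier_fs_group)
    assume "y \<in> carrier (free_module R X)"
    then have y: "y \<in> fsupp R X" by (simp add: carrier_free_module)
    show "(\<lambda>c. rsmult A a ((x \<oplus>\<^bsub>free_module R X\<^esub> y) c))
      = (\<lambda>c. rsmult A a (x c)) \<oplus>\<^bsub>fs_group A X\<^esub> (\<lambda>c. rsmult A a (y c))"
      using fsupp_closed[OF x R.is_abelian_group] fsupp_closed[OF y R.is_abelian_group]
      by (simp add: add_free_module add_fs_group right_module.rsmult_r_distr[OF A a])
  qed
  have \<beta>': "\<And>b. b \<in> B \<Longrightarrow> \<beta> b \<in> carrier (free_module R B')" using \<beta> by (simp add: carrier_free_module)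
  show ?thesis
  proof (rule fs_ahom_eqI[OF fsR fs_group_group[OF AA] _ _ p, of "\<lambda>p. rext A B' \<beta> (\<lambda>c. rsmult A a (p c))" _
        "\<lambda>p c. rsmult A a (linear_extension R (free_module R B') \<beta> p c)"])
    show "(\<lambda>p. rext A B' \<beta> (\<lambda>c. rsmult A a (p c))) \<in> ahom (free_module R B) (fs_group A B')"
      by (rule ahom_compose[OF act rext_ahom[OF A \<beta>]])
    show "(\<lambda>p c. rsmult A a (linear_extension R (free_module R B') \<beta> p c)) \<in> ahom (free_module R B) (fs_group A B')"
      by (rule ahom_compose[OF lin_ahom[OF free_left_module[OF R] \<beta>'] act])
    fix r b assume rb: "r \<in> carrier R" "b \<in> B"
    have "(\<lambda>c. rsmult A a (single R b r c)) = single A b (rsmult A a r)"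
      by (auto simp: single_def rsmult_zero[OF A a])
    then have "rext A B' \<beta> (\<lambda>c. rsmult A a (single R b r c)) = (\<lambda>c. rsmult A (rsmult A a r) (\<beta> b c))"
      using rext_single[OF A \<beta> rb(2) right_module.rsmult_closed[OF A a rb(1)]] by simp
    moreover have "linear_extension R (free_module R B') \<beta> (single R b r) = (\<lambda>c. r \<otimes>\<^bsub>R\<^esub> \<beta> b c)"
      using lin_single[OF free_left_module[OF R] \<beta>' rb(2,1)] by (simp add: smult_free_module)
    ultimately show "rext A B' \<beta> (\<lambda>c. rsmult A a (single R b r c))
        = (\<lambda>c. rsmult A a (linear_extension R (free_module R B') \<beta> (single R b r) c))"
      using right_module.rsmult_assoc[OF A a rb(1)] fsupp_closed[OF \<beta>[OF rb(2)] R.is_abelian_group] by simp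
  qed
qed

text \<open>Functoriality of the tensor product in the second factor.\<close>

lemma rext_assoc:
  assumes A: "right_module R A" and \<alpha>: "\<And>b. b \<in> B \<Longrightarrow> \<alpha> b \<in> fsupp R B'" and \<beta>: "\<And>b. b \<in> B' \<Longrightarrow> \<beta> b \<in> fsupp R B''"
    and \<phi>: "\<phi> \<in> fsupp A B"
  shows "rext A B'' \<beta> (rext A B' \<alpha> \<phi>) = rext A B'' (\<lambda>b. linear_extension R (free_module R B'') \<beta> (\<alpha> b)) \<phi>"
proof -
  note AA = right_moduleD(2)[OF A] and R = right_moduleD(1)[OF A]
  have \<beta>': "\<And>b. b \<in> B' \<Longrightarrow> \<beta> b \<in> carrier (free_module R B'')" using \<beta> by (simp add: carrier_free_module)
  have lc: "linear_extension R (free_module R B'') \<beta> (\<alpha> b) \<in> fsupp R B''" if "b \<in> B" for b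
    using lin_closed[OF free_left_module[OF R] \<beta>' \<alpha>[OF that]] by (simp add: carrier_free_module)
  have "rext A B'' \<beta> (fext A (fs_group A B') (\<lambda>a b c. rsmult A a (\<alpha> b c)) \<phi>)
     = fext A (fs_group A B'') (\<lambda>a b. rext A B'' \<beta> (\<lambda>c. rsmult A a (\<alpha> b c))) \<phi>"
    by (rule ahom_fext[OF AA fs_group_group[OF AA] fs_group_group[OF AA] rext_ahom[OF A \<beta>] biadd_rsmult[OF A \<alpha>] \<phi>])
  also have "\<dots> = fext A (fs_group A B'') (\<lambda>a b c. rsmult A a (linear_extension R (free_module R B'') \<beta> (\<alpha> b) c)) \<phi>"
    by (rule fext_cong[OF AA fs_group_group[OF AA] biadd_rsmult[OF A lc] \<phi> rext_rsmult[OF A \<beta> _ \<alpha>]]) auto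
  finally show ?thesis by (simp add: rext_def)
qed

lemma rext_add_fun:
  assumes A: "right_module R A" and \<alpha>: "\<And>b. b \<in> B \<Longrightarrow> \<alpha> b \<in> fsupp R B'" and \<beta>: "\<And>b. b \<in> B \<Longrightarrow> \<beta> b \<in> fsupp R B'"
    and \<phi>: "\<phi> \<in> fsupp A B"
  shows "rext A B' (\<lambda>b. \<alpha> b \<oplus>\<^bsub>free_module R B'\<^esub> \<beta> b) \<phi> = rext A B' \<alpha> \<phi> \<oplus>\<^bsub>fs_group A B'\<^esub> rext A B' \<beta> \<phi>"
proof -
  note AA = right_moduleD(2)[OF A] and R = ring.is_abelian_group[OF right_moduleD(1)[OF A]]
  note b1 = biadd_rsmult[where B = B and \<alpha> = \<alpha>, OF A \<alpha>]
    and b2 = biadd_rsmult[where B = B and \<alpha> = \<beta>, OF A \<beta>]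
  have b3: "biadd A B (fs_group A B') (\<lambda>a b. (\<lambda>c. rsmult A a (\<alpha> b c)) \<oplus>\<^bsub>fs_group A B'\<^esub> (\<lambda>c. rsmult A a (\<beta> b c)))"
    using b1 b2 unfolding biadd_def by (auto intro!: ahom_add_map fs_group_group AA)
  have "fext A (fs_group A B') (\<lambda>a b c. rsmult A a ((\<alpha> b \<oplus>\<^bsub>free_module R B'\<^esub> \<beta> b) c)) \<phi>
     = fext A (fs_group A B') (\<lambda>a b. (\<lambda>c. rsmult A a (\<alpha> b c)) \<oplus>\<^bsub>fs_group A B'\<^esub> (\<lambda>c. rsmult A a (\<beta> b c))) \<phi>"
    by (rule fext_cong[OF AA fs_group_group[OF AA] b3 \<phi>])
      (auto simp: add_free_module add_fs_group right_module.rsmult_r_distr[OF A] fsupp_closed[OF \<alpha> R] fsupp_closed[OF \<beta> R])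
  also have "\<dots> = fext A (fs_group A B') (\<lambda>a b c. rsmult A a (\<alpha> b c)) \<phi> \<oplus>\<^bsub>fs_group A B'\<^esub> fext A (fs_group A B') (\<lambda>a b c. rsmult A a (\<beta> b c)) \<phi>"
    by (rule fext_add[OF AA fs_group_group[OF AA] b1 b2 \<phi>])
  finally show ?thesis by (simp add: rext_def)
qed

lemma rext_unit:
  assumes A: "right_module R A" and \<phi>: "\<phi> \<in> fsupp A B"
  shows "rext A B (\<lambda>b. single R b \<one>\<^bsub>R\<^esub>) \<phi> = \<phi>"
proof -
  note AA = right_moduleD(2)[OF A] and R = right_moduleD(1)[OF A]
  have "fext A (fs_group A B) (\<lambda>a b c. rsmult A a (single R b \<one>\<^bsub>R\<^esub> c)) \<phi>
    = fext A (fs_group A B) (\<lambda>a b. single A b a) \<phi>"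
    by (rule fext_cong[OF AA fs_group_group[OF AA] biadd_single[OF is_fs_fs_group[OF AA]] \<phi>])
      (auto simp: single_def fun_eq_iff right_module.rsmult_one[OF A] rsmult_zero[OF A])
  then show ?thesis using fext_expand[OF is_fs_fs_group[OF AA] \<phi>] by (simp add: rext_def)
qed

lemma rext_zero_fun:
  assumes A: "right_module R A" and \<phi>: "\<phi> \<in> fsupp A B" and "\<And>b. b \<in> B \<Longrightarrow> \<alpha> b = \<zero>\<^bsub>free_module R B'\<^esub>"
  shows "rext A B' \<alpha> \<phi> = \<zero>\<^bsub>fs_group A B'\<^esub>"
  unfolding rext_def
  by (rule fext_zero[OF fs_group_group[OF right_moduleD(2)[OF A]]])
    (use assms fsuppD(4)[OF \<phi>] fsuppD(1)[OF \<phi>] rsmult_zero[OF A] in \<open>auto simp: zero_fs_group zero_free_module\<close>)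

section \<open>The universal property of the tensor product\<close>

definition balanced ::
    "('r, 'z) ring_scheme \<Rightarrow> ('l, 'a, 'r, 'y) bimodule_scheme \<Rightarrow> ('r, 'b, 'x) module_scheme
      \<Rightarrow> ('g, 'p) ring_scheme \<Rightarrow> ('a \<Rightarrow> 'b \<Rightarrow> 'g) \<Rightarrow> bool" where
  "balanced R A B G \<phi> \<longleftrightarrow>
     (\<forall>b\<in>carrier B. (\<lambda>a. \<phi> a b) \<in> ahom A G) \<and> (\<forall>a\<in>carrier A. \<phi> a \<in> ahom B G) \<and>
     (\<forall>a\<in>carrier A. \<forall>r\<in>carrier R. \<forall>b\<in>carrier B. \<phi> (rsmult A a r) b = \<phi> a (smult B r b))"

lemma balancedD:
  assumes "balanced R A B G \<phi>"
  shows "a \<in> carrier A \<Longrightarrow> b \<in> carrier B \<Longrightarrow> \<phi> a b \<in> carrier G"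
    "a \<in> carrier A \<Longrightarrow> a' \<in> carrier A \<Longrightarrow> b \<in> carrier B \<Longrightarrow> \<phi> (a \<oplus>\<^bsub>A\<^esub> a') b = \<phi> a b \<oplus>\<^bsub>G\<^esub> \<phi> a' b"
    "a \<in> carrier A \<Longrightarrow> b \<in> carrier B \<Longrightarrow> b' \<in> carrier B \<Longrightarrow> \<phi> a (b \<oplus>\<^bsub>B\<^esub> b') = \<phi> a b \<oplus>\<^bsub>G\<^esub> \<phi> a b'"
    "a \<in> carrier A \<Longrightarrow> r \<in> carrier R \<Longrightarrow> b \<in> carrier B \<Longrightarrow> \<phi> (rsmult A a r) b = \<phi> a (smult B r b)"
  using assms unfolding balanced_def ahom_def by auto

lemma balancedI:
  assumes "\<And>a b. a \<in> carrier A \<Longrightarrow> b \<in> carrier B \<Longrightarrow> \<phi> a b \<in> carrier G"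
    "\<And>a a' b. a \<in> carrier A \<Longrightarrow> a' \<in> carrier A \<Longrightarrow> b \<in> carrier B \<Longrightarrow> \<phi> (a \<oplus>\<^bsub>A\<^esub> a') b = \<phi> a b \<oplus>\<^bsub>G\<^esub> \<phi> a' b"
    "\<And>a b b'. a \<in> carrier A \<Longrightarrow> b \<in> carrier B \<Longrightarrow> b' \<in> carrier B \<Longrightarrow> \<phi> a (b \<oplus>\<^bsub>B\<^esub> b') = \<phi> a b \<oplus>\<^bsub>G\<^esub> \<phi> a b'"
    "\<And>a r b. a \<in> carrier A \<Longrightarrow> r \<in> carrier R \<Longrightarrow> b \<in> carrier B \<Longrightarrow> \<phi> (rsmult A a r) b = \<phi> a (smult B r b)"
  shows "balanced R A B G \<phi>"
  using assms unfolding balanced_def by (auto intro!: ahomI)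

lemma abelian_group_cong:
  assumes "abelian_group G" "carrier H = carrier G" "ring.add H = ring.add G" "\<zero>\<^bsub>H\<^esub> = \<zero>\<^bsub>G\<^esub>"
  shows "abelian_group H"
  by (rule abelian_groupI) (use abelian_groupE[OF assms(1)] assms(2-) in auto)

locale tensor = A: right_module R A + B: left_module R B
  for R :: "('r, 'z) ring_scheme" and A :: "('l, 'a, 'r, 'y) bimodule_scheme"
    and B :: "('r, 'b, 'x) module_scheme"
begin

abbreviation "F \<equiv> free_Abelian_group (carrier A \<times> carrier B)"
abbreviation "N \<equiv> tensor_null R A B"
abbreviation "T \<equiv> tensor_group R A B"
abbreviation "pure \<equiv> pure_tensor R A B"

lemma relators_subset: "tensor_relators R A B \<subseteq> carrier F"
proof -
  have *: "Poly_Mapping.keys (frag_of p - frag_of q - frag_of r) \<subseteq> carrier A \<times> carrier B"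
    "Poly_Mapping.keys (frag_of p - frag_of q) \<subseteq> carrier A \<times> carrier B"
    if "p \<in> carrier A \<times> carrier B" "q \<in> carrier A \<times> carrier B" "r \<in> carrier A \<times> carrier B"
    for p q r :: "'a \<times> 'b"
    using that keys_diff[of "frag_of p - frag_of q" "frag_of r"] keys_diff[of "frag_of p" "frag_of q"]
    by (auto simp: keys_frag_of)
  show ?thesis
    unfolding tensor_relators_def
    using A.rsmult_closed B.smult_closed by (auto dest!: subsetD[OF *(1), rotated 3] subsetD[OF *(2)[where r = p for p], rotated 3])
qed

sublocale F: comm_group F
  by (rule abelian_free_Abelian_group)

lemma null_subgroup: "subgroup N F"
  unfolding tensor_null_def by (rule F.generate_is_subgroup[OF relators_subset])

sublocale N: normal N F
  by (rule F.subgroup_imp_normal[OF null_subgroup])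

lemma tensor_group_simps:
  "carrier T = carrier (F Mod N)" "\<zero>\<^bsub>T\<^esub> = N" "ring.add T = set_mult F"
  by (simp_all add: tensor_group_def tensor_quotient_def FactGroup_def)

sublocale T: abelian_group T
proof (rule comm_group_abelian_groupI)
  have "add_monoid T = F Mod N" by (simp add: tensor_group_def tensor_quotient_def)
  moreover have "comm_group (F Mod N)" by (rule F.abelian_FactGroup[OF null_subgroup])
  ultimately show "comm_group (add_monoid T)" by simp
qed

definition cls :: "('a \<times> 'b \<Rightarrow>\<^sub>0 int) \<Rightarrow> ('a \<times> 'b \<Rightarrow>\<^sub>0 int) set" where
  "cls x = N #>\<^bsub>F\<^esub> x"

lemma carrier_T: "carrier T = cls ` carrier F"
  by (simp add: tensor_group_simps carrier_FactGroup cls_def)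

lemma cls_closed: "x \<in> carrier F \<Longrightarrow> cls x \<in> carrier T"
  unfolding carrier_T by (rule imageI)

lemma cls_add: "x \<in> carrier F \<Longrightarrow> y \<in> carrier F \<Longrightarrow> cls (x + y) = cls x \<oplus>\<^bsub>T\<^esub> cls y"
  using N.rcos_sum[of x y] by (simp add: cls_def tensor_group_simps)

lemma cls_zero: "cls 0 = \<zero>\<^bsub>T\<^esub>"
  using F.coset_mult_one[of N] N.subset by (simp add: cls_def tensor_group_simps)

lemma diff_closed: "x \<in> carrier F \<Longrightarrow> y \<in> carrier F \<Longrightarrow> x - y \<in> carrier F"
  using keys_diff[of x y] by auto

lemma cls_diff: "x \<in> carrier F \<Longrightarrow> y \<in> carrier F \<Longrightarrow> cls (x - y) \<oplus>\<^bsub>T\<^esub> cls y = cls x"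
  using cls_add[OF diff_closed, of x y y] by simp

lemma cls_mem: "x \<in> carrier F \<Longrightarrow> x \<in> cls x"
  unfolding cls_def by (rule F.rcos_self[OF _ null_subgroup])

lemma cls_eqI:
  assumes "x \<in> carrier F" "y \<in> carrier F" "x - y \<in> N"
  shows "cls x = cls y"
proof -
  have "x \<in> cls y" unfolding cls_def r_coset_def using assms(3) by force
  then show ?thesis unfolding cls_def using F.repr_independence[OF _ assms(2) null_subgroup] by simp
qed

lemma relator_null: "x \<in> tensor_relators R A B \<Longrightarrow> x \<in> N"
  unfolding tensor_null_def by (rule generate.incl)

lemma pure_cls: "pure a b = cls (frag_of (a, b))"
  by (simp add: pure_tensor_def cls_def)

lemma frag_closed: "a \<in> carrier A \<Longrightarrow> b \<in> carrier B \<Longrightarrow> frag_of (a, b) \<in> carrier F"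
  by simp

lemma add_closed: "x \<in> carrier F \<Longrightarrow> y \<in> carrier F \<Longrightarrow> x + y \<in> carrier F"
  using F.m_closed[of x y] by simp

lemma pure_balanced: "balanced R A B T pure"
proof (rule balancedI)
  show "pure a b \<in> carrier T" if "a \<in> carrier A" "b \<in> carrier B" for a b
    unfolding pure_cls by (rule cls_closed[OF frag_closed[OF that]])
  show "pure (a \<oplus>\<^bsub>A\<^esub> a') b = pure a b \<oplus>\<^bsub>T\<^esub> pure a' b"
    if "a \<in> carrier A" "a' \<in> carrier A" "b \<in> carrier B" for a a' b
    unfolding pure_cls cls_add[OF frag_closed[OF that(1,3)] frag_closed[OF that(2,3)], symmetric]
    by (rule cls_eqI[OF frag_closed add_closed[OF frag_closed frag_closed] relator_null])
      (use that in \<open>auto simp: tensor_relators_def diff_diff_eq[symmetric]\<close>)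
  show "pure a (b \<oplus>\<^bsub>B\<^esub> b') = pure a b \<oplus>\<^bsub>T\<^esub> pure a b'"
    if "a \<in> carrier A" "b \<in> carrier B" "b' \<in> carrier B" for a b b'
    unfolding pure_cls cls_add[OF frag_closed[OF that(1,2)] frag_closed[OF that(1,3)], symmetric]
    by (rule cls_eqI[OF frag_closed add_closed[OF frag_closed frag_closed] relator_null])
      (use that in \<open>auto simp: tensor_relators_def diff_diff_eq[symmetric]\<close>)
  show "pure (rsmult A a r) b = pure a (smult B r b)"
    if "a \<in> carrier A" "r \<in> carrier R" "b \<in> carrier B" for a r b
    unfolding pure_cls
    by (rule cls_eqI[OF frag_closed[OF A.rsmult_closed] frag_closed[OF _ B.smult_closed] relator_null])
      (use that in \<open>auto simp: tensor_relators_def\<close>)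
qed

text \<open>Pure tensors generate. The induction principle of the free abelian group builds elements
  by differences, hence the detour through \<open>cls (x - y)\<close> plus
  \<open>cls y\<close>.\<close>

lemma ahom_eqI:
  assumes G: "abelian_group G" and h: "h \<in> ahom T G" "h' \<in> ahom T G" and c: "c \<in> carrier T"
    and eq: "\<And>a b. a \<in> carrier A \<Longrightarrow> b \<in> carrier B \<Longrightarrow> h (pure a b) = h' (pure a b)"
  shows "h c = h' c"
proof -
  interpret G: abelian_group G by fact
  obtain x where x: "Poly_Mapping.keys x \<subseteq> carrier A \<times> carrier B" "c = cls x"
    using c by (auto simp: carrier_T)
  have "h (cls x) = h' (cls x)"
    using x(1)
  proof (induction x rule: free_Abelian_group_induct[consumes 1, case_names 1 2 3])
    case 1
    show ?case unfolding cls_zero by (simp add: ahom_zero[OF T.abelian_group_axioms G h(1)] ahom_zero[OF T.abelian_group_axioms G h(2)])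
  next
    case (2 x y)
    have xy: "x \<in> carrier F" "y \<in> carrier F" using 2 by auto
    note cl = cls_closed[OF diff_closed[OF xy]] cls_closed[OF xy(2)]
    have "h (cls (x - y)) \<oplus>\<^bsub>G\<^esub> h (cls y) = h' (cls (x - y)) \<oplus>\<^bsub>G\<^esub> h (cls y)"
      using 2(3,4) ahom_add[OF h(1) cl] ahom_add[OF h(2) cl] cls_diff[OF xy] by simp
    then show ?case
      using ahom_closed[OF h(1) cl(1)] ahom_closed[OF h(2) cl(1)] ahom_closed[OF h(1) cl(2)] by simp
  next
    case (3 p)
    then show ?case using eq by (cases p) (auto simp: pure_cls)
  qed
  then show ?thesis by (simp add: x)
qed

text \<open>The linear extension \<open>L\<close> of \<open>\<phi>\<close> to the free abelian group
  kills the relators, hence the subgroup \<open>N\<close> generated by them, and is constant on each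
  coset. The image of a coset is then a singleton, as \<open>the_elem\<close> in
  \<open>tensor_lift\<close> expects.\<close>

lemma tensor_lift_cls:
  assumes G: "abelian_group G" and \<phi>: "balanced R A B G \<phi>"
  shows "\<exists>h \<in> hom F (add_monoid G). (\<forall>a\<in>carrier A. \<forall>b\<in>carrier B. h (frag_of (a, b)) = \<phi> a b) \<and>
     (\<forall>x\<in>carrier F. tensor_lift G \<phi> (cls x) = h x)"
proof -
  interpret G: abelian_group G by fact
  \<comment> \<open>The integers as a ring record: elements of the free abelian group become
    finitely supported functions with coefficients in \<open>?Z\<close>, and additivity of
    \<open>L\<close> is an instance of \<open>fext_ahom\<close>.\<close>
  let ?Z = "\<lparr>carrier = UNIV, monoid.mult = (*), one = 1, ring.zero = 0, ring.add = (+)\<rparr> :: int ring"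
  let ?S = "carrier A \<times> carrier B"
  let ?\<Phi> = "\<lambda>k p. add_pow G k (\<phi> (fst p) (snd p))"
  have Z: "abelian_group ?Z"
    by (rule abelian_groupI) (auto intro: exI[of _ "- x" for x])
  have \<Phi>: "biadd ?Z ?S G ?\<Phi>"
    by (rule biaddI) (auto simp: balancedD(1)[OF \<phi>] G.add.int_pow_mult)
  define L where "L f = fext ?Z G ?\<Phi> (Poly_Mapping.lookup f)" for f
  note fsZ = is_fs_fs_group[OF Z, of ?S]
  have look: "Poly_Mapping.lookup f \<in> fsupp ?Z ?S" if "f \<in> carrier F" for f
    using that by (auto simp: fsupp_def keys_def)
  have Lhom: "L \<in> hom F (add_monoid G)"
  proof (rule homI)
    show "L x \<in> carrier (add_monoid G)" if "x \<in> carrier F" for x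
      using fext_closed[OF Z G \<Phi> look[OF that]] by (simp add: L_def)
    show "L (x \<otimes>\<^bsub>F\<^esub> y) = L x \<otimes>\<^bsub>add_monoid G\<^esub> L y" if "x \<in> carrier F" "y \<in> carrier F" for x y
      using ahom_add[OF fext_ahom[OF fsZ G \<Phi>], of "Poly_Mapping.lookup x" "Poly_Mapping.lookup y"]
        look[OF that(1)] look[OF that(2)]
      by (simp add: L_def carrier_fs_group add_fs_group lookup_add[abs_def])
  qed
  interpret L: group_hom F "add_monoid G" L
    by (unfold_locales, rule Lhom)
  have Lfrag: "L (frag_of (a, b)) = \<phi> a b" if "a \<in> carrier A" "b \<in> carrier B" for a b
  proof -
    have "Poly_Mapping.lookup (frag_of (a, b)) = single ?Z (a, b) 1"
      by (auto simp: single_def)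
    then show ?thesis
      using fext_single[OF Z G \<Phi>, of "(a, b)" 1] that balancedD(1)[OF \<phi> that] by (simp add: L_def)
  qed
  have Lminus: "L (x - y) \<oplus>\<^bsub>G\<^esub> L y = L x" if "x \<in> carrier F" "y \<in> carrier F" for x y
    using L.hom_mult[OF diff_closed[OF that] that(2)] by simp
  have Lcl: "L x \<in> carrier G" if "x \<in> carrier F" for x using L.hom_closed[OF that] by simp
  have Ldiff: "L (x - y) = L x \<ominus>\<^bsub>G\<^esub> L y" if "x \<in> carrier F" "y \<in> carrier F" for x y
    using Lminus[OF that] Lcl[OF that(1)] Lcl[OF that(2)] Lcl[OF diff_closed[OF that]]
    by (metis G.add.inv_closed G.add.m_assoc G.r_neg G.r_zero a_minus_def)
  have Lrel: "L x = \<zero>\<^bsub>G\<^esub>" if "x \<in> tensor_relators R A B" for x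
  proof -
    have *: "(u \<oplus>\<^bsub>G\<^esub> v) \<ominus>\<^bsub>G\<^esub> u \<ominus>\<^bsub>G\<^esub> v = \<zero>\<^bsub>G\<^esub>" if "u \<in> carrier G" "v \<in> carrier G" for u v
      using that G.r_neg[of "u \<oplus>\<^bsub>G\<^esub> v"] G.minus_add[of u v] by (simp add: a_minus_def G.a_assoc)
    show ?thesis
      using that unfolding tensor_relators_def
    proof (elim UnE CollectE exE conjE)
      fix a a' b assume x: "x = frag_of (a \<oplus>\<^bsub>A\<^esub> a', b) - frag_of (a, b) - frag_of (a', b)"
        and c: "a \<in> carrier A" "a' \<in> carrier A" "b \<in> carrier B"
      show ?thesis unfolding x using c
        by (subst Ldiff, (auto intro!: diff_closed simp del: carrier_free_Abelian_group_iff)[2],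
            subst Ldiff, auto simp: Lfrag balancedD[OF \<phi>] *)
    next
      fix a b b' assume x: "x = frag_of (a, b \<oplus>\<^bsub>B\<^esub> b') - frag_of (a, b) - frag_of (a, b')"
        and c: "a \<in> carrier A" "b \<in> carrier B" "b' \<in> carrier B"
      show ?thesis unfolding x using c
        by (subst Ldiff, (auto intro!: diff_closed simp del: carrier_free_Abelian_group_iff)[2],
            subst Ldiff, auto simp: Lfrag balancedD[OF \<phi>] *)
    next
      fix a r b assume x: "x = frag_of (rsmult A a r, b) - frag_of (a, smult B r b)"
        and c: "a \<in> carrier A" "r \<in> carrier R" "b \<in> carrier B"
      show ?thesis unfolding x using c A.rsmult_closed B.smult_closed
        by (subst Ldiff, auto simp: Lfrag balancedD[OF \<phi>] a_minus_def G.r_neg)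
    qed
  qed
  have Lnull: "L x = \<zero>\<^bsub>G\<^esub>" if "x \<in> N" for x
  proof -
    have "subgroup (kernel F (add_monoid G) L) F" by (rule L.subgroup_kernel)
    then have "N \<subseteq> kernel F (add_monoid G) L"
      unfolding tensor_null_def
      by (rule F.generate_subgroup_incl[rotated]) (use relators_subset Lrel in \<open>auto simp: kernel_def simp del: carrier_free_Abelian_group_iff\<close>)
    then show ?thesis using that by (auto simp: kernel_def)
  qed
  have "tensor_lift G \<phi> (cls x) = L x" if x: "x \<in> carrier F" for x
  proof -
    have "L y = L x" if y: "y \<in> cls x" for y
    proof -
      obtain z where z: "z \<in> N" "y = z + x" using y by (auto simp: cls_def r_coset_def)
      have "L (z + x) = L z \<oplus>\<^bsub>G\<^esub> L x" using L.hom_mult[OF N.mem_carrier[OF z(1)] x] by simp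
      then show ?thesis unfolding z(2) Lnull[OF z(1)] G.l_zero[OF Lcl[OF x]] .
    qed
    then have img: "L ` cls x = {L x}" using cls_mem[OF x] by blast
    have L': "(\<lambda>f. \<Oplus>\<^bsub>G\<^esub>p\<in>Poly_Mapping.keys f. add_pow G (Poly_Mapping.lookup f p) (\<phi> (fst p) (snd p))) = L"
      by (auto simp: L_def fext_def keys_def)
    show ?thesis unfolding tensor_lift_def L' using img by simp
  qed
  then show ?thesis using Lhom Lfrag by blast
qed

lemma tensor_lift_ahom:
  assumes G: "abelian_group G" and \<phi>: "balanced R A B G \<phi>"
  shows "tensor_lift G \<phi> \<in> ahom T G"
proof -
  obtain h where h: "h \<in> hom F (add_monoid G)" "\<And>x. x \<in> carrier F \<Longrightarrow> tensor_lift G \<phi> (cls x) = h x"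
    using tensor_lift_cls[OF assms] by blast
  show ?thesis
  proof (rule ahomI)
    fix c assume "c \<in> carrier T"
    then obtain x where x: "x \<in> carrier F" "c = cls x" unfolding carrier_T by blast
    show "tensor_lift G \<phi> c \<in> carrier G" using h x hom_in_carrier[OF h(1)] by auto
    fix d assume "d \<in> carrier T"
    then obtain y where y: "y \<in> carrier F" "d = cls y" unfolding carrier_T by blast
    show "tensor_lift G \<phi> (c \<oplus>\<^bsub>T\<^esub> d) = tensor_lift G \<phi> c \<oplus>\<^bsub>G\<^esub> tensor_lift G \<phi> d"
      unfolding x(2) y(2) cls_add[OF x(1) y(1), symmetric] h(2)[OF x(1)] h(2)[OF y(1)] h(2)[OF add_closed[OF x(1) y(1)]]
      using hom_mult[OF h(1) x(1) y(1)] by simp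
  qed
qed

lemma tensor_lift_pure:
  assumes G: "abelian_group G" and \<phi>: "balanced R A B G \<phi>" and "a \<in> carrier A" "b \<in> carrier B"
  shows "tensor_lift G \<phi> (pure a b) = \<phi> a b"
  using tensor_lift_cls[OF G \<phi>] frag_closed[OF assms(3,4)] assms(3,4) unfolding pure_cls by auto

lemma pure_closed: "a \<in> carrier A \<Longrightarrow> b \<in> carrier B \<Longrightarrow> pure a b \<in> carrier T"
  by (rule balancedD(1)[OF pure_balanced])

lemma pure_uminus:
  assumes "a \<in> carrier A" "b \<in> carrier B"
  shows "pure (\<ominus>\<^bsub>A\<^esub> a) b = \<ominus>\<^bsub>T\<^esub> pure a b"
  by (rule ahom_uminus[OF A.M.abelian_group_axioms T.abelian_group_axioms])
    (use pure_balanced assms in \<open>auto simp: balanced_def\<close>)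

text \<open>No differences are needed, because \<open>- (a \<otimes> b) = (- a) \<otimes> b\<close>.\<close>

lemma tensor_ex_list:
  assumes "c \<in> carrier T"
  shows "\<exists>ps. set ps \<subseteq> carrier A \<times> carrier B \<and> cls (sum_list (map frag_of ps)) = c"
proof -
  obtain x where x: "Poly_Mapping.keys x \<subseteq> carrier A \<times> carrier B" "c = cls x"
    using assms by (auto simp: carrier_T)
  have cl: "sum_list (map frag_of ps) \<in> carrier F" if "set ps \<subseteq> carrier A \<times> carrier B" for ps :: "('a \<times> 'b) list"
    using that
  proof (induction ps)
    case (Cons p ps)
    have "frag_of p + sum_list (map frag_of ps) \<in> carrier F"
      by (rule add_closed) (use Cons in auto)
    then show ?case by simp
  qed simp
  have app: "\<exists>ps. set ps \<subseteq> carrier A \<times> carrier B \<and> cls (sum_list (map frag_of ps)) = c \<oplus>\<^bsub>T\<^esub> d"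
    if ex: "\<exists>ps. set ps \<subseteq> carrier A \<times> carrier B \<and> cls (sum_list (map frag_of ps)) = c"
      "\<exists>ps. set ps \<subseteq> carrier A \<times> carrier B \<and> cls (sum_list (map frag_of ps)) = d" for c d
  proof -
    obtain ps qs where p: "set ps \<subseteq> carrier A \<times> carrier B" "cls (sum_list (map frag_of ps)) = c"
      and q: "set qs \<subseteq> carrier A \<times> carrier B" "cls (sum_list (map frag_of qs)) = d"
      using ex by blast
    have "cls (sum_list (map frag_of (ps @ qs))) = c \<oplus>\<^bsub>T\<^esub> d"
      using cls_add[OF cl[OF p(1)] cl[OF q(1)]] p(2) q(2) by simp
    then show ?thesis using p q by (intro exI[of _ "ps @ qs"]) auto
  qed
  have neg: "\<exists>qs. set qs \<subseteq> carrier A \<times> carrier B \<and> cls (sum_list (map frag_of qs)) = \<ominus>\<^bsub>T\<^esub> cls (sum_list (map frag_of ps))"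
    if "set ps \<subseteq> carrier A \<times> carrier B" for ps
    using that
  proof (induction ps)
    case Nil
    have "\<ominus>\<^bsub>T\<^esub> cls (sum_list (map frag_of [])) = cls (sum_list (map frag_of []))"
      unfolding list.map sum_list.Nil cls_zero by (rule T.minus_equality) auto
    then show ?case by (intro exI[of _ "[]"]) (simp del: list.map sum_list.Nil)
  next
    case (Cons p ps)
    obtain a b where ab: "p = (a, b)" "a \<in> carrier A" "b \<in> carrier B" using Cons(2) by auto
    have "\<exists>qs. set qs \<subseteq> carrier A \<times> carrier B \<and> cls (sum_list (map frag_of qs)) = \<ominus>\<^bsub>T\<^esub> pure a b"
      unfolding pure_uminus[OF ab(2,3), symmetric]
      using ab by (intro exI[of _ "[(\<ominus>\<^bsub>A\<^esub> a, b)]"]) (simp add: pure_cls)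
    moreover have "\<exists>qs. set qs \<subseteq> carrier A \<times> carrier B \<and> cls (sum_list (map frag_of qs)) = \<ominus>\<^bsub>T\<^esub> cls (sum_list (map frag_of ps))"
      using Cons by simp
    moreover have "\<ominus>\<^bsub>T\<^esub> cls (sum_list (map frag_of (p # ps)))
      = \<ominus>\<^bsub>T\<^esub> pure a b \<oplus>\<^bsub>T\<^esub> \<ominus>\<^bsub>T\<^esub> cls (sum_list (map frag_of ps))"
    proof -
      have "cls (sum_list (map frag_of (p # ps))) = pure a b \<oplus>\<^bsub>T\<^esub> cls (sum_list (map frag_of ps))"
        using cls_add[OF frag_closed[OF ab(2,3)] cl, of ps] Cons(2) by (simp add: ab pure_cls)
      then show ?thesis
        using T.minus_add[OF pure_closed[OF ab(2,3)] cls_closed[OF cl, of ps]] Cons(2) by simp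
    qed
    ultimately show ?case using app by metis
  qed
  have "\<exists>ps. set ps \<subseteq> carrier A \<times> carrier B \<and> cls (sum_list (map frag_of ps)) = cls x"
    using x(1)
  proof (induction x rule: free_Abelian_group_induct[consumes 1, case_names 1 2 3])
    case 1
    show ?case by (intro exI[of _ "[]"]) simp
  next
    case (2 x y)
    have xy: "x \<in> carrier F" "y \<in> carrier F" using 2 by auto
    have "cls (x - y) = cls x \<oplus>\<^bsub>T\<^esub> \<ominus>\<^bsub>T\<^esub> cls y"
      unfolding cls_diff[OF xy, symmetric]
      using cls_closed[OF diff_closed[OF xy]] cls_closed[OF xy(2)] by (simp add: T.a_assoc T.r_neg)
    moreover have "\<exists>ps. set ps \<subseteq> carrier A \<times> carrier B \<and> cls (sum_list (map frag_of ps)) = \<ominus>\<^bsub>T\<^esub> cls y"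
      using 2(4) neg by metis
    ultimately show ?case using app 2(3) by metis
  next
    case (3 p)
    then show ?case by (intro exI[of _ "[p]"]) simp
  qed
  then show ?thesis by (simp add: x)
qed

end

section \<open>Left and right actions on a tensor product\<close>

lemma tensor_module_simps:
  "carrier (tensor_module R A B) = carrier (tensor_group R A B)"
  "ring.add (tensor_module R A B) = ring.add (tensor_group R A B)"
  "\<zero>\<^bsub>tensor_module R A B\<^esub> = \<zero>\<^bsub>tensor_group R A B\<^esub>"
  "smult (tensor_module R A B) l = tensor_lift (tensor_group R A B) (\<lambda>a b. pure_tensor R A B (smult A l a) b)"
  by (simp_all add: tensor_module_def ring.defs)

lemma tensor_bimodule_simps:
  "carrier (tensor_bimodule R A B) = carrier (tensor_group R A B)"
  "ring.add (tensor_bimodule R A B) = ring.add (tensor_group R A B)"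
  "\<zero>\<^bsub>tensor_bimodule R A B\<^esub> = \<zero>\<^bsub>tensor_group R A B\<^esub>"
  "smult (tensor_bimodule R A B) l = tensor_lift (tensor_group R A B) (\<lambda>a b. pure_tensor R A B (smult A l a) b)"
  "rsmult (tensor_bimodule R A B) c s = tensor_lift (tensor_group R A B) (\<lambda>a b. pure_tensor R A B a (rsmult B b s)) c"
  by (simp_all add: tensor_bimodule_def tensor_module_def ring.defs module.defs)

locale tensor_left = tensor R A B + L: bimodule L R A
  for L :: "('l, 'q) ring_scheme" and R :: "('r, 'z) ring_scheme" and A :: "('l, 'a, 'r, 'y) bimodule_scheme"
    and B :: "('r, 'b, 'x) module_scheme"
begin

lemma left_balanced:
  assumes "l \<in> carrier L"
  shows "balanced R A B T (\<lambda>a b. pure (smult A l a) b)"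
  by (rule balancedI)
    (use assms in \<open>simp_all add: L.left.smult_closed L.left.smult_r_distr L.smult_rsmult[symmetric] balancedD[OF pure_balanced]\<close>)

lemma tensor_smult_ahom: "l \<in> carrier L \<Longrightarrow> smult (tensor_module R A B) l \<in> ahom T T"
  unfolding tensor_module_simps by (rule tensor_lift_ahom[OF T.abelian_group_axioms left_balanced])

lemma tensor_smult_pure:
  "l \<in> carrier L \<Longrightarrow> a \<in> carrier A \<Longrightarrow> b \<in> carrier B \<Longrightarrow>
    smult (tensor_module R A B) l (pure a b) = pure (smult A l a) b"
  unfolding tensor_module_simps by (rule tensor_lift_pure[OF T.abelian_group_axioms left_balanced])

text \<open>Closure and additivity come with \<open>tensor_lift\<close>; every other axiom compares
  two additive maps of the tensor product, so it can be checked on pure tensors, where it is an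
  axiom of \<open>A\<close>.\<close>

lemma tensor_left_module: "left_module L (tensor_module R A B)"
proof -
  interpret TM: abelian_group "tensor_module R A B"
    by (rule abelian_group_cong[OF T.abelian_group_axioms]) (simp_all add: tensor_module_simps(1-3))
  note pures = tensor_smult_pure L.left.smult_closed balancedD[OF pure_balanced]
  let ?s = "smult (tensor_module R A B)"
  note cl = ahom_closed[OF tensor_smult_ahom]
  have id: "(\<lambda>x. x) \<in> ahom T T" by (rule ahomI) auto
  show ?thesis
  proof unfold_locales
    fix l x assume l: "l \<in> carrier L" and "x \<in> carrier (tensor_module R A B)"
    then have x: "x \<in> carrier T" by (simp add: tensor_module_simps(1))
    show "?s l x \<in> carrier (tensor_module R A B)"
      unfolding tensor_module_simps(1) by (rule cl[OF l x])
    fix k assume k: "k \<in> carrier L"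
    show "?s (l \<oplus>\<^bsub>L\<^esub> k) x = ?s l x \<oplus>\<^bsub>tensor_module R A B\<^esub> ?s k x"
      unfolding tensor_module_simps(2)
    proof (rule ahom_eqI[OF T.abelian_group_axioms _ _ x])
      show "?s (l \<oplus>\<^bsub>L\<^esub> k) \<in> ahom T T" by (rule tensor_smult_ahom) (use l k in simp)
      show "(\<lambda>x. ?s l x \<oplus>\<^bsub>T\<^esub> ?s k x) \<in> ahom T T"
        by (rule ahom_add_map[OF T.abelian_group_axioms tensor_smult_ahom[OF l] tensor_smult_ahom[OF k]])
    qed (use l k in \<open>simp add: pures L.left.smult_l_distr\<close>)
    show "?s (l \<otimes>\<^bsub>L\<^esub> k) x = ?s l (?s k x)"
    proof (rule ahom_eqI[OF T.abelian_group_axioms _ _ x])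
      show "?s (l \<otimes>\<^bsub>L\<^esub> k) \<in> ahom T T" by (rule tensor_smult_ahom) (use l k in simp)
      show "(\<lambda>x. ?s l (?s k x)) \<in> ahom T T"
        by (rule ahom_compose[OF tensor_smult_ahom[OF k] tensor_smult_ahom[OF l]])
    qed (use l k in \<open>simp add: pures L.left.smult_assoc\<close>)
  next
    fix l x y assume l: "l \<in> carrier L" and "x \<in> carrier (tensor_module R A B)" "y \<in> carrier (tensor_module R A B)"
    then show "?s l (x \<oplus>\<^bsub>tensor_module R A B\<^esub> y) = ?s l x \<oplus>\<^bsub>tensor_module R A B\<^esub> ?s l y"
      unfolding tensor_module_simps(1,2) by (intro ahom_add[OF tensor_smult_ahom])
  next
    fix x assume "x \<in> carrier (tensor_module R A B)"
    then have x: "x \<in> carrier T" by (simp add: tensor_module_simps(1))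
    show "?s \<one>\<^bsub>L\<^esub> x = x"
      by (rule ahom_eqI[OF T.abelian_group_axioms tensor_smult_ahom id x])
        (simp_all add: pures L.left.smult_one)
  qed
qed

end

locale tensor_bi = tensor_left L R A B + S: bimodule R S B
  for L :: "('l, 'q) ring_scheme" and R :: "('r, 'z) ring_scheme" and S :: "('s, 'p) ring_scheme"
    and A :: "('l, 'a, 'r, 'y) bimodule_scheme" and B :: "('r, 'b, 's, 'x) bimodule_scheme"
begin

lemma right_balanced:
  assumes "s \<in> carrier S"
  shows "balanced R A B T (\<lambda>a b. pure a (rsmult B b s))"
  by (rule balancedI)
    (use assms in \<open>simp_all add: S.right.rsmult_closed S.right.rsmult_l_distr S.smult_rsmult balancedD[OF pure_balanced]\<close>)

lemma tensor_rsmult_ahom: "s \<in> carrier S \<Longrightarrow> (\<lambda>c. rsmult (tensor_bimodule R A B) c s) \<in> ahom T T"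
  unfolding tensor_bimodule_simps by (rule tensor_lift_ahom[OF T.abelian_group_axioms right_balanced])

lemma tensor_rsmult_pure:
  "s \<in> carrier S \<Longrightarrow> a \<in> carrier A \<Longrightarrow> b \<in> carrier B \<Longrightarrow>
    rsmult (tensor_bimodule R A B) (pure a b) s = pure a (rsmult B b s)"
  unfolding tensor_bimodule_simps by (rule tensor_lift_pure[OF T.abelian_group_axioms right_balanced])

lemma tensor_bimodule: "bimodule L S (tensor_bimodule R A B)"
proof -
  interpret TM: left_module L "tensor_module R A B" by (rule tensor_left_module)
  interpret TB: abelian_group "tensor_bimodule R A B"
    by (rule abelian_group_cong[OF T.abelian_group_axioms]) (simp_all add: tensor_bimodule_simps(1-3))
  have sm: "smult (tensor_bimodule R A B) = smult (tensor_module R A B)"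
    by (rule ext) (simp add: tensor_bimodule_simps(4) tensor_module_simps(4))
  note pures = tensor_smult_pure tensor_rsmult_pure L.left.smult_closed S.right.rsmult_closed balancedD[OF pure_balanced]
  let ?r = "rsmult (tensor_bimodule R A B)" and ?s = "smult (tensor_module R A B)"
  note cl = ahom_closed[OF tensor_rsmult_ahom]
  have id: "(\<lambda>x. x) \<in> ahom T T" by (rule ahomI) auto
  show ?thesis
  proof unfold_locales
    show "smult (tensor_bimodule R A B) a x \<in> carrier (tensor_bimodule R A B)"
      if "a \<in> carrier L" "x \<in> carrier (tensor_bimodule R A B)" for a x
      using TM.smult_closed that by (simp add: sm tensor_bimodule_simps(1) tensor_module_simps(1))
    show "smult (tensor_bimodule R A B) (a \<oplus>\<^bsub>L\<^esub> b) x
      = smult (tensor_bimodule R A B) a x \<oplus>\<^bsub>tensor_bimodule R A B\<^esub> smult (tensor_bimodule R A B) b x"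
      if "a \<in> carrier L" "b \<in> carrier L" "x \<in> carrier (tensor_bimodule R A B)" for a b x
      using TM.smult_l_distr that by (simp add: sm tensor_bimodule_simps(1,2) tensor_module_simps(1,2))
    show "smult (tensor_bimodule R A B) a (x \<oplus>\<^bsub>tensor_bimodule R A B\<^esub> y)
      = smult (tensor_bimodule R A B) a x \<oplus>\<^bsub>tensor_bimodule R A B\<^esub> smult (tensor_bimodule R A B) a y"
      if "a \<in> carrier L" "x \<in> carrier (tensor_bimodule R A B)" "y \<in> carrier (tensor_bimodule R A B)" for a x y
      using TM.smult_r_distr that by (simp add: sm tensor_bimodule_simps(1,2) tensor_module_simps(1,2))
    show "smult (tensor_bimodule R A B) (a \<otimes>\<^bsub>L\<^esub> b) x
      = smult (tensor_bimodule R A B) a (smult (tensor_bimodule R A B) b x)"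
      if "a \<in> carrier L" "b \<in> carrier L" "x \<in> carrier (tensor_bimodule R A B)" for a b x
      using TM.smult_assoc that by (simp add: sm tensor_bimodule_simps(1) tensor_module_simps(1))
    show "smult (tensor_bimodule R A B) \<one>\<^bsub>L\<^esub> x = x" if "x \<in> carrier (tensor_bimodule R A B)" for x
      using TM.smult_one that by (simp add: sm tensor_bimodule_simps(1) tensor_module_simps(1))
  next
    fix x s assume "x \<in> carrier (tensor_bimodule R A B)" and s: "s \<in> carrier S"
    then have x: "x \<in> carrier T" by (simp add: tensor_bimodule_simps(1))
    show "?r x s \<in> carrier (tensor_bimodule R A B)"
      unfolding tensor_bimodule_simps(1) by (rule cl[OF s x])
    fix t assume t: "t \<in> carrier S"
    show "?r x (s \<oplus>\<^bsub>S\<^esub> t) = ?r x s \<oplus>\<^bsub>tensor_bimodule R A B\<^esub> ?r x t"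
      unfolding tensor_bimodule_simps(2)
    proof (rule ahom_eqI[OF T.abelian_group_axioms _ _ x, of "\<lambda>x. ?r x (s \<oplus>\<^bsub>S\<^esub> t)" "\<lambda>x. ?r x s \<oplus>\<^bsub>T\<^esub> ?r x t"])
      show "(\<lambda>x. ?r x (s \<oplus>\<^bsub>S\<^esub> t)) \<in> ahom T T" by (rule tensor_rsmult_ahom) (use s t in simp)
      show "(\<lambda>x. ?r x s \<oplus>\<^bsub>T\<^esub> ?r x t) \<in> ahom T T"
        by (rule ahom_add_map[OF T.abelian_group_axioms tensor_rsmult_ahom[OF s] tensor_rsmult_ahom[OF t]])
    qed (use s t in \<open>simp add: pures S.right.rsmult_r_distr\<close>)
    show "?r x (s \<otimes>\<^bsub>S\<^esub> t) = ?r (?r x s) t"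
    proof (rule ahom_eqI[OF T.abelian_group_axioms _ _ x, of "\<lambda>x. ?r x (s \<otimes>\<^bsub>S\<^esub> t)" "\<lambda>x. ?r (?r x s) t"])
      show "(\<lambda>x. ?r x (s \<otimes>\<^bsub>S\<^esub> t)) \<in> ahom T T" by (rule tensor_rsmult_ahom) (use s t in simp)
      show "(\<lambda>x. ?r (?r x s) t) \<in> ahom T T"
        by (rule ahom_compose[OF tensor_rsmult_ahom[OF s] tensor_rsmult_ahom[OF t]])
    qed (use s t in \<open>simp add: pures S.right.rsmult_assoc\<close>)
  next
    fix x y s assume "x \<in> carrier (tensor_bimodule R A B)" "y \<in> carrier (tensor_bimodule R A B)" "s \<in> carrier S"
    then show "?r (x \<oplus>\<^bsub>tensor_bimodule R A B\<^esub> y) s = ?r x s \<oplus>\<^bsub>tensor_bimodule R A B\<^esub> ?r y s"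
      unfolding tensor_bimodule_simps(1,2) by (intro ahom_add[OF tensor_rsmult_ahom])
  next
    fix x assume "x \<in> carrier (tensor_bimodule R A B)"
    then have x: "x \<in> carrier T" by (simp add: tensor_bimodule_simps(1))
    show "?r x \<one>\<^bsub>S\<^esub> = x"
      by (rule ahom_eqI[OF T.abelian_group_axioms tensor_rsmult_ahom id x])
        (simp_all add: pures S.right.rsmult_one)
  next
    fix l x s assume l: "l \<in> carrier L" and "x \<in> carrier (tensor_bimodule R A B)" and s: "s \<in> carrier S"
    then have x: "x \<in> carrier T" by (simp add: tensor_bimodule_simps(1))
    have "?r (?s l x) s = ?s l (?r x s)"
    proof (rule ahom_eqI[OF T.abelian_group_axioms _ _ x, of "\<lambda>x. ?r (?s l x) s" "\<lambda>x. ?s l (?r x s)"])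
      show "(\<lambda>x. ?r (?s l x) s) \<in> ahom T T"
        by (rule ahom_compose[OF tensor_smult_ahom[OF l] tensor_rsmult_ahom[OF s]])
      show "(\<lambda>x. ?s l (?r x s)) \<in> ahom T T"
        by (rule ahom_compose[OF tensor_rsmult_ahom[OF s] tensor_smult_ahom[OF l]])
    qed (use l s in \<open>simp add: pures\<close>)
    then show "?r (smult (tensor_bimodule R A B) l x) s = smult (tensor_bimodule R A B) l (?r x s)"
      by (simp add: sm)
  qed
qed

end

section \<open>Tensor powers and the trivial extension\<close>

lemma transport_simps:
  assumes "inj_on h (carrier A)"
  shows "carrier (transport_bimodule h A) = h ` carrier A"
    "\<zero>\<^bsub>transport_bimodule h A\<^esub> = h \<zero>\<^bsub>A\<^esub>"
    "x \<in> carrier A \<Longrightarrow> y \<in> carrier A \<Longrightarrow> h x \<oplus>\<^bsub>transport_bimodule h A\<^esub> h y = h (x \<oplus>\<^bsub>A\<^esub> y)"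
    "x \<in> carrier A \<Longrightarrow> smult (transport_bimodule h A) l (h x) = h (smult A l x)"
    "x \<in> carrier A \<Longrightarrow> rsmult (transport_bimodule h A) (h x) r = h (rsmult A x r)"
  using assms by (simp_all add: transport_bimodule_def Let_def)

lemma transport_bimodule:
  assumes A: "bimodule L R A" and h: "inj_on h (carrier A)"
  shows "bimodule L R (transport_bimodule h A)"
proof -
  interpret A: bimodule L R A by fact
  let ?A = "transport_bimodule h A"
  note sim = transport_simps[OF h]
  have "abelian_group ?A"
  proof (rule abelian_groupI)
    fix x assume "x \<in> carrier ?A"
    then obtain a where a: "a \<in> carrier A" "x = h a" by (auto simp: sim)
    then show "\<exists>y\<in>carrier ?A. y \<oplus>\<^bsub>?A\<^esub> x = \<zero>\<^bsub>?A\<^esub>"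
      by (intro bexI[of _ "h (\<ominus>\<^bsub>A\<^esub> a)"]) (auto simp: sim A.left.M.l_neg)
  qed (auto simp: sim A.left.M.a_ac)
  then interpret TA: abelian_group ?A .
  show ?thesis
    by unfold_locales
      (auto simp: sim A.left.smult_closed A.left.smult_l_distr A.left.smult_r_distr A.left.smult_assoc A.left.smult_one
        A.right.rsmult_closed A.right.rsmult_l_distr A.right.rsmult_r_distr A.right.rsmult_assoc A.right.rsmult_one
        A.smult_rsmult)
qed

lemma regular_simps:
  "carrier (regular_bimodule R) = carrier R" "\<zero>\<^bsub>regular_bimodule R\<^esub> = \<zero>\<^bsub>R\<^esub>"
  "ring.add (regular_bimodule R) = ring.add R" "smult (regular_bimodule R) = monoid.mult R"
  "rsmult (regular_bimodule R) = monoid.mult R"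
  by (simp_all add: regular_bimodule_def)

lemma regular_bimodule:
  assumes "ring R"
  shows "bimodule R R (regular_bimodule R)"
proof -
  interpret R: ring R by fact
  interpret A: abelian_group "regular_bimodule R"
    by (rule abelian_group_cong[OF R.is_abelian_group]) (simp_all add: regular_simps)
  show ?thesis
    by unfold_locales (auto simp: regular_simps R.l_distr R.r_distr R.m_assoc)
qed

lemma restrict_left_simps:
  "carrier (restrict_left \<phi> Y) = carrier Y" "\<zero>\<^bsub>restrict_left \<phi> Y\<^esub> = \<zero>\<^bsub>Y\<^esub>"
  "ring.add (restrict_left \<phi> Y) = ring.add Y" "smult (restrict_left \<phi> Y) r = smult Y (\<phi> r)"
  by (simp_all add: restrict_left_def fun_eq_iff)

lemma restrict_right_simps:
  "carrier (restrict_right \<phi> Y) = carrier Y" "\<zero>\<^bsub>restrict_right \<phi> Y\<^esub> = \<zero>\<^bsub>Y\<^esub>"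
  "ring.add (restrict_right \<phi> Y) = ring.add Y" "smult (restrict_right \<phi> Y) = smult Y"
  "rsmult (restrict_right \<phi> Y) y r = rsmult Y y (\<phi> r)"
  by (simp_all add: restrict_right_def fun_eq_iff)

lemma restrict_left_module:
  assumes R: "ring R" and Y: "left_module S Y" and \<phi>: "\<phi> \<in> ring_hom R S"
  shows "left_module R (restrict_left \<phi> Y)"
proof -
  interpret R: ring R by fact
  interpret Y: left_module S Y by fact
  interpret A: abelian_group "restrict_left \<phi> Y"
    by (rule abelian_group_cong[OF Y.M.abelian_group_axioms]) (simp_all add: restrict_left_simps)
  note h = ring_hom_closed[OF \<phi>] ring_hom_add[OF \<phi>] ring_hom_mult[OF \<phi>] ring_hom_one[OF \<phi>]
  show ?thesis
    by unfold_locales (auto simp: restrict_left_simps h Y.smult_closed Y.smult_l_distr Y.smult_r_distr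
      Y.smult_assoc Y.smult_one)
qed

lemma restrict_right_module:
  assumes R: "ring R" and Y: "right_module S Y" and \<phi>: "\<phi> \<in> ring_hom R S"
  shows "right_module R (restrict_right \<phi> Y)"
proof -
  interpret R: ring R by fact
  interpret Y: right_module S Y by fact
  interpret A: abelian_group "restrict_right \<phi> Y"
    by (rule abelian_group_cong[OF Y.M.abelian_group_axioms]) (simp_all add: restrict_right_simps)
  note h = ring_hom_closed[OF \<phi>] ring_hom_add[OF \<phi>] ring_hom_mult[OF \<phi>] ring_hom_one[OF \<phi>]
  show ?thesis
    by unfold_locales (auto simp: restrict_right_simps h Y.rsmult_closed Y.rsmult_l_distr Y.rsmult_r_distr
      Y.rsmult_assoc Y.rsmult_one)
qed

lemma restrict_regular_bimodule:
  assumes R: "ring R" and S: "ring S" and \<phi>: "\<phi> \<in> ring_hom R S"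
  shows "bimodule S R (restrict_right \<phi> (regular_bimodule S))"
proof -
  interpret S: ring S by fact
  interpret A: right_module R "restrict_right \<phi> (regular_bimodule S)"
    by (rule restrict_right_module[OF R bimoduleD(2)[OF regular_bimodule[OF S]] \<phi>])
  note h = ring_hom_closed[OF \<phi>]
  show ?thesis
    by unfold_locales (auto simp: restrict_right_simps regular_simps h S.l_distr S.r_distr S.m_assoc)
qed

text \<open>The list chosen for a class sums to a representative of it, so classes with the same
  list share an element and, being cosets, coincide. That such a list exists is
  \<open>tensor_ex_list\<close>: lists carry no signs, so the representative must be a sum of
  generators.\<close>

lemma tens_encode_inj:
  assumes "tensor R A B"
  shows "inj_on tens_encode (carrier (tensor_group R A B))"
proof (rule inj_onI)
  interpret tensor R A B by fact
  fix c d assume c: "c \<in> carrier T" and d: "d \<in> carrier T" and eq: "tens_encode c = tens_encode d"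
  have *: "\<exists>x. x = sum_list (map frag_of (SOME ps. sum_list (map frag_of ps) \<in> c)) \<and> x \<in> c"
    if "c \<in> carrier T" for c
  proof -
    obtain y where y: "c = cls y" "y \<in> carrier F" using \<open>c \<in> carrier T\<close> unfolding carrier_T by blast
    obtain ps where ps: "cls (sum_list (map frag_of ps)) = c" "set ps \<subseteq> carrier A \<times> carrier B"
      using tensor_ex_list[OF \<open>c \<in> carrier T\<close>] by blast
    have "sum_list (map frag_of ps) \<in> carrier F"
      using ps(2)
    proof (induction ps)
      case (Cons p ps)
      have "frag_of p + sum_list (map frag_of ps) \<in> carrier F"
        by (rule add_closed) (use Cons in auto)
      then show ?case by simp
    qed simp
    then have "sum_list (map frag_of ps) \<in> c" using cls_mem ps(1) by metis
    then have "sum_list (map frag_of (SOME ps. sum_list (map frag_of ps) \<in> c)) \<in> c" by (rule someI)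
    then show ?thesis by blast
  qed
  have "\<exists>x. x \<in> c \<and> x \<in> d"
    using *[OF c] *[OF d] eq by (auto simp: tens_encode_def)
  then obtain x where x: "x \<in> c" "x \<in> d" by blast
  obtain y z where yz: "c = cls y" "y \<in> carrier F" "d = cls z" "z \<in> carrier F"
    using c d unfolding carrier_T by blast
  show "c = d"
    using F.repr_independence[of x N y] F.repr_independence[of x N z] x yz null_subgroup by (simp add: cls_def)
qed

text \<open>The ring axioms of \<open>ntriv n R M\<close>, associativity of \<open>tpow_mult\<close>
  among them, are assumed here; they are part of what it means to have a module over the trivial
  extension.\<close>

locale trivial_extension =
  fixes R :: "('r, 'z) ring_scheme" and M :: "('r, 'm, 'r, 'y) bimodule_scheme" and n :: nat
  assumes R: "ring R" and bimodule_M: "bimodule R R M" and S: "ring (ntriv n R M)"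
begin

abbreviation "P \<equiv> tpow R M"
abbreviation "S \<equiv> ntriv n R M"
abbreviation "e \<equiv> ntriv_emb n R M"

sublocale M: bimodule R R M by (rule bimodule_M)

lemma scal_inj: "inj_on (Scal :: 'r \<Rightarrow> ('r, 'm) tpow_el) (carrier (regular_bimodule R))"
  and vect_inj: "inj_on (Vect :: 'm \<Rightarrow> ('r, 'm) tpow_el) (carrier M)"
  by (auto intro!: inj_onI)

lemma P_bimodule: "bimodule R R (P i)"
proof (induction i rule: less_induct)
  case (less i)
  consider "i = 0" | "i = 1" | j where "i = Suc (Suc j)"
    by (metis One_nat_def not0_implies_Suc)
  then show ?case
  proof cases
    case 1 then show ?thesis by (simp add: transport_bimodule regular_bimodule R scal_inj)
  next
    case 2 then show ?thesis by (simp add: transport_bimodule bimodule_M vect_inj)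
  next
    case 3
    have B: "bimodule R R (P (Suc j))" using less 3 by simp
    interpret t: tensor_bi R R R M "P (Suc j)"
      unfolding tensor_bi_def tensor_left_def tensor_def using B bimodule_M by (simp add: bimoduleD)
    have "inj_on tens_encode (carrier (tensor_bimodule R M (P (Suc j))))"
      unfolding tensor_bimodule_simps(1) by (rule tens_encode_inj) (rule t.tensor_axioms)
    then show ?thesis using 3 transport_bimodule[OF t.tensor_bimodule] by simp
  qed
qed

lemma tensor_P: "tensor_bi R R R M (P j)"
  unfolding tensor_bi_def tensor_left_def tensor_def using P_bimodule[of j] bimodule_M by (simp add: bimoduleD)

sublocale P: bimodule R R "P i" for i by (rule P_bimodule)

lemma enc_inj: "inj_on tens_encode (carrier (tensor_bimodule R M (P (Suc j))))"
  unfolding tensor_bimodule_simps(1)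
  by (rule tens_encode_inj) (use tensor_P[of "Suc j"] in \<open>simp add: tensor_bi_def tensor_left_def\<close>)

text \<open>Computation rules for the powers 0, 1 and at least 2. From here on
  \<open>tpow.simps\<close> is kept out of simplification so that \<open>P i\<close> stays folded
  and these rules apply.\<close>

lemmas P0 = transport_simps[OF scal_inj, unfolded regular_simps, folded tpow.simps(1)[of R M]]
lemmas P1 = transport_simps[OF vect_inj, folded tpow.simps(2)[of R M]]
lemmas P2 = transport_simps[OF enc_inj, folded tpow.simps(3)[of R M]]

lemma enc_ahom: "tens_encode \<in> ahom (tensor_group R M (P (Suc j))) (P (Suc (Suc j)))"
  by (rule ahomI) (auto simp: P2 tensor_bimodule_simps(1,2)[symmetric] simp del: tpow.simps)

lemma balanced_ahom: "balanced R A B G \<phi> \<Longrightarrow> h \<in> ahom G H \<Longrightarrow> balanced R A B H (\<lambda>a b. h (\<phi> a b))"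
  by (auto simp: balanced_def intro: ahom_compose)

lemma cons_balanced: "balanced R M (P j) (P (Suc j)) (tpow_cons R M j)"
proof (cases j)
  case 0
  show ?thesis unfolding 0
    by (rule balancedI) (auto simp: P0 P1 M.right.rsmult_closed M.right.rsmult_l_distr M.right.rsmult_r_distr
      M.right.rsmult_assoc simp del: tpow.simps)
next
  case (Suc i)
  interpret t: tensor_bi R R R M "P j" by (rule tensor_P)
  have "tpow_cons R M (Suc i) = (\<lambda>m b. tens_encode (pure_tensor R M (P (Suc i)) m b))"
    by (intro ext) simp
  then show ?thesis
    using balanced_ahom[OF t.pure_balanced enc_ahom[of i, folded Suc]] unfolding Suc by simp
qed

lemma cons_smult:
  assumes "r \<in> carrier R" "m \<in> carrier M" "b \<in> carrier (P j)"
  shows "tpow_cons R M j (smult M r m) b = smult (P (Suc j)) r (tpow_cons R M j m b)"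
proof (cases j)
  case 0
  then show ?thesis using assms
    by (auto simp: P0 P1 M.right.rsmult_closed M.smult_rsmult simp del: tpow.simps)
next
  case (Suc i)
  interpret t: tensor_bi R R R M "P j" by (rule tensor_P)
  have "pure_tensor R M (P j) m b \<in> carrier (tensor_bimodule R M (P j))"
    unfolding tensor_bimodule_simps(1) by (rule t.pure_closed[OF assms(2,3)])
  moreover have "smult (tensor_bimodule R M (P j)) r (pure_tensor R M (P j) m b) = pure_tensor R M (P j) (smult M r m) b"
    using t.tensor_smult_pure[OF assms] by (simp add: tensor_bimodule_simps(4) tensor_module_simps(4) del: tpow.simps)
  ultimately show ?thesis unfolding Suc by (simp add: P2 del: tpow.simps)
qed

lemma cons_zero: "m \<in> carrier M \<Longrightarrow> tpow_cons R M j m \<zero>\<^bsub>P j\<^esub> = \<zero>\<^bsub>P (Suc j)\<^esub>"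
  by (rule ahom_zero[OF P.left.M.abelian_group_axioms P.left.M.abelian_group_axioms])
    (use cons_balanced[of j] in \<open>auto simp: balanced_def simp del: tpow.simps\<close>)

text \<open>The invariant of the recursion for \<open>tpow_mult\<close>. Linearity over
  \<open>R\<close> in the left factor is included because it makes
  \<open>(m, a) \<mapsto> m \<otimes> (a \<otimes> y)\<close> balanced, and only for a balanced map
  does \<open>tensor_lift\<close> in the next step behave as intended.\<close>

definition mult_ok :: "nat \<Rightarrow> nat \<Rightarrow> ('r, 'm) tpow_el \<Rightarrow> bool" where
  "mult_ok i j y \<longleftrightarrow> (\<lambda>x. tpow_mult R M i j x y) \<in> ahom (P i) (P (i + j)) \<and>
     (\<forall>r\<in>carrier R. \<forall>x\<in>carrier (P i). tpow_mult R M i j (smult (P i) r x) y = smult (P (i + j)) r (tpow_mult R M i j x y))"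

lemma mult_step_balanced:
  assumes ok: "mult_ok (Suc i) j y"
  shows "balanced R M (P (Suc i)) (P (Suc (Suc i) + j)) (\<lambda>m a. tpow_cons R M (Suc i + j) m (tpow_mult R M (Suc i) j a y))"
proof -
  have *: "Suc (Suc i) + j = Suc (Suc i + j)" by simp
  have ah: "(\<lambda>x. tpow_mult R M (Suc i) j x y) \<in> ahom (P (Suc i)) (P (Suc i + j))" using ok by (simp add: mult_ok_def)
  note cb = balancedD[OF cons_balanced] and cl = ahom_closed[OF ah] and add = ahom_add[OF ah]
  show ?thesis unfolding *
  proof (rule balancedI)
    fix m r a assume m: "m \<in> carrier M" and r: "r \<in> carrier R" and a: "a \<in> carrier (P (Suc i))"
    have eq: "tpow_mult R M (Suc i) j (smult (P (Suc i)) r a) y = smult (P (Suc i + j)) r (tpow_mult R M (Suc i) j a y)"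
      using ok r a unfolding mult_ok_def by blast
    show "tpow_cons R M (Suc i + j) (rsmult M m r) (tpow_mult R M (Suc i) j a y)
      = tpow_cons R M (Suc i + j) m (tpow_mult R M (Suc i) j (smult (P (Suc i)) r a) y)"
      unfolding eq by (rule cb(4)[OF m r cl[OF a]])
  next
    fix m m' a assume m: "m \<in> carrier M" "m' \<in> carrier M" and a: "a \<in> carrier (P (Suc i))"
    show "tpow_cons R M (Suc i + j) m (tpow_mult R M (Suc i) j a y) \<in> carrier (P (Suc (Suc i + j)))"
      by (rule cb(1)[OF m(1) cl[OF a]])
    show "tpow_cons R M (Suc i + j) (m \<oplus>\<^bsub>M\<^esub> m') (tpow_mult R M (Suc i) j a y)
      = tpow_cons R M (Suc i + j) m (tpow_mult R M (Suc i) j a y)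
        \<oplus>\<^bsub>P (Suc (Suc i + j))\<^esub> tpow_cons R M (Suc i + j) m' (tpow_mult R M (Suc i) j a y)"
      by (rule cb(2)[OF m cl[OF a]])
  next
    fix m a a' assume m: "m \<in> carrier M" and a: "a \<in> carrier (P (Suc i))" "a' \<in> carrier (P (Suc i))"
    show "tpow_cons R M (Suc i + j) m (tpow_mult R M (Suc i) j (a \<oplus>\<^bsub>P (Suc i)\<^esub> a') y)
      = tpow_cons R M (Suc i + j) m (tpow_mult R M (Suc i) j a y)
        \<oplus>\<^bsub>P (Suc (Suc i + j))\<^esub> tpow_cons R M (Suc i + j) m (tpow_mult R M (Suc i) j a' y)"
      unfolding add[OF a] by (rule cb(3)[OF m cl[OF a(1)] cl[OF a(2)]])
  qed
qed

lemma mult_enc: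
  assumes "c \<in> carrier (tensor_group R M (P (Suc i)))"
  shows "tpow_mult R M (Suc (Suc i)) j (tens_encode c) y = tensor_lift (P (Suc (Suc i) + j))
     (\<lambda>m a. tpow_cons R M (Suc i + j) m (tpow_mult R M (Suc i) j a y)) c"
  using assms enc_inj[of i] by (simp add: tensor_bimodule_simps(1) del: tpow.simps)

lemma P2_obtain:
  assumes "x \<in> carrier (P (Suc (Suc i)))"
  obtains c where "c \<in> carrier (tensor_group R M (P (Suc i)))" "x = tens_encode c"
  using assms by (auto simp: P2 tensor_bimodule_simps(1) simp del: tpow.simps)

lemma tens_smult:
  assumes "c \<in> carrier (tensor_group R M (P (Suc i)))"
  shows "smult (P (Suc (Suc i))) r (tens_encode c) = tens_encode (smult (tensor_module R M (P (Suc i))) r c)"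
    "rsmult (P (Suc (Suc i))) (tens_encode c) r = tens_encode (rsmult (tensor_bimodule R M (P (Suc i))) c r)"
  using assms by (simp_all add: P2 tensor_bimodule_simps(1,4) tensor_module_simps(4) del: tpow.simps)

text \<open>The two base cases follow the recursion of \<open>tpow_mult\<close>, since the powers 0
  and 1 are \<open>R\<close> and \<open>M\<close> and not tensor products.\<close>

lemma mult_ok: "y \<in> carrier (P j) \<Longrightarrow> mult_ok i j y"
proof (induction i rule: less_induct)
  case (less i)
  note y = less.prems
  consider "i = 0" | "i = Suc 0" | k where "i = Suc (Suc k)"
    by (metis not0_implies_Suc)
  then show ?case
  proof cases
    case 1
    show ?thesis unfolding 1 mult_ok_def
      using y by (auto intro!: ahomI simp: P0 P.left.smult_closed P.left.smult_l_distr P.left.smult_assoc simp del: tpow.simps)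
  next
    case 2
    note cb = balancedD[OF cons_balanced]
    show ?thesis unfolding 2 mult_ok_def
      using y by (auto intro!: ahomI simp: P1 vect_inj inv_into_f_f cb cons_smult M.left.smult_closed simp del: tpow.simps)
  next
    case (3 k)
    have ok: "mult_ok (Suc k) j y" using less 3 by simp
    interpret t: tensor_bi R R R M "P (Suc k)" by (rule tensor_P)
    note bal = mult_step_balanced[OF ok]
    let ?\<phi> = "\<lambda>m a. tpow_cons R M (Suc k + j) m (tpow_mult R M (Suc k) j a y)"
    let ?Q = "P (Suc (Suc k) + j)"
    note Q = P.left.M.abelian_group_axioms[of "Suc (Suc k) + j"]
    note lift = t.tensor_lift_ahom[OF Q bal] and lp = t.tensor_lift_pure[OF Q bal]
    have ah: "(\<lambda>x. tpow_mult R M (Suc (Suc k)) j x y) \<in> ahom (P (Suc (Suc k))) ?Q"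
    proof (rule ahomI)
      fix x assume "x \<in> carrier (P (Suc (Suc k)))"
      then obtain c where c: "c \<in> carrier t.T" "x = tens_encode c" by (rule P2_obtain)
      show "tpow_mult R M (Suc (Suc k)) j x y \<in> carrier ?Q"
        unfolding c(2) mult_enc[OF c(1)] by (rule ahom_closed[OF lift c(1)])
      fix x' assume "x' \<in> carrier (P (Suc (Suc k)))"
      then obtain d where d: "d \<in> carrier t.T" "x' = tens_encode d" by (rule P2_obtain)
      have cd: "c \<oplus>\<^bsub>t.T\<^esub> d \<in> carrier t.T" using c d by simp
      show "tpow_mult R M (Suc (Suc k)) j (x \<oplus>\<^bsub>P (Suc (Suc k))\<^esub> x') y
        = tpow_mult R M (Suc (Suc k)) j x y \<oplus>\<^bsub>?Q\<^esub> tpow_mult R M (Suc (Suc k)) j x' y"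
        unfolding c(2) d(2) ahom_add[OF enc_ahom c(1) d(1), symmetric] mult_enc[OF c(1)] mult_enc[OF d(1)] mult_enc[OF cd]
        by (rule ahom_add[OF lift c(1) d(1)])
    qed
    have "tpow_mult R M (Suc (Suc k)) j (smult (P (Suc (Suc k))) r x) y = smult ?Q r (tpow_mult R M (Suc (Suc k)) j x y)"
      if r: "r \<in> carrier R" and x: "x \<in> carrier (P (Suc (Suc k)))" for r x
    proof -
      obtain c where c: "c \<in> carrier t.T" "x = tens_encode c" using x by (rule P2_obtain)
      have rc: "smult (tensor_module R M (P (Suc k))) r c \<in> carrier t.T"
        by (rule ahom_closed[OF t.tensor_smult_ahom[OF r] c(1)])
      \<comment> \<open>Both sides are additive, so linearity is inherited from pure tensors, where
        it is \<open>cons_smult\<close>.\<close>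
      have "tensor_lift ?Q ?\<phi> (smult (tensor_module R M (P (Suc k))) r c) = smult ?Q r (tensor_lift ?Q ?\<phi> c)"
      proof (rule t.ahom_eqI[OF Q _ _ c(1), of "\<lambda>c. tensor_lift ?Q ?\<phi> (smult (tensor_module R M (P (Suc k))) r c)" "\<lambda>c. smult ?Q r (tensor_lift ?Q ?\<phi> c)"])
        show "(\<lambda>c. tensor_lift ?Q ?\<phi> (smult (tensor_module R M (P (Suc k))) r c)) \<in> ahom t.T ?Q"
          by (rule ahom_compose[OF t.tensor_smult_ahom[OF r] lift])
        show "(\<lambda>c. smult ?Q r (tensor_lift ?Q ?\<phi> c)) \<in> ahom t.T ?Q"
          by (rule ahom_compose[OF lift smult_ahom[OF bimoduleD(1)[OF P_bimodule] r]])
        fix m a assume m: "m \<in> carrier M" and a: "a \<in> carrier (P (Suc k))"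
        have ay: "tpow_mult R M (Suc k) j a y \<in> carrier (P (Suc k + j))"
          using ok a unfolding mult_ok_def by (auto intro: ahom_closed)
        show "tensor_lift ?Q ?\<phi> (smult (tensor_module R M (P (Suc k))) r (pure_tensor R M (P (Suc k)) m a))
          = smult ?Q r (tensor_lift ?Q ?\<phi> (pure_tensor R M (P (Suc k)) m a))"
          unfolding t.tensor_smult_pure[OF r m a] lp[OF m a] lp[OF M.left.smult_closed[OF r m] a]
          using cons_smult[OF r m ay] by simp
      qed
      then show ?thesis unfolding c(2) tens_smult[OF c(1)] mult_enc[OF c(1)] mult_enc[OF rc] .
    qed
    then show ?thesis using ah unfolding 3 mult_ok_def by blast
  qed
qed

lemma mult_closed:
  assumes "x \<in> carrier (P i)" "y \<in> carrier (P j)"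
  shows "tpow_mult R M i j x y \<in> carrier (P (i + j))"
proof -
  have "(\<lambda>x. tpow_mult R M i j x y) \<in> ahom (P i) (P (i + j))"
    using mult_ok[OF assms(2)] unfolding mult_ok_def by blast
  then show ?thesis by (rule ahom_closed[OF _ assms(1)])
qed

text \<open>Removes the contributions of the components of \<open>e r\<close> in positive degree
  from a product. For \<open>i\<close> at least 2 the lifted map vanishes on pure tensors, hence
  everywhere.\<close>

lemma mult_zero_right: "x \<in> carrier (P i) \<Longrightarrow> tpow_mult R M i j x \<zero>\<^bsub>P j\<^esub> = \<zero>\<^bsub>P (i + j)\<^esub>"
proof (induction i arbitrary: x rule: less_induct)
  case (less i)
  consider "i = 0" | "i = Suc 0" | k where "i = Suc (Suc k)"
    by (metis not0_implies_Suc)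
  then show ?case
  proof cases
    case 1
    then show ?thesis using less.prems smult_zero[OF bimoduleD(1)[OF P_bimodule]] by (auto simp: P0 simp del: tpow.simps)
  next
    case 2
    then show ?thesis using less.prems by (auto simp: P1 vect_inj cons_zero simp del: tpow.simps)
  next
    case (3 k)
    interpret t: tensor_bi R R R M "P (Suc k)" by (rule tensor_P)
    have y: "\<zero>\<^bsub>P j\<^esub> \<in> carrier (P j)" by simp
    note bal = mult_step_balanced[OF mult_ok[OF y, of "Suc k"]]
    note Q = P.left.M.abelian_group_axioms[of "Suc (Suc k) + j"]
    obtain c where c: "c \<in> carrier t.T" "x = tens_encode c" using less.prems unfolding 3 by (rule P2_obtain)
    have "tensor_lift (P (Suc (Suc k) + j)) (\<lambda>m a. tpow_cons R M (Suc k + j) m (tpow_mult R M (Suc k) j a \<zero>\<^bsub>P j\<^esub>)) c = \<zero>\<^bsub>P (Suc (Suc k) + j)\<^esub>"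
    proof (rule t.ahom_eqI[OF Q t.tensor_lift_ahom[OF Q bal] ahom_zero_map[OF Q] c(1)])
      fix m a assume m: "m \<in> carrier M" and a: "a \<in> carrier (P (Suc k))"
      show "tensor_lift (P (Suc (Suc k) + j)) (\<lambda>m a. tpow_cons R M (Suc k + j) m (tpow_mult R M (Suc k) j a \<zero>\<^bsub>P j\<^esub>))
         (pure_tensor R M (P (Suc k)) m a) = \<zero>\<^bsub>P (Suc (Suc k) + j)\<^esub>"
        unfolding t.tensor_lift_pure[OF Q bal m a] using less.IH[of "Suc k" a] 3 a m cons_zero[of m "Suc k + j"] by simp
    qed
    then show ?thesis unfolding c(2) 3 mult_enc[OF c(1)] .
  qed
qed

text \<open>The recursion of \<open>tpow_mult\<close> runs along the left factor, so the
  identification of \<open>N \<otimes> R\<close> with \<open>N\<close>, built in for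
  \<open>N = M\<close>, has to be carried along the induction.\<close>

lemma mult_scal: "x \<in> carrier (P i) \<Longrightarrow> r \<in> carrier R \<Longrightarrow> tpow_mult R M i 0 x (Scal r) = rsmult (P i) x r"
proof (induction i arbitrary: x rule: less_induct)
  case (less i)
  have y: "Scal r \<in> carrier (P 0)" using less.prems by (auto simp: P0 simp del: tpow.simps)
  consider "i = 0" | "i = Suc 0" | k where "i = Suc (Suc k)"
    by (metis not0_implies_Suc)
  then show ?case
  proof cases
    case 1
    then show ?thesis using less.prems by (auto simp: P0 simp del: tpow.simps)
  next
    case 2
    then show ?thesis using less.prems by (auto simp: P1 vect_inj simp del: tpow.simps)
  next
    case (3 k)
    interpret t: tensor_bi R R R M "P (Suc k)" by (rule tensor_P)
    note bal = mult_step_balanced[OF mult_ok[OF y, of "Suc k"], unfolded add_0_right]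
    note Q = P.left.M.abelian_group_axioms[of "Suc (Suc k)"]
    obtain c where c: "c \<in> carrier t.T" "x = tens_encode c" using less.prems(1) unfolding 3 by (rule P2_obtain)
    have "tensor_lift (P (Suc (Suc k))) (\<lambda>m a. tpow_cons R M (Suc k) m (tpow_mult R M (Suc k) 0 a (Scal r))) c
      = tens_encode (rsmult (tensor_bimodule R M (P (Suc k))) c r)"
    proof (rule t.ahom_eqI[OF Q t.tensor_lift_ahom[OF Q bal] ahom_compose[OF t.tensor_rsmult_ahom[OF less.prems(2)] enc_ahom] c(1)])
      fix m a assume m: "m \<in> carrier M" and a: "a \<in> carrier (P (Suc k))"
      show "tensor_lift (P (Suc (Suc k))) (\<lambda>m a. tpow_cons R M (Suc k) m (tpow_mult R M (Suc k) 0 a (Scal r)))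
         (pure_tensor R M (P (Suc k)) m a) = tens_encode (rsmult (tensor_bimodule R M (P (Suc k))) (pure_tensor R M (P (Suc k)) m a) r)"
        unfolding t.tensor_lift_pure[OF Q bal m a] t.tensor_rsmult_pure[OF less.prems(2) m a]
        using less.IH[of "Suc k" a] 3 a less.prems(2) by simp
    qed
    then show ?thesis unfolding c(2) 3 mult_enc[OF c(1)] tens_smult[OF c(1)] by simp
  qed
qed

section \<open>Components of the trivial extension and the embedding of the base ring\<close>

lemma carrier_S: "s \<in> carrier S \<longleftrightarrow> s \<in> (\<Pi>\<^sub>E k\<in>{..n}. carrier (P k))"
  by (simp add: ntriv_def)

lemma S_comp: "s \<in> carrier S \<Longrightarrow> k \<le> n \<Longrightarrow> s k \<in> carrier (P k)"
  unfolding carrier_S by (auto simp del: tpow.simps)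

lemma S_eqI: "s \<in> carrier S \<Longrightarrow> t \<in> carrier S \<Longrightarrow> (\<And>k. k \<le> n \<Longrightarrow> s k = t k) \<Longrightarrow> s = t"
  unfolding carrier_S by (rule PiE_ext) auto

lemma add_S: "k \<le> n \<Longrightarrow> (s \<oplus>\<^bsub>S\<^esub> t) k = s k \<oplus>\<^bsub>P k\<^esub> t k"
  and zero_S: "k \<le> n \<Longrightarrow> \<zero>\<^bsub>S\<^esub> k = \<zero>\<^bsub>P k\<^esub>"
  and mult_S: "k \<le> n \<Longrightarrow> (s \<otimes>\<^bsub>S\<^esub> t) k = (\<Oplus>\<^bsub>P k\<^esub>i\<in>{..k}. tpow_mult R M i (k - i) (s i) (t (k - i)))"
  by (simp_all add: ntriv_def)

lemma S_comp_ahom: "k \<le> n \<Longrightarrow> (\<lambda>s. s k) \<in> ahom S (P k)"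
  by (rule ahomI) (auto simp: S_comp add_S simp del: tpow.simps)

lemma e_comp: "k \<le> n \<Longrightarrow> e r k = (if k = 0 then Scal r else \<zero>\<^bsub>P k\<^esub>)"
  by (simp add: ntriv_emb_def)

lemma scal_closed: "r \<in> carrier R \<Longrightarrow> Scal r \<in> carrier (P 0)"
  by (auto simp: P0 simp del: tpow.simps)

lemma e_closed: "r \<in> carrier R \<Longrightarrow> e r \<in> carrier S"
  unfolding carrier_S by (rule PiE_I) (auto simp: e_comp scal_closed ntriv_emb_def simp del: tpow.simps)

interpretation S: ring S by (rule S)

text \<open>Only the component of degree 0 of \<open>e r\<close> is nonzero, so the convolution sum
  has a single term. Together with \<open>e_right\<close> this says that over \<open>R\<close> the
  trivial extension is, on either side, the sum of the tensor powers.\<close>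

lemma e_left:
  assumes r: "r \<in> carrier R" and s: "s \<in> carrier S" and k: "k \<le> n"
  shows "(e r \<otimes>\<^bsub>S\<^esub> s) k = smult (P k) r (s k)"
proof -
  let ?f = "\<lambda>i. tpow_mult R M i (k - i) (e r i) (s (k - i))"
  have cl: "?f i \<in> carrier (P k)" if "i \<le> k" for i
    using mult_closed[OF S_comp[OF e_closed[OF r], of i] S_comp[OF s, of "k - i"]] that k
    by (simp del: tpow.simps)
  have z: "?f i = \<zero>\<^bsub>P k\<^esub>" if "i \<in> {..k} - {0}" for i
  proof -
    have "(\<lambda>x. tpow_mult R M i (k - i) x (s (k - i))) \<in> ahom (P i) (P (i + (k - i)))"
      using mult_ok[OF S_comp[OF s, of "k - i"], of i] k unfolding mult_ok_def by simp
    then have "tpow_mult R M i (k - i) \<zero>\<^bsub>P i\<^esub> (s (k - i)) = \<zero>\<^bsub>P (i + (k - i))\<^esub>"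
      by (rule ahom_zero[OF P.left.M.abelian_group_axioms P.left.M.abelian_group_axioms])
    then show ?thesis using that k by (simp add: e_comp del: tpow.simps)
  qed
  have "(\<Oplus>\<^bsub>P k\<^esub>i\<in>{0}. ?f i) = (\<Oplus>\<^bsub>P k\<^esub>i\<in>{..k}. ?f i)"
    by (rule P.left.M.add.finprod_mono_neutral_cong_left) (use z cl in \<open>auto simp del: tpow.simps\<close>)
  then show ?thesis
    using cl[of 0] k by (simp add: mult_S e_comp del: tpow.simps)
qed

lemma e_right:
  assumes r: "r \<in> carrier R" and s: "s \<in> carrier S" and k: "k \<le> n"
  shows "(s \<otimes>\<^bsub>S\<^esub> e r) k = rsmult (P k) (s k) r"
proof -
  let ?f = "\<lambda>i. tpow_mult R M i (k - i) (s i) (e r (k - i))"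
  have cl: "?f i \<in> carrier (P k)" if "i \<le> k" for i
    using mult_closed[OF S_comp[OF s, of i] S_comp[OF e_closed[OF r], of "k - i"]] that k
    by (simp del: tpow.simps)
  have z: "?f i = \<zero>\<^bsub>P k\<^esub>" if "i \<in> {..k} - {k}" for i
  proof -
    have "tpow_mult R M i (k - i) (s i) \<zero>\<^bsub>P (k - i)\<^esub> = \<zero>\<^bsub>P (i + (k - i))\<^esub>"
      by (rule mult_zero_right[OF S_comp[OF s]]) (use that k in auto)
    then show ?thesis using that k by (simp add: e_comp del: tpow.simps)
  qed
  have "(\<Oplus>\<^bsub>P k\<^esub>i\<in>{k}. ?f i) = (\<Oplus>\<^bsub>P k\<^esub>i\<in>{..k}. ?f i)"
    by (rule P.left.M.add.finprod_mono_neutral_cong_left) (use z cl in \<open>auto simp del: tpow.simps\<close>)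
  then show ?thesis
    using cl[of k] k mult_scal[OF S_comp[OF s k] r] by (simp add: mult_S e_comp del: tpow.simps)
qed

lemma e_add: "a \<in> carrier R \<Longrightarrow> b \<in> carrier R \<Longrightarrow> e (a \<oplus>\<^bsub>R\<^esub> b) = e a \<oplus>\<^bsub>S\<^esub> e b"
  by (rule S_eqI) (auto simp: e_closed e_comp add_S P0 simp del: tpow.simps)

lemma e_mult: "a \<in> carrier R \<Longrightarrow> b \<in> carrier R \<Longrightarrow> e (a \<otimes>\<^bsub>R\<^esub> b) = e a \<otimes>\<^bsub>S\<^esub> e b"
  using smult_zero[OF bimoduleD(1)[OF P_bimodule]]
  by (intro S_eqI) (auto simp: e_closed e_left e_comp P0 simp del: tpow.simps)

lemma e_hom: "e \<in> ring_hom R S"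
  by (rule ring_hom_memI) (simp_all add: e_closed e_add e_mult, simp add: ntriv_def ntriv_emb_def)

lemma e_zero: "e \<zero>\<^bsub>R\<^esub> = \<zero>\<^bsub>S\<^esub>"
  by (rule S_eqI) (auto simp: e_closed e_comp zero_S P0 simp del: tpow.simps)

lemma e_eq_zero: "e r = \<zero>\<^bsub>S\<^esub> \<longleftrightarrow> r = \<zero>\<^bsub>R\<^esub>"
proof
  assume "e r = \<zero>\<^bsub>S\<^esub>"
  then have "e r 0 = \<zero>\<^bsub>P 0\<^esub>" by (simp add: zero_S del: tpow.simps)
  then show "r = \<zero>\<^bsub>R\<^esub>" by (simp add: e_comp P0 del: tpow.simps)
qed (simp add: e_zero)

end

section \<open>Based free resolutions and their comparison\<close>

abbreviation flin ::
    "('r, 'z) ring_scheme \<Rightarrow> 'c set \<Rightarrow> ('b \<Rightarrow> 'c \<Rightarrow> 'r) \<Rightarrow> ('b \<Rightarrow> 'r) \<Rightarrow> 'c \<Rightarrow> 'r" where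
  "flin R B \<equiv> linear_extension R (free_module R B)"

lemma flin_ahom:
  assumes "ring R" "\<And>b. b \<in> B \<Longrightarrow> \<alpha> b \<in> fsupp R B'"
  shows "flin R B' \<alpha> \<in> ahom (free_module R B) (free_module R B')"
  by (rule lin_ahom[OF free_left_module[OF assms(1)]]) (simp add: carrier_free_module assms(2))

lemma flin_closed:
  assumes "ring R" "\<And>b. b \<in> B \<Longrightarrow> \<alpha> b \<in> fsupp R B'" "f \<in> fsupp R B"
  shows "flin R B' \<alpha> f \<in> fsupp R B'"
  using ahom_closed[OF flin_ahom[OF assms(1,2)]] assms(3) by (simp add: carrier_free_module)

lemma flin_assoc:
  assumes "ring R" "\<And>b. b \<in> B \<Longrightarrow> \<alpha> b \<in> fsupp R B'" "\<And>b. b \<in> B' \<Longrightarrow> \<beta> b \<in> fsupp R B''" "f \<in> fsupp R B"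
  shows "flin R B'' \<beta> (flin R B' \<alpha> f) = flin R B'' (\<lambda>b. flin R B'' \<beta> (\<alpha> b)) f"
  by (rule lin_assoc[OF free_left_module[OF assms(1)] assms(2) _ assms(4)])
    (simp_all add: carrier_free_module assms(3))

lemma flin_cong:
  assumes "ring R" "\<And>b. b \<in> B \<Longrightarrow> \<alpha> b \<in> fsupp R B'" "f \<in> fsupp R B" "\<And>b. b \<in> B \<Longrightarrow> \<alpha> b = \<beta> b"
  shows "flin R B' \<alpha> f = flin R B' \<beta> f"
  by (rule lin_cong[OF free_left_module[OF assms(1)] _ assms(3,4)]) (simp_all add: carrier_free_module assms(2))

lemma flin_add_fun:
  assumes "ring R" "\<And>b. b \<in> B \<Longrightarrow> \<alpha> b \<in> fsupp R B'" "\<And>b. b \<in> B \<Longrightarrow> \<beta> b \<in> fsupp R B'" "f \<in> fsupp R B"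
  shows "flin R B' (\<lambda>b. \<alpha> b \<oplus>\<^bsub>free_module R B'\<^esub> \<beta> b) f = flin R B' \<alpha> f \<oplus>\<^bsub>free_module R B'\<^esub> flin R B' \<beta> f"
  by (rule lin_add_fun[OF free_left_module[OF assms(1)] _ _ assms(4)]) (simp_all add: carrier_free_module assms(2,3))

lemma free_group: "ring R \<Longrightarrow> abelian_group (free_module R B)"
  by (rule is_fs_group[OF is_fs_free_module])

lemma flin_zero: "ring R \<Longrightarrow> (\<And>b. b \<in> B \<Longrightarrow> \<alpha> b \<in> fsupp R B') \<Longrightarrow>
    flin R B' \<alpha> \<zero>\<^bsub>free_module R B\<^esub> = \<zero>\<^bsub>free_module R B'\<^esub>"
  by (rule ahom_zero[OF free_group free_group flin_ahom])

lemma lin_zero: "left_module R N \<Longrightarrow> (\<And>b. b \<in> B \<Longrightarrow> g b \<in> carrier N) \<Longrightarrow>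
    linear_extension R N g \<zero>\<^bsub>free_module R B\<^esub> = \<zero>\<^bsub>N\<^esub>"
  by (rule ahom_zero[OF free_group[OF left_moduleD(1)] left_moduleD(2) lin_ahom])

lemma unit_closed: "ring R \<Longrightarrow> b \<in> B \<Longrightarrow> single R b \<one>\<^bsub>R\<^esub> \<in> fsupp R B"
  by (rule single_closed[OF ring.is_abelian_group _ monoid.one_closed[OF ring.is_monoid]])

lemma lin_unit_eval:
  assumes "left_module R N" "\<And>b. b \<in> B \<Longrightarrow> g b \<in> carrier N" "b \<in> B"
  shows "linear_extension R N g (single R b \<one>\<^bsub>R\<^esub>) = g b"
  using lin_single[OF assms monoid.one_closed[OF ring.is_monoid[OF left_moduleD(1)[OF assms(1)]]]]
    left_module.smult_one[OF assms(1) assms(2)[OF assms(3)]] by simp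

lemma flin_unit_eval:
  assumes "ring R" "\<And>b. b \<in> B \<Longrightarrow> \<alpha> b \<in> fsupp R B'" "b \<in> B"
  shows "flin R B' \<alpha> (single R b \<one>\<^bsub>R\<^esub>) = \<alpha> b"
  by (rule lin_unit_eval[OF free_left_module[OF assms(1)] _ assms(3)]) (simp add: carrier_free_module assms(2))

lemma add_minus_cancel:
  assumes "abelian_group G" "a \<in> carrier G" "b \<in> carrier G"
  shows "b \<oplus>\<^bsub>G\<^esub> (a \<ominus>\<^bsub>G\<^esub> b) = a"
proof -
  interpret abelian_group G by fact
  have "b \<oplus>\<^bsub>G\<^esub> (a \<ominus>\<^bsub>G\<^esub> b) = a \<oplus>\<^bsub>G\<^esub> (b \<oplus>\<^bsub>G\<^esub> \<ominus>\<^bsub>G\<^esub> b)"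
    unfolding a_minus_def by (rule a_lcomm) (use assms in auto)
  then show ?thesis using assms by (simp add: r_neg)
qed

lemma add_minus_cancel3:
  assumes "abelian_group G" "a \<in> carrier G" "b \<in> carrier G" "c \<in> carrier G"
  shows "b \<oplus>\<^bsub>G\<^esub> ((a \<ominus>\<^bsub>G\<^esub> (b \<oplus>\<^bsub>G\<^esub> c)) \<oplus>\<^bsub>G\<^esub> c) = a"
proof -
  interpret abelian_group G by fact
  have "b \<oplus>\<^bsub>G\<^esub> ((a \<ominus>\<^bsub>G\<^esub> (b \<oplus>\<^bsub>G\<^esub> c)) \<oplus>\<^bsub>G\<^esub> c) = (b \<oplus>\<^bsub>G\<^esub> c) \<oplus>\<^bsub>G\<^esub> (a \<ominus>\<^bsub>G\<^esub> (b \<oplus>\<^bsub>G\<^esub> c))"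
    using assms by (simp add: a_ac)
  then show ?thesis using add_minus_cancel[OF assms(1,2), of "b \<oplus>\<^bsub>G\<^esub> c"] assms by simp
qed

text \<open>In degree 0 the kernel of the augmentation, so that exactness at all terms of the
  resolution is a single condition in \<open>resolution\<close>.\<close>

fun based_cycles ::
    "('r, 'z) ring_scheme \<Rightarrow> ('r, 'x, 'y) module_scheme \<Rightarrow> (nat \<Rightarrow> 'b set) \<Rightarrow> (nat \<Rightarrow> 'b \<Rightarrow> 'b \<Rightarrow> 'r)
      \<Rightarrow> ('b \<Rightarrow> 'x) \<Rightarrow> nat \<Rightarrow> ('b \<Rightarrow> 'r) set" where
  "based_cycles R N B D \<epsilon> 0 = {f \<in> fsupp R (B 0). linear_extension R N \<epsilon> f = \<zero>\<^bsub>N\<^esub>}"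
| "based_cycles R N B D \<epsilon> (Suc k) = {f \<in> fsupp R (B (Suc k)). flin R (B k) (D k) f = \<zero>\<^bsub>free_module R (B k)\<^esub>}"

text \<open>A free resolution with chosen bases: \<open>D k b\<close> is the image in degree
  \<open>k\<close> of the basis element \<open>b\<close> of degree \<open>k + 1\<close>. Bases and
  differentials are arbitrary, which admits extended, quotient and direct sum resolutions beside the
  canonical one.\<close>

locale resolution = left_module R N
  for R :: "('r, 'z) ring_scheme" and N :: "('r, 'x, 'y) module_scheme" +
  fixes B :: "nat \<Rightarrow> 'b set" and D :: "nat \<Rightarrow> 'b \<Rightarrow> 'b \<Rightarrow> 'r" and \<epsilon> :: "'b \<Rightarrow> 'x"
  assumes aug_closed: "b \<in> B 0 \<Longrightarrow> \<epsilon> b \<in> carrier N"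
    and D_cycle: "b \<in> B (Suc k) \<Longrightarrow> D k b \<in> based_cycles R N B D \<epsilon> k"
    and exact: "f \<in> based_cycles R N B D \<epsilon> k \<Longrightarrow> \<exists>g\<in>fsupp R (B (Suc k)). flin R (B k) (D k) g = f"
    and aug_surj: "x \<in> carrier N \<Longrightarrow> \<exists>f\<in>fsupp R (B 0). linear_extension R N \<epsilon> f = x"
begin

abbreviation "Z \<equiv> based_cycles R N B D \<epsilon>"

lemma R: "ring R" and N: "left_module R N"
  using left_module_axioms by (auto simp: left_module_def)

lemma cycle_closed: "f \<in> Z k \<Longrightarrow> f \<in> fsupp R (B k)"
  by (cases k) auto

lemma D_closed: "b \<in> B (Suc k) \<Longrightarrow> D k b \<in> fsupp R (B k)"
  by (rule cycle_closed[OF D_cycle])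

lemma asub_cycles: "asub (Z k) (free_module R (B k))"
proof (cases k)
  case 0
  then show ?thesis
    using asub_kernel[OF free_group[OF R] left_moduleD(2)[OF N] asub_carrier[OF free_group[OF R]] lin_ahom[where B = "B 0" and g = \<epsilon>, OF N aug_closed]]
    by (simp add: carrier_free_module)
next
  case (Suc j)
  then show ?thesis
    using asub_kernel[OF free_group[OF R] free_group[OF R] asub_carrier[OF free_group[OF R]] flin_ahom[where B = "B (Suc j)" and B' = "B j" and \<alpha> = "D j", OF R D_closed]]
    by (simp add: carrier_free_module)
qed

lemma boundary_cycle:
  assumes "g \<in> fsupp R (B (Suc k))"
  shows "flin R (B k) (D k) g \<in> Z k"
proof (cases k)
  case 0
  have "linear_extension R N \<epsilon> (flin R (B 0) (D 0) g) = linear_extension R N (\<lambda>b. linear_extension R N \<epsilon> (D 0 b)) g"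
    by (rule lin_assoc[OF N D_closed aug_closed]) (use assms 0 in auto)
  also have "\<dots> = \<zero>\<^bsub>N\<^esub>"
    by (rule lin_zero_fun[OF N assms]) (use D_cycle[of _ 0] 0 in auto)
  finally show ?thesis using flin_closed[OF R D_closed assms] 0 by simp
next
  case (Suc j)
  have "flin R (B j) (D j) (flin R (B (Suc j)) (D (Suc j)) g) = flin R (B j) (\<lambda>b. flin R (B j) (D j) (D (Suc j) b)) g"
    by (rule flin_assoc[OF R D_closed D_closed]) (use assms Suc in auto)
  also have "\<dots> = \<zero>\<^bsub>free_module R (B j)\<^esub>"
    by (rule lin_zero_fun[OF free_left_module[OF R] assms]) (use D_cycle[of _ "Suc j"] Suc in auto)
  finally show ?thesis using flin_closed[OF R D_closed assms] Suc by simp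
qed

end

definition chain_map ::
    "('r, 'z) ring_scheme \<Rightarrow> (nat \<Rightarrow> 'b set) \<Rightarrow> (nat \<Rightarrow> 'b \<Rightarrow> 'b \<Rightarrow> 'r) \<Rightarrow> (nat \<Rightarrow> 'c set)
      \<Rightarrow> (nat \<Rightarrow> 'c \<Rightarrow> 'c \<Rightarrow> 'r) \<Rightarrow> (nat \<Rightarrow> 'b \<Rightarrow> 'c \<Rightarrow> 'r) \<Rightarrow> bool" where
  "chain_map R B D B' D' \<alpha> \<longleftrightarrow> (\<forall>k. \<forall>b\<in>B k. \<alpha> k b \<in> fsupp R (B' k)) \<and>
     (\<forall>k. \<forall>b\<in>B (Suc k). flin R (B' k) (D' k) (\<alpha> (Suc k) b) = flin R (B' k) (\<alpha> k) (D k b))"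

text \<open>The usual \<open>\<gamma> - id = dh + hd\<close>, written without subtraction. It is
  demanded in positive degrees, where the groups \<open>bExt\<close> and \<open>bTor\<close>
  live.\<close>

definition homotopy_to_id ::
    "('r, 'z) ring_scheme \<Rightarrow> (nat \<Rightarrow> 'b set) \<Rightarrow> (nat \<Rightarrow> 'b \<Rightarrow> 'b \<Rightarrow> 'r)
      \<Rightarrow> (nat \<Rightarrow> 'b \<Rightarrow> 'b \<Rightarrow> 'r) \<Rightarrow> (nat \<Rightarrow> 'b \<Rightarrow> 'b \<Rightarrow> 'r) \<Rightarrow> bool" where
  "homotopy_to_id R B D \<gamma> h \<longleftrightarrow> (\<forall>k. \<forall>b\<in>B k. h k b \<in> fsupp R (B (Suc k))) \<and>
     (\<forall>k. \<forall>b\<in>B (Suc k). \<gamma> (Suc k) b = single R b \<one>\<^bsub>R\<^esub> \<oplus>\<^bsub>free_module R (B (Suc k))\<^esub>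
        (flin R (B (Suc k)) (D (Suc k)) (h (Suc k) b) \<oplus>\<^bsub>free_module R (B (Suc k))\<^esub> flin R (B (Suc k)) (h k) (D k b)))"

lemma chain_mapD:
  assumes "chain_map R B D B' D' \<alpha>"
  shows "b \<in> B k \<Longrightarrow> \<alpha> k b \<in> fsupp R (B' k)"
    "b \<in> B (Suc k) \<Longrightarrow> flin R (B' k) (D' k) (\<alpha> (Suc k) b) = flin R (B' k) (\<alpha> k) (D k b)"
  using assms by (auto simp: chain_map_def)

text \<open>The comparison theorem. The recursive choice carries along that cycles go to cycles:
  then the image of the cycle \<open>D k b\<close> has a preimage under the next differential, which
  serves as the value on \<open>b\<close>.\<close>

lemma ex_chain_map:
  assumes "resolution R N B D \<epsilon>" "resolution R N B' D' \<epsilon>'"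
  shows "\<exists>\<alpha>. chain_map R B D B' D' \<alpha> \<and> (\<forall>b\<in>B 0. linear_extension R N \<epsilon>' (\<alpha> 0 b) = \<epsilon> b)"
proof -
  interpret P: resolution R N B D \<epsilon> by fact
  interpret Q: resolution R N B' D' \<epsilon>' by fact
  note R = P.R and N = P.N
  let ?P = "\<lambda>k \<alpha>. (\<forall>b\<in>B k. \<alpha> b \<in> fsupp R (B' k)) \<and> (\<forall>f\<in>P.Z k. flin R (B' k) \<alpha> f \<in> Q.Z k) \<and>
    (k = 0 \<longrightarrow> (\<forall>b\<in>B 0. linear_extension R N \<epsilon>' (\<alpha> b) = \<epsilon> b))"
  let ?Q = "\<lambda>k \<alpha> \<alpha>'. \<forall>b\<in>B (Suc k). flin R (B' k) (D' k) (\<alpha>' b) = flin R (B' k) \<alpha> (D k b)"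
  have "\<exists>\<alpha>. \<forall>k. ?P k (\<alpha> k) \<and> ?Q k (\<alpha> k) (\<alpha> (Suc k))"
  proof (rule dependent_nat_choice[where P = ?P and Q = ?Q])
    have "\<forall>b\<in>B 0. \<exists>g. g \<in> fsupp R (B' 0) \<and> linear_extension R N \<epsilon>' g = \<epsilon> b"
      using Q.aug_surj P.aug_closed by blast
    then obtain \<alpha> where a1: "\<And>b. b \<in> B 0 \<Longrightarrow> \<alpha> b \<in> fsupp R (B' 0)"
      and a2: "\<And>b. b \<in> B 0 \<Longrightarrow> linear_extension R N \<epsilon>' (\<alpha> b) = \<epsilon> b"
      using bchoice[of "B 0" "\<lambda>b g. g \<in> fsupp R (B' 0) \<and> linear_extension R N \<epsilon>' g = \<epsilon> b"] by blast
    have "flin R (B' 0) \<alpha> f \<in> Q.Z 0" if "f \<in> P.Z 0" for f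
    proof -
      have f: "f \<in> fsupp R (B 0)" "linear_extension R N \<epsilon> f = \<zero>\<^bsub>N\<^esub>" using that by auto
      have "linear_extension R N \<epsilon>' (flin R (B' 0) \<alpha> f) = linear_extension R N (\<lambda>b. linear_extension R N \<epsilon>' (\<alpha> b)) f"
        by (rule lin_assoc[OF N a1 Q.aug_closed f(1)])
      also have "\<dots> = linear_extension R N \<epsilon> f"
        by (rule lin_cong[OF N _ f(1)]) (use a2 P.aug_closed in auto)
      finally show ?thesis using f flin_closed[OF R a1 f(1)] by simp
    qed
    then show "\<exists>\<alpha>. ?P 0 \<alpha>" using a1 a2 by (intro exI[of _ \<alpha>]) blast
  next
    fix \<alpha> k assume "?P k \<alpha>"
    then have a1: "\<And>b. b \<in> B k \<Longrightarrow> \<alpha> b \<in> fsupp R (B' k)" and a2: "\<And>f. f \<in> P.Z k \<Longrightarrow> flin R (B' k) \<alpha> f \<in> Q.Z k"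
      by auto
    have "\<forall>b\<in>B (Suc k). \<exists>g. g \<in> fsupp R (B' (Suc k)) \<and> flin R (B' k) (D' k) g = flin R (B' k) \<alpha> (D k b)"
      using Q.exact[OF a2[OF P.D_cycle]] by blast
    then obtain \<alpha>' where b1: "\<And>b. b \<in> B (Suc k) \<Longrightarrow> \<alpha>' b \<in> fsupp R (B' (Suc k))"
      and b2: "\<And>b. b \<in> B (Suc k) \<Longrightarrow> flin R (B' k) (D' k) (\<alpha>' b) = flin R (B' k) \<alpha> (D k b)"
      using bchoice[of "B (Suc k)" "\<lambda>b g. g \<in> fsupp R (B' (Suc k)) \<and> flin R (B' k) (D' k) g = flin R (B' k) \<alpha> (D k b)"] by blast
    have "flin R (B' (Suc k)) \<alpha>' f \<in> Q.Z (Suc k)" if "f \<in> P.Z (Suc k)" for f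
    proof -
      have f: "f \<in> fsupp R (B (Suc k))" "flin R (B k) (D k) f = \<zero>\<^bsub>free_module R (B k)\<^esub>" using that by auto
      have "flin R (B' k) (D' k) (flin R (B' (Suc k)) \<alpha>' f) = flin R (B' k) (\<lambda>b. flin R (B' k) (D' k) (\<alpha>' b)) f"
        by (rule flin_assoc[OF R b1 Q.D_closed f(1)])
      also have "\<dots> = flin R (B' k) (\<lambda>b. flin R (B' k) \<alpha> (D k b)) f"
        by (rule flin_cong[OF R _ f(1) b2]) (simp_all add: b2 flin_closed[OF R a1 P.D_closed])
      also have "\<dots> = flin R (B' k) \<alpha> (flin R (B k) (D k) f)"
        by (rule flin_assoc[OF R P.D_closed a1 f(1), symmetric])
      also have "\<dots> = \<zero>\<^bsub>free_module R (B' k)\<^esub>" unfolding f(2) by (rule flin_zero[OF R a1])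
      finally show ?thesis using flin_closed[OF R b1 f(1)] by simp
    qed
    then show "\<exists>\<alpha>'. ?P (Suc k) \<alpha>' \<and> ?Q k \<alpha> \<alpha>'" using b1 b2 by (intro exI[of _ \<alpha>']) blast
  qed
  then obtain \<alpha> where \<alpha>: "\<And>k. ?P k (\<alpha> k) \<and> ?Q k (\<alpha> k) (\<alpha> (Suc k))" by metis
  then have "chain_map R B D B' D' \<alpha>" unfolding chain_map_def by simp
  moreover have "\<forall>b\<in>B 0. linear_extension R N \<epsilon>' (\<alpha> 0 b) = \<epsilon> b" using \<alpha>[of 0] by simp
  ultimately show ?thesis by (intro exI conjI)
qed

lemma chain_map_compose:
  assumes "resolution R N B D \<epsilon>" "resolution R N B' D' \<epsilon>'"
    and a: "chain_map R B D B' D' \<alpha>" "\<And>b. b \<in> B 0 \<Longrightarrow> linear_extension R N \<epsilon>' (\<alpha> 0 b) = \<epsilon> b"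
    and b: "chain_map R B' D' B D \<beta>" "\<And>b. b \<in> B' 0 \<Longrightarrow> linear_extension R N \<epsilon> (\<beta> 0 b) = \<epsilon>' b"
  shows "chain_map R B D B D (\<lambda>k b. flin R (B k) (\<beta> k) (\<alpha> k b))"
    "b \<in> B 0 \<Longrightarrow> linear_extension R N \<epsilon> (flin R (B 0) (\<beta> 0) (\<alpha> 0 b)) = \<epsilon> b"
proof -
  interpret P: resolution R N B D \<epsilon> by fact
  interpret Q: resolution R N B' D' \<epsilon>' by fact
  note R = P.R and N = P.N
  note a1 = chain_mapD(1)[OF a(1)] and a2 = chain_mapD(2)[OF a(1)] and b1 = chain_mapD(1)[OF b(1)] and b2 = chain_mapD(2)[OF b(1)]
  show "chain_map R B D B D (\<lambda>k b. flin R (B k) (\<beta> k) (\<alpha> k b))"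
    unfolding chain_map_def
  proof (intro conjI allI ballI)
    show "flin R (B k) (\<beta> k) (\<alpha> k b) \<in> fsupp R (B k)" if "b \<in> B k" for k b
      by (rule flin_closed[OF R b1 a1[OF that]])
    fix k b assume bB: "b \<in> B (Suc k)"
    have "flin R (B k) (D k) (flin R (B (Suc k)) (\<beta> (Suc k)) (\<alpha> (Suc k) b))
      = flin R (B k) (\<lambda>c. flin R (B k) (D k) (\<beta> (Suc k) c)) (\<alpha> (Suc k) b)"
      by (rule flin_assoc[OF R b1 P.D_closed a1[OF bB]])
    also have "\<dots> = flin R (B k) (\<lambda>c. flin R (B k) (\<beta> k) (D' k c)) (\<alpha> (Suc k) b)"
      by (rule flin_cong[OF R _ a1[OF bB] b2]) (use flin_closed[OF R P.D_closed b1] in auto)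
    also have "\<dots> = flin R (B k) (\<beta> k) (flin R (B' k) (D' k) (\<alpha> (Suc k) b))"
      by (rule flin_assoc[OF R Q.D_closed b1 a1[OF bB], symmetric])
    also have "\<dots> = flin R (B k) (\<beta> k) (flin R (B' k) (\<alpha> k) (D k b))"
      unfolding a2[OF bB] ..
    also have "\<dots> = flin R (B k) (\<lambda>b. flin R (B k) (\<beta> k) (\<alpha> k b)) (D k b)"
      by (rule flin_assoc[OF R a1 b1 P.D_closed[OF bB]])
    finally show "flin R (B k) (D k) (flin R (B (Suc k)) (\<beta> (Suc k)) (\<alpha> (Suc k) b))
      = flin R (B k) (\<lambda>b. flin R (B k) (\<beta> k) (\<alpha> k b)) (D k b)" .
  qed
  assume bB: "b \<in> B 0"
  have "linear_extension R N \<epsilon> (flin R (B 0) (\<beta> 0) (\<alpha> 0 b)) = linear_extension R N (\<lambda>c. linear_extension R N \<epsilon> (\<beta> 0 c)) (\<alpha> 0 b)"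
    by (rule lin_assoc[OF N b1 P.aug_closed a1[OF bB]])
  also have "\<dots> = linear_extension R N \<epsilon>' (\<alpha> 0 b)"
    by (rule lin_cong[OF N _ a1[OF bB]]) (use b(2) Q.aug_closed in auto)
  finally show "linear_extension R N \<epsilon> (flin R (B 0) (\<beta> 0) (\<alpha> 0 b)) = \<epsilon> b" using a(2)[OF bB] by simp
qed

text \<open>Built degree by degree with the invariant that on a cycle \<open>f\<close> the map
  \<open>\<gamma>\<close> gives \<open>f\<close> plus the boundary of \<open>h f\<close>; the
  summand \<open>h (d f)\<close> of the homotopy formula vanishes there. Compatibility of
  \<open>\<gamma>\<close> with the augmentation starts the construction in degree 0.\<close>

lemma ex_homotopy:
  assumes "resolution R N B D \<epsilon>" and \<gamma>: "chain_map R B D B D \<gamma>"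
    and \<gamma>0: "\<And>b. b \<in> B 0 \<Longrightarrow> linear_extension R N \<epsilon> (\<gamma> 0 b) = \<epsilon> b"
  shows "\<exists>h. homotopy_to_id R B D \<gamma> h"
proof -
  interpret P: resolution R N B D \<epsilon> by fact
  note R = P.R and N = P.N
  interpret F: abelian_group "free_module R (B k)" for k by (rule free_group[OF R])
  note g1 = chain_mapD(1)[OF \<gamma>] and g2 = chain_mapD(2)[OF \<gamma>]
  note u1 = unit_closed[OF R]
  let ?P = "\<lambda>k h. (\<forall>b\<in>B k. h b \<in> fsupp R (B (Suc k))) \<and>
    (\<forall>f\<in>P.Z k. flin R (B k) (\<gamma> k) f = f \<oplus>\<^bsub>free_module R (B k)\<^esub> flin R (B k) (\<lambda>b. flin R (B k) (D k) (h b)) f)"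
  let ?Q = "\<lambda>k h h'. \<forall>b\<in>B (Suc k). \<gamma> (Suc k) b = single R b \<one>\<^bsub>R\<^esub> \<oplus>\<^bsub>free_module R (B (Suc k))\<^esub>
        (flin R (B (Suc k)) (D (Suc k)) (h' b) \<oplus>\<^bsub>free_module R (B (Suc k))\<^esub> flin R (B (Suc k)) h (D k b))"
  have "\<exists>h. \<forall>k. ?P k (h k) \<and> ?Q k (h k) (h (Suc k))"
  proof (rule dependent_nat_choice[where P = ?P and Q = ?Q])
    let ?F = "free_module R (B 0)"
    have z: "\<gamma> 0 b \<ominus>\<^bsub>?F\<^esub> single R b \<one>\<^bsub>R\<^esub> \<in> P.Z 0" if b: "b \<in> B 0" for b
    proof -
      have c: "\<gamma> 0 b \<in> carrier ?F" "single R b \<one>\<^bsub>R\<^esub> \<in> carrier ?F" using g1[OF b] u1[OF b] by (simp_all add: carrier_free_module)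
      have "linear_extension R N \<epsilon> (\<gamma> 0 b \<ominus>\<^bsub>?F\<^esub> single R b \<one>\<^bsub>R\<^esub>) = \<epsilon> b \<ominus>\<^bsub>N\<^esub> \<epsilon> b"
        using ahom_minus[OF F.abelian_group_axioms P.M.abelian_group_axioms lin_ahom[OF N P.aug_closed] c]
          \<gamma>0[OF b] lin_unit_eval[OF N P.aug_closed b] by simp
      then show ?thesis using F.minus_closed[OF c] P.aug_closed[OF b] by (simp add: carrier_free_module a_minus_def P.M.r_neg)
    qed
    then have "\<forall>b\<in>B 0. \<exists>g. g \<in> fsupp R (B (Suc 0)) \<and> flin R (B 0) (D 0) g = \<gamma> 0 b \<ominus>\<^bsub>?F\<^esub> single R b \<one>\<^bsub>R\<^esub>"
      using P.exact by blast
    then obtain h where h1: "\<And>b. b \<in> B 0 \<Longrightarrow> h b \<in> fsupp R (B (Suc 0))"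
      and h2: "\<And>b. b \<in> B 0 \<Longrightarrow> flin R (B 0) (D 0) (h b) = \<gamma> 0 b \<ominus>\<^bsub>?F\<^esub> single R b \<one>\<^bsub>R\<^esub>"
      using bchoice[of "B 0" "\<lambda>b g. g \<in> fsupp R (B (Suc 0)) \<and> flin R (B 0) (D 0) g = \<gamma> 0 b \<ominus>\<^bsub>?F\<^esub> single R b \<one>\<^bsub>R\<^esub>"] by blast
    have eq: "\<gamma> 0 b = single R b \<one>\<^bsub>R\<^esub> \<oplus>\<^bsub>?F\<^esub> flin R (B 0) (D 0) (h b)" if b: "b \<in> B 0" for b
      unfolding h2[OF b]
      by (rule add_minus_cancel[OF F.abelian_group_axioms, symmetric]) (simp_all add: carrier_free_module g1[OF b] u1[OF b])
    have "flin R (B 0) (\<gamma> 0) f = f \<oplus>\<^bsub>?F\<^esub> flin R (B 0) (\<lambda>b. flin R (B 0) (D 0) (h b)) f" if f: "f \<in> fsupp R (B 0)" for f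
    proof -
      have "flin R (B 0) (\<gamma> 0) f = flin R (B 0) (\<lambda>b. single R b \<one>\<^bsub>R\<^esub> \<oplus>\<^bsub>?F\<^esub> flin R (B 0) (D 0) (h b)) f"
        by (rule flin_cong[OF R g1 f eq])
      also have "\<dots> = flin R (B 0) (\<lambda>b. single R b \<one>\<^bsub>R\<^esub>) f \<oplus>\<^bsub>?F\<^esub> flin R (B 0) (\<lambda>b. flin R (B 0) (D 0) (h b)) f"
        by (rule flin_add_fun[OF R u1 flin_closed[OF R P.D_closed h1] f])
      finally show ?thesis using lin_unit[OF R f] by simp
    qed
    then show "\<exists>h. ?P 0 h" using h1 by (intro exI[of _ h]) (auto simp del: based_cycles.simps dest: P.cycle_closed)
  next
    fix h k assume Ph: "?P k h"
    let ?F = "free_module R (B k)" and ?F' = "free_module R (B (Suc k))"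
    have h1: "\<And>b. b \<in> B k \<Longrightarrow> h b \<in> fsupp R (B (Suc k))" using Ph by blast
    have h2: "flin R (B k) (\<gamma> k) f = f \<oplus>\<^bsub>?F\<^esub> flin R (B k) (\<lambda>b. flin R (B k) (D k) (h b)) f" if "f \<in> P.Z k" for f
      using Ph that by blast
    \<comment> \<open>The differential of \<open>\<gamma> b\<close> is
      \<open>\<gamma> (D b)\<close>, which the invariant at the cycle \<open>D b\<close> rewrites as
      \<open>D b\<close> plus the boundary of \<open>h (D b)\<close>; these are the differentials of
      the two subtracted terms.\<close>
    have z: "\<gamma> (Suc k) b \<ominus>\<^bsub>?F'\<^esub> (single R b \<one>\<^bsub>R\<^esub> \<oplus>\<^bsub>?F'\<^esub> flin R (B (Suc k)) h (D k b)) \<in> P.Z (Suc k)" if b: "b \<in> B (Suc k)" for b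
    proof -
      have c: "\<gamma> (Suc k) b \<in> carrier ?F'" "single R b \<one>\<^bsub>R\<^esub> \<in> carrier ?F'" "flin R (B (Suc k)) h (D k b) \<in> carrier ?F'"
        using g1[OF b] u1[OF b] flin_closed[OF R h1 P.D_closed[OF b]] by (simp_all add: carrier_free_module)
      have dh: "flin R (B k) (D k) \<in> ahom (free_module R (B (Suc k))) (free_module R (B k))"
        by (rule flin_ahom[OF R P.D_closed])
      have 1: "flin R (B k) (D k) (\<gamma> (Suc k) b) = D k b \<oplus>\<^bsub>?F\<^esub> flin R (B k) (\<lambda>b. flin R (B k) (D k) (h b)) (D k b)"
        unfolding g2[OF b] by (rule h2[OF P.D_cycle[OF b]])
      have 2: "flin R (B k) (D k) (single R b \<one>\<^bsub>R\<^esub>) = D k b" by (rule flin_unit_eval[OF R P.D_closed b])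
      have 3: "flin R (B k) (D k) (flin R (B (Suc k)) h (D k b)) = flin R (B k) (\<lambda>b. flin R (B k) (D k) (h b)) (D k b)"
        by (rule flin_assoc[OF R h1 P.D_closed P.D_closed[OF b]])
      have cc: "D k b \<oplus>\<^bsub>?F\<^esub> flin R (B k) (\<lambda>b. flin R (B k) (D k) (h b)) (D k b) \<in> carrier ?F"
        using P.D_closed[OF b] flin_closed[OF R flin_closed[OF R P.D_closed h1] P.D_closed[OF b]] by (simp add: carrier_free_module[symmetric])
      have "flin R (B k) (D k) (\<gamma> (Suc k) b \<ominus>\<^bsub>?F'\<^esub> (single R b \<one>\<^bsub>R\<^esub> \<oplus>\<^bsub>?F'\<^esub> flin R (B (Suc k)) h (D k b))) = \<zero>\<^bsub>?F\<^esub>"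
        unfolding ahom_minus[OF F.abelian_group_axioms F.abelian_group_axioms dh c(1) F.a_closed[OF c(2,3)]]
          ahom_add[OF dh c(2,3)] 1 2 3
        unfolding a_minus_def by (rule F.r_neg[OF cc])
      then show ?thesis using F.minus_closed[OF c(1) F.a_closed[OF c(2,3)]] by (simp add: carrier_free_module)
    qed
    then have "\<forall>b\<in>B (Suc k). \<exists>g. g \<in> fsupp R (B (Suc (Suc k))) \<and> flin R (B (Suc k)) (D (Suc k)) g
        = \<gamma> (Suc k) b \<ominus>\<^bsub>?F'\<^esub> (single R b \<one>\<^bsub>R\<^esub> \<oplus>\<^bsub>?F'\<^esub> flin R (B (Suc k)) h (D k b))"
      using P.exact by blast
    then obtain h' where i1: "\<And>b. b \<in> B (Suc k) \<Longrightarrow> h' b \<in> fsupp R (B (Suc (Suc k)))"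
      and i2: "\<And>b. b \<in> B (Suc k) \<Longrightarrow> flin R (B (Suc k)) (D (Suc k)) (h' b) = \<gamma> (Suc k) b \<ominus>\<^bsub>?F'\<^esub> (single R b \<one>\<^bsub>R\<^esub> \<oplus>\<^bsub>?F'\<^esub> flin R (B (Suc k)) h (D k b))"
      using bchoice[of "B (Suc k)" "\<lambda>b g. g \<in> fsupp R (B (Suc (Suc k))) \<and> flin R (B (Suc k)) (D (Suc k)) g
        = \<gamma> (Suc k) b \<ominus>\<^bsub>?F'\<^esub> (single R b \<one>\<^bsub>R\<^esub> \<oplus>\<^bsub>?F'\<^esub> flin R (B (Suc k)) h (D k b))"] by blast
    have eq: "\<gamma> (Suc k) b = single R b \<one>\<^bsub>R\<^esub> \<oplus>\<^bsub>?F'\<^esub> (flin R (B (Suc k)) (D (Suc k)) (h' b) \<oplus>\<^bsub>?F'\<^esub> flin R (B (Suc k)) h (D k b))"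
      if b: "b \<in> B (Suc k)" for b
    proof -
      have c: "\<gamma> (Suc k) b \<in> carrier ?F'" "single R b \<one>\<^bsub>R\<^esub> \<in> carrier ?F'" "flin R (B (Suc k)) h (D k b) \<in> carrier ?F'"
        using g1[OF b] u1[OF b] flin_closed[OF R h1 P.D_closed[OF b]] by (simp_all add: carrier_free_module)
      show ?thesis unfolding i2[OF b] by (rule add_minus_cancel3[OF F.abelian_group_axioms c, symmetric])
    qed
    \<comment> \<open>The invariant for the next degree: expand \<open>\<gamma>\<close> by the
      homotopy formula; the term \<open>h (d f)\<close> drops out because \<open>f\<close> is a
      cycle.\<close>
    have "flin R (B (Suc k)) (\<gamma> (Suc k)) f = f \<oplus>\<^bsub>?F'\<^esub> flin R (B (Suc k)) (\<lambda>b. flin R (B (Suc k)) (D (Suc k)) (h' b)) f"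
      if fZ: "f \<in> P.Z (Suc k)" for f
    proof -
      have f: "f \<in> fsupp R (B (Suc k))" "flin R (B k) (D k) f = \<zero>\<^bsub>?F\<^esub>" using fZ by auto
      note c1 = flin_closed[OF R P.D_closed i1] and c2 = flin_closed[OF R h1 P.D_closed]
      have c3: "flin R (B (Suc k)) (D (Suc k)) (h' b) \<oplus>\<^bsub>?F'\<^esub> flin R (B (Suc k)) h (D k b) \<in> fsupp R (B (Suc k))" if "b \<in> B (Suc k)" for b
        using F.a_closed[of "flin R (B (Suc k)) (D (Suc k)) (h' b)" "Suc k" "flin R (B (Suc k)) h (D k b)"] c1[OF _ that] c2[OF _ that] by (simp add: carrier_free_module)
      have "flin R (B (Suc k)) (\<gamma> (Suc k)) f = flin R (B (Suc k)) (\<lambda>b. single R b \<one>\<^bsub>R\<^esub> \<oplus>\<^bsub>?F'\<^esub> (flin R (B (Suc k)) (D (Suc k)) (h' b) \<oplus>\<^bsub>?F'\<^esub> flin R (B (Suc k)) h (D k b))) f"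
        by (rule flin_cong[OF R g1 f(1) eq])
      also have "\<dots> = flin R (B (Suc k)) (\<lambda>b. single R b \<one>\<^bsub>R\<^esub>) f \<oplus>\<^bsub>?F'\<^esub> flin R (B (Suc k)) (\<lambda>b. flin R (B (Suc k)) (D (Suc k)) (h' b) \<oplus>\<^bsub>?F'\<^esub> flin R (B (Suc k)) h (D k b)) f"
        by (rule flin_add_fun[OF R u1 c3 f(1)])
      also have "flin R (B (Suc k)) (\<lambda>b. flin R (B (Suc k)) (D (Suc k)) (h' b) \<oplus>\<^bsub>?F'\<^esub> flin R (B (Suc k)) h (D k b)) f
        = flin R (B (Suc k)) (\<lambda>b. flin R (B (Suc k)) (D (Suc k)) (h' b)) f \<oplus>\<^bsub>?F'\<^esub> flin R (B (Suc k)) (\<lambda>b. flin R (B (Suc k)) h (D k b)) f"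
        by (rule flin_add_fun[OF R c1 c2 f(1)])
      also have "flin R (B (Suc k)) (\<lambda>b. flin R (B (Suc k)) h (D k b)) f = flin R (B (Suc k)) h (flin R (B k) (D k) f)"
        by (rule flin_assoc[OF R P.D_closed h1 f(1), symmetric])
      also have "\<dots> = \<zero>\<^bsub>?F'\<^esub>" unfolding f(2) by (rule flin_zero[OF R h1])
      finally show ?thesis using lin_unit[OF R f(1)] flin_closed[OF R c1 f(1)] by (simp add: carrier_free_module)
    qed
    then show "\<exists>h'. ?P (Suc k) h' \<and> ?Q k h h'" using i1 eq by (intro exI[of _ h']) blast
  qed
  then obtain h where "\<And>k. ?P k (h k) \<and> ?Q k (h k) (h (Suc k))" by metis
  then have "homotopy_to_id R B D \<gamma> h" unfolding homotopy_to_id_def by simp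
  then show ?thesis by blast
qed

lemma ex_homotopy_equivalence:
  assumes P: "resolution R N B D \<epsilon>" and Q: "resolution R N B' D' \<epsilon>'"
  shows "\<exists>\<alpha> \<beta> h h'. chain_map R B D B' D' \<alpha> \<and> chain_map R B' D' B D \<beta> \<and>
    homotopy_to_id R B D (\<lambda>k b. flin R (B k) (\<beta> k) (\<alpha> k b)) h \<and>
    homotopy_to_id R B' D' (\<lambda>k b. flin R (B' k) (\<alpha> k) (\<beta> k b)) h'"
proof -
  obtain \<alpha> where a: "chain_map R B D B' D' \<alpha>" "\<And>b. b \<in> B 0 \<Longrightarrow> linear_extension R N \<epsilon>' (\<alpha> 0 b) = \<epsilon> b"
    using ex_chain_map[OF P Q] by blast
  obtain \<beta> where b: "chain_map R B' D' B D \<beta>" "\<And>b. b \<in> B' 0 \<Longrightarrow> linear_extension R N \<epsilon> (\<beta> 0 b) = \<epsilon>' b"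
    using ex_chain_map[OF Q P] by blast
  show ?thesis
    using a(1) b(1) ex_homotopy[OF P chain_map_compose[OF P Q a b]] ex_homotopy[OF Q chain_map_compose[OF Q P b a]]
    by blast
qed

section \<open>Ext and Tor from an arbitrary based resolution\<close>

text \<open>Surjectivity of \<open>u0\<close> makes boundaries come from boundaries, and injectivity
  of \<open>u2\<close> makes \<open>u1\<close> reflect cycles.\<close>

lemma complex_iso:
  assumes G: "complex3 G0 d0 G1 d1 G2" and H: "complex3 H0 e0 H1 e1 H2"
    and u0: "\<And>x. x \<in> carrier G0 \<Longrightarrow> u0 x \<in> carrier H0" "\<And>y. y \<in> carrier H0 \<Longrightarrow> \<exists>x\<in>carrier G0. u0 x = y"
    and u1: "u1 \<in> ahom G1 H1" "\<And>y. y \<in> carrier H1 \<Longrightarrow> \<exists>x\<in>carrier G1. u1 x = y"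
      "\<And>x y. x \<in> carrier G1 \<Longrightarrow> y \<in> carrier G1 \<Longrightarrow> u1 x = u1 y \<Longrightarrow> x = y"
    and u2: "u2 \<in> ahom G2 H2" "\<And>x y. x \<in> carrier G2 \<Longrightarrow> y \<in> carrier G2 \<Longrightarrow> u2 x = u2 y \<Longrightarrow> x = y"
    and c0: "\<And>x. x \<in> carrier G0 \<Longrightarrow> u1 (d0 x) = e0 (u0 x)"
    and c1: "\<And>x. x \<in> carrier G1 \<Longrightarrow> u2 (d1 x) = e1 (u1 x)"
  shows "homology G0 d0 G1 d1 G2 \<cong> homology H0 e0 H1 e1 H2"
  unfolding homology_def
proof (rule subquotient_iso[where u = u1])
  interpret G0: abelian_group G0 using G by (simp add: complex3_def)
  interpret G1: abelian_group G1 using G by (simp add: complex3_def)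
  interpret G2: abelian_group G2 using G by (simp add: complex3_def)
  interpret H1: abelian_group H1 using H by (simp add: complex3_def)
  interpret H2: abelian_group H2 using H by (simp add: complex3_def)
  have d: "d0 \<in> ahom G0 G1" "d1 \<in> ahom G1 G2" using G by (auto simp: complex3_def)
  note u2z = ahom_zero[OF G2.abelian_group_axioms H2.abelian_group_axioms u2(1)]
  have zz: "e1 (u1 z) = \<zero>\<^bsub>H2\<^esub> \<longleftrightarrow> d1 z = \<zero>\<^bsub>G2\<^esub>" if "z \<in> carrier G1" for z
  proof
    assume "e1 (u1 z) = \<zero>\<^bsub>H2\<^esub>"
    then have "u2 (d1 z) = u2 \<zero>\<^bsub>G2\<^esub>" unfolding c1[OF that] u2z .
    then show "d1 z = \<zero>\<^bsub>G2\<^esub>" by (rule u2(2)[OF ahom_closed[OF d(2) that] G2.zero_closed])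
  next
    assume "d1 z = \<zero>\<^bsub>G2\<^esub>"
    then show "e1 (u1 z) = \<zero>\<^bsub>H2\<^esub>" using c1[OF that] u2z by simp
  qed
  show "u1 z \<in> {x \<in> carrier H1. e1 x = \<zero>\<^bsub>H2\<^esub>}" if "z \<in> {x \<in> carrier G1. d1 x = \<zero>\<^bsub>G2\<^esub>}" for z
    using that zz ahom_closed[OF u1(1)] by auto
  show "u1 (x \<oplus>\<^bsub>G1\<^esub> y) = u1 x \<oplus>\<^bsub>H1\<^esub> u1 y"
    if "x \<in> {x \<in> carrier G1. d1 x = \<zero>\<^bsub>G2\<^esub>}" "y \<in> {x \<in> carrier G1. d1 x = \<zero>\<^bsub>G2\<^esub>}" for x y
    using that by (simp add: ahom_add[OF u1(1)])
  show "u1 z \<in> e0 ` carrier H0 \<longleftrightarrow> z \<in> d0 ` carrier G0" if "z \<in> {x \<in> carrier G1. d1 x = \<zero>\<^bsub>G2\<^esub>}" for z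
  proof
    assume "u1 z \<in> e0 ` carrier H0"
    then obtain y where y: "y \<in> carrier H0" "u1 z = e0 y" by auto
    then obtain x where x: "x \<in> carrier G0" "u0 x = y" using u0(2) by blast
    have "u1 (d0 x) = u1 z" using c0[OF x(1)] x(2) y(2) by simp
    then have "d0 x = z" using u1(3)[of "d0 x" z] ahom_closed[OF d(1) x(1)] that by simp
    then show "z \<in> d0 ` carrier G0" using x(1) by auto
  qed (use c0 u0(1) in auto)
  show "\<exists>z\<in>{x \<in> carrier G1. d1 x = \<zero>\<^bsub>G2\<^esub>}. \<exists>b\<in>e0 ` carrier H0. z' = b \<oplus>\<^bsub>H1\<^esub> u1 z"
    if z': "z' \<in> {x \<in> carrier H1. e1 x = \<zero>\<^bsub>H2\<^esub>}" for z'
  proof -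
    obtain z where z: "z \<in> carrier G1" "u1 z = z'" using u1(2) z' by blast
    then have "z \<in> {x \<in> carrier G1. d1 x = \<zero>\<^bsub>G2\<^esub>}" using zz z' by auto
    moreover have "z' = \<zero>\<^bsub>H1\<^esub> \<oplus>\<^bsub>H1\<^esub> u1 z" using z z' by simp
    ultimately show ?thesis using asubD(2)[OF complex3_asub(2)[OF H]] by blast
  qed
qed (use G H complex3_asub[OF G] complex3_asub[OF H] in \<open>auto simp: complex3_def\<close>)

text \<open>Linear maps from the free module on \<open>B\<close> to \<open>Y\<close>, recorded by
  their values on the basis. Extensional functions make the record unique.\<close>

definition bcoch :: "('y, 'p) ring_scheme \<Rightarrow> 'b set \<Rightarrow> ('b \<Rightarrow> 'y) ring" where
  "bcoch Y B = \<lparr>carrier = B \<rightarrow>\<^sub>E carrier Y, monoid.mult = undefined, one = undefined,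
     ring.zero = (\<lambda>b\<in>B. \<zero>\<^bsub>Y\<^esub>), ring.add = (\<lambda>f g. \<lambda>b\<in>B. f b \<oplus>\<^bsub>Y\<^esub> g b)\<rparr>"

text \<open>Composition with the linear map \<open>b \<mapsto> \<alpha> b\<close> between free
  modules, in terms of values on bases.\<close>

definition pull ::
    "('r, 'z) ring_scheme \<Rightarrow> ('r, 'y, 'v) module_scheme \<Rightarrow> 'b set \<Rightarrow> ('b \<Rightarrow> 'c \<Rightarrow> 'r) \<Rightarrow> ('c \<Rightarrow> 'y) \<Rightarrow> 'b \<Rightarrow> 'y" where
  "pull R Y B \<alpha> f = (\<lambda>b\<in>B. linear_extension R Y f (\<alpha> b))"

text \<open>The middle term sits in degree \<open>k + 1\<close>, so \<open>k\<close> counts from the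
  first positive degree. The same holds for \<open>bTor\<close>, whose complex runs the other
  way.\<close>

definition bExt ::
    "('r, 'z) ring_scheme \<Rightarrow> ('r, 'y, 'v) module_scheme \<Rightarrow> (nat \<Rightarrow> 'b set) \<Rightarrow> (nat \<Rightarrow> 'b \<Rightarrow> 'b \<Rightarrow> 'r) \<Rightarrow> nat
      \<Rightarrow> ('b \<Rightarrow> 'y) set monoid" where
  "bExt R Y B D k = homology (bcoch Y (B k)) (pull R Y (B (Suc k)) (D k)) (bcoch Y (B (Suc k)))
     (pull R Y (B (Suc (Suc k))) (D (Suc k))) (bcoch Y (B (Suc (Suc k))))"

definition bTor ::
    "('l, 'a, 'r, 'w) bimodule_scheme \<Rightarrow> (nat \<Rightarrow> 'b set) \<Rightarrow> (nat \<Rightarrow> 'b \<Rightarrow> 'b \<Rightarrow> 'r) \<Rightarrow> nat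
      \<Rightarrow> ('b \<Rightarrow> 'a) set monoid" where
  "bTor A B D k = homology (fs_group A (B (Suc (Suc k)))) (rext A (B (Suc k)) (D (Suc k))) (fs_group A (B (Suc k)))
     (rext A (B k) (D k)) (fs_group A (B k))"

lemma bcoch_simps:
  "carrier (bcoch Y B) = (B \<rightarrow>\<^sub>E carrier Y)" "\<zero>\<^bsub>bcoch Y B\<^esub> = (\<lambda>b\<in>B. \<zero>\<^bsub>Y\<^esub>)"
  "f \<oplus>\<^bsub>bcoch Y B\<^esub> g = (\<lambda>b\<in>B. f b \<oplus>\<^bsub>Y\<^esub> g b)"
  by (simp_all add: bcoch_def)

lemma bcoch_mem: "f \<in> carrier (bcoch Y B) \<Longrightarrow> b \<in> B \<Longrightarrow> f b \<in> carrier Y"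
  by (auto simp: bcoch_simps)

lemma bcoch_eqI: "f \<in> carrier (bcoch Y B) \<Longrightarrow> g \<in> carrier (bcoch Y B) \<Longrightarrow> (\<And>b. b \<in> B \<Longrightarrow> f b = g b) \<Longrightarrow> f = g"
  unfolding bcoch_simps by (rule PiE_ext)

lemma bcoch_group:
  assumes "abelian_group Y"
  shows "abelian_group (bcoch Y B)"
proof (rule abelian_groupI)
  interpret Y: abelian_group Y by fact
  fix f assume "f \<in> carrier (bcoch Y B)"
  then have f: "f \<in> B \<rightarrow>\<^sub>E carrier Y" by (simp add: bcoch_simps)
  show "\<exists>g\<in>carrier (bcoch Y B). g \<oplus>\<^bsub>bcoch Y B\<^esub> f = \<zero>\<^bsub>bcoch Y B\<^esub>"
    using f by (intro bexI[of _ "\<lambda>b\<in>B. \<ominus>\<^bsub>Y\<^esub> f b"]) (auto simp: bcoch_simps Y.l_neg[OF PiE_mem[OF f]] intro!: restrict_ext)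
  note fc = PiE_mem[OF f]
  show "\<zero>\<^bsub>bcoch Y B\<^esub> \<oplus>\<^bsub>bcoch Y B\<^esub> f = f"
    using f fc by (auto simp: bcoch_simps fun_eq_iff PiE_def extensional_def)
  fix g assume "g \<in> carrier (bcoch Y B)"
  then have g: "g \<in> B \<rightarrow>\<^sub>E carrier Y" by (simp add: bcoch_simps)
  show "f \<oplus>\<^bsub>bcoch Y B\<^esub> g \<in> carrier (bcoch Y B)" using f g by (auto simp: bcoch_simps)
  show "f \<oplus>\<^bsub>bcoch Y B\<^esub> g = g \<oplus>\<^bsub>bcoch Y B\<^esub> f"
    using f g by (auto simp: bcoch_simps fun_eq_iff PiE_def Pi_def intro: Y.a_comm)
  fix h assume "h \<in> carrier (bcoch Y B)"
  then have h: "h \<in> B \<rightarrow>\<^sub>E carrier Y" by (simp add: bcoch_simps)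
  show "f \<oplus>\<^bsub>bcoch Y B\<^esub> g \<oplus>\<^bsub>bcoch Y B\<^esub> h = f \<oplus>\<^bsub>bcoch Y B\<^esub> (g \<oplus>\<^bsub>bcoch Y B\<^esub> h)"
    using f g h by (auto simp: bcoch_simps fun_eq_iff PiE_def Pi_def intro: Y.a_assoc)
next
  interpret Y: abelian_group Y by fact
  show "\<zero>\<^bsub>bcoch Y B\<^esub> \<in> carrier (bcoch Y B)" by (auto simp: bcoch_simps)
qed

lemma pull_closed:
  assumes Y: "left_module R Y" and \<alpha>: "\<And>b. b \<in> B \<Longrightarrow> \<alpha> b \<in> fsupp R B'" and f: "f \<in> carrier (bcoch Y B')"
  shows "pull R Y B \<alpha> f \<in> carrier (bcoch Y B)"
  unfolding pull_def bcoch_simps by (rule restrict_PiE_iff[THEN iffD2]) (auto intro!: lin_closed[OF Y bcoch_mem[OF f]] \<alpha>)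

lemma pull_ahom:
  assumes Y: "left_module R Y" and \<alpha>: "\<And>b. b \<in> B \<Longrightarrow> \<alpha> b \<in> fsupp R B'"
  shows "pull R Y B \<alpha> \<in> ahom (bcoch Y B') (bcoch Y B)"
proof (rule ahomI)
  interpret C: abelian_group "bcoch Y B'" by (rule bcoch_group[OF left_moduleD(2)[OF Y]])
  fix f assume f: "f \<in> carrier (bcoch Y B')"
  show "pull R Y B \<alpha> f \<in> carrier (bcoch Y B)" by (rule pull_closed[OF Y \<alpha> f])
  fix g assume g: "g \<in> carrier (bcoch Y B')"
  have "linear_extension R Y (f \<oplus>\<^bsub>bcoch Y B'\<^esub> g) (\<alpha> b) = linear_extension R Y f (\<alpha> b) \<oplus>\<^bsub>Y\<^esub> linear_extension R Y g (\<alpha> b)"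
    if b: "b \<in> B" for b
  proof -
    have "linear_extension R Y (f \<oplus>\<^bsub>bcoch Y B'\<^esub> g) (\<alpha> b) = linear_extension R Y (\<lambda>b. f b \<oplus>\<^bsub>Y\<^esub> g b) (\<alpha> b)"
      by (rule lin_cong[OF Y bcoch_mem[OF C.a_closed[OF f g]] \<alpha>[OF b]]) (simp_all add: bcoch_simps)
    also have "\<dots> = linear_extension R Y f (\<alpha> b) \<oplus>\<^bsub>Y\<^esub> linear_extension R Y g (\<alpha> b)"
      by (rule lin_add_fun[OF Y bcoch_mem[OF f] bcoch_mem[OF g] \<alpha>[OF b]])
    finally show ?thesis .
  qed
  then show "pull R Y B \<alpha> (f \<oplus>\<^bsub>bcoch Y B'\<^esub> g) = pull R Y B \<alpha> f \<oplus>\<^bsub>bcoch Y B\<^esub> pull R Y B \<alpha> g"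
    by (auto simp: pull_def bcoch_simps(3)[of Y B] fun_eq_iff)
qed

lemma pull_pull:
  assumes Y: "left_module R Y" and \<alpha>: "\<And>b. b \<in> B \<Longrightarrow> \<alpha> b \<in> fsupp R B'" and \<beta>: "\<And>b. b \<in> B' \<Longrightarrow> \<beta> b \<in> fsupp R B''"
    and f: "f \<in> carrier (bcoch Y B'')"
  shows "pull R Y B \<alpha> (pull R Y B' \<beta> f) = pull R Y B (\<lambda>b. flin R B'' \<beta> (\<alpha> b)) f"
proof -
  have "linear_extension R Y (\<lambda>c\<in>B'. linear_extension R Y f (\<beta> c)) (\<alpha> b) = linear_extension R Y f (flin R B'' \<beta> (\<alpha> b))"
    if b: "b \<in> B" for b
  proof -
    have "linear_extension R Y (\<lambda>c\<in>B'. linear_extension R Y f (\<beta> c)) (\<alpha> b) = linear_extension R Y (\<lambda>c. linear_extension R Y f (\<beta> c)) (\<alpha> b)"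
      by (rule lin_cong[OF Y _ \<alpha>[OF b]]) (auto intro: lin_closed[OF Y bcoch_mem[OF f] \<beta>])
    then show ?thesis using lin_assoc[OF Y \<beta> bcoch_mem[OF f] \<alpha>[OF b]] by simp
  qed
  then show ?thesis by (auto simp: pull_def fun_eq_iff)
qed

lemma pull_cong: "(\<And>b. b \<in> B \<Longrightarrow> \<alpha> b = \<beta> b) \<Longrightarrow> pull R Y B \<alpha> f = pull R Y B \<beta> f"
  unfolding pull_def by (rule restrict_ext) simp

lemma pull_add:
  assumes Y: "left_module R Y" and \<alpha>: "\<And>b. b \<in> B \<Longrightarrow> \<alpha> b \<in> fsupp R B'" and \<beta>: "\<And>b. b \<in> B \<Longrightarrow> \<beta> b \<in> fsupp R B'"
    and f: "f \<in> carrier (bcoch Y B')"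
  shows "pull R Y B (\<lambda>b. \<alpha> b \<oplus>\<^bsub>free_module R B'\<^esub> \<beta> b) f = pull R Y B \<alpha> f \<oplus>\<^bsub>bcoch Y B\<^esub> pull R Y B \<beta> f"
proof -
  have "linear_extension R Y f (\<alpha> b \<oplus>\<^bsub>free_module R B'\<^esub> \<beta> b) = linear_extension R Y f (\<alpha> b) \<oplus>\<^bsub>Y\<^esub> linear_extension R Y f (\<beta> b)"
    if "b \<in> B" for b
    by (rule ahom_add[OF lin_ahom[OF Y bcoch_mem[OF f]]]) (use \<alpha> \<beta> that in \<open>simp_all add: carrier_free_module\<close>)
  then show ?thesis by (auto simp: pull_def bcoch_simps fun_eq_iff)
qed

lemma pull_unit:
  assumes Y: "left_module R Y" and f: "f \<in> carrier (bcoch Y B)"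
  shows "pull R Y B (\<lambda>b. single R b \<one>\<^bsub>R\<^esub>) f = f"
  by (rule bcoch_eqI[OF pull_closed[OF Y unit_closed[OF left_moduleD(1)[OF Y]] f] f])
    (auto simp: pull_def intro!: lin_unit_eval[OF Y bcoch_mem[OF f]])

lemma pull_zero:
  assumes Y: "left_module R Y" and f: "f \<in> carrier (bcoch Y B')" and "\<And>b. b \<in> B \<Longrightarrow> \<alpha> b = \<zero>\<^bsub>free_module R B'\<^esub>"
  shows "pull R Y B \<alpha> f = \<zero>\<^bsub>bcoch Y B\<^esub>"
proof -
  have "linear_extension R Y f \<zero>\<^bsub>free_module R B'\<^esub> = \<zero>\<^bsub>Y\<^esub>" by (rule lin_zero[OF Y bcoch_mem[OF f]])
  then show ?thesis unfolding pull_def bcoch_simps by (intro restrict_ext) (simp add: assms(3))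
qed

lemma rext_cong:
  assumes A: "right_module R A" and "\<phi> \<in> fsupp A B" and "\<And>b. b \<in> B \<Longrightarrow> \<alpha> b \<in> fsupp R B'" "\<And>b. b \<in> B \<Longrightarrow> \<alpha> b = \<beta> b"
  shows "rext A B' \<alpha> \<phi> = rext A B' \<beta> \<phi>"
  unfolding rext_def
  by (rule fext_cong[OF right_moduleD(2)[OF A] fs_group_group[OF right_moduleD(2)[OF A]] _ assms(2)],
      rule biadd_rsmult[OF A]) (use assms in auto)

context resolution
begin

lemma DD: "b \<in> B (Suc (Suc k)) \<Longrightarrow> flin R (B k) (D k) (D (Suc k) b) = \<zero>\<^bsub>free_module R (B k)\<^esub>"
  using D_cycle[of b "Suc k"] by simp

lemma bExt_complex:
  assumes Y: "left_module R Y"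
  shows "complex3 (bcoch Y (B k)) (pull R Y (B (Suc k)) (D k)) (bcoch Y (B (Suc k)))
     (pull R Y (B (Suc (Suc k))) (D (Suc k))) (bcoch Y (B (Suc (Suc k))))"
  unfolding complex3_def
proof (intro conjI ballI)
  show "pull R Y (B (Suc (Suc k))) (D (Suc k)) (pull R Y (B (Suc k)) (D k) f) = \<zero>\<^bsub>bcoch Y (B (Suc (Suc k)))\<^esub>"
    if f: "f \<in> carrier (bcoch Y (B k))" for f
    by (rule trans[OF pull_pull[OF Y D_closed D_closed f] pull_zero[OF Y f DD]])
qed (auto intro!: bcoch_group left_moduleD(2)[OF Y] pull_ahom[OF Y D_closed])

lemma bTor_complex:
  assumes A: "right_module R A"
  shows "complex3 (fs_group A (B (Suc (Suc k)))) (rext A (B (Suc k)) (D (Suc k))) (fs_group A (B (Suc k)))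
     (rext A (B k) (D k)) (fs_group A (B k))"
  unfolding complex3_def
proof (intro conjI ballI)
  show "rext A (B k) (D k) (rext A (B (Suc k)) (D (Suc k)) f) = \<zero>\<^bsub>fs_group A (B k)\<^esub>"
    if "f \<in> carrier (fs_group A (B (Suc (Suc k))))" for f
  proof -
    have f: "f \<in> fsupp A (B (Suc (Suc k)))" using that by (simp add: carrier_fs_group)
    show ?thesis by (rule trans[OF rext_assoc[OF A D_closed D_closed f] rext_zero_fun[OF A f DD]])
  qed
qed (auto intro!: fs_group_group right_moduleD(2)[OF A] rext_ahom[OF A D_closed])

end

section \<open>Independence of Ext and Tor from the based resolution\<close>

lemma pull_chain_map:
  assumes "resolution R N B D \<epsilon>" "resolution R N B' D' \<epsilon>'" and \<alpha>: "chain_map R B D B' D' \<alpha>"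
    and Y: "left_module R Y" and f: "f \<in> carrier (bcoch Y (B' k))"
  shows "pull R Y (B (Suc k)) (\<alpha> (Suc k)) (pull R Y (B' (Suc k)) (D' k) f) = pull R Y (B (Suc k)) (D k) (pull R Y (B k) (\<alpha> k) f)"
proof -
  interpret P: resolution R N B D \<epsilon> by fact
  interpret Q: resolution R N B' D' \<epsilon>' by fact
  note a1 = chain_mapD(1)[OF \<alpha>] and a2 = chain_mapD(2)[OF \<alpha>]
  show ?thesis
    by (rule trans[OF trans[OF pull_pull[OF Y a1 Q.D_closed f] pull_cong[OF a2]] pull_pull[OF Y P.D_closed a1 f, symmetric]])
qed

text \<open>Applied to a cocycle \<open>f\<close>, the homotopy formula leaves \<open>f\<close>, a
  term that factors through the coboundary of \<open>f\<close> and is zero, and the coboundary of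
  \<open>f\<close> composed with \<open>h k\<close>.\<close>

lemma pull_homotopy:
  assumes "resolution R N B D \<epsilon>" "resolution R N B' D' \<epsilon>'"
    and \<alpha>: "chain_map R B D B' D' \<alpha>" and \<beta>: "chain_map R B' D' B D \<beta>"
    and h: "homotopy_to_id R B D (\<lambda>k b. flin R (B k) (\<beta> k) (\<alpha> k b)) h"
    and Y: "left_module R Y" and f: "f \<in> carrier (bcoch Y (B (Suc k)))"
    and cyc: "pull R Y (B (Suc (Suc k))) (D (Suc k)) f = \<zero>\<^bsub>bcoch Y (B (Suc (Suc k)))\<^esub>"
  shows "\<exists>y\<in>carrier (bcoch Y (B k)). pull R Y (B (Suc k)) (\<alpha> (Suc k)) (pull R Y (B' (Suc k)) (\<beta> (Suc k)) f)
    = pull R Y (B (Suc k)) (D k) y \<oplus>\<^bsub>bcoch Y (B (Suc k))\<^esub> f"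
proof -
  interpret P: resolution R N B D \<epsilon> by fact
  note R = P.R
  let ?B = "B (Suc k)" and ?F = "free_module R (B (Suc k))" and ?C = "bcoch Y (B (Suc k))"
  interpret F: abelian_group ?F by (rule free_group[OF R])
  interpret C: abelian_group ?C by (rule bcoch_group[OF left_moduleD(2)[OF Y]])
  note a1 = chain_mapD(1)[OF \<alpha>] and b1 = chain_mapD(1)[OF \<beta>]
  have h1: "\<And>b k. b \<in> B k \<Longrightarrow> h k b \<in> fsupp R (B (Suc k))"
    and h2: "\<And>b. b \<in> ?B \<Longrightarrow> flin R ?B (\<beta> (Suc k)) (\<alpha> (Suc k) b) = single R b \<one>\<^bsub>R\<^esub> \<oplus>\<^bsub>?F\<^esub>
      (flin R ?B (D (Suc k)) (h (Suc k) b) \<oplus>\<^bsub>?F\<^esub> flin R ?B (h k) (D k b))"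
    using h by (auto simp: homotopy_to_id_def)
  have c1: "flin R ?B (D (Suc k)) (h (Suc k) b) \<in> fsupp R ?B" if "b \<in> ?B" for b
    by (rule flin_closed[OF R P.D_closed h1[OF that]])
  have c2: "flin R ?B (h k) (D k b) \<in> fsupp R ?B" if "b \<in> ?B" for b
    by (rule flin_closed[OF R h1 P.D_closed[OF that]])
  have c3: "flin R ?B (D (Suc k)) (h (Suc k) b) \<oplus>\<^bsub>?F\<^esub> flin R ?B (h k) (D k b) \<in> fsupp R ?B" if "b \<in> ?B" for b
    using F.a_closed[of "flin R ?B (D (Suc k)) (h (Suc k) b)" "flin R ?B (h k) (D k b)"] c1[OF that] c2[OF that]
    by (simp add: carrier_free_module)
  have "pull R Y ?B (\<alpha> (Suc k)) (pull R Y (B' (Suc k)) (\<beta> (Suc k)) f)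
    = pull R Y ?B (\<lambda>b. flin R ?B (\<beta> (Suc k)) (\<alpha> (Suc k) b)) f"
    by (rule pull_pull[OF Y a1 b1 f])
  also have "\<dots> = pull R Y ?B (\<lambda>b. single R b \<one>\<^bsub>R\<^esub> \<oplus>\<^bsub>?F\<^esub>
      (flin R ?B (D (Suc k)) (h (Suc k) b) \<oplus>\<^bsub>?F\<^esub> flin R ?B (h k) (D k b))) f"
    by (rule pull_cong[OF h2])
  also have "\<dots> = pull R Y ?B (\<lambda>b. single R b \<one>\<^bsub>R\<^esub>) f \<oplus>\<^bsub>?C\<^esub>
      pull R Y ?B (\<lambda>b. flin R ?B (D (Suc k)) (h (Suc k) b) \<oplus>\<^bsub>?F\<^esub> flin R ?B (h k) (D k b)) f"
    by (rule pull_add[OF Y unit_closed[OF R] c3 f])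
  also have "pull R Y ?B (\<lambda>b. flin R ?B (D (Suc k)) (h (Suc k) b) \<oplus>\<^bsub>?F\<^esub> flin R ?B (h k) (D k b)) f
    = pull R Y ?B (\<lambda>b. flin R ?B (D (Suc k)) (h (Suc k) b)) f \<oplus>\<^bsub>?C\<^esub> pull R Y ?B (\<lambda>b. flin R ?B (h k) (D k b)) f"
    by (rule pull_add[OF Y c1 c2 f])
  also have "pull R Y ?B (\<lambda>b. flin R ?B (D (Suc k)) (h (Suc k) b)) f
    = pull R Y ?B (h (Suc k)) (pull R Y (B (Suc (Suc k))) (D (Suc k)) f)"
    by (rule pull_pull[OF Y h1 P.D_closed f, symmetric])
  also have "\<dots> = \<zero>\<^bsub>?C\<^esub>" unfolding cyc
    by (rule ahom_zero[OF bcoch_group[OF left_moduleD(2)[OF Y]] C.abelian_group_axioms pull_ahom[OF Y h1]])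
  also have "pull R Y ?B (\<lambda>b. flin R ?B (h k) (D k b)) f = pull R Y ?B (D k) (pull R Y (B k) (h k) f)"
    by (rule pull_pull[OF Y P.D_closed h1 f, symmetric])
  also have "pull R Y ?B (\<lambda>b. single R b \<one>\<^bsub>R\<^esub>) f = f" by (rule pull_unit[OF Y f])
  finally have eq: "pull R Y ?B (\<alpha> (Suc k)) (pull R Y (B' (Suc k)) (\<beta> (Suc k)) f)
    = f \<oplus>\<^bsub>?C\<^esub> (\<zero>\<^bsub>?C\<^esub> \<oplus>\<^bsub>?C\<^esub> pull R Y ?B (D k) (pull R Y (B k) (h k) f))" .
  have y: "pull R Y (B k) (h k) f \<in> carrier (bcoch Y (B k))" by (rule pull_closed[OF Y h1 f])
  have "pull R Y ?B (D k) (pull R Y (B k) (h k) f) \<in> carrier ?C" by (rule pull_closed[OF Y P.D_closed y])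
  then show ?thesis using y f unfolding eq by (intro bexI[of _ "pull R Y (B k) (h k) f"]) (simp_all add: C.a_comm)
qed

text \<open>Cochains are contravariant: the comparison map \<open>\<beta>\<close> from the second
  resolution to the first induces the map from the first cochain complex to the second.\<close>

theorem bExt_unique:
  assumes P: "resolution R N B D \<epsilon>" and Q: "resolution R N B' D' \<epsilon>'" and Y: "left_module R Y"
  shows "bExt R Y B D k \<cong> bExt R Y B' D' k"
proof -
  interpret P: resolution R N B D \<epsilon> by fact
  interpret Q: resolution R N B' D' \<epsilon>' by fact
  obtain \<alpha> \<beta> h h' where \<alpha>: "chain_map R B D B' D' \<alpha>" and \<beta>: "chain_map R B' D' B D \<beta>"
    and h: "homotopy_to_id R B D (\<lambda>k b. flin R (B k) (\<beta> k) (\<alpha> k b)) h"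
    and h': "homotopy_to_id R B' D' (\<lambda>k b. flin R (B' k) (\<alpha> k) (\<beta> k b)) h'"
    using ex_homotopy_equivalence[OF P Q] by blast
  note a1 = chain_mapD(1)[OF \<alpha>] and b1 = chain_mapD(1)[OF \<beta>]
  note grp = bcoch_group[OF left_moduleD(2)[OF Y]]
  have za: "pull R Y (B k) (\<alpha> k) \<zero>\<^bsub>bcoch Y (B' k)\<^esub> = \<zero>\<^bsub>bcoch Y (B k)\<^esub>" for k
    by (rule ahom_zero[OF grp grp pull_ahom[OF Y a1]])
  have zb: "pull R Y (B' k) (\<beta> k) \<zero>\<^bsub>bcoch Y (B k)\<^esub> = \<zero>\<^bsub>bcoch Y (B' k)\<^esub>" for k
    by (rule ahom_zero[OF grp grp pull_ahom[OF Y b1]])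
  show ?thesis
    unfolding bExt_def
  proof (rule homology_iso[OF P.bExt_complex[OF Y] Q.bExt_complex[OF Y]])
    show "pull R Y (B' (Suc k)) (\<beta> (Suc k)) \<in> ahom (bcoch Y (B (Suc k))) (bcoch Y (B' (Suc k)))"
      by (rule pull_ahom[OF Y b1])
    show "pull R Y (B (Suc k)) (\<alpha> (Suc k)) \<in> ahom (bcoch Y (B' (Suc k))) (bcoch Y (B (Suc k)))"
      by (rule pull_ahom[OF Y a1])
  next
    fix x assume "x \<in> carrier (bcoch Y (B (Suc k)))"
      "pull R Y (B (Suc (Suc k))) (D (Suc k)) x = \<zero>\<^bsub>bcoch Y (B (Suc (Suc k)))\<^esub>"
    then show "pull R Y (B' (Suc (Suc k))) (D' (Suc k)) (pull R Y (B' (Suc k)) (\<beta> (Suc k)) x) = \<zero>\<^bsub>bcoch Y (B' (Suc (Suc k)))\<^esub>"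
      using pull_chain_map[OF Q P \<beta> Y, of x "Suc k"] zb by simp
  next
    fix x assume "x \<in> carrier (bcoch Y (B' (Suc k)))"
      "pull R Y (B' (Suc (Suc k))) (D' (Suc k)) x = \<zero>\<^bsub>bcoch Y (B' (Suc (Suc k)))\<^esub>"
    then show "pull R Y (B (Suc (Suc k))) (D (Suc k)) (pull R Y (B (Suc k)) (\<alpha> (Suc k)) x) = \<zero>\<^bsub>bcoch Y (B (Suc (Suc k)))\<^esub>"
      using pull_chain_map[OF P Q \<alpha> Y, of x "Suc k"] za by simp
  next
    fix x assume x: "x \<in> carrier (bcoch Y (B k))"
    show "pull R Y (B' (Suc k)) (\<beta> (Suc k)) (pull R Y (B (Suc k)) (D k) x) \<in> pull R Y (B' (Suc k)) (D' k) ` carrier (bcoch Y (B' k))"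
      unfolding pull_chain_map[OF Q P \<beta> Y x] by (rule imageI[OF pull_closed[OF Y b1 x]])
  next
    fix x assume x: "x \<in> carrier (bcoch Y (B' k))"
    show "pull R Y (B (Suc k)) (\<alpha> (Suc k)) (pull R Y (B' (Suc k)) (D' k) x) \<in> pull R Y (B (Suc k)) (D k) ` carrier (bcoch Y (B k))"
      unfolding pull_chain_map[OF P Q \<alpha> Y x] by (rule imageI[OF pull_closed[OF Y a1 x]])
  next
    fix x assume "x \<in> carrier (bcoch Y (B (Suc k)))"
      "pull R Y (B (Suc (Suc k))) (D (Suc k)) x = \<zero>\<^bsub>bcoch Y (B (Suc (Suc k)))\<^esub>"
    then show "\<exists>y\<in>carrier (bcoch Y (B k)). pull R Y (B (Suc k)) (\<alpha> (Suc k)) (pull R Y (B' (Suc k)) (\<beta> (Suc k)) x)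
        = pull R Y (B (Suc k)) (D k) y \<oplus>\<^bsub>bcoch Y (B (Suc k))\<^esub> x"
      by (rule pull_homotopy[OF P Q \<alpha> \<beta> h Y])
  next
    fix x assume "x \<in> carrier (bcoch Y (B' (Suc k)))"
      "pull R Y (B' (Suc (Suc k))) (D' (Suc k)) x = \<zero>\<^bsub>bcoch Y (B' (Suc (Suc k)))\<^esub>"
    then show "\<exists>y\<in>carrier (bcoch Y (B' k)). pull R Y (B' (Suc k)) (\<beta> (Suc k)) (pull R Y (B (Suc k)) (\<alpha> (Suc k)) x)
        = pull R Y (B' (Suc k)) (D' k) y \<oplus>\<^bsub>bcoch Y (B' (Suc k))\<^esub> x"
      by (rule pull_homotopy[OF Q P \<beta> \<alpha> h' Y])
  qed
qed

lemma rext_chain_map: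
  assumes "resolution R N B D \<epsilon>" "resolution R N B' D' \<epsilon>'" and \<alpha>: "chain_map R B D B' D' \<alpha>"
    and A: "right_module R A" and f: "f \<in> carrier (fs_group A (B (Suc k)))"
  shows "rext A (B' k) (D' k) (rext A (B' (Suc k)) (\<alpha> (Suc k)) f) = rext A (B' k) (\<alpha> k) (rext A (B k) (D k) f)"
proof -
  interpret P: resolution R N B D \<epsilon> by fact
  interpret Q: resolution R N B' D' \<epsilon>' by fact
  note a1 = chain_mapD(1)[OF \<alpha>] and a2 = chain_mapD(2)[OF \<alpha>]
  have f: "f \<in> fsupp A (B (Suc k))" using f by (simp add: carrier_fs_group)
  show ?thesis
    by (rule trans[OF trans[OF rext_assoc[OF A a1 Q.D_closed f] rext_cong[OF A f flin_closed[OF P.R Q.D_closed a1] a2]]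
          rext_assoc[OF A P.D_closed a1 f, symmetric]])
qed

text \<open>Dual to \<open>pull_homotopy\<close>: for a cycle \<open>f\<close> the term through the
  differential of \<open>f\<close> vanishes, and \<open>y\<close> is the image of \<open>f\<close>
  under \<open>h (Suc k)\<close>.\<close>

lemma rext_homotopy:
  assumes "resolution R N B D \<epsilon>" "resolution R N B' D' \<epsilon>'"
    and \<alpha>: "chain_map R B D B' D' \<alpha>" and \<beta>: "chain_map R B' D' B D \<beta>"
    and h: "homotopy_to_id R B D (\<lambda>k b. flin R (B k) (\<beta> k) (\<alpha> k b)) h"
    and A: "right_module R A" and f: "f \<in> carrier (fs_group A (B (Suc k)))"
    and cyc: "rext A (B k) (D k) f = \<zero>\<^bsub>fs_group A (B k)\<^esub>"
  shows "\<exists>y\<in>carrier (fs_group A (B (Suc (Suc k)))). rext A (B (Suc k)) (\<beta> (Suc k)) (rext A (B' (Suc k)) (\<alpha> (Suc k)) f)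
    = rext A (B (Suc k)) (D (Suc k)) y \<oplus>\<^bsub>fs_group A (B (Suc k))\<^esub> f"
proof -
  interpret P: resolution R N B D \<epsilon> by fact
  note R = P.R
  let ?B = "B (Suc k)" and ?F = "free_module R (B (Suc k))" and ?C = "fs_group A (B (Suc k))"
  interpret F: abelian_group ?F by (rule free_group[OF R])
  interpret C: abelian_group ?C by (rule fs_group_group[OF right_moduleD(2)[OF A]])
  have f': "f \<in> fsupp A (B (Suc k))" using f by (simp add: carrier_fs_group)
  note a1 = chain_mapD(1)[OF \<alpha>] and b1 = chain_mapD(1)[OF \<beta>]
  have h1: "\<And>b k. b \<in> B k \<Longrightarrow> h k b \<in> fsupp R (B (Suc k))"
    and h2: "\<And>b. b \<in> ?B \<Longrightarrow> flin R ?B (\<beta> (Suc k)) (\<alpha> (Suc k) b) = single R b \<one>\<^bsub>R\<^esub> \<oplus>\<^bsub>?F\<^esub>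
      (flin R ?B (D (Suc k)) (h (Suc k) b) \<oplus>\<^bsub>?F\<^esub> flin R ?B (h k) (D k b))"
    using h by (auto simp: homotopy_to_id_def)
  have c0: "flin R ?B (\<beta> (Suc k)) (\<alpha> (Suc k) b) \<in> fsupp R ?B" if "b \<in> ?B" for b
    by (rule flin_closed[OF R b1 a1[OF that]])
  have c1: "flin R ?B (D (Suc k)) (h (Suc k) b) \<in> fsupp R ?B" if "b \<in> ?B" for b
    by (rule flin_closed[OF R P.D_closed h1[OF that]])
  have c2: "flin R ?B (h k) (D k b) \<in> fsupp R ?B" if "b \<in> ?B" for b
    by (rule flin_closed[OF R h1 P.D_closed[OF that]])
  have c3: "flin R ?B (D (Suc k)) (h (Suc k) b) \<oplus>\<^bsub>?F\<^esub> flin R ?B (h k) (D k b) \<in> fsupp R ?B" if "b \<in> ?B" for b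
    using F.a_closed[of "flin R ?B (D (Suc k)) (h (Suc k) b)" "flin R ?B (h k) (D k b)"] c1[OF that] c2[OF that]
    by (simp add: carrier_free_module)
  have "rext A ?B (\<beta> (Suc k)) (rext A (B' (Suc k)) (\<alpha> (Suc k)) f) = rext A ?B (\<lambda>b. flin R ?B (\<beta> (Suc k)) (\<alpha> (Suc k) b)) f"
    by (rule rext_assoc[OF A a1 b1 f'])
  also have "\<dots> = rext A ?B (\<lambda>b. single R b \<one>\<^bsub>R\<^esub> \<oplus>\<^bsub>?F\<^esub>
      (flin R ?B (D (Suc k)) (h (Suc k) b) \<oplus>\<^bsub>?F\<^esub> flin R ?B (h k) (D k b))) f"
    by (rule rext_cong[OF A f' c0 h2])
  also have "\<dots> = rext A ?B (\<lambda>b. single R b \<one>\<^bsub>R\<^esub>) f \<oplus>\<^bsub>?C\<^esub>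
      rext A ?B (\<lambda>b. flin R ?B (D (Suc k)) (h (Suc k) b) \<oplus>\<^bsub>?F\<^esub> flin R ?B (h k) (D k b)) f"
    by (rule rext_add_fun[OF A unit_closed[OF R] c3 f'])
  also have "rext A ?B (\<lambda>b. flin R ?B (D (Suc k)) (h (Suc k) b) \<oplus>\<^bsub>?F\<^esub> flin R ?B (h k) (D k b)) f
    = rext A ?B (\<lambda>b. flin R ?B (D (Suc k)) (h (Suc k) b)) f \<oplus>\<^bsub>?C\<^esub> rext A ?B (\<lambda>b. flin R ?B (h k) (D k b)) f"
    by (rule rext_add_fun[OF A c1 c2 f'])
  also have "rext A ?B (\<lambda>b. flin R ?B (D (Suc k)) (h (Suc k) b)) f
    = rext A ?B (D (Suc k)) (rext A (B (Suc (Suc k))) (h (Suc k)) f)"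
    by (rule rext_assoc[OF A h1 P.D_closed f', symmetric])
  also have "rext A ?B (\<lambda>b. flin R ?B (h k) (D k b)) f = rext A ?B (h k) (rext A (B k) (D k) f)"
    by (rule rext_assoc[OF A P.D_closed h1 f', symmetric])
  also have "\<dots> = \<zero>\<^bsub>?C\<^esub>" unfolding cyc
    by (rule ahom_zero[OF fs_group_group[OF right_moduleD(2)[OF A]] C.abelian_group_axioms rext_ahom[OF A h1]])
  also have "rext A ?B (\<lambda>b. single R b \<one>\<^bsub>R\<^esub>) f = f" by (rule rext_unit[OF A f'])
  finally have eq: "rext A ?B (\<beta> (Suc k)) (rext A (B' (Suc k)) (\<alpha> (Suc k)) f)
    = f \<oplus>\<^bsub>?C\<^esub> (rext A ?B (D (Suc k)) (rext A (B (Suc (Suc k))) (h (Suc k)) f) \<oplus>\<^bsub>?C\<^esub> \<zero>\<^bsub>?C\<^esub>)" .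
  have y: "rext A (B (Suc (Suc k))) (h (Suc k)) f \<in> fsupp A (B (Suc (Suc k)))" by (rule rext_closed[OF A h1 f'])
  have "rext A ?B (D (Suc k)) (rext A (B (Suc (Suc k))) (h (Suc k)) f) \<in> carrier ?C"
    unfolding carrier_fs_group by (rule rext_closed[OF A P.D_closed y])
  then show ?thesis using y f unfolding eq
    by (intro bexI[of _ "rext A (B (Suc (Suc k))) (h (Suc k)) f"]) (simp_all add: C.a_comm, simp add: carrier_fs_group)
qed

theorem bTor_unique:
  assumes P: "resolution R N B D \<epsilon>" and Q: "resolution R N B' D' \<epsilon>'" and A: "right_module R A"
  shows "bTor A B D k \<cong> bTor A B' D' k"
proof -
  interpret P: resolution R N B D \<epsilon> by fact
  interpret Q: resolution R N B' D' \<epsilon>' by fact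
  obtain \<alpha> \<beta> h h' where \<alpha>: "chain_map R B D B' D' \<alpha>" and \<beta>: "chain_map R B' D' B D \<beta>"
    and h: "homotopy_to_id R B D (\<lambda>k b. flin R (B k) (\<beta> k) (\<alpha> k b)) h"
    and h': "homotopy_to_id R B' D' (\<lambda>k b. flin R (B' k) (\<alpha> k) (\<beta> k b)) h'"
    using ex_homotopy_equivalence[OF P Q] by blast
  note a1 = chain_mapD(1)[OF \<alpha>] and b1 = chain_mapD(1)[OF \<beta>]
  note grp = fs_group_group[OF right_moduleD(2)[OF A]]
  have za: "rext A (B' k) (\<alpha> k) \<zero>\<^bsub>fs_group A (B k)\<^esub> = \<zero>\<^bsub>fs_group A (B' k)\<^esub>" for k
    by (rule ahom_zero[OF grp grp rext_ahom[OF A a1]])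
  have zb: "rext A (B k) (\<beta> k) \<zero>\<^bsub>fs_group A (B' k)\<^esub> = \<zero>\<^bsub>fs_group A (B k)\<^esub>" for k
    by (rule ahom_zero[OF grp grp rext_ahom[OF A b1]])
  have cl: "rext A (B' k) (\<alpha> k) x \<in> carrier (fs_group A (B' k))" if "x \<in> carrier (fs_group A (B k))" for x k
    by (rule ahom_closed[OF rext_ahom[OF A a1] that])
  have cl': "rext A (B k) (\<beta> k) x \<in> carrier (fs_group A (B k))" if "x \<in> carrier (fs_group A (B' k))" for x k
    by (rule ahom_closed[OF rext_ahom[OF A b1] that])
  show ?thesis
    unfolding bTor_def
  proof (rule homology_iso[OF P.bTor_complex[OF A] Q.bTor_complex[OF A]])
    show "rext A (B' (Suc k)) (\<alpha> (Suc k)) \<in> ahom (fs_group A (B (Suc k))) (fs_group A (B' (Suc k)))"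
      by (rule rext_ahom[OF A a1])
    show "rext A (B (Suc k)) (\<beta> (Suc k)) \<in> ahom (fs_group A (B' (Suc k))) (fs_group A (B (Suc k)))"
      by (rule rext_ahom[OF A b1])
  next
    fix x assume "x \<in> carrier (fs_group A (B (Suc k)))" "rext A (B k) (D k) x = \<zero>\<^bsub>fs_group A (B k)\<^esub>"
    then show "rext A (B' k) (D' k) (rext A (B' (Suc k)) (\<alpha> (Suc k)) x) = \<zero>\<^bsub>fs_group A (B' k)\<^esub>"
      using rext_chain_map[OF P Q \<alpha> A, of x k] za by simp
  next
    fix x assume "x \<in> carrier (fs_group A (B' (Suc k)))" "rext A (B' k) (D' k) x = \<zero>\<^bsub>fs_group A (B' k)\<^esub>"
    then show "rext A (B k) (D k) (rext A (B (Suc k)) (\<beta> (Suc k)) x) = \<zero>\<^bsub>fs_group A (B k)\<^esub>"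
      using rext_chain_map[OF Q P \<beta> A, of x k] zb by simp
  next
    fix x assume x: "x \<in> carrier (fs_group A (B (Suc (Suc k))))"
    show "rext A (B' (Suc k)) (\<alpha> (Suc k)) (rext A (B (Suc k)) (D (Suc k)) x)
      \<in> rext A (B' (Suc k)) (D' (Suc k)) ` carrier (fs_group A (B' (Suc (Suc k))))"
      unfolding rext_chain_map[OF P Q \<alpha> A x, symmetric] by (rule imageI[OF cl[OF x]])
  next
    fix x assume x: "x \<in> carrier (fs_group A (B' (Suc (Suc k))))"
    show "rext A (B (Suc k)) (\<beta> (Suc k)) (rext A (B' (Suc k)) (D' (Suc k)) x)
      \<in> rext A (B (Suc k)) (D (Suc k)) ` carrier (fs_group A (B (Suc (Suc k))))"
      unfolding rext_chain_map[OF Q P \<beta> A x, symmetric] by (rule imageI[OF cl'[OF x]])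
  next
    fix x assume "x \<in> carrier (fs_group A (B (Suc k)))" "rext A (B k) (D k) x = \<zero>\<^bsub>fs_group A (B k)\<^esub>"
    then show "\<exists>y\<in>carrier (fs_group A (B (Suc (Suc k)))). rext A (B (Suc k)) (\<beta> (Suc k)) (rext A (B' (Suc k)) (\<alpha> (Suc k)) x)
      = rext A (B (Suc k)) (D (Suc k)) y \<oplus>\<^bsub>fs_group A (B (Suc k))\<^esub> x"
      by (rule rext_homotopy[OF P Q \<alpha> \<beta> h A])
  next
    fix x assume "x \<in> carrier (fs_group A (B' (Suc k)))" "rext A (B' k) (D' k) x = \<zero>\<^bsub>fs_group A (B' k)\<^esub>"
    then show "\<exists>y\<in>carrier (fs_group A (B' (Suc (Suc k)))). rext A (B' (Suc k)) (\<alpha> (Suc k)) (rext A (B (Suc k)) (\<beta> (Suc k)) x)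
      = rext A (B' (Suc k)) (D' (Suc k)) y \<oplus>\<^bsub>fs_group A (B' (Suc k))\<^esub> x"
      by (rule rext_homotopy[OF Q P \<beta> \<alpha> h' A])
  qed
qed

section \<open>The canonical resolution\<close>

lemma ex_coeff_fun:
  assumes "f \<in> fsupp R B"
  shows "\<exists>l. coeff_fun R l = f"
proof -
  obtain bs where bs: "set bs = {b. f b \<noteq> \<zero>\<^bsub>R\<^esub>}" using finite_list[OF fsuppD(3)[OF assms]] by blast
  have "map_of (map (\<lambda>b. (b, f b)) bs) b = (if b \<in> set bs then Some (f b) else None)" for b
    by (induction bs) auto
  then have "coeff_fun R (map (\<lambda>b. (b, f b)) bs) = f"
    by (auto simp: coeff_fun_def fun_eq_iff bs)
  then show ?thesis by blast
qed

text \<open>The two successor cases of \<open>res_basis\<close> differ only in what counts as a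
  cycle, and \<open>based_cycles\<close> covers both; the differential is given by
  \<open>syz_val\<close> in all degrees.\<close>

lemma res_basis_Suc:
  "res_basis R X (Suc k) = Syz ` {l. coeff_fun R l \<in> based_cycles R X (res_basis R X) (\<lambda>_. syz_val R) gen_val k}"
  by (cases k) (simp_all add: carrier_free_module)

text \<open>Exact by construction: a cycle \<open>f\<close> is the image of the basis element
  \<open>Syz l\<close> for any list \<open>l\<close> describing \<open>f\<close>, and
  \<open>x\<close> is the image of \<open>Gen x\<close>.\<close>

theorem canonical_resolution:
  fixes R :: "('r, 'z) ring_scheme" and X :: "('r, 'x, 'y) module_scheme"
  assumes X: "left_module R X"
  shows "resolution R X (res_basis R X) (\<lambda>_. syz_val R) gen_val"
proof -
  interpret left_module R X by fact
  have R: "ring R" by (rule left_moduleD(1)[OF X])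
  let ?Z = "based_cycles R X (res_basis R X) (\<lambda>_. syz_val R) gen_val"
  have aug: "gen_val b \<in> carrier X" if "b \<in> res_basis R X 0" for b using that by auto
  have Dc: "syz_val R b \<in> ?Z k" if "b \<in> res_basis R X (Suc k)" for b k
    using that by (auto simp: res_basis_Suc simp del: res_basis.simps)
  have ZD: "f \<in> fsupp R (res_basis R X k)" if "f \<in> ?Z k" for f k using that by (cases k) auto
  show ?thesis
  proof unfold_locales
    fix f k assume f: "f \<in> ?Z k"
    obtain l where l: "coeff_fun R l = f" using ex_coeff_fun[OF ZD[OF f]] by blast
    have b: "Syz l \<in> res_basis R X (Suc k)" unfolding res_basis_Suc using f l by auto
    show "\<exists>g\<in>fsupp R (res_basis R X (Suc k)). flin R (res_basis R X k) (syz_val R) g = f"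
    proof
      show "single R (Syz l) \<one>\<^bsub>R\<^esub> \<in> fsupp R (res_basis R X (Suc k))" by (rule unit_closed[OF R b])
      have "flin R (res_basis R X k) (syz_val R) (single R (Syz l) \<one>\<^bsub>R\<^esub>) = syz_val R (Syz l)"
        by (rule flin_unit_eval[OF R ZD[OF Dc] b])
      then show "flin R (res_basis R X k) (syz_val R) (single R (Syz l) \<one>\<^bsub>R\<^esub>) = f" using l by simp
    qed
  next
    fix x assume x: "x \<in> carrier X"
    let ?g = "Gen x :: ('r, 'x) res_gen"
    have b: "?g \<in> res_basis R X 0" using x by simp
    have "linear_extension R X gen_val (single R ?g \<one>\<^bsub>R\<^esub>) = gen_val ?g"
      by (rule lin_unit_eval[OF X aug b])
    then show "\<exists>f\<in>fsupp R (res_basis R X 0). linear_extension R X gen_val f = x"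
      using unit_closed[OF R b] by auto
  qed (use aug Dc in blast)+
qed

section \<open>Ext and Tor in terms of based cochains and chains\<close>

lemma linear_mapsD:
  assumes "f \<in> linear_maps R A B"
  shows "f \<in> ahom A B" "r \<in> carrier R \<Longrightarrow> x \<in> carrier A \<Longrightarrow> f (smult A r x) = smult B r (f x)"
    "f \<in> extensional (carrier A)"
  using assms by (auto simp: linear_maps_def ahom_def PiE_def)

lemma linear_mapsI:
  assumes "f \<in> ahom A B" "f \<in> extensional (carrier A)"
    "\<And>r x. r \<in> carrier R \<Longrightarrow> x \<in> carrier A \<Longrightarrow> f (smult A r x) = smult B r (f x)"
  shows "f \<in> linear_maps R A B"
  using assms by (auto simp: linear_maps_def ahom_def PiE_def)

lemma Hom_simps:
  "carrier (Hom_group R A B) = linear_maps R A B" "\<zero>\<^bsub>Hom_group R A B\<^esub> = (\<lambda>x\<in>carrier A. \<zero>\<^bsub>B\<^esub>)"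
  "f \<oplus>\<^bsub>Hom_group R A B\<^esub> g = (\<lambda>x\<in>carrier A. f x \<oplus>\<^bsub>B\<^esub> g x)"
  by (simp_all add: Hom_group_def)

lemma linear_maps_restrict:
  assumes A: "left_module R A" and f: "f \<in> ahom A B"
    and "\<And>r x. r \<in> carrier R \<Longrightarrow> x \<in> carrier A \<Longrightarrow> f (smult A r x) = smult B r (f x)"
  shows "restrict f (carrier A) \<in> linear_maps R A B"
proof (rule linear_mapsI)
  interpret A: left_module R A by fact
  show "restrict f (carrier A) \<in> ahom A B"
    by (rule ahom_cong[OF f]) (auto intro: A.M.abelian_monoid_axioms)
  show "restrict f (carrier A) (smult A r x) = smult B r (restrict f (carrier A) x)"
    if "r \<in> carrier R" "x \<in> carrier A" for r x
    using that assms(3) A.smult_closed by simp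
qed simp

lemma linear_maps_eqI: "f \<in> linear_maps R A B \<Longrightarrow> g \<in> linear_maps R A B \<Longrightarrow> (\<And>x. x \<in> carrier A \<Longrightarrow> f x = g x) \<Longrightarrow> f = g"
  by (rule extensionalityI[of _ "carrier A"]) (auto dest: linear_mapsD(3))

lemma Hom_group_group:
  assumes A: "left_module R A" and B: "left_module R B"
  shows "abelian_group (Hom_group R A B)"
proof (rule abelian_groupI)
  interpret A: left_module R A by fact
  interpret B: left_module R B by fact
  note BB = B.M.abelian_group_axioms
  have add: "f \<oplus>\<^bsub>Hom_group R A B\<^esub> g \<in> linear_maps R A B" if f: "f \<in> linear_maps R A B" and g: "g \<in> linear_maps R A B" for f g
    unfolding Hom_simps
    by (rule linear_maps_restrict[OF A ahom_add_map[OF BB linear_mapsD(1)[OF f] linear_mapsD(1)[OF g]]])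
      (simp add: linear_mapsD(2)[OF f] linear_mapsD(2)[OF g] B.smult_r_distr ahom_closed[OF linear_mapsD(1)[OF f]]
        ahom_closed[OF linear_mapsD(1)[OF g]])
  have z: "\<zero>\<^bsub>Hom_group R A B\<^esub> \<in> linear_maps R A B"
    unfolding Hom_simps by (rule linear_maps_restrict[OF A ahom_zero_map[OF BB]]) (simp add: smult_zero[OF B])
  show "\<zero>\<^bsub>Hom_group R A B\<^esub> \<in> carrier (Hom_group R A B)" using z by (simp add: Hom_simps)
  fix f assume "f \<in> carrier (Hom_group R A B)"
  then have f: "f \<in> linear_maps R A B" by (simp add: Hom_simps)
  note fc = ahom_closed[OF linear_mapsD(1)[OF f]]
  show "\<zero>\<^bsub>Hom_group R A B\<^esub> \<oplus>\<^bsub>Hom_group R A B\<^esub> f = f"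
    by (rule linear_maps_eqI[OF add[OF z f] f]) (simp add: Hom_simps fc)
  have neg: "(\<lambda>x\<in>carrier A. \<ominus>\<^bsub>B\<^esub> f x) \<in> linear_maps R A B"
  proof (rule linear_maps_restrict[OF A])
    show "(\<lambda>x. \<ominus>\<^bsub>B\<^esub> f x) \<in> ahom A B"
      by (rule ahomI) (simp_all add: fc ahom_add[OF linear_mapsD(1)[OF f]] B.M.minus_add)
    show "\<ominus>\<^bsub>B\<^esub> f (smult A r x) = smult B r (\<ominus>\<^bsub>B\<^esub> f x)" if "r \<in> carrier R" "x \<in> carrier A" for r x
      unfolding linear_mapsD(2)[OF f that]
      by (rule ahom_uminus[OF BB BB smult_ahom[OF B that(1)] fc[OF that(2)], symmetric])
  qed
  show "\<exists>g\<in>carrier (Hom_group R A B). g \<oplus>\<^bsub>Hom_group R A B\<^esub> f = \<zero>\<^bsub>Hom_group R A B\<^esub>"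
  proof
    show "(\<lambda>x\<in>carrier A. \<ominus>\<^bsub>B\<^esub> f x) \<in> carrier (Hom_group R A B)" using neg by (simp add: Hom_simps)
    show "(\<lambda>x\<in>carrier A. \<ominus>\<^bsub>B\<^esub> f x) \<oplus>\<^bsub>Hom_group R A B\<^esub> f = \<zero>\<^bsub>Hom_group R A B\<^esub>"
      by (rule linear_maps_eqI[OF add[OF neg f] z]) (simp add: Hom_simps fc B.M.l_neg)
  qed
  fix g assume "g \<in> carrier (Hom_group R A B)"
  then have g: "g \<in> linear_maps R A B" by (simp add: Hom_simps)
  note gc = ahom_closed[OF linear_mapsD(1)[OF g]]
  show "f \<oplus>\<^bsub>Hom_group R A B\<^esub> g \<in> carrier (Hom_group R A B)" using add[OF f g] by (simp add: Hom_simps)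
  show "f \<oplus>\<^bsub>Hom_group R A B\<^esub> g = g \<oplus>\<^bsub>Hom_group R A B\<^esub> f"
    by (rule linear_maps_eqI[OF add[OF f g] add[OF g f]]) (simp add: Hom_simps fc gc B.M.a_comm)
  fix h assume "h \<in> carrier (Hom_group R A B)"
  then have h: "h \<in> linear_maps R A B" by (simp add: Hom_simps)
  note hc = ahom_closed[OF linear_mapsD(1)[OF h]]
  show "f \<oplus>\<^bsub>Hom_group R A B\<^esub> g \<oplus>\<^bsub>Hom_group R A B\<^esub> h = f \<oplus>\<^bsub>Hom_group R A B\<^esub> (g \<oplus>\<^bsub>Hom_group R A B\<^esub> h)"
    by (rule linear_maps_eqI[OF add[OF add[OF f g] h] add[OF f add[OF g h]]]) (simp add: Hom_simps fc gc hc B.M.a_assoc)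
qed

lemma linear_free_eq:
  assumes Y: "left_module R Y" and f: "f \<in> linear_maps R (free_module R B) Y" and p: "p \<in> fsupp R B"
  shows "f p = linear_extension R Y (\<lambda>b\<in>B. f (single R b \<one>\<^bsub>R\<^esub>)) p"
proof -
  have R: "ring R" by (rule left_moduleD(1)[OF Y])
  interpret R: ring R by fact
  have c: "f (single R b \<one>\<^bsub>R\<^esub>) \<in> carrier Y" if "b \<in> B" for b
    by (rule ahom_closed[OF linear_mapsD(1)[OF f]]) (simp add: carrier_free_module unit_closed[OF R that])
  have c': "(\<lambda>b\<in>B. f (single R b \<one>\<^bsub>R\<^esub>)) b \<in> carrier Y" if "b \<in> B" for b using c that by simp
  show ?thesis
  proof (rule fs_ahom_eqI[OF is_fs_free_module[OF R] left_moduleD(2)[OF Y] linear_mapsD(1)[OF f] lin_ahom[OF Y c'] p])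
    fix r b assume r: "r \<in> carrier R" and b: "b \<in> B"
    have "f (single R b r) = f (smult (free_module R B) r (single R b \<one>\<^bsub>R\<^esub>))"
      using r by (simp add: smult_single[OF R])
    also have "\<dots> = smult Y r (f (single R b \<one>\<^bsub>R\<^esub>))"
      by (rule linear_mapsD(2)[OF f r]) (simp add: carrier_free_module unit_closed[OF R b])
    also have "\<dots> = linear_extension R Y (\<lambda>b\<in>B. f (single R b \<one>\<^bsub>R\<^esub>)) (single R b r)"
      using b by (subst lin_single[OF Y c' b r]) simp_all
    finally show "f (single R b r) = linear_extension R Y (\<lambda>b\<in>B. f (single R b \<one>\<^bsub>R\<^esub>)) (single R b r)" .
  qed
qed

lemma lin_linear_maps:
  assumes Y: "left_module R Y" and g: "\<And>b. b \<in> B \<Longrightarrow> g b \<in> carrier Y"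
  shows "restrict (linear_extension R Y g) (fsupp R B) \<in> linear_maps R (free_module R B) Y"
proof -
  have "restrict (linear_extension R Y g) (carrier (free_module R B)) \<in> linear_maps R (free_module R B) Y"
  proof (rule linear_maps_restrict[OF free_left_module[OF left_moduleD(1)[OF Y]] lin_ahom[OF Y g]])
    show "linear_extension R Y g (smult (free_module R B) r x) = smult Y r (linear_extension R Y g x)"
      if "r \<in> carrier R" "x \<in> carrier (free_module R B)" for r x
      by (rule lin_smult[OF Y g]) (use that in \<open>simp_all add: carrier_free_module\<close>)
  qed
  then show ?thesis by (simp add: carrier_free_module)
qed

text \<open>Evaluation on the basis, \<open>?u k\<close>, identifies linear maps on
  \<open>res_mod R X k\<close> with \<open>bcoch\<close>, and the differentials correspond because
  \<open>res_diff\<close> sends the basis element \<open>b\<close> to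
  \<open>syz_val R b\<close>.\<close>

theorem Ext_iso_bExt:
  assumes X: "left_module R X" and Y: "left_module R Y"
  shows "Ext R (Suc k) X Y \<cong> bExt R Y (res_basis R X) (\<lambda>_. syz_val R) k"
    and Ext_group: "group (Ext R (Suc k) X Y)"
proof -
  interpret P: resolution R X "res_basis R X" "\<lambda>_. syz_val R" gen_val by (rule canonical_resolution[OF X])
  note R = P.R
  let ?B = "res_basis R X"
  let ?G = "\<lambda>k. Hom_group R (res_mod R X k) Y"
  let ?d = "\<lambda>k g. \<lambda>p\<in>carrier (res_mod R X (Suc k)). g (res_diff R X k p)"
  let ?u = "\<lambda>k f. \<lambda>b\<in>?B k. f (single R b \<one>\<^bsub>R\<^esub>)"
  have grp: "abelian_group (?G k)" for k
    unfolding res_mod_def by (rule Hom_group_group[OF free_left_module[OF R] Y])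
  have rd: "res_diff R X k = flin R (?B k) (syz_val R)" for k by (simp add: res_diff_def res_mod_def)
  have rdc: "res_diff R X k p \<in> fsupp R (?B k)" if "p \<in> fsupp R (?B (Suc k))" for k p
    unfolding rd by (rule flin_closed[OF R P.D_closed that])
  have uc: "?u k f \<in> carrier (bcoch Y (?B k))" if "f \<in> carrier (?G k)" for k f
  proof -
    have f: "f \<in> ahom (free_module R (?B k)) Y"
      by (rule linear_mapsD(1)) (use that in \<open>simp add: Hom_simps res_mod_def\<close>)
    have "f (single R b \<one>\<^bsub>R\<^esub>) \<in> carrier Y" if "b \<in> ?B k" for b
      by (rule ahom_closed[OF f]) (simp add: carrier_free_module unit_closed[OF R that])
    then show ?thesis by (simp add: bcoch_simps)
  qed
  have val: "f p = linear_extension R Y (?u k f) p" if "f \<in> carrier (?G k)" "p \<in> fsupp R (?B k)" for k f p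
    using linear_free_eq[OF Y _ that(2), of f] that(1) by (simp add: Hom_simps res_mod_def)
  have uinj: "f = g" if "f \<in> carrier (?G k)" "g \<in> carrier (?G k)" "?u k f = ?u k g" for k f g
  proof (rule linear_maps_eqI[of f R "res_mod R X k" Y])
    show "f x = g x" if x: "x \<in> carrier (res_mod R X k)" for x
      using val[OF \<open>f \<in> _\<close>, of x] val[OF \<open>g \<in> _\<close>, of x] x that \<open>?u k f = ?u k g\<close> by (simp add: res_mod_def carrier_free_module)
  qed (use that in \<open>simp_all add: Hom_simps\<close>)
  have usurj: "\<exists>f\<in>carrier (?G k). ?u k f = g" if g: "g \<in> carrier (bcoch Y (?B k))" for k g
  proof
    show "restrict (linear_extension R Y g) (fsupp R (?B k)) \<in> carrier (?G k)"
      unfolding Hom_simps res_mod_def by (rule lin_linear_maps[OF Y bcoch_mem[OF g]])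
    have "linear_extension R Y g (single R b \<one>\<^bsub>R\<^esub>) = g b" if "b \<in> ?B k" for b
      by (rule lin_unit_eval[OF Y bcoch_mem[OF g] that])
    then have "?u k (restrict (linear_extension R Y g) (fsupp R (?B k))) = restrict g (?B k)"
      by (intro restrict_ext) (simp add: unit_closed[OF R])
    then show "?u k (restrict (linear_extension R Y g) (fsupp R (?B k))) = g"
      using g by (simp add: bcoch_simps PiE_restrict)
  qed
  have uh: "?u k \<in> ahom (?G k) (bcoch Y (?B k))" for k
    by (rule ahomI[OF uc]) (auto simp: Hom_simps bcoch_simps res_mod_def carrier_free_module unit_closed[OF R] intro!: restrict_ext)
  have dc: "?d k g \<in> carrier (?G (Suc k))" if g: "g \<in> carrier (?G k)" for k g
  proof -
    have gl: "g \<in> linear_maps R (free_module R (?B k)) Y" using g by (simp add: Hom_simps res_mod_def)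
    show ?thesis unfolding Hom_simps res_mod_def
    proof (rule linear_maps_restrict[OF free_left_module[OF R]])
      show "(\<lambda>p. g (res_diff R X k p)) \<in> ahom (free_module R (?B (Suc k))) Y"
        unfolding rd by (rule ahom_compose[OF flin_ahom[OF R P.D_closed] linear_mapsD(1)[OF gl]])
      fix r p assume r: "r \<in> carrier R" and "p \<in> carrier (free_module R (?B (Suc k)))"
      then have p: "p \<in> fsupp R (?B (Suc k))" by (simp add: carrier_free_module)
      have "res_diff R X k (smult (free_module R (?B (Suc k))) r p) = smult (free_module R (?B k)) r (res_diff R X k p)"
        unfolding rd by (rule lin_smult[OF free_left_module[OF R] _ p r]) (simp add: carrier_free_module P.D_closed)
      then show "g (res_diff R X k (smult (free_module R (?B (Suc k))) r p)) = smult Y r (g (res_diff R X k p))"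
        using linear_mapsD(2)[OF gl r] rdc[OF p] by (simp add: carrier_free_module)
    qed
  qed
  have du: "?u (Suc k) (?d k g) = pull R Y (?B (Suc k)) (syz_val R) (?u k g)" if g: "g \<in> carrier (?G k)" for k g
  proof -
    have "g (res_diff R X k (single R b \<one>\<^bsub>R\<^esub>)) = linear_extension R Y (?u k g) (syz_val R b)" if b: "b \<in> ?B (Suc k)" for b
    proof -
      have "res_diff R X k (single R b \<one>\<^bsub>R\<^esub>) = syz_val R b"
        unfolding rd by (rule flin_unit_eval[OF R P.D_closed b])
      then show ?thesis using val[OF g P.D_closed[OF b]] by simp
    qed
    then show ?thesis unfolding pull_def
      by (intro restrict_ext) (simp add: res_mod_def carrier_free_module unit_closed[OF R] del: res_basis.simps)
  qed
  have complex: "complex3 (?G k) (?d k) (?G (Suc k)) (?d (Suc k)) (?G (Suc (Suc k)))"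
    unfolding complex3_def
  proof (intro conjI ballI grp)
    show "?d k \<in> ahom (?G k) (?G (Suc k))" for k
      by (rule ahomI[OF dc]) (auto simp: Hom_simps res_mod_def carrier_free_module rdc intro!: restrict_ext)
    then show "?d (Suc k) \<in> ahom (?G (Suc k)) (?G (Suc (Suc k)))" .
    fix g assume g: "g \<in> carrier (?G k)"
    have gl: "g \<in> linear_maps R (free_module R (?B k)) Y" using g by (simp add: Hom_simps res_mod_def)
    have "g (res_diff R X k (res_diff R X (Suc k) p)) = \<zero>\<^bsub>Y\<^esub>" if p: "p \<in> fsupp R (?B (Suc (Suc k)))" for p
    proof -
      have "res_diff R X k (res_diff R X (Suc k) p) = \<zero>\<^bsub>free_module R (?B k)\<^esub>"
        using P.boundary_cycle[OF p] unfolding rd by simp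
      then show ?thesis using ahom_zero[OF free_group[OF R] left_moduleD(2)[OF Y] linear_mapsD(1)[OF gl]] by simp
    qed
    then show "?d (Suc k) (?d k g) = \<zero>\<^bsub>?G (Suc (Suc k))\<^esub>"
      by (auto simp: Hom_simps res_mod_def carrier_free_module rdc simp del: res_basis.simps intro!: restrict_ext)
  qed
  have eq: "Ext R (Suc k) X Y = homology (?G k) (?d k) (?G (Suc k)) (?d (Suc k)) (?G (Suc (Suc k)))"
  proof -
    have "?d (Suc k) f = \<zero>\<^bsub>?G (Suc (Suc k))\<^esub> \<longleftrightarrow> (\<forall>p\<in>carrier (res_mod R X (Suc (Suc k))). f (res_diff R X (Suc k) p) = \<zero>\<^bsub>Y\<^esub>)" for f
      by (auto simp: Hom_simps fun_eq_iff)
    then show ?thesis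
      unfolding Ext_def homology_def ext_cocycles_def ext_coboundaries.simps by (simp add: Hom_simps(1))
  qed
  show "group (Ext R (Suc k) X Y)" unfolding eq by (rule homology_group[OF complex])
  show "Ext R (Suc k) X Y \<cong> bExt R Y (res_basis R X) (\<lambda>_. syz_val R) k"
    unfolding eq bExt_def
    by (rule complex_iso[where ?u0.0 = "?u k" and ?u1.0 = "?u (Suc k)" and ?u2.0 = "?u (Suc (Suc k))", OF complex P.bExt_complex[OF Y] uc usurj uh usurj uinj uh uinj du du])
qed

text \<open>The tensor product of \<open>A\<close> with a free module is a direct sum of copies of
  \<open>A\<close>: the map \<open>?u k\<close>, which sends the pure tensor of \<open>a\<close> and
  \<open>p\<close> to \<open>\<lambda>c. rsmult A a (p c)\<close>, has the inverse
  \<open>?\<tau> k\<close>, which sends \<open>single A b a\<close> to the pure tensor of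
  \<open>a\<close> and the basis element \<open>b\<close>. Under \<open>?u\<close> the differential
  becomes \<open>rext\<close>.\<close>

theorem Tor_iso_bTor:
  assumes X: "left_module R X" and A: "right_module R A"
  shows "Tor R (Suc k) A X \<cong> bTor A (res_basis R X) (\<lambda>_. syz_val R) k"
    and Tor_group: "group (Tor R (Suc k) A X)"
    and tor_vanish: "trivial_group (Tor R (Suc k) A X) \<Longrightarrow> trivial_group (bTor A (res_basis R X) (\<lambda>_. syz_val R) k)"
proof -
  interpret P: resolution R X "res_basis R X" "\<lambda>_. syz_val R" gen_val by (rule canonical_resolution[OF X])
  note R = P.R
  note AA = right_moduleD(2)[OF A]
  let ?B = "res_basis R X"
  have ten: "tensor R A (free_module R (?B k))" for k
    unfolding tensor_def using A free_left_module[OF R] by simp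
  interpret t: tensor R A "free_module R (?B k)" for k by (rule ten)
  let ?G = "\<lambda>k. tor_chains R k A X"
  have Gdef: "?G k = tensor_group R A (free_module R (?B k))" for k by (simp add: tor_chains_def res_mod_def)
  let ?\<phi> = "\<lambda>a p c. rsmult A a (p c)"
  let ?u = "\<lambda>k. tensor_lift (fs_group A (?B k)) ?\<phi>"
  have bal: "balanced R A (free_module R (?B k)) (fs_group A (?B k)) ?\<phi>" for k
  proof (rule balancedI)
    fix a p assume a: "a \<in> carrier A" and "p \<in> carrier (free_module R (?B k))"
    then have p: "p \<in> fsupp R (?B k)" by (simp add: carrier_free_module)
    note pc = fsupp_closed[OF p ring.is_abelian_group[OF R]]
    show "(\<lambda>c. rsmult A a (p c)) \<in> carrier (fs_group A (?B k))"
      using rsmult_fsupp[OF A a p] by (simp add: carrier_fs_group)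
    show "(\<lambda>c. rsmult A (a \<oplus>\<^bsub>A\<^esub> a') (p c)) = (\<lambda>c. rsmult A a (p c)) \<oplus>\<^bsub>fs_group A (?B k)\<^esub> (\<lambda>c. rsmult A a' (p c))"
      if "a' \<in> carrier A" for a' using a that pc by (simp add: add_fs_group right_module.rsmult_l_distr[OF A])
    show "(\<lambda>c. rsmult A (rsmult A a r) (p c)) = (\<lambda>c. rsmult A a (smult (free_module R (?B k)) r p c))"
      if "r \<in> carrier R" for r using a that pc by (simp add: smult_free_module right_module.rsmult_assoc[OF A])
    fix q assume "q \<in> carrier (free_module R (?B k))"
    then have q: "q \<in> fsupp R (?B k)" by (simp add: carrier_free_module)
    show "(\<lambda>c. rsmult A a ((p \<oplus>\<^bsub>free_module R (?B k)\<^esub> q) c)) = (\<lambda>c. rsmult A a (p c)) \<oplus>\<^bsub>fs_group A (?B k)\<^esub> (\<lambda>c. rsmult A a (q c))"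
      using a pc fsupp_closed[OF q ring.is_abelian_group[OF R]] by (simp add: add_free_module add_fs_group right_module.rsmult_r_distr[OF A])
  qed
  note fg = fs_group_group[OF AA]
  have uh: "?u k \<in> ahom (?G k) (fs_group A (?B k))" for k
    unfolding Gdef by (rule t.tensor_lift_ahom[OF fg bal])
  have up: "?u k (pure_tensor R A (free_module R (?B k)) a p) = (\<lambda>c. rsmult A a (p c))"
    if "a \<in> carrier A" "p \<in> fsupp R (?B k)" for k a p
    by (rule t.tensor_lift_pure[OF fg bal]) (use that in \<open>simp_all add: carrier_free_module\<close>)
  let ?\<tau>f = "\<lambda>k a b. pure_tensor R A (free_module R (?B k)) a (single R b \<one>\<^bsub>R\<^esub>)"
  let ?\<tau> = "\<lambda>k. fext A (?G k) (?\<tau>f k)"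
  have unit: "single R b \<one>\<^bsub>R\<^esub> \<in> carrier (free_module R (?B k))" if "b \<in> ?B k" for b k
    using unit_closed[OF R that] by (simp add: carrier_free_module)
  have \<tau>b: "biadd A (?B k) (?G k) (?\<tau>f k)" for k
    unfolding Gdef
    by (rule biaddI) (simp_all only: balancedD(1)[OF t.pure_balanced _ unit] balancedD(2)[OF t.pure_balanced _ _ unit])
  have Gg: "abelian_group (?G k)" for k unfolding Gdef by (rule t.T.abelian_group_axioms)
  have \<tau>h: "?\<tau> k \<in> ahom (fs_group A (?B k)) (?G k)" for k
    by (rule fext_ahom[OF is_fs_fs_group[OF AA] Gg \<tau>b])
  have id: "(\<lambda>x. x) \<in> ahom G G" for G :: "('g, 'h) ring_scheme" by (rule ahomI) auto
  have u\<tau>: "?u k (?\<tau> k f) = f" if f: "f \<in> fsupp A (?B k)" for k f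
  proof (rule fs_ahom_eqI[OF is_fs_fs_group[OF AA] fg ahom_compose[OF \<tau>h uh] ahomI f])
    fix a b assume a: "a \<in> carrier A" and b: "b \<in> ?B k"
    have "?\<tau> k (single A b a) = ?\<tau>f k a b" by (rule fext_single[OF AA Gg \<tau>b b a])
    then have "?u k (?\<tau> k (single A b a)) = (\<lambda>c. rsmult A a (single R b \<one>\<^bsub>R\<^esub> c))"
      using up[OF a unit_closed[OF R b]] by simp
    also have "\<dots> = single A b a"
      using a by (auto simp: single_def right_module.rsmult_one[OF A] rsmult_zero[OF A])
    finally show "?u k (?\<tau> k (single A b a)) = single A b a" .
  qed auto
  have \<tau>u: "?\<tau> k (?u k c) = c" if c: "c \<in> carrier (?G k)" for k c
  proof (rule t.ahom_eqI[OF t.T.abelian_group_axioms _ _ c[unfolded Gdef], where h = "\<lambda>c. ?\<tau> k (?u k c)" and h' = "\<lambda>c. c"])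
    show "(\<lambda>c. ?\<tau> k (?u k c)) \<in> ahom (tensor_group R A (free_module R (?B k))) (tensor_group R A (free_module R (?B k)))"
      using ahom_compose[OF uh[of k] \<tau>h[of k]] by (simp add: Gdef)
    show "(\<lambda>c. c) \<in> ahom (tensor_group R A (free_module R (?B k))) (tensor_group R A (free_module R (?B k)))"
      by (rule ahomI) auto
    fix a p assume a: "a \<in> carrier A" and "p \<in> carrier (free_module R (?B k))"
    then have p: "p \<in> fsupp R (?B k)" by (simp add: carrier_free_module)
    \<comment> \<open>Both sides are additive in \<open>p\<close>, so \<open>p\<close> may be a
      multiple of one basis element; then the scalar moves across the tensor sign.\<close>
    have "?\<tau> k (\<lambda>c. rsmult A a (p c)) = pure_tensor R A (free_module R (?B k)) a p"
    proof (rule fs_ahom_eqI[OF is_fs_free_module[OF R] Gg _ _ p, of "\<lambda>p. ?\<tau> k (\<lambda>c. rsmult A a (p c))"])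
      show "(\<lambda>p. ?\<tau> k (\<lambda>c. rsmult A a (p c))) \<in> ahom (free_module R (?B k)) (?G k)"
        by (rule ahom_compose[OF _ \<tau>h]) (use bal a in \<open>simp add: balanced_def\<close>)
      show "pure_tensor R A (free_module R (?B k)) a \<in> ahom (free_module R (?B k)) (?G k)"
        unfolding Gdef using t.pure_balanced a by (simp add: balanced_def)
      fix r b assume r: "r \<in> carrier R" and b: "b \<in> ?B k"
      have "(\<lambda>c. rsmult A a (single R b r c)) = single A b (rsmult A a r)"
        by (auto simp: single_def rsmult_zero[OF A a])
      then have "?\<tau> k (\<lambda>c. rsmult A a (single R b r c)) = ?\<tau>f k (rsmult A a r) b"
        using fext_single[OF AA Gg \<tau>b b right_module.rsmult_closed[OF A a r]] by simp
      also have "\<dots> = pure_tensor R A (free_module R (?B k)) a (smult (free_module R (?B k)) r (single R b \<one>\<^bsub>R\<^esub>))"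
        by (rule balancedD(4)[OF t.pure_balanced a r unit[OF b]])
      finally show "?\<tau> k (\<lambda>c. rsmult A a (single R b r c)) = pure_tensor R A (free_module R (?B k)) a (single R b r)"
        using r by (simp add: smult_single[OF R])
    qed
    then show "?\<tau> k (?u k (pure_tensor R A (free_module R (?B k)) a p)) = pure_tensor R A (free_module R (?B k)) a p"
      unfolding up[OF a p] .
  qed
  have uinj: "c = d" if "c \<in> carrier (?G k)" "d \<in> carrier (?G k)" "?u k c = ?u k d" for k c d
  proof -
    have "?\<tau> k (?u k c) = ?\<tau> k (?u k d)" by (rule arg_cong[OF that(3)])
    then show ?thesis unfolding \<tau>u[OF that(1)] \<tau>u[OF that(2)] .
  qed
  have usurj: "\<exists>c\<in>carrier (?G k). ?u k c = f" if "f \<in> carrier (fs_group A (?B k))" for k f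
  proof
    show "?\<tau> k f \<in> carrier (?G k)" by (rule ahom_closed[OF \<tau>h that])
    show "?u k (?\<tau> k f) = f" by (rule u\<tau>) (use that in \<open>simp only: carrier_fs_group\<close>)
  qed
  have rd: "res_diff R X k = flin R (?B k) (syz_val R)" for k by (simp add: res_diff_def res_mod_def)
  have rdh: "res_diff R X k \<in> ahom (free_module R (?B (Suc k))) (free_module R (?B k))" for k
    unfolding rd by (rule flin_ahom[OF R P.D_closed])
  have rdc: "res_diff R X k p \<in> fsupp R (?B k)" if "p \<in> fsupp R (?B (Suc k))" for k p
    unfolding rd by (rule flin_closed[OF R P.D_closed that])
  let ?\<delta> = "\<lambda>k a p. pure_tensor R A (free_module R (?B k)) a (res_diff R X k p)"
  have dbal: "balanced R A (free_module R (?B (Suc k))) (?G k) (?\<delta> k)" for k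
    unfolding Gdef
  proof (rule balancedI)
    note pb = balancedD[OF t.pure_balanced] and c = ahom_closed[OF rdh] and ad = ahom_add[OF rdh]
    fix a p assume a: "a \<in> carrier A" and p: "p \<in> carrier (free_module R (?B (Suc k)))"
    show "?\<delta> k a p \<in> carrier (tensor_group R A (free_module R (?B k)))" by (rule pb(1)[OF a c[OF p]])
    show "?\<delta> k (a \<oplus>\<^bsub>A\<^esub> a') p = ?\<delta> k a p \<oplus>\<^bsub>tensor_group R A (free_module R (?B k))\<^esub> ?\<delta> k a' p" if "a' \<in> carrier A" for a'
      by (rule pb(2)[OF a that c[OF p]])
    show "?\<delta> k a (p \<oplus>\<^bsub>free_module R (?B (Suc k))\<^esub> q) = ?\<delta> k a p \<oplus>\<^bsub>tensor_group R A (free_module R (?B k))\<^esub> ?\<delta> k a q"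
      if q: "q \<in> carrier (free_module R (?B (Suc k)))" for q
      unfolding ad[OF p q] by (rule pb(3)[OF a c[OF p] c[OF q]])
    show "?\<delta> k (rsmult A a r) p = ?\<delta> k a (smult (free_module R (?B (Suc k))) r p)" if r: "r \<in> carrier R" for r
    proof -
      have "res_diff R X k (smult (free_module R (?B (Suc k))) r p) = smult (free_module R (?B k)) r (res_diff R X k p)"
        unfolding rd by (rule lin_smult[OF free_left_module[OF R] _ _ r]) (use p in \<open>simp_all add: carrier_free_module P.D_closed\<close>)
      then show ?thesis using pb(4)[OF a r c[OF p]] by simp
    qed
  qed
  have td: "tor_diff R k A X = tensor_lift (?G k) (?\<delta> k)" for k
    by (simp add: tor_diff_def res_mod_def)
  have tdh: "tor_diff R k A X \<in> ahom (?G (Suc k)) (?G k)" for k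
    unfolding td Gdef[of "Suc k"] by (rule t.tensor_lift_ahom[OF Gg dbal])
  have du: "?u k (tor_diff R k A X c) = rext A (?B k) (syz_val R) (?u (Suc k) c)" if c: "c \<in> carrier (?G (Suc k))" for k c
  proof (rule t.ahom_eqI[OF fg _ _ c[unfolded Gdef], where h = "\<lambda>c. ?u k (tor_diff R k A X c)" and h' = "\<lambda>c. rext A (?B k) (syz_val R) (?u (Suc k) c)"])
    show "(\<lambda>c. ?u k (tor_diff R k A X c)) \<in> ahom (tensor_group R A (free_module R (?B (Suc k)))) (fs_group A (?B k))"
      unfolding Gdef[of "Suc k", symmetric] by (rule ahom_compose[OF tdh uh])
    have "(\<lambda>c. rext A (?B k) (syz_val R) (?u (Suc k) c)) \<in> ahom (?G (Suc k)) (fs_group A (?B k))"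
      by (rule ahom_compose[OF uh rext_ahom[OF A P.D_closed]])
    then show "(\<lambda>c. rext A (?B k) (syz_val R) (?u (Suc k) c)) \<in> ahom (tensor_group R A (free_module R (?B (Suc k)))) (fs_group A (?B k))"
      by (simp only: Gdef)
    fix a p assume a: "a \<in> carrier A" and pc: "p \<in> carrier (free_module R (?B (Suc k)))"
    then have p: "p \<in> fsupp R (?B (Suc k))" by (simp only: carrier_free_module)
    have 1: "tor_diff R k A X (pure_tensor R A (free_module R (?B (Suc k))) a p) = ?\<delta> k a p"
      unfolding td by (rule t.tensor_lift_pure[OF Gg dbal a pc])
    have 2: "rext A (?B k) (syz_val R) (\<lambda>c. rsmult A a (p c)) = (\<lambda>c. rsmult A a (flin R (?B k) (syz_val R) p c))"
      by (rule rext_rsmult[OF A P.D_closed a p])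
    show "?u k (tor_diff R k A X (pure_tensor R A (free_module R (?B (Suc k))) a p))
      = rext A (?B k) (syz_val R) (?u (Suc k) (pure_tensor R A (free_module R (?B (Suc k))) a p))"
      unfolding 1 up[OF a p] up[OF a rdc[OF p]] 2 by (simp add: rd)
  qed
  \<comment> \<open>That the differential squares to zero is pulled back along the injective
    \<open>?u k\<close> from the complex of direct sums.\<close>
  have tdd: "tor_diff R k A X (tor_diff R (Suc k) A X c) = \<zero>\<^bsub>?G k\<^esub>" if c: "c \<in> carrier (?G (Suc (Suc k)))" for k c
  proof (rule uinj)
    have c1: "tor_diff R (Suc k) A X c \<in> carrier (?G (Suc k))" by (rule ahom_closed[OF tdh c])
    show "tor_diff R k A X (tor_diff R (Suc k) A X c) \<in> carrier (?G k)" by (rule ahom_closed[OF tdh c1])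
    show "\<zero>\<^bsub>?G k\<^esub> \<in> carrier (?G k)" by (rule abelian_groupE(2)[OF Gg])
    have "rext A (?B k) (syz_val R) (rext A (?B (Suc k)) (syz_val R) (?u (Suc (Suc k)) c)) = \<zero>\<^bsub>fs_group A (?B k)\<^esub>"
      using P.bTor_complex[OF A, of k] ahom_closed[OF uh c] unfolding complex3_def by blast
    then show "?u k (tor_diff R k A X (tor_diff R (Suc k) A X c)) = ?u k \<zero>\<^bsub>?G k\<^esub>"
      unfolding du[OF c1] du[OF c] ahom_zero[OF Gg fg uh] .
  qed
  have eq: "Tor R (Suc k) A X = homology (?G (Suc (Suc k))) (tor_diff R (Suc k) A X) (?G (Suc k)) (tor_diff R k A X) (?G k)"
    unfolding Tor_def homology_def tor_boundaries_def tor_cycles.simps ..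
  have complex: "complex3 (?G (Suc (Suc k))) (tor_diff R (Suc k) A X) (?G (Suc k)) (tor_diff R k A X) (?G k)"
    unfolding complex3_def using Gg tdh tdd by blast
  show "group (Tor R (Suc k) A X)" unfolding eq by (rule homology_group[OF complex])
  show iso: "Tor R (Suc k) A X \<cong> bTor A (res_basis R X) (\<lambda>_. syz_val R) k"
    unfolding eq bTor_def
    by (rule complex_iso[where ?u0.0 = "?u (Suc (Suc k))" and ?u1.0 = "?u (Suc k)" and ?u2.0 = "?u k", OF complex P.bTor_complex[OF A] ahom_closed[OF uh] usurj uh usurj uinj uh uinj du du])
  assume "trivial_group (Tor R (Suc k) A X)"
  moreover have "group (bTor A (res_basis R X) (\<lambda>_. syz_val R) k)"
    unfolding bTor_def by (rule homology_group[OF P.bTor_complex[OF A]])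
  ultimately show "trivial_group (bTor A (res_basis R X) (\<lambda>_. syz_val R) k)"
    using isomorphic_group_triviality1[OF iso] by blast
qed

section \<open>Extension of scalars to the trivial extension\<close>

text \<open>A subgroup becomes the zero set of an additive map. Membership in an image can then be
  tested by comparing additive maps, and on a tensor product this is a matter of pure
  tensors.\<close>

lemma ex_quotient:
  fixes G :: "('a, 'p) ring_scheme"
  assumes G: "abelian_group G" and I: "asub I G"
  shows "\<exists>(Q :: 'a set ring) q. abelian_group Q \<and> q \<in> ahom G Q \<and>
    (\<forall>x\<in>carrier G. q x = \<zero>\<^bsub>Q\<^esub> \<longleftrightarrow> x \<in> I)"
proof -
  let ?M = "add_monoid G"
  let ?Q = "\<lparr>carrier = carrier (?M Mod I), monoid.mult = undefined, one = undefined, ring.zero = I, ring.add = set_mult ?M\<rparr> :: 'a set ring"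
  interpret G: abelian_group G by fact
  interpret N: normal I ?M
    using asub_normal[OF G asub_carrier[OF G] I] asubD(1)[OF I] by auto
  have sg: "subgroup I ?M" by (rule N.subgroup_axioms)
  have "comm_group (?M Mod I)" by (rule comm_group.abelian_FactGroup[OF G.a_comm_group sg])
  then have "comm_group (add_monoid ?Q)" by (simp add: FactGroup_def)
  then have Q: "abelian_group ?Q" by (rule comm_group_abelian_groupI)
  let ?q = "\<lambda>x. I #>\<^bsub>?M\<^esub> x"
  have q: "?q \<in> ahom G ?Q"
    using N.r_coset_hom_Mod by (auto simp: ahom_def hom_def)
  have "?q x = \<zero>\<^bsub>?Q\<^esub> \<longleftrightarrow> x \<in> I" if "x \<in> carrier G" for x
    using group.rcos_self[OF G.a_group _ sg, of x] group.coset_join2[OF G.a_group _ sg, of x] that by auto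
  then show ?thesis using Q q by blast
qed

text \<open>\<open>finsum\<close> depends on the additive part of a record only, which a module
  shares with its restriction of scalars although the record types differ.\<close>

lemma finsum_same:
  assumes "carrier G = carrier H" "ring.add G = ring.add H" "\<zero>\<^bsub>G\<^esub> = \<zero>\<^bsub>H\<^esub>"
  shows "finsum G f A = finsum H f A"
  by (simp add: finsum_def finprod_def assms)

context trivial_extension
begin

abbreviation "S' \<equiv> restrict_right e (regular_bimodule S)"

lemma bimodule_S': "bimodule S R S'"
  by (rule restrict_regular_bimodule[OF R S e_hom])

interpretation S: ring S by (rule S)

lemmas RA = ring.is_abelian_group[OF R] and R1 = monoid.one_closed[OF ring.is_monoid[OF R]]

lemma S'_simps:
  "carrier S' = carrier S" "ring.add S' = ring.add S" "\<zero>\<^bsub>S'\<^esub> = \<zero>\<^bsub>S\<^esub>" "smult S' s t = s \<otimes>\<^bsub>S\<^esub> t"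
  "rsmult S' s r = s \<otimes>\<^bsub>S\<^esub> e r"
  by (simp_all add: restrict_right_simps regular_simps)

text \<open>The map \<open>p \<mapsto> 1 \<otimes> p\<close> from a free module over
  \<open>R\<close> to its extension of scalars, the free module over the trivial extension on the
  same basis.\<close>

definition scalars :: "('b \<Rightarrow> 'r) \<Rightarrow> 'b \<Rightarrow> ('r, 'm) ntriv_el" where
  "scalars p = (\<lambda>b. e (p b))"

lemma scalars_closed:
  assumes "p \<in> fsupp R B"
  shows "scalars p \<in> fsupp S B"
  unfolding scalars_def
  by (rule fsuppI[OF _ _ fsuppD(3)[OF assms]])
    (use fsuppD(1,2)[OF assms] in \<open>auto simp: e_closed e_zero e_eq_zero\<close>)

lemma scalars_ahom: "scalars \<in> ahom (free_module R B) (free_module S B)"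
proof (rule ahomI)
  fix x y assume "x \<in> carrier (free_module R B)" "y \<in> carrier (free_module R B)"
  then have x: "x \<in> fsupp R B" and y: "y \<in> fsupp R B" by (simp_all add: carrier_free_module)
  show "scalars (x \<oplus>\<^bsub>free_module R B\<^esub> y) = scalars x \<oplus>\<^bsub>free_module S B\<^esub> scalars y"
    using fsupp_closed[OF x RA] fsupp_closed[OF y RA]
    by (simp add: scalars_def add_free_module e_add)
qed (simp add: carrier_free_module scalars_closed)

lemma scalars_smult:
  assumes "r \<in> carrier R" "p \<in> fsupp R B"
  shows "scalars (smult (free_module R B) r p) = smult (free_module S B) (e r) (scalars p)"
  using assms(1) fsupp_closed[OF assms(2) RA] by (simp add: scalars_def smult_free_module e_mult)

lemma scalars_single: "scalars (single R b r) = single S b (e r)"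
  by (auto simp: scalars_def single_def e_zero)

text \<open>On \<open>single R b r\<close> both sides are the multiple by \<open>e r\<close> of
  \<open>scalars (\<alpha> b)\<close>. Thus \<open>scalars\<close> is a map between the complex over
  \<open>R\<close> and the extended one.\<close>

lemma scalars_flin:
  assumes \<alpha>: "\<And>b. b \<in> B \<Longrightarrow> \<alpha> b \<in> fsupp R B'" and p: "p \<in> fsupp R B"
  shows "flin S B' (\<lambda>b. scalars (\<alpha> b)) (scalars p) = scalars (flin R B' \<alpha> p)"
proof (rule fs_ahom_eqI[OF is_fs_free_module[OF R] free_group[OF S] _ _ p])
  have s\<alpha>: "\<And>b. b \<in> B \<Longrightarrow> scalars (\<alpha> b) \<in> fsupp S B'" by (rule scalars_closed[OF \<alpha>])
  have s\<alpha>': "\<And>b. b \<in> B \<Longrightarrow> scalars (\<alpha> b) \<in> carrier (free_module S B')" using s\<alpha> by (simp add: carrier_free_module)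
  have \<alpha>': "\<And>b. b \<in> B \<Longrightarrow> \<alpha> b \<in> carrier (free_module R B')" using \<alpha> by (simp add: carrier_free_module)
  show "(\<lambda>p. flin S B' (\<lambda>b. scalars (\<alpha> b)) (scalars p)) \<in> ahom (free_module R B) (free_module S B')"
    by (rule ahom_compose[OF scalars_ahom flin_ahom[OF S s\<alpha>]])
  show "(\<lambda>p. scalars (flin R B' \<alpha> p)) \<in> ahom (free_module R B) (free_module S B')"
    by (rule ahom_compose[OF flin_ahom[OF R \<alpha>] scalars_ahom])
  fix r b assume r: "r \<in> carrier R" and b: "b \<in> B"
  have "flin S B' (\<lambda>b. scalars (\<alpha> b)) (single S b (e r)) = smult (free_module S B') (e r) (scalars (\<alpha> b))"
    by (rule lin_single[OF free_left_module[OF S] s\<alpha>' b e_closed[OF r]])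
  moreover have "flin R B' \<alpha> (single R b r) = smult (free_module R B') r (\<alpha> b)"
    by (rule lin_single[OF free_left_module[OF R] \<alpha>' b r])
  ultimately show "flin S B' (\<lambda>b. scalars (\<alpha> b)) (scalars (single R b r)) = scalars (flin R B' \<alpha> (single R b r))"
    using scalars_smult[OF r \<alpha>[OF b]] by (simp add: scalars_single)
qed

text \<open>The projection of a direct sum of copies of the trivial extension onto its part of
  degree \<open>i\<close>.\<close>

definition comp :: "nat \<Rightarrow> ('b \<Rightarrow> ('r, 'm) ntriv_el) \<Rightarrow> 'b \<Rightarrow> ('r, 'm) tpow_el" where
  "comp i \<phi> = (\<lambda>b. \<phi> b i)"

lemma PA: "abelian_group (P i)"
  by (rule P.left.M.abelian_group_axioms)

lemma comp_closed:
  assumes i: "i \<le> n" and \<phi>: "\<phi> \<in> fsupp S B"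
  shows "comp i \<phi> \<in> fsupp (P i) B"
  unfolding comp_def
  by (rule fsuppI[OF _ _ fsuppD(3)[OF \<phi>]])
    (use fsuppD(1,2)[OF \<phi>] i in \<open>auto simp: S_comp zero_S simp del: tpow.simps\<close>)

lemma comp_ahom: "i \<le> n \<Longrightarrow> comp i \<in> ahom (free_module S B) (fs_group (P i) B)"
  by (rule ahomI) (simp_all add: carrier_free_module carrier_fs_group comp_closed,
      simp add: comp_def add_free_module add_fs_group add_S del: tpow.simps)

lemma comp_single: "i \<le> n \<Longrightarrow> comp i (single S b s) = single (P i) b (s i)"
  by (auto simp: comp_def single_def zero_S simp del: tpow.simps)

text \<open>Right multiplication by \<open>e r\<close> acts on the component of degree
  \<open>i\<close> as \<open>r\<close> does (\<open>e_right\<close>). So the extended map splits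
  into the maps obtained by tensoring with the right modules \<open>P i\<close>, and exactness can
  be studied for each \<open>i\<close>.\<close>

lemma comp_flin:
  assumes i: "i \<le> n" and \<alpha>: "\<And>b. b \<in> B \<Longrightarrow> \<alpha> b \<in> fsupp R B'" and \<phi>: "\<phi> \<in> fsupp S B"
  shows "comp i (flin S B' (\<lambda>b. scalars (\<alpha> b)) \<phi>) = rext (P i) B' \<alpha> (comp i \<phi>)"
proof (rule fs_ahom_eqI[OF is_fs_free_module[OF S] fs_group_group[OF PA] _ _ \<phi>])
  have s\<alpha>: "\<And>b. b \<in> B \<Longrightarrow> scalars (\<alpha> b) \<in> fsupp S B'" by (rule scalars_closed[OF \<alpha>])
  have s\<alpha>': "\<And>b. b \<in> B \<Longrightarrow> scalars (\<alpha> b) \<in> carrier (free_module S B')" using s\<alpha> by (simp add: carrier_free_module)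
  show "(\<lambda>\<phi>. comp i (flin S B' (\<lambda>b. scalars (\<alpha> b)) \<phi>)) \<in> ahom (free_module S B) (fs_group (P i) B')"
    by (rule ahom_compose[OF flin_ahom[OF S s\<alpha>] comp_ahom[OF i]])
  show "(\<lambda>\<phi>. rext (P i) B' \<alpha> (comp i \<phi>)) \<in> ahom (free_module S B) (fs_group (P i) B')"
    by (rule ahom_compose[OF comp_ahom[OF i] rext_ahom[OF bimoduleD(2)[OF P_bimodule] \<alpha>]])
  fix s b assume s: "s \<in> carrier S" and b: "b \<in> B"
  have 1: "flin S B' (\<lambda>b. scalars (\<alpha> b)) (single S b s) = smult (free_module S B') s (scalars (\<alpha> b))"
    by (rule lin_single[OF free_left_module[OF S] s\<alpha>' b s])
  have 2: "rext (P i) B' \<alpha> (single (P i) b (s i)) = (\<lambda>c. rsmult (P i) (s i) (\<alpha> b c))"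
    by (rule rext_single[OF bimoduleD(2)[OF P_bimodule] \<alpha> b S_comp[OF s i]])
  show "comp i (flin S B' (\<lambda>b. scalars (\<alpha> b)) (single S b s)) = rext (P i) B' \<alpha> (comp i (single S b s))"
    unfolding 1 comp_single[OF i] 2
    using e_right[OF fsupp_closed[OF \<alpha>[OF b] RA] s i]
    by (simp add: comp_def smult_free_module scalars_def del: tpow.simps)
qed

text \<open>\<open>P 0\<close> is a copy of \<open>R\<close> behind the constructor
  \<open>Scal\<close>, so tensoring with it gives the original map back.\<close>

lemma rext_P0:
  assumes \<alpha>: "\<And>b. b \<in> B \<Longrightarrow> \<alpha> b \<in> fsupp R B'" and f: "f \<in> fsupp R B"
  shows "rext (P 0) B' \<alpha> (\<lambda>b. Scal (f b)) = (\<lambda>c. Scal (flin R B' \<alpha> f c))"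
proof (rule fs_ahom_eqI[OF is_fs_free_module[OF R] fs_group_group[OF PA] _ _ f, where h = "\<lambda>f. rext (P 0) B' \<alpha> (\<lambda>b. Scal (f b))" and h' = "\<lambda>f c. Scal (flin R B' \<alpha> f c)"])
  have \<alpha>': "\<And>b. b \<in> B \<Longrightarrow> \<alpha> b \<in> carrier (free_module R B')" using \<alpha> by (simp add: carrier_free_module)
  have sc: "(\<lambda>f b. Scal (f b)) \<in> ahom (free_module R X) (fs_group (P 0) X)" for X :: "'x set"
  proof (rule ahomI)
    fix f g assume "f \<in> carrier (free_module R X)" "g \<in> carrier (free_module R X)"
    then have fg: "f \<in> fsupp R X" "g \<in> fsupp R X" by (simp_all add: carrier_free_module)
    show "(\<lambda>b. Scal ((f \<oplus>\<^bsub>free_module R X\<^esub> g) b)) = (\<lambda>b. Scal (f b)) \<oplus>\<^bsub>fs_group (P 0) X\<^esub> (\<lambda>b. Scal (g b))"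
      using fsupp_closed[OF fg(1) RA] fsupp_closed[OF fg(2) RA]
      by (simp add: add_free_module add_fs_group P0 del: tpow.simps)
  next
    fix f assume "f \<in> carrier (free_module R X)"
    then have f: "f \<in> fsupp R X" by (simp add: carrier_free_module)
    show "(\<lambda>b. Scal (f b)) \<in> carrier (fs_group (P 0) X)"
      unfolding carrier_fs_group
      by (rule fsuppI[OF _ _ fsuppD(3)[OF f]]) (use fsuppD(1,2)[OF f] in \<open>auto simp: P0 simp del: tpow.simps\<close>)
  qed
  show "(\<lambda>f. rext (P 0) B' \<alpha> (\<lambda>b. Scal (f b))) \<in> ahom (free_module R B) (fs_group (P 0) B')"
    by (rule ahom_compose[OF sc rext_ahom[OF bimoduleD(2)[OF P_bimodule] \<alpha>]])
  show "(\<lambda>f c. Scal (flin R B' \<alpha> f c)) \<in> ahom (free_module R B) (fs_group (P 0) B')"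
    by (rule ahom_compose[OF flin_ahom[OF R \<alpha>] sc])
  fix r b assume r: "r \<in> carrier R" and b: "b \<in> B"
  have "(\<lambda>c. Scal (single R b r c)) = single (P 0) b (Scal r)"
    by (auto simp: single_def P0 simp del: tpow.simps)
  moreover have "rext (P 0) B' \<alpha> (single (P 0) b (Scal r)) = (\<lambda>c. rsmult (P 0) (Scal r) (\<alpha> b c))"
    by (rule rext_single[OF bimoduleD(2)[OF P_bimodule] \<alpha> b scal_closed[OF r]])
  moreover have "flin R B' \<alpha> (single R b r) = smult (free_module R B') r (\<alpha> b)"
    by (rule lin_single[OF free_left_module[OF R] \<alpha>' b r])
  ultimately show "rext (P 0) B' \<alpha> (\<lambda>c. Scal (single R b r c)) = (\<lambda>c. Scal (flin R B' \<alpha> (single R b r) c))"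
    using r by (simp add: smult_free_module P0 del: tpow.simps)
qed

end

section \<open>The resolution of T(X) obtained by extension of scalars\<close>

locale trivial_extension_tor = trivial_extension R M n
  for R :: "('r, 'z) ring_scheme" and M :: "('r, 'm, 'r, 'y) bimodule_scheme" and n :: nat +
  fixes X :: "('r, 'x, 'c) module_scheme"
  assumes X: "left_module R X"
    and tor: "\<And>i j. i \<ge> 1 \<Longrightarrow> j \<ge> 1 \<Longrightarrow> trivial_group (Tor R j (tpow R M i) X)"
begin

interpretation S: ring S by (rule S)

abbreviation "B \<equiv> res_basis R X"
abbreviation "TX \<equiv> T_fun n R M X"
abbreviation "DS \<equiv> \<lambda>k::nat. \<lambda>b. scalars (syz_val R b)"
abbreviation "pure \<equiv> pure_tensor R S' X"
definition eps :: "('r, 'x) res_gen \<Rightarrow> (('r, 'm) ntriv_el \<times> 'x \<Rightarrow>\<^sub>0 int) set" where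
  "eps b = pure \<one>\<^bsub>S\<^esub> (gen_val b)"

sublocale Q: resolution R X B "\<lambda>_. syz_val R" gen_val
  by (rule canonical_resolution[OF X])

sublocale t: tensor_left S R S' X
  unfolding tensor_left_def tensor_def using bimodule_S' X by (simp add: bimoduleD)

lemma TX: "left_module S TX"
  unfolding T_fun_def by (rule t.tensor_left_module)

lemma TX_simps: "carrier TX = carrier t.T" "ring.add TX = ring.add t.T" "\<zero>\<^bsub>TX\<^esub> = \<zero>\<^bsub>t.T\<^esub>"
  "smult TX s = smult (tensor_module R S' X) s"
  by (simp_all add: T_fun_def tensor_module_simps(1-3))

lemma TX_ahom: "ahom G TX = ahom G t.T" "ahom TX H = ahom t.T H"
  by (auto simp: ahom_def TX_simps)

lemma DS_closed: "b \<in> B (Suc k) \<Longrightarrow> DS k b \<in> fsupp S (B k)"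
  by (rule scalars_closed[OF Q.D_closed])

lemma eps_closed: "b \<in> B 0 \<Longrightarrow> eps b \<in> carrier TX"
  unfolding eps_def TX_simps by (rule t.pure_closed) (auto simp: S'_simps)

lemma aug_single:
  assumes "s \<in> carrier S" "x \<in> carrier X"
  shows "linear_extension S TX eps (single S (Gen x) s) = pure s x"
proof -
  have b: "(Gen x :: ('r, 'x) res_gen) \<in> B 0" using assms by simp
  have "linear_extension S TX eps (single S (Gen x) s) = smult TX s (eps (Gen x))"
    by (rule lin_single[OF TX eps_closed b assms(1)])
  also have "\<dots> = pure (s \<otimes>\<^bsub>S\<^esub> \<one>\<^bsub>S\<^esub>) x"
    unfolding TX_simps eps_def using t.tensor_smult_pure[of s "\<one>\<^bsub>S\<^esub>" x] assms by (simp add: S'_simps)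
  finally show ?thesis using assms by simp
qed

text \<open>The augmentations over the two rings are related by
  \<open>x \<mapsto> 1 \<otimes> x\<close>; hence \<open>scalars\<close> takes cycles of degree 0 to
  cycles.\<close>

lemma aug_scalars:
  assumes p: "p \<in> fsupp R (B 0)"
  shows "linear_extension S TX eps (scalars p) = pure \<one>\<^bsub>S\<^esub> (linear_extension R X gen_val p)"
proof (rule fs_ahom_eqI[OF is_fs_free_module[OF R] left_moduleD(2)[OF TX] _ _ p])
  show "(\<lambda>p. linear_extension S TX eps (scalars p)) \<in> ahom (free_module R (B 0)) TX"
    by (rule ahom_compose[OF scalars_ahom lin_ahom[OF TX eps_closed]])
  show "(\<lambda>p. pure \<one>\<^bsub>S\<^esub> (linear_extension R X gen_val p)) \<in> ahom (free_module R (B 0)) TX"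
    unfolding TX_ahom
    by (rule ahom_compose[OF lin_ahom[OF X Q.aug_closed]]) (use t.pure_balanced in \<open>auto simp: balanced_def S'_simps\<close>)
  fix r b assume r: "r \<in> carrier R" and b: "b \<in> B 0"
  obtain x where x: "x \<in> carrier X" "b = Gen x" using b by auto
  have "linear_extension R X gen_val (single R b r) = smult X r (gen_val b)"
    by (rule lin_single[OF X Q.aug_closed b r])
  then have 1: "linear_extension R X gen_val (single R b r) = smult X r x" using x by simp
  have "pure (rsmult S' \<one>\<^bsub>S\<^esub> r) x = pure \<one>\<^bsub>S\<^esub> (smult X r x)"
    by (rule balancedD(4)[OF t.pure_balanced _ r x(1)]) (simp add: S'_simps)
  then show "linear_extension S TX eps (scalars (single R b r)) = pure \<one>\<^bsub>S\<^esub> (linear_extension R X gen_val (single R b r))"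
    unfolding x(2) 1[unfolded x(2)] scalars_single aug_single[OF e_closed[OF r] x(1)] using r by (simp add: S'_simps e_closed)
qed

lemma DS_cycle:
  assumes b: "b \<in> B (Suc k)"
  shows "DS k b \<in> based_cycles S TX B DS eps k"
proof (cases k)
  case 0
  have c: "syz_val R b \<in> fsupp R (B 0)" using Q.D_closed[of b 0] b 0 by simp
  have "linear_extension R X gen_val (syz_val R b) = \<zero>\<^bsub>X\<^esub>" using Q.D_cycle[of b 0] b 0 by simp
  then have "linear_extension S TX eps (DS 0 b) = pure \<one>\<^bsub>S\<^esub> \<zero>\<^bsub>X\<^esub>"
    using aug_scalars[OF c] by simp
  also have "\<dots> = \<zero>\<^bsub>t.T\<^esub>"
    by (rule ahom_zero[OF left_moduleD(2)[OF X] t.T.abelian_group_axioms])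
      (use t.pure_balanced in \<open>auto simp: balanced_def S'_simps\<close>)
  finally show ?thesis using scalars_closed[OF c] 0 by (simp add: TX_simps del: res_basis.simps)
next
  case (Suc j)
  have c: "syz_val R b \<in> fsupp R (B (Suc j))" using Q.D_closed[of b "Suc j"] b Suc by simp
  have "flin R (B j) (syz_val R) (syz_val R b) = \<zero>\<^bsub>free_module R (B j)\<^esub>"
    using Q.DD[of b j] b Suc by simp
  moreover have "flin S (B j) (DS j) (scalars (syz_val R b)) = scalars (flin R (B j) (syz_val R) (syz_val R b))"
    by (rule scalars_flin[OF Q.D_closed c])
  moreover have "scalars \<zero>\<^bsub>free_module R (B j)\<^esub> = \<zero>\<^bsub>free_module S (B j)\<^esub>"
    by (rule ahom_zero[OF free_group[OF R] free_group[OF S] scalars_ahom])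
  ultimately show ?thesis using scalars_closed[OF c] Suc by (simp del: res_basis.simps)
qed

text \<open>For \<open>i \<ge> 1\<close> this is the vanishing of Tor with coefficients in
  \<open>P i\<close>; for \<open>i = 0\<close> it is exactness of the canonical resolution itself,
  transported along \<open>Scal\<close>.\<close>

lemma exact_P:
  assumes f: "f \<in> fsupp (P i) (B (Suc k))" and z: "rext (P i) (B k) (syz_val R) f = \<zero>\<^bsub>fs_group (P i) (B k)\<^esub>"
  shows "\<exists>g\<in>fsupp (P i) (B (Suc (Suc k))). rext (P i) (B (Suc k)) (syz_val R) g = f"
proof (cases "i = 0")
  case False
  have A: "right_module R (P i)" by (rule bimoduleD(2)[OF P_bimodule])
  have tr: "trivial_group (bTor (P i) B (\<lambda>_. syz_val R) k)"
    by (rule tor_vanish[OF X A tor]) (use False in auto)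
  have cx: "complex3 (fs_group (P i) (B (Suc (Suc k)))) (rext (P i) (B (Suc k)) (syz_val R)) (fs_group (P i) (B (Suc k)))
     (rext (P i) (B k) (syz_val R)) (fs_group (P i) (B k))"
    by (rule Q.bTor_complex[OF A])
  have "f \<in> rext (P i) (B (Suc k)) (syz_val R) ` carrier (fs_group (P i) (B (Suc (Suc k))))"
    by (rule trivial_subquotient_imp[OF tr[unfolded bTor_def homology_def] fs_group_group[OF PA] _ asubD(2)[OF complex3_asub(2)[OF cx]]])
      (use f z in \<open>simp_all add: carrier_fs_group del: tpow.simps res_basis.simps\<close>)
  then show ?thesis by (auto simp: carrier_fs_group simp del: tpow.simps)
next
  case True
  define f' where "f' = (\<lambda>b. the_scal (f b))"
  have ff: "f = (\<lambda>b. Scal (f' b))"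
  proof
    fix b
    have "f b \<in> carrier (P 0)" using fsupp_closed[OF f PA] True by simp
    then show "f b = Scal (f' b)" by (auto simp: f'_def P0 simp del: tpow.simps)
  qed
  have f': "f' \<in> fsupp R (B (Suc k))"
  proof (rule fsuppI)
    show "f' b \<in> carrier R" if "b \<in> B (Suc k)" for b
      using fsuppD(1)[OF f that] True by (auto simp: f'_def P0 simp del: tpow.simps)
    show "f' b = \<zero>\<^bsub>R\<^esub>" if "b \<notin> B (Suc k)" for b
      using fsuppD(2)[OF f that] True by (auto simp: f'_def P0 simp del: tpow.simps)
    show "finite {b. f b \<noteq> \<zero>\<^bsub>P i\<^esub>}" by (rule fsuppD(3)[OF f])
    show "{b. f' b \<noteq> \<zero>\<^bsub>R\<^esub>} \<subseteq> {b. f b \<noteq> \<zero>\<^bsub>P i\<^esub>}"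
      using True by (auto simp: f'_def P0 simp del: tpow.simps)
  qed
  have "(\<lambda>c. Scal (flin R (B k) (syz_val R) f' c)) = \<zero>\<^bsub>fs_group (P 0) (B k)\<^esub>"
    using rext_P0[OF Q.D_closed f'] z True ff by simp
  then have "flin R (B k) (syz_val R) f' = \<zero>\<^bsub>free_module R (B k)\<^esub>"
    by (auto simp: zero_fs_group zero_free_module P0 fun_eq_iff simp del: tpow.simps)
  then have "f' \<in> Q.Z (Suc k)" using f' by simp
  then obtain g where g: "g \<in> fsupp R (B (Suc (Suc k)))" "flin R (B (Suc k)) (syz_val R) g = f'"
    using Q.exact by blast
  have "rext (P 0) (B (Suc k)) (syz_val R) (\<lambda>b. Scal (g b)) = f"
    using rext_P0[OF Q.D_closed g(1)] g(2) ff by simp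
  moreover have "(\<lambda>b. Scal (g b)) \<in> fsupp (P 0) (B (Suc (Suc k)))"
    by (rule fsuppI[OF _ _ fsuppD(3)[OF g(1)]]) (use fsuppD(1,2)[OF g(1)] in \<open>auto simp: P0 simp del: tpow.simps res_basis.simps\<close>)
  ultimately show ?thesis using True by auto
qed

text \<open>The components of a cycle are cycles, they have preimages by \<open>exact_P\<close>, and
  the preimages are put together to one vector. Its support is finite because only the degrees up to
  \<open>n\<close> occur.\<close>

lemma DS_exact_Suc:
  assumes \<phi>: "\<phi> \<in> fsupp S (B (Suc k))" and z: "flin S (B k) (DS k) \<phi> = \<zero>\<^bsub>free_module S (B k)\<^esub>"
  shows "\<exists>\<psi>\<in>fsupp S (B (Suc (Suc k))). flin S (B (Suc k)) (DS (Suc k)) \<psi> = \<phi>"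
proof -
  have "\<exists>g. g \<in> fsupp (P i) (B (Suc (Suc k))) \<and> rext (P i) (B (Suc k)) (syz_val R) g = comp i \<phi>" if i: "i \<le> n" for i
  proof -
    have "rext (P i) (B k) (syz_val R) (comp i \<phi>) = comp i (flin S (B k) (DS k) \<phi>)"
      by (rule comp_flin[OF i Q.D_closed \<phi>, symmetric])
    also have "\<dots> = \<zero>\<^bsub>fs_group (P i) (B k)\<^esub>"
      unfolding z by (rule ahom_zero[OF free_group[OF S] fs_group_group[OF PA] comp_ahom[OF i]])
    finally show ?thesis using exact_P[OF comp_closed[OF i \<phi>]] by blast
  qed
  then obtain g where g: "\<And>i. i \<le> n \<Longrightarrow> g i \<in> fsupp (P i) (B (Suc (Suc k)))"
    "\<And>i. i \<le> n \<Longrightarrow> rext (P i) (B (Suc k)) (syz_val R) (g i) = comp i \<phi>" by metis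
  define \<psi> where "\<psi> = (\<lambda>b. \<lambda>i\<in>{..n}. g i b)"
  have \<psi>S: "\<psi> b \<in> carrier S" for b
    unfolding carrier_S \<psi>_def using fsupp_closed[OF g(1) PA] by (auto simp del: tpow.simps)
  have z\<psi>: "\<psi> b = \<zero>\<^bsub>S\<^esub>" if "\<And>i. i \<le> n \<Longrightarrow> g i b = \<zero>\<^bsub>P i\<^esub>" for b
    by (rule S_eqI[OF \<psi>S S.zero_closed]) (simp add: \<psi>_def zero_S that del: tpow.simps)
  have \<psi>: "\<psi> \<in> fsupp S (B (Suc (Suc k)))"
  proof (rule fsuppI[OF \<psi>S])
    show "\<psi> b = \<zero>\<^bsub>S\<^esub>" if "b \<notin> B (Suc (Suc k))" for b
      by (rule z\<psi>) (rule fsuppD(2)[OF g(1) that])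
    show "finite (\<Union>i\<le>n. {b. g i b \<noteq> \<zero>\<^bsub>P i\<^esub>})" by (intro finite_UN_I) (auto intro: fsuppD(3)[OF g(1)])
    show "{b. \<psi> b \<noteq> \<zero>\<^bsub>S\<^esub>} \<subseteq> (\<Union>i\<le>n. {b. g i b \<noteq> \<zero>\<^bsub>P i\<^esub>})" using z\<psi> by blast
  qed
  have "flin S (B (Suc k)) (DS (Suc k)) \<psi> = \<phi>"
  proof
    fix b
    have c: "flin S (B (Suc k)) (DS (Suc k)) \<psi> \<in> fsupp S (B (Suc k))" by (rule flin_closed[OF S DS_closed \<psi>])
    show "flin S (B (Suc k)) (DS (Suc k)) \<psi> b = \<phi> b"
    proof (rule S_eqI[OF fsupp_closed[OF c S.is_abelian_group] fsupp_closed[OF \<phi> S.is_abelian_group]])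
      fix i assume i: "i \<le> n"
      have "comp i \<psi> = g i" using i by (simp add: comp_def \<psi>_def)
      then have "comp i (flin S (B (Suc k)) (DS (Suc k)) \<psi>) = comp i \<phi>"
        using trans[OF comp_flin[OF i Q.D_closed \<psi>]] g(2)[OF i] by simp
      then show "flin S (B (Suc k)) (DS (Suc k)) \<psi> b i = \<phi> b i" by (simp add: comp_def fun_eq_iff)
    qed
  qed
  then show ?thesis using \<psi> by blast
qed

text \<open>Exactness in degree 0 is right exactness of the tensor product: \<open>T X\<close> satisfies the relations of the
  cokernel, because additivity and balancedness of \<open>(s, x) \<mapsto> s [x]\<close> only fail by multiples of cycles over \<open>R\<close>.\<close>

lemma DS_exact_0:
  assumes \<phi>: "\<phi> \<in> fsupp S (B 0)" and z: "linear_extension S TX eps \<phi> = \<zero>\<^bsub>TX\<^esub>"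
  shows "\<exists>\<psi>\<in>fsupp S (B (Suc 0)). flin S (B 0) (DS 0) \<psi> = \<phi>"
proof -
  let ?G = "free_module S (B 0)"
  let ?I = "flin S (B 0) (DS 0) ` carrier (free_module S (B (Suc 0)))"
  interpret G: abelian_group ?G by (rule free_group[OF S])
  have dh: "flin S (B 0) (DS 0) \<in> ahom (free_module S (B (Suc 0))) ?G" by (rule flin_ahom[OF S DS_closed])
  have I: "asub ?I ?G" by (rule asub_image[OF free_group[OF S] free_group[OF S] asub_carrier[OF free_group[OF S]] dh])
  \<comment> \<open>\<open>Q\<close> is the cokernel of the first differential. An additive map from
    \<open>T X\<close> to \<open>Q\<close> that sends \<open>s \<otimes> x\<close> to the class of
    \<open>s\<close> times the generator \<open>Gen x\<close> turns the vanishing of the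
    augmentation on \<open>\<phi>\<close> into \<open>q \<phi> = 0\<close>.\<close>
  obtain Q :: "(('r, 'x) res_gen \<Rightarrow> ('r, 'm) ntriv_el) set ring" and q where Q: "abelian_group Q" and q: "q \<in> ahom ?G Q"
    and qz: "\<forall>x\<in>carrier ?G. q x = \<zero>\<^bsub>Q\<^esub> \<longleftrightarrow> x \<in> ?I"
    using ex_quotient[OF free_group[OF S] I] by blast
  interpret Q: abelian_group Q by (rule Q)
  have mult_cyc: "q (smult ?G s (scalars p)) = \<zero>\<^bsub>Q\<^esub>"
    if s: "s \<in> carrier S" and p: "p \<in> fsupp R (B 0)" "linear_extension R X gen_val p = \<zero>\<^bsub>X\<^esub>" for s p
  proof -
    obtain g where g: "g \<in> fsupp R (B (Suc 0))" "flin R (B 0) (syz_val R) g = p"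
      using Q.exact[of p 0] p by auto
    have "flin S (B 0) (DS 0) (smult (free_module S (B (Suc 0))) s (scalars g)) = smult ?G s (flin S (B 0) (DS 0) (scalars g))"
      by (rule lin_smult[OF free_left_module[OF S] _ scalars_closed[OF g(1)] s]) (simp only: carrier_free_module DS_closed)
    also have "flin S (B 0) (DS 0) (scalars g) = scalars p"
      unfolding g(2)[symmetric] by (rule scalars_flin[OF Q.D_closed g(1)])
    finally have fin: "flin S (B 0) (DS 0) (smult (free_module S (B (Suc 0))) s (scalars g)) = smult ?G s (scalars p)" .
    have gc: "smult (free_module S (B (Suc 0))) s (scalars g) \<in> carrier (free_module S (B (Suc 0)))"
      by (rule left_module.smult_closed[OF free_left_module[OF S] s])
        (simp only: carrier_free_module scalars_closed[OF g(1)])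
    have "smult ?G s (scalars p) \<in> ?I"
      using imageI[OF gc, of "flin S (B 0) (DS 0)"] unfolding fin .
    moreover have "smult ?G s (scalars p) \<in> carrier ?G"
      using left_module.smult_closed[OF free_left_module[OF S] s] scalars_closed[OF p(1)] by (simp only: carrier_free_module)
    ultimately show ?thesis using qz by blast
  qed
  let ?g = "\<lambda>x. Gen x :: ('r, 'x) res_gen"
  let ?\<Phi> = "\<lambda>s x. q (single S (?g x) s)"
  have sc: "single S (?g x) s \<in> carrier ?G" if "s \<in> carrier S" "x \<in> carrier X" for s x
    using single_closed[OF S.is_abelian_group, of "?g x" "B 0" s] that by (simp add: carrier_free_module)
  have qm: "q a = q b" if "q (a \<ominus>\<^bsub>?G\<^esub> b) = \<zero>\<^bsub>Q\<^esub>" "a \<in> carrier ?G" "b \<in> carrier ?G" for a b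
  proof -
    have "q a \<ominus>\<^bsub>Q\<^esub> q b = \<zero>\<^bsub>Q\<^esub>"
      using that(1) unfolding ahom_minus[OF G.abelian_group_axioms Q q that(2,3)] .
    then show ?thesis
      using add_minus_cancel[OF Q ahom_closed[OF q that(2)] ahom_closed[OF q that(3)]] ahom_closed[OF q that(3)] by simp
  qed
  interpret F: abelian_group "free_module R (B 0)" by (rule free_group[OF R])
  have ru: "single R (?g x) r \<in> carrier (free_module R (B 0))" if "r \<in> carrier R" "x \<in> carrier X" for r x
    using single_closed[OF RA, of "?g x" "B 0" r] that by (simp add: carrier_free_module)
  have lg: "linear_extension R X gen_val (single R (?g x) r) = smult X r x" if "r \<in> carrier R" "x \<in> carrier X" for r x
  proof -
    have "linear_extension R X gen_val (single R (?g x) r) = smult X r (gen_val (?g x))"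
      by (rule lin_single[OF X Q.aug_closed _ that(1)]) (use that in auto)
    then show ?thesis by simp
  qed
  have lh: "linear_extension R X gen_val \<in> ahom (free_module R (B 0)) X" by (rule lin_ahom[OF X Q.aug_closed])
  \<comment> \<open>As \<open>p\<close> and \<open>r\<close> times the generator of \<open>x\<close>
    have the same image in \<open>X\<close>, their difference is a cycle over \<open>R\<close>;
    multiplied by \<open>s\<close> it dies in \<open>Q\<close> by \<open>mult_cyc\<close>. With
    \<open>p\<close> the generator of \<open>smult X r x\<close> this gives balancedness, with
    \<open>p\<close> a sum of two generators and \<open>r = 1\<close> additivity in
    \<open>x\<close>.\<close>
  have key: "q (single S (?g x) (s \<otimes>\<^bsub>S\<^esub> e r) \<ominus>\<^bsub>?G\<^esub> smult ?G s (scalars p)) = \<zero>\<^bsub>Q\<^esub>"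
    if s: "s \<in> carrier S" and x: "x \<in> carrier X" and r: "r \<in> carrier R" and p: "p \<in> carrier (free_module R (B 0))"
      "linear_extension R X gen_val p = smult X r x" for s x r p
  proof -
    note rx = ru[OF r x]
    let ?c = "single R (?g x) r \<ominus>\<^bsub>free_module R (B 0)\<^esub> p"
    have "linear_extension R X gen_val ?c = smult X r x \<ominus>\<^bsub>X\<^esub> smult X r x"
      using ahom_minus[OF F.abelian_group_axioms left_moduleD(2)[OF X] lh rx p(1)] lg[OF r x] p(2) by simp
    then have cz: "linear_extension R X gen_val ?c = \<zero>\<^bsub>X\<^esub>"
      using Q.smult_closed[OF r x] by (simp add: a_minus_def Q.M.r_neg)
    have "smult ?G s (scalars ?c) = smult ?G s (single S (?g x) (e r)) \<ominus>\<^bsub>?G\<^esub> smult ?G s (scalars p)"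
      using ahom_minus[OF F.abelian_group_axioms G.abelian_group_axioms scalars_ahom rx p(1)]
        ahom_minus[OF G.abelian_group_axioms G.abelian_group_axioms smult_ahom[OF free_left_module[OF S] s]
          ahom_closed[OF scalars_ahom rx] ahom_closed[OF scalars_ahom p(1)]]
      by (simp add: scalars_single)
    also have "smult ?G s (single S (?g x) (e r)) = single S (?g x) (s \<otimes>\<^bsub>S\<^esub> e r)" by (rule smult_single[OF S s])
    finally show ?thesis
      using mult_cyc[OF s _ cz] F.minus_closed[OF rx p(1)] by (simp add: carrier_free_module)
  qed
  have sp: "smult ?G s (scalars p) \<in> carrier ?G" if "s \<in> carrier S" "p \<in> carrier (free_module R (B 0))" for s p
    by (rule left_module.smult_closed[OF free_left_module[OF S] that(1) ahom_closed[OF scalars_ahom that(2)]])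
  have key': "q (single S (?g x) (s \<otimes>\<^bsub>S\<^esub> e r)) = q (smult ?G s (scalars p))"
    if "s \<in> carrier S" "x \<in> carrier X" "r \<in> carrier R" "p \<in> carrier (free_module R (B 0))"
      "linear_extension R X gen_val p = smult X r x" for s x r p
    by (rule qm[OF key[OF that] sc sp]) (use that in \<open>auto simp: e_closed\<close>)
  have bal: "balanced R S' X Q ?\<Phi>"
  proof (rule balancedI, unfold S'_simps)
    show "?\<Phi> s x \<in> carrier Q" if "s \<in> carrier S" "x \<in> carrier X" for s x
      by (rule ahom_closed[OF q sc[OF that]])
    show "?\<Phi> (s \<oplus>\<^bsub>S\<^esub> s') x = ?\<Phi> s x \<oplus>\<^bsub>Q\<^esub> ?\<Phi> s' x" if "s \<in> carrier S" "s' \<in> carrier S" "x \<in> carrier X" for s s' x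
    proof -
      have "single S (?g x) (s \<oplus>\<^bsub>S\<^esub> s') = single S (?g x) s \<oplus>\<^bsub>?G\<^esub> single S (?g x) s'"
        by (auto simp: single_def add_free_module)
      then show ?thesis using ahom_add[OF q sc[OF that(1,3)] sc[OF that(2,3)]] by simp
    qed
    show "?\<Phi> (s \<otimes>\<^bsub>S\<^esub> e r) x = ?\<Phi> s (smult X r x)" if "s \<in> carrier S" "r \<in> carrier R" "x \<in> carrier X" for s r x
    proof -
      have rx: "smult X r x \<in> carrier X" using that Q.smult_closed by simp
      have "q (single S (?g x) (s \<otimes>\<^bsub>S\<^esub> e r)) = q (smult ?G s (scalars (single R (?g (smult X r x)) \<one>\<^bsub>R\<^esub>)))"
        by (rule key'[OF that(1,3,2) ru[OF R1 rx]]) (use lg[OF R1 rx] rx Q.smult_one in simp)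
      also have "smult ?G s (scalars (single R (?g (smult X r x)) \<one>\<^bsub>R\<^esub>)) = single S (?g (smult X r x)) s"
        using smult_single[OF S that(1), of "B 0" "?g (smult X r x)" "\<one>\<^bsub>S\<^esub>"] that(1)
        by (simp add: scalars_single ring_hom_one[OF e_hom])
      finally show ?thesis .
    qed
    show "?\<Phi> s (x \<oplus>\<^bsub>X\<^esub> y) = ?\<Phi> s x \<oplus>\<^bsub>Q\<^esub> ?\<Phi> s y" if s: "s \<in> carrier S" and x: "x \<in> carrier X" and y: "y \<in> carrier X" for s x y
    proof -
      let ?p = "single R (?g x) \<one>\<^bsub>R\<^esub> \<oplus>\<^bsub>free_module R (B 0)\<^esub> single R (?g y) \<one>\<^bsub>R\<^esub>"
      note u = ru[OF R1 x] ru[OF R1 y]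
      have xy: "x \<oplus>\<^bsub>X\<^esub> y \<in> carrier X" using x y by simp
      have se: "smult ?G s (scalars (single R (?g x) \<one>\<^bsub>R\<^esub>)) = single S (?g x) s" for x
        using smult_single[OF S s, of "B 0" "?g x" "\<one>\<^bsub>S\<^esub>"] s by (simp add: scalars_single ring_hom_one[OF e_hom])
      have "q (single S (?g (x \<oplus>\<^bsub>X\<^esub> y)) (s \<otimes>\<^bsub>S\<^esub> e \<one>\<^bsub>R\<^esub>)) = q (smult ?G s (scalars ?p))"
        by (rule key'[OF s xy R1 F.a_closed[OF u]])
          (use ahom_add[OF lh u] lg[OF R1 x] lg[OF R1 y] Q.smult_one x y xy in simp)
      also have "smult ?G s (scalars ?p) = single S (?g x) s \<oplus>\<^bsub>?G\<^esub> single S (?g y) s"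
        using ahom_add[OF scalars_ahom u] ahom_add[OF smult_ahom[OF free_left_module[OF S] s]
          ahom_closed[OF scalars_ahom u(1)] ahom_closed[OF scalars_ahom u(2)]] se by simp
      also have "q \<dots> = ?\<Phi> s x \<oplus>\<^bsub>Q\<^esub> ?\<Phi> s y" by (rule ahom_add[OF q sc[OF s x] sc[OF s y]])
      finally show ?thesis using s by (simp add: ring_hom_one[OF e_hom])
    qed
  qed
  let ?h = "tensor_lift Q ?\<Phi>"
  have h: "?h \<in> ahom t.T Q" by (rule t.tensor_lift_ahom[OF Q bal])
  \<comment> \<open>On a multiple \<open>s\<close> of the generator \<open>Gen x\<close> the
    augmentation is \<open>s \<otimes> x\<close>, which \<open>?h\<close> sends back to the class of
    that multiple.\<close>
  have "?h (linear_extension S TX eps \<phi>) = q \<phi>"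
  proof (rule fs_ahom_eqI[OF is_fs_free_module[OF S] Q _ q \<phi>, where h = "\<lambda>\<phi>. ?h (linear_extension S TX eps \<phi>)"])
    show "(\<lambda>\<phi>. ?h (linear_extension S TX eps \<phi>)) \<in> ahom ?G Q"
      by (rule ahom_compose[OF lin_ahom[OF TX eps_closed] h[folded TX_ahom(2)]])
    fix s b assume s: "s \<in> carrier S" and b: "b \<in> B 0"
    obtain x where x: "x \<in> carrier X" "b = Gen x" using b by auto
    show "?h (linear_extension S TX eps (single S b s)) = q (single S b s)"
      unfolding x(2) aug_single[OF s x(1)] by (rule t.tensor_lift_pure[OF Q bal]) (use s x in \<open>auto simp: S'_simps\<close>)
  qed
  then have "q \<phi> = \<zero>\<^bsub>Q\<^esub>"
    unfolding z TX_simps using ahom_zero[OF t.T.abelian_group_axioms Q h] by simp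
  then have "\<phi> \<in> ?I" using qz \<phi> by (simp only: carrier_free_module)
  then show ?thesis unfolding carrier_free_module by blast
qed

text \<open>The projection of \<open>T X\<close> modulo the image of the augmentation kills all pure
  tensors, hence everything.\<close>

lemma aug_surj:
  assumes "c \<in> carrier TX"
  shows "\<exists>f\<in>fsupp S (B 0). linear_extension S TX eps f = c"
proof -
  let ?I = "linear_extension S TX eps ` carrier (free_module S (B 0))"
  have I: "asub ?I TX"
    by (rule asub_image[OF free_group[OF S] left_moduleD(2)[OF TX] asub_carrier[OF free_group[OF S]] lin_ahom[OF TX eps_closed]])
  obtain Q :: "(('r, 'm) ntriv_el \<times> 'x \<Rightarrow>\<^sub>0 int) set set ring" and q where Q: "abelian_group Q" and q: "q \<in> ahom TX Q"
    and qz: "\<forall>x\<in>carrier TX. q x = \<zero>\<^bsub>Q\<^esub> \<longleftrightarrow> x \<in> ?I"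
    using ex_quotient[OF left_moduleD(2)[OF TX] I] by blast
  have "q c = \<zero>\<^bsub>Q\<^esub>"
  proof (rule t.ahom_eqI[OF Q _ ahom_zero_map[OF Q]])
    show "q \<in> ahom t.T Q" using q by (simp add: TX_ahom)
    show "c \<in> carrier t.T" using assms by (simp add: TX_simps)
    fix s x assume "s \<in> carrier S'" and x: "x \<in> carrier X"
    then have s: "s \<in> carrier S" by (simp add: S'_simps)
    have "single S (Gen x :: ('r, 'x) res_gen) s \<in> carrier (free_module S (B 0))"
      unfolding carrier_free_module by (rule single_closed[OF S.is_abelian_group _ s]) (use x in simp)
    then have "pure s x \<in> ?I" unfolding aug_single[OF s x, symmetric] by (rule imageI)
    moreover have "pure s x \<in> carrier TX" unfolding TX_simps by (rule t.pure_closed) (use s x in \<open>auto simp: S'_simps\<close>)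
    ultimately show "q (pure s x) = \<zero>\<^bsub>Q\<^esub>" using qz by blast
  qed
  then have "c \<in> ?I" using bspec[OF qz assms] by (simp del: res_basis.simps)
  then obtain f where "c = linear_extension S TX eps f" "f \<in> carrier (free_module S (B 0))" by (rule imageE)
  then show ?thesis by (intro bexI[of _ f]) (simp_all only: carrier_free_module)
qed

lemma scalar_resolution: "resolution S TX B DS eps"
proof -
  interpret TX: left_module S TX by (rule TX)
  show ?thesis
  proof unfold_locales
    show "\<exists>g\<in>fsupp S (B (Suc k)). flin S (B k) (DS k) g = f" if "f \<in> based_cycles S TX B DS eps k" for f k
    proof (cases k)
      case 0
      then show ?thesis using that DS_exact_0[of f] by (simp del: res_basis.simps)
    next
      case (Suc j)
      then show ?thesis using that DS_exact_Suc[of f j] by (simp del: res_basis.simps)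
    qed
  qed (use eps_closed DS_cycle aug_surj in auto)
qed

text \<open>A scalar \<open>e r\<close> acts on \<open>Y\<close> as \<open>r\<close> acts on its
  restriction, and \<open>e r\<close> is zero only for \<open>r = 0\<close>, so the two linear
  extensions run over the same support and have the same terms.\<close>

lemma pull_scalars:
  assumes "left_module S Y"
  shows "pull S Y B' (\<lambda>b. scalars (\<alpha> b)) f = pull R (restrict_left e Y) B' \<alpha> f"
  unfolding pull_def linear_extension_def scalars_def e_eq_zero restrict_left_simps(4)
  by (subst finsum_same[of "restrict_left e Y" Y]) (simp_all add: restrict_left_simps)

lemma bcoch_restrict_left: "bcoch (restrict_left \<phi> Y) C = bcoch Y C"
  by (simp add: bcoch_def restrict_left_simps)

lemma fs_group_restrict_right: "fs_group (restrict_right \<phi> W) C = fs_group W C"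
  by (simp add: fs_group_def fsupp_def restrict_right_simps)

lemma rext_scalars: "rext W C (\<lambda>b. scalars (\<alpha> b)) = rext (restrict_right e W) C \<alpha>"
  by (rule ext) (simp add: rext_def fext_def scalars_def restrict_right_simps fs_group_restrict_right)

theorem Ext_T:
  assumes Y: "left_module S Y"
  shows "Ext S (Suc k) TX Y \<cong> Ext R (Suc k) X (U_left n R M Y)"
proof -
  let ?U = "restrict_left e Y"
  have U: "left_module R ?U" by (rule restrict_left_module[OF R Y e_hom])
  have "Ext S (Suc k) TX Y \<cong> bExt S Y (res_basis S TX) (\<lambda>_. syz_val S) k" by (rule Ext_iso_bExt(1)[OF TX Y])
  also have "\<dots> \<cong> bExt S Y B DS k"
    by (rule bExt_unique[OF canonical_resolution[OF TX] scalar_resolution Y])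
  also have "bExt S Y B DS k = bExt R ?U B (\<lambda>_. syz_val R) k"
    unfolding bExt_def pull_scalars[OF Y] bcoch_restrict_left ..
  also have "\<dots> \<cong> Ext R (Suc k) X ?U"
    by (rule group.iso_sym[OF Ext_group[OF X U] Ext_iso_bExt(1)[OF X U]])
  finally show ?thesis by (simp add: U_left_def)
qed

theorem Tor_T:
  assumes W: "right_module S W"
  shows "Tor S (Suc k) W TX \<cong> Tor R (Suc k) (U_right n R M W) X"
proof -
  let ?U = "restrict_right e W"
  have U: "right_module R ?U" by (rule restrict_right_module[OF R W e_hom])
  have "Tor S (Suc k) W TX \<cong> bTor W (res_basis S TX) (\<lambda>_. syz_val S) k" by (rule Tor_iso_bTor(1)[OF TX W])
  also have "\<dots> \<cong> bTor W B DS k"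
    by (rule bTor_unique[OF canonical_resolution[OF TX] scalar_resolution W])
  also have "bTor W B DS k = bTor ?U B (\<lambda>_. syz_val R) k"
    unfolding bTor_def fs_group_restrict_right rext_scalars ..
  also have "\<dots> \<cong> Tor R (Suc k) ?U X"
    by (rule group.iso_sym[OF Tor_group[OF X U] Tor_iso_bTor(1)[OF X U]])
  finally show ?thesis by (simp add: U_right_def)
qed

end

section \<open>Dimension shifting\<close>

text \<open>The coordinate projection of a free module onto the part spanned by
  \<open>C\<close>.\<close>

definition fs_restrict :: "('r, 'z) ring_scheme \<Rightarrow> 'b set \<Rightarrow> ('b \<Rightarrow> 'r) \<Rightarrow> 'b \<Rightarrow> 'r" where
  "fs_restrict R C f = (\<lambda>b. if b \<in> C then f b else \<zero>\<^bsub>R\<^esub>)"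

lemma fs_restrict_closed:
  assumes "f \<in> fsupp R B" "C \<subseteq> B"
  shows "fs_restrict R C f \<in> fsupp R C"
  by (rule fsuppI[OF _ _ fsuppD(3)[OF assms(1)]])
    (use fsuppD(1)[OF assms(1)] assms(2) in \<open>auto simp: fs_restrict_def\<close>)

lemma fs_restrict_ahom:
  assumes R: "ring R" and "C \<subseteq> B"
  shows "fs_restrict R C \<in> ahom (free_module R B) (free_module R C)"
proof -
  interpret R: ring R by fact
  show ?thesis
    by (rule ahomI) (use assms(2) in \<open>auto simp: carrier_free_module fs_restrict_closed,
      auto simp: fs_restrict_def add_free_module\<close>)
qed

lemma fs_restrict_smult:
  assumes R: "ring R" and "r \<in> carrier R"
  shows "fs_restrict R C (smult (free_module R B) r f) = smult (free_module R C) r (fs_restrict R C f)"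
proof -
  interpret R: ring R by fact
  show ?thesis using assms(2) by (auto simp: fs_restrict_def smult_free_module)
qed

lemma fs_restrict_id: "f \<in> fsupp R C \<Longrightarrow> fs_restrict R C f = f"
  using fsuppD(2)[of f R C] by (auto simp: fs_restrict_def)

lemma fs_restrict_zero: "f \<in> fsupp R A \<Longrightarrow> A \<inter> C = {} \<Longrightarrow> fs_restrict R C f = (\<lambda>_. \<zero>\<^bsub>R\<^esub>)"
  using fsuppD(2)[of f R A] by (auto simp: fs_restrict_def fun_eq_iff)

lemma fs_restrict_zeroD:
  assumes "fs_restrict R C f = (\<lambda>_. \<zero>\<^bsub>R\<^esub>)" "f \<in> fsupp R B" "B - C \<subseteq> A" "A \<subseteq> B"
  shows "f \<in> fsupp R A"
proof (rule fsuppI[OF _ _ fsuppD(3)[OF assms(2)] order_refl])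
  show "f b \<in> carrier R" if "b \<in> A" for b using fsuppD(1)[OF assms(2)] that assms(4) by auto
  show "f b = \<zero>\<^bsub>R\<^esub>" if "b \<notin> A" for b
    using fsuppD(2)[OF assms(2), of b] fun_cong[OF assms(1), of b] that assms(3)
    by (auto simp: fs_restrict_def split: if_splits)
qed

lemma lin_fs_restrict:
  assumes N: "left_module R N" and g: "\<And>b. b \<in> B \<Longrightarrow> g b \<in> carrier N" and f: "f \<in> fsupp R B" and C: "C \<subseteq> B"
    and z: "\<And>b. b \<in> B - C \<Longrightarrow> g b = \<zero>\<^bsub>N\<^esub>"
  shows "linear_extension R N g (fs_restrict R C f) = linear_extension R N g f"
proof (rule fs_ahom_eqI[OF is_fs_free_module left_moduleD(2)[OF N] _ lin_ahom[OF N g] f])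
  show R: "ring R" by (rule left_moduleD(1)[OF N])
  have gC: "\<And>b. b \<in> C \<Longrightarrow> g b \<in> carrier N" using g C by auto
  show "(\<lambda>f. linear_extension R N g (fs_restrict R C f)) \<in> ahom (free_module R B) N"
    by (rule ahom_compose[OF fs_restrict_ahom[OF R C] lin_ahom[OF N gC]])
  fix r b assume r: "r \<in> carrier R" and b: "b \<in> B"
  have 1: "linear_extension R N g (single R b r) = smult N r (g b)" by (rule lin_single[OF N g b r])
  show "linear_extension R N g (fs_restrict R C (single R b r)) = linear_extension R N g (single R b r)"
  proof (cases "b \<in> C")
    case True
    then have "fs_restrict R C (single R b r) = single R b r" by (auto simp: fs_restrict_def single_def)
    then show ?thesis by simp
  next
    case False
    then have "fs_restrict R C (single R b r) = \<zero>\<^bsub>free_module R C\<^esub>"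
      by (auto simp: fs_restrict_def single_def zero_free_module)
    moreover have "linear_extension R N g \<zero>\<^bsub>free_module R C\<^esub> = \<zero>\<^bsub>N\<^esub>" by (rule lin_zero[OF N gC])
    moreover have "smult N r (g b) = \<zero>\<^bsub>N\<^esub>" using z[of b] b False smult_zero[OF N r] by simp
    ultimately show ?thesis using 1 by simp
  qed
qed

text \<open>The inclusion of the free module on \<open>B'\<close> into the one on \<open>B''\<close>
  is linear and commutes with linear extension.\<close>

lemma flin_mono:
  assumes R: "ring R" and sub: "B' \<subseteq> B''" and \<alpha>: "\<And>b. b \<in> B \<Longrightarrow> \<alpha> b \<in> fsupp R B'" and f: "f \<in> fsupp R B"
  shows "flin R B'' \<alpha> f = flin R B' \<alpha> f"
proof -
  have id: "(\<lambda>x. x) \<in> ahom (free_module R B') (free_module R B'')"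
    by (rule ahomI) (use fsupp_mono[OF ring.is_abelian_group[OF R] sub] in \<open>auto simp: carrier_free_module add_free_module\<close>)
  have "(\<lambda>x. x) (flin R B' \<alpha> f) = flin R B'' (\<lambda>b. (\<lambda>x. x) (\<alpha> b)) f"
    by (rule lin_linear_hom[OF free_left_module[OF R] free_left_module[OF R] _ f id])
      (simp_all add: carrier_free_module \<alpha> smult_free_module)
  then show ?thesis by simp
qed

lemma minus_zero:
  assumes "abelian_group G" "a \<in> carrier G"
  shows "a \<ominus>\<^bsub>G\<^esub> \<zero>\<^bsub>G\<^esub> = a"
proof -
  interpret abelian_group G by fact
  show ?thesis using add_minus_cancel[OF assms zero_closed] assms(2) by simp
qed

definition submod :: "('r, 'z) ring_scheme \<Rightarrow> 'x set \<Rightarrow> ('r, 'x, 'y) module_scheme \<Rightarrow> bool" where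
  "submod R A M \<longleftrightarrow> asub A M \<and> (\<forall>r\<in>carrier R. \<forall>x\<in>A. smult M r x \<in> A)"

lemma submod_left_module:
  assumes M: "left_module R M" and A: "submod R A M"
  shows "left_module R (M\<lparr>carrier := A\<rparr>)"
proof -
  interpret M: left_module R M by fact
  have as: "asub A M" using A by (simp add: submod_def)
  note a = asubD[OF as]
  have "abelian_group (M\<lparr>carrier := A\<rparr>)"
  proof (rule abelian_groupI)
    fix x assume "x \<in> carrier (M\<lparr>carrier := A\<rparr>)"
    then have x: "x \<in> A" by simp
    then show "\<exists>y\<in>carrier (M\<lparr>carrier := A\<rparr>). y \<oplus>\<^bsub>M\<lparr>carrier := A\<rparr>\<^esub> x = \<zero>\<^bsub>M\<lparr>carrier := A\<rparr>\<^esub>"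
      using a(1,4) by (intro bexI[of _ "\<ominus>\<^bsub>M\<^esub> x"]) (simp_all add: M.M.l_neg)
  next
    fix x y assume "x \<in> carrier (M\<lparr>carrier := A\<rparr>)" "y \<in> carrier (M\<lparr>carrier := A\<rparr>)"
    then show "x \<oplus>\<^bsub>M\<lparr>carrier := A\<rparr>\<^esub> y = y \<oplus>\<^bsub>M\<lparr>carrier := A\<rparr>\<^esub> x" using a(1) by (simp add: M.M.a_comm)
  qed (simp_all add: a M.M.a_assoc)
  then interpret A: abelian_group "M\<lparr>carrier := A\<rparr>" .
  have s: "\<And>r x. r \<in> carrier R \<Longrightarrow> x \<in> A \<Longrightarrow> smult M r x \<in> A" using A by (simp add: submod_def)
  show ?thesis
    by unfold_locales (simp_all add: s a(1) M.smult_l_distr M.smult_r_distr M.smult_assoc M.smult_one)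
qed

lemma lin_submod:
  assumes M: "left_module R M" and A: "submod R A M" and g: "\<And>b. b \<in> B \<Longrightarrow> g b \<in> A" and f: "f \<in> fsupp R B"
  shows "linear_extension R (M\<lparr>carrier := A\<rparr>) g f = linear_extension R M g f"
proof -
  have as: "asub A M" using A by (simp add: submod_def)
  have id: "(\<lambda>x. x) \<in> ahom (M\<lparr>carrier := A\<rparr>) M"
    by (rule ahomI) (use asubD[OF as] in auto)
  have "(\<lambda>x. x) (linear_extension R (M\<lparr>carrier := A\<rparr>) g f) = linear_extension R M (\<lambda>b. (\<lambda>x. x) (g b)) f"
    by (rule lin_linear_hom[OF submod_left_module[OF M A] M _ f id]) (simp_all add: g)
  then show ?thesis by simp
qed

text \<open>Generators of the next degree are named by cycles, so the inclusions of bases and of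
  cycles have to be proved in one induction; that the differential of a chain is the same in both
  free modules is \<open>flin_mono\<close>.\<close>

lemma sub_basis:
  assumes M: "left_module R M" and A: "submod R A M"
  shows "res_basis R (M\<lparr>carrier := A\<rparr>) k \<subseteq> res_basis R M k"
proof -
  let ?A = "M\<lparr>carrier := A\<rparr>"
  note LA = submod_left_module[OF M A]
  interpret PA: resolution R ?A "res_basis R ?A" "\<lambda>_. syz_val R" gen_val by (rule canonical_resolution[OF LA])
  interpret PM: resolution R M "res_basis R M" "\<lambda>_. syz_val R" gen_val by (rule canonical_resolution[OF M])
  have R: "ring R" by (rule PM.R)
  have AM: "A \<subseteq> carrier M" using A by (auto simp: submod_def asub_def)
  have "res_basis R ?A k \<subseteq> res_basis R M k \<and> PA.Z k \<subseteq> PM.Z k"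
  proof (induction k)
    case 0
    have b: "res_basis R ?A 0 \<subseteq> res_basis R M 0" using AM by auto
    have "PA.Z 0 \<subseteq> PM.Z 0"
    proof
      fix f assume "f \<in> PA.Z 0"
      then have f: "f \<in> fsupp R (res_basis R ?A 0)" "linear_extension R ?A gen_val f = \<zero>\<^bsub>M\<^esub>" by auto
      have "linear_extension R ?A gen_val f = linear_extension R M gen_val f"
        by (rule lin_submod[OF M A _ f(1)]) auto
      then show "f \<in> PM.Z 0" using f fsupp_mono[OF ring.is_abelian_group[OF R] b] by auto
    qed
    then show ?case using b by blast
  next
    case (Suc k)
    have b: "res_basis R ?A (Suc k) \<subseteq> res_basis R M (Suc k)"
      unfolding res_basis_Suc using Suc by blast
    have "PA.Z (Suc k) \<subseteq> PM.Z (Suc k)"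
    proof
      fix f assume "f \<in> PA.Z (Suc k)"
      then have f: "f \<in> fsupp R (res_basis R ?A (Suc k))"
        "flin R (res_basis R ?A k) (syz_val R) f = \<zero>\<^bsub>free_module R (res_basis R ?A k)\<^esub>"
        by (simp_all del: res_basis.simps)
      have "flin R (res_basis R M k) (syz_val R) f = flin R (res_basis R ?A k) (syz_val R) f"
        by (rule flin_mono[OF R _ PA.D_closed f(1)]) (use Suc in blast)
      then show "f \<in> PM.Z (Suc k)" using f fsupp_mono[OF ring.is_abelian_group[OF R] b]
        by (auto simp: zero_free_module simp del: res_basis.simps)
    qed
    then show ?case using b by blast
  qed
  then show ?thesis by blast
qed

text \<open>An exact sequence \<open>0 \<rightarrow> A \<rightarrow> Bm \<rightarrow> N
  \<rightarrow> 0\<close> whose first two terms are resolved with the same differential, on bases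
  \<open>RA k\<close> inside \<open>RB k\<close>. The basis elements in \<open>C k\<close> span the
  quotient complex, which resolves \<open>N\<close>; its differential \<open>DC\<close> drops the
  coordinates in \<open>RA\<close>.\<close>

locale submodule_resolution =
  B: resolution R Bm RB D \<epsilon> + A: resolution R "Bm\<lparr>carrier := A\<rparr>" RA D \<epsilon> + N: left_module R N
  for R :: "('r, 'z) ring_scheme" and Bm :: "('r, 'x, 'y) module_scheme" and A :: "'x set"
    and N :: "('r, 'n, 'w) module_scheme"
    and RB RA :: "nat \<Rightarrow> 'b set" and D :: "nat \<Rightarrow> 'b \<Rightarrow> 'b \<Rightarrow> 'r" and \<epsilon> :: "'b \<Rightarrow> 'x" +
  fixes d :: "'x \<Rightarrow> 'n"
  assumes A: "submod R A Bm" and sub: "RA k \<subseteq> RB k"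
    and d: "d \<in> ahom Bm N" and d_smult: "r \<in> carrier R \<Longrightarrow> x \<in> carrier Bm \<Longrightarrow> d (smult Bm r x) = smult N r (d x)"
    and d_ker: "x \<in> carrier Bm \<Longrightarrow> d x = \<zero>\<^bsub>N\<^esub> \<longleftrightarrow> x \<in> A"
    and d_surj: "y \<in> carrier N \<Longrightarrow> \<exists>x\<in>carrier Bm. d x = y"
begin

abbreviation "C k \<equiv> RB k - RA k"
abbreviation "pr k \<equiv> fs_restrict R (C k)"
abbreviation "DC \<equiv> \<lambda>k b. pr k (D k b)"
abbreviation "\<epsilon>C \<equiv> \<lambda>b. d (\<epsilon> b)"

lemmas R = B.R and NL = N.left_module_axioms and BL = B.left_module_axioms

lemma fsA: "f \<in> fsupp R (RA k) \<Longrightarrow> f \<in> fsupp R (RB k)"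
  using fsupp_mono[OF ring.is_abelian_group[OF R] sub] by blast

lemma fsC: "f \<in> fsupp R (C k) \<Longrightarrow> f \<in> fsupp R (RB k)"
  using fsupp_mono[OF ring.is_abelian_group[OF R], of "C k" "RB k"] by blast

lemma pr_closed: "f \<in> fsupp R (RB k) \<Longrightarrow> pr k f \<in> fsupp R (C k)"
  by (rule fs_restrict_closed) auto

lemma pr_A: "f \<in> fsupp R (RA k) \<Longrightarrow> pr k f = \<zero>\<^bsub>free_module R (C k)\<^esub>"
  unfolding zero_free_module by (rule fs_restrict_zero) auto

lemma DC_closed: "b \<in> RB (Suc k) \<Longrightarrow> DC k b \<in> fsupp R (C k)"
  by (rule pr_closed[OF B.D_closed])

lemma pr_flin:
  assumes f: "f \<in> fsupp R (RB (Suc k))"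
  shows "pr k (flin R (RB k) (D k) f) = flin R (C k) (DC k) f"
  by (rule lin_linear_hom[OF free_left_module[OF R] free_left_module[OF R] _ f fs_restrict_ahom[OF R]])
    (auto simp: carrier_free_module B.D_closed fs_restrict_smult[OF R])

text \<open>The differential of a generator from \<open>RA\<close> stays in \<open>RA\<close> and is
  projected to zero.\<close>

lemma DC_pr:
  assumes f: "f \<in> fsupp R (RB (Suc k))"
  shows "flin R (C k) (DC k) (pr (Suc k) f) = flin R (C k) (DC k) f"
  by (rule lin_fs_restrict[OF free_left_module[OF R] _ f])
    (use pr_A A.D_closed in \<open>auto simp: carrier_free_module DC_closed\<close>)

lemma aug_A: "b \<in> RA 0 \<Longrightarrow> \<epsilon> b \<in> A"
  using A.aug_closed by simp

lemma A_sub: "A \<subseteq> carrier Bm"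
  using A by (auto simp: submod_def asub_def)

lemma aug_C: "b \<in> RB 0 \<Longrightarrow> \<epsilon>C b \<in> carrier N"
  by (rule ahom_closed[OF d B.aug_closed])

lemma d_lin:
  assumes f: "f \<in> fsupp R (RB 0)"
  shows "d (linear_extension R Bm \<epsilon> f) = linear_extension R N \<epsilon>C f"
  by (rule lin_linear_hom[OF BL NL B.aug_closed f d d_smult])

lemma aug_pr:
  assumes f: "f \<in> fsupp R (RB 0)"
  shows "linear_extension R N \<epsilon>C (pr 0 f) = linear_extension R N \<epsilon>C f"
  by (rule lin_fs_restrict[OF NL aug_C f]) (use aug_A d_ker A_sub in auto)

text \<open>The differential of \<open>f\<close> in the resolution of \<open>Bm\<close> projects to
  zero, so it is supported on \<open>RA\<close> and is a cycle for \<open>A\<close>. By exactness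
  there it is the differential of some \<open>g\<close> over \<open>RA\<close>, and
  \<open>f - g\<close> is a cycle for \<open>Bm\<close>. In degree 0 the augmentation takes the
  place of the differential.\<close>

lemma cycle_lift:
  assumes f: "f \<in> based_cycles R N C DC \<epsilon>C k"
  shows "\<exists>g\<in>fsupp R (RA k). f \<ominus>\<^bsub>free_module R (RB k)\<^esub> g \<in> B.Z k"
proof (cases k)
  case 0
  have f': "f \<in> fsupp R (RB 0)" "linear_extension R N \<epsilon>C f = \<zero>\<^bsub>N\<^esub>" using f fsC[of f 0] 0 by auto
  have "linear_extension R Bm \<epsilon> f \<in> A"
    using d_lin[OF f'(1)] f'(2) d_ker[OF lin_closed[OF BL B.aug_closed f'(1)]] by simp
  then obtain g where g: "g \<in> fsupp R (RA 0)" "linear_extension R (Bm\<lparr>carrier := A\<rparr>) \<epsilon> g = linear_extension R Bm \<epsilon> f"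
    using A.aug_surj by auto
  have "linear_extension R (Bm\<lparr>carrier := A\<rparr>) \<epsilon> g = linear_extension R Bm \<epsilon> g"
    by (rule lin_submod[OF BL A aug_A g(1)])
  then have eq: "linear_extension R Bm \<epsilon> g = linear_extension R Bm \<epsilon> f" using g(2) by simp
  have c: "f \<in> carrier (free_module R (RB 0))" "g \<in> carrier (free_module R (RB 0))"
    using f'(1) fsA[OF g(1)] by (simp_all add: carrier_free_module)
  have "linear_extension R Bm \<epsilon> (f \<ominus>\<^bsub>free_module R (RB 0)\<^esub> g) = linear_extension R Bm \<epsilon> f \<ominus>\<^bsub>Bm\<^esub> linear_extension R Bm \<epsilon> g"
    by (rule ahom_minus[OF free_group[OF R] left_moduleD(2)[OF BL] lin_ahom[OF BL B.aug_closed] c])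
  also have "\<dots> = \<zero>\<^bsub>Bm\<^esub>"
    unfolding eq a_minus_def by (rule abelian_group.r_neg[OF left_moduleD(2)[OF BL] lin_closed[OF BL B.aug_closed f'(1)]])
  finally have "f \<ominus>\<^bsub>free_module R (RB 0)\<^esub> g \<in> B.Z 0"
    using abelian_group.minus_closed[OF free_group[OF R] c] by (simp add: carrier_free_module)
  then show ?thesis using g(1) 0 by auto
next
  case (Suc j)
  have f': "f \<in> fsupp R (RB k)" "flin R (C j) (DC j) f = \<zero>\<^bsub>free_module R (C j)\<^esub>" using f fsC[of f k] Suc by auto
  let ?y = "flin R (RB j) (D j) f"
  have yB: "?y \<in> B.Z j" using B.boundary_cycle[of f j] f'(1) Suc by simp
  have "pr j ?y = (\<lambda>_. \<zero>\<^bsub>R\<^esub>)" using pr_flin[of f j] f' Suc by (simp add: zero_free_module)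
  then have yA: "?y \<in> fsupp R (RA j)"
    by (rule fs_restrict_zeroD[OF _ B.cycle_closed[OF yB] _ sub]) auto
  have "?y \<in> A.Z j"
  proof (cases j)
    case 0
    have "linear_extension R (Bm\<lparr>carrier := A\<rparr>) \<epsilon> ?y = linear_extension R Bm \<epsilon> ?y"
      by (rule lin_submod[OF BL A aug_A]) (use yA 0 in auto)
    then show ?thesis using yA yB 0 by simp
  next
    case (Suc l)
    have "flin R (RB l) (D l) ?y = flin R (RA l) (D l) ?y"
      by (rule flin_mono[OF R sub A.D_closed]) (use yA Suc in auto)
    then show ?thesis using yA yB Suc by (simp add: zero_free_module)
  qed
  then obtain g where g: "g \<in> fsupp R (RA (Suc j))" "flin R (RA j) (D j) g = ?y" using A.exact by blast
  have "flin R (RB j) (D j) g = flin R (RA j) (D j) g" by (rule flin_mono[OF R sub A.D_closed g(1)])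
  then have eq: "flin R (RB j) (D j) g = ?y" using g(2) by simp
  have c: "f \<in> carrier (free_module R (RB (Suc j)))" "g \<in> carrier (free_module R (RB (Suc j)))"
    using f'(1) fsA[OF g(1)] Suc by (simp_all add: carrier_free_module)
  have "flin R (RB j) (D j) (f \<ominus>\<^bsub>free_module R (RB (Suc j))\<^esub> g) = ?y \<ominus>\<^bsub>free_module R (RB j)\<^esub> flin R (RB j) (D j) g"
    by (rule ahom_minus[OF free_group[OF R] free_group[OF R] flin_ahom[OF R B.D_closed] c])
  also have "\<dots> = \<zero>\<^bsub>free_module R (RB j)\<^esub>"
    unfolding eq a_minus_def
    by (rule abelian_group.r_neg[OF free_group[OF R]]) (simp add: carrier_free_module B.cycle_closed[OF yB])
  finally have "f \<ominus>\<^bsub>free_module R (RB (Suc j))\<^esub> g \<in> B.Z (Suc j)"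
    using abelian_group.minus_closed[OF free_group[OF R] c] by (simp add: carrier_free_module)
  then show ?thesis using g(1) Suc by auto
qed

text \<open>For exactness, correct a cycle to one for \<open>Bm\<close> by
  \<open>cycle_lift\<close>, take a preimage there and project it, which removes the
  correction.\<close>

lemma quotient_resolution: "resolution R N C DC \<epsilon>C"
proof unfold_locales
  show "\<epsilon>C b \<in> carrier N" if "b \<in> C 0" for b using aug_C that by auto
  show "DC k b \<in> based_cycles R N C DC \<epsilon>C k" if "b \<in> C (Suc k)" for b k
  proof -
    have b: "b \<in> RB (Suc k)" using that by auto
    note Db = B.D_closed[OF b]
    show ?thesis
    proof (cases k)
      case 0
      have "linear_extension R N \<epsilon>C (pr 0 (D 0 b)) = d (linear_extension R Bm \<epsilon> (D 0 b))"
        using aug_pr d_lin Db 0 by simp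
      also have "\<dots> = d \<zero>\<^bsub>Bm\<^esub>" using B.D_cycle[OF b] 0 by simp
      also have "\<dots> = \<zero>\<^bsub>N\<^esub>" by (rule ahom_zero[OF left_moduleD(2)[OF BL] left_moduleD(2)[OF NL] d])
      finally show ?thesis using DC_closed[OF b] 0 by simp
    next
      case (Suc j)
      have "flin R (C j) (DC j) (pr (Suc j) (D (Suc j) b)) = pr j (flin R (RB j) (D j) (D (Suc j) b))"
        using DC_pr[of "D (Suc j) b" j] pr_flin[of "D (Suc j) b" j] Db Suc by simp
      also have "\<dots> = pr j \<zero>\<^bsub>free_module R (RB j)\<^esub>" using B.DD[of b j] b Suc by simp
      also have "\<dots> = \<zero>\<^bsub>free_module R (C j)\<^esub>" by (simp add: zero_free_module fs_restrict_def)
      finally show ?thesis using DC_closed[OF b] Suc by simp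
    qed
  qed
  show "\<exists>g\<in>fsupp R (C (Suc k)). flin R (C k) (DC k) g = f" if f: "f \<in> based_cycles R N C DC \<epsilon>C k" for f k
  proof -
    obtain g where g: "g \<in> fsupp R (RA k)" "f \<ominus>\<^bsub>free_module R (RB k)\<^esub> g \<in> B.Z k" using cycle_lift[OF f] by blast
    obtain \<chi> where \<chi>: "\<chi> \<in> fsupp R (RB (Suc k))" "flin R (RB k) (D k) \<chi> = f \<ominus>\<^bsub>free_module R (RB k)\<^esub> g"
      using B.exact[OF g(2)] by blast
    have fC: "f \<in> fsupp R (C k)" using f by (cases k) auto
    have c: "f \<in> carrier (free_module R (RB k))" "g \<in> carrier (free_module R (RB k))"
      using fsC[OF fC] fsA[OF g(1)] by (simp_all add: carrier_free_module)
    have "flin R (C k) (DC k) (pr (Suc k) \<chi>) = pr k (f \<ominus>\<^bsub>free_module R (RB k)\<^esub> g)"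
      using DC_pr[OF \<chi>(1)] pr_flin[OF \<chi>(1)] \<chi>(2) by simp
    also have "\<dots> = pr k f \<ominus>\<^bsub>free_module R (C k)\<^esub> pr k g"
      by (rule ahom_minus[OF free_group[OF R] free_group[OF R] fs_restrict_ahom[OF R] c]) auto
    also have "\<dots> = f"
      unfolding pr_A[OF g(1)] fs_restrict_id[OF fC]
      by (rule minus_zero[OF free_group[OF R]]) (simp add: fC carrier_free_module)
    finally show ?thesis using pr_closed[OF \<chi>(1)] by blast
  qed
  show "\<exists>f\<in>fsupp R (C 0). linear_extension R N \<epsilon>C f = y" if y: "y \<in> carrier N" for y
  proof -
    obtain x where x: "x \<in> carrier Bm" "d x = y" using d_surj[OF y] by blast
    obtain f where f: "f \<in> fsupp R (RB 0)" "linear_extension R Bm \<epsilon> f = x" using B.aug_surj[OF x(1)] by blast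
    show ?thesis
    proof
      show "linear_extension R N \<epsilon>C (pr 0 f) = y" unfolding aug_pr[OF f(1)] d_lin[OF f(1), symmetric] f(2) by (rule x(2))
      show "pr 0 f \<in> fsupp R (C 0)" by (rule pr_closed[OF f(1)])
    qed
  qed
qed

end

text \<open>Extension of a cochain by zero. From \<open>C\<close> it is the inclusion of the
  cochains of the quotient; from \<open>RA\<close> it is a lifting of cochains that need not commute
  with the differentials.\<close>

definition ext0 :: "('y, 'p) ring_scheme \<Rightarrow> 'b set \<Rightarrow> 'b set \<Rightarrow> ('b \<Rightarrow> 'y) \<Rightarrow> 'b \<Rightarrow> 'y" where
  "ext0 Y C B f = (\<lambda>b\<in>B. if b \<in> C then f b else \<zero>\<^bsub>Y\<^esub>)"

lemma ext0_ahom: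
  assumes Y: "abelian_group Y" and "C \<subseteq> B"
  shows "ext0 Y C B \<in> ahom (bcoch Y C) (bcoch Y B)"
proof (rule ahomI)
  interpret Y: abelian_group Y by fact
  show "ext0 Y C B f \<in> carrier (bcoch Y B)" if "f \<in> carrier (bcoch Y C)" for f
    using that bcoch_mem[OF that] unfolding bcoch_simps ext0_def by (intro restrict_PiE_iff[THEN iffD2]) simp
  show "ext0 Y C B (f \<oplus>\<^bsub>bcoch Y C\<^esub> g) = ext0 Y C B f \<oplus>\<^bsub>bcoch Y B\<^esub> ext0 Y C B g" for f g
    unfolding bcoch_simps ext0_def by (intro restrict_ext) simp
qed

lemma restrict_ahom: "C \<subseteq> B \<Longrightarrow> (\<lambda>f. restrict f C) \<in> ahom (bcoch Y B) (bcoch Y C)"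
  by (rule ahomI) (auto simp: bcoch_simps subset_iff intro!: restrict_ext)

lemma restrict_ext0: "f \<in> carrier (bcoch Y C) \<Longrightarrow> C \<subseteq> B \<Longrightarrow> restrict (ext0 Y C B f) C = f"
  by (rule ext) (auto simp: bcoch_simps ext0_def PiE_def extensional_def)

lemma ext0_restrict:
  assumes f: "f \<in> carrier (bcoch Y B)" and A: "restrict f A = \<zero>\<^bsub>bcoch Y A\<^esub>" "A \<subseteq> B"
  shows "ext0 Y (B - A) B (restrict f (B - A)) = f"
proof (rule ext)
  fix b
  have "b \<in> A \<Longrightarrow> f b = \<zero>\<^bsub>Y\<^esub>" using fun_cong[OF A(1), of b] by (simp add: bcoch_simps)
  moreover have "b \<notin> B \<Longrightarrow> f b = undefined" using f by (auto simp: bcoch_simps)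
  ultimately show "ext0 Y (B - A) B (restrict f (B - A)) b = f b" using A(2) by (auto simp: ext0_def)
qed

lemma restrict_ext0_A: "A \<subseteq> B \<Longrightarrow> restrict (ext0 Y (B - A) B g) A = \<zero>\<^bsub>bcoch Y A\<^esub>"
  by (auto simp: ext0_def bcoch_simps subset_iff intro!: restrict_ext)

section \<open>The connecting isomorphism\<close>

context submodule_resolution
begin

abbreviation "dB X k \<equiv> pull R X (RB (Suc k)) (D k)"
abbreviation "dA X k \<equiv> pull R X (RA (Suc k)) (D k)"
abbreviation "dC X k \<equiv> pull R X (C (Suc k)) (DC k)"
abbreviation "E X k \<equiv> ext0 X (C k) (RB k)"

lemma subC: "C k \<subseteq> RB k" by auto

lemma restrict_dB:
  assumes X: "left_module R X" and f: "f \<in> carrier (bcoch X (RB k))"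
  shows "restrict (dB X k f) (RA (Suc k)) = dA X k (restrict f (RA k))"
proof -
  have "linear_extension R X f (D k b) = linear_extension R X (restrict f (RA k)) (D k b)" if "b \<in> RA (Suc k)" for b
    by (rule lin_cong[OF X _ A.D_closed[OF that]]) (use bcoch_mem[OF f] sub in auto)
  then show ?thesis using sub[of "Suc k"] by (auto simp: pull_def subset_iff intro!: ext)
qed

text \<open>The linear extension of \<open>E X k g\<close> does not see the coordinates in
  \<open>RA\<close>, and these are the ones that \<open>pr\<close> removes. Together with
  \<open>restrict_dB\<close> this gives an exact sequence of cochain complexes that splits in each
  degree.\<close>

lemma dB_E:
  assumes X: "left_module R X" and g: "g \<in> carrier (bcoch X (C k))"
  shows "dB X k (E X k g) = E X (Suc k) (dC X k g)"
proof -
  have f: "E X k g \<in> carrier (bcoch X (RB k))" by (rule ahom_closed[OF ext0_ahom[OF left_moduleD(2)[OF X] subC] g])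
  have fc: "E X k g b \<in> carrier X" if "b \<in> RB k" for b by (rule bcoch_mem[OF f that])
  have val: "linear_extension R X (E X k g) (D k b) = linear_extension R X g (DC k b)" if b: "b \<in> RB (Suc k)" for b
  proof -
    have "linear_extension R X (E X k g) (pr k (D k b)) = linear_extension R X (E X k g) (D k b)"
      by (rule lin_fs_restrict[OF X fc B.D_closed[OF b] subC]) (auto simp: ext0_def)
    moreover have "linear_extension R X (E X k g) (pr k (D k b)) = linear_extension R X g (pr k (D k b))"
      by (rule lin_cong[OF X bcoch_mem[OF g] pr_closed[OF B.D_closed[OF b]], symmetric]) (auto simp: ext0_def)
    ultimately show ?thesis by simp
  qed
  have z: "linear_extension R X g (DC k b) = \<zero>\<^bsub>X\<^esub>" if b: "b \<in> RA (Suc k)" for b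
    unfolding pr_A[OF A.D_closed[OF b]] by (rule lin_zero[OF X bcoch_mem[OF g]])
  show ?thesis
    unfolding pull_def ext0_def[of X "C (Suc k)"] by (rule restrict_ext) (auto simp: val z)
qed

lemma E_inj: "f \<in> carrier (bcoch X (C k)) \<Longrightarrow> g \<in> carrier (bcoch X (C k)) \<Longrightarrow> E X k f = E X k g \<Longrightarrow> f = g"
  using restrict_ext0[OF _ subC] by metis

text \<open>The snake construction: extend a cocycle on \<open>RA\<close> by zero, apply
  \<open>dB\<close>, and read the result on \<open>C\<close>. Dividing by restrictions of cocycles
  of \<open>Bm\<close> in place of coboundaries makes the map injective in every degree, so that
  \<open>k = 0\<close> yields a cokernel of Hom groups. The hypothesis \<open>acyc\<close> concerns
  degree \<open>k + 1\<close> and gives surjectivity.\<close>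

lemma connecting_iso:
  assumes X: "left_module R X"
    and acyc: "\<And>f. f \<in> carrier (bcoch X (RB (Suc k))) \<Longrightarrow> dB X (Suc k) f = \<zero>\<^bsub>bcoch X (RB (Suc (Suc k)))\<^esub> \<Longrightarrow>
      \<exists>h\<in>carrier (bcoch X (RB k)). dB X k h = f"
  shows "subquotient (bcoch X (RA k)) {f \<in> carrier (bcoch X (RA k)). dA X k f = \<zero>\<^bsub>bcoch X (RA (Suc k))\<^esub>}
      ((\<lambda>f. restrict f (RA k)) ` {f \<in> carrier (bcoch X (RB k)). dB X k f = \<zero>\<^bsub>bcoch X (RB (Suc k))\<^esub>})
    \<cong> bExt R X C DC k"
proof -
  interpret Q: resolution R N C DC \<epsilon>C by (rule quotient_resolution)
  note XX = left_moduleD(2)[OF X]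
  note grp = bcoch_group[OF XX]
  let ?GA = "\<lambda>k. bcoch X (RA k)" and ?GB = "\<lambda>k. bcoch X (RB k)" and ?GC = "\<lambda>k. bcoch X (C k)"
  let ?i = "\<lambda>k. ext0 X (RA k) (RB k)"
  let ?u = "\<lambda>f. restrict (dB X k (?i k f)) (C (Suc k))"
  let ?ZA = "{f \<in> carrier (?GA k). dA X k f = \<zero>\<^bsub>?GA (Suc k)\<^esub>}"
  let ?ZB = "{f \<in> carrier (?GB k). dB X k f = \<zero>\<^bsub>?GB (Suc k)\<^esub>}"
  let ?W = "(\<lambda>f. restrict f (RA k)) ` ?ZB"
  have ih: "?i k \<in> ahom (?GA k) (?GB k)" for k by (rule ext0_ahom[OF XX sub])
  have Eh: "E X k \<in> ahom (?GC k) (?GB k)" for k by (rule ext0_ahom[OF XX subC])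
  have dBh: "dB X k \<in> ahom (?GB k) (?GB (Suc k))" for k by (rule pull_ahom[OF X B.D_closed])
  have dAh: "dA X k \<in> ahom (?GA k) (?GA (Suc k))" for k by (rule pull_ahom[OF X A.D_closed])
  have dCh: "dC X k \<in> ahom (?GC k) (?GC (Suc k))" for k by (rule pull_ahom[OF X Q.D_closed])
  have rA: "(\<lambda>f. restrict f (RA k)) \<in> ahom (?GB k) (?GA k)" for k by (rule restrict_ahom[OF sub])
  have rC: "(\<lambda>f. restrict f (C k)) \<in> ahom (?GB k) (?GC k)" for k by (rule restrict_ahom[OF subC])
  have dd: "dB X (Suc k) (dB X k f) = \<zero>\<^bsub>?GB (Suc (Suc k))\<^esub>" if "f \<in> carrier (?GB k)" for f
    using B.bExt_complex[OF X, of k] that unfolding complex3_def by blast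
  note cl = ahom_closed[OF ih] ahom_closed[OF Eh] ahom_closed[OF dBh] ahom_closed[OF dCh] ahom_closed[OF rA] ahom_closed[OF rC]
  have Ez: "E X j \<zero>\<^bsub>?GC j\<^esub> = \<zero>\<^bsub>?GB j\<^esub>" for j by (rule ahom_zero[OF grp grp Eh])
  \<comment> \<open>\<open>dB\<close> of the extension vanishes on \<open>RA\<close> since
    \<open>f\<close> is a cocycle there, so it is the extension by zero of its restriction to
    \<open>C\<close>.\<close>
  have Eu: "E X (Suc k) (?u f) = dB X k (?i k f)" if f: "f \<in> ?ZA" for f
  proof (rule ext0_restrict[OF _ _ sub])
    have fi: "?i k f \<in> carrier (?GB k)" by (rule cl(1)) (use f in simp)
    show "dB X k (?i k f) \<in> carrier (?GB (Suc k))" by (rule cl(3)[OF fi])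
    show "restrict (dB X k (?i k f)) (RA (Suc k)) = \<zero>\<^bsub>?GA (Suc k)\<^esub>"
      unfolding restrict_dB[OF X fi] using f by (simp add: restrict_ext0[OF _ sub])
  qed
  have uc: "?u f \<in> carrier (?GC (Suc k))" if f: "f \<in> ?ZA" for f
    by (rule cl(6)[OF cl(3)[OF cl(1)]]) (use f in simp)
  \<comment> \<open>Exactness in the middle: cochains with the same restriction to \<open>RA\<close>
    differ by a cochain of the quotient.\<close>
  have diff: "\<exists>w\<in>carrier (?GC k). f \<ominus>\<^bsub>?GB k\<^esub> g = E X k w"
    if f: "f \<in> carrier (?GB k)" and g: "g \<in> carrier (?GB k)" and eq: "restrict f (RA k) = restrict g (RA k)" for f g
  proof -
    interpret GA: abelian_group "?GA k" by (rule grp)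
    have c: "f \<ominus>\<^bsub>?GB k\<^esub> g \<in> carrier (?GB k)" by (rule abelian_group.minus_closed[OF grp f g])
    have "restrict (f \<ominus>\<^bsub>?GB k\<^esub> g) (RA k) = restrict f (RA k) \<ominus>\<^bsub>?GA k\<^esub> restrict g (RA k)"
      by (rule ahom_minus[OF grp grp rA f g])
    also have "\<dots> = \<zero>\<^bsub>?GA k\<^esub>" unfolding eq a_minus_def by (rule GA.r_neg[OF cl(5)[OF g]])
    finally have "E X k (restrict (f \<ominus>\<^bsub>?GB k\<^esub> g) (C k)) = f \<ominus>\<^bsub>?GB k\<^esub> g" by (rule ext0_restrict[OF c _ sub])
    then show ?thesis using cl(6)[OF c] by metis
  qed
  interpret GB: abelian_group "?GB j" for j by (rule grp)
  show ?thesis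
    unfolding bExt_def homology_def
  proof (rule subquotient_iso[where u = ?u])
    show "abelian_group (?GA k)" "abelian_group (?GC (Suc k))" by (rule grp)+
    show "asub ?ZA (?GA k)" using asub_kernel[OF grp grp asub_carrier[OF grp] dAh] .
    have sZB: "asub ?ZB (?GB k)" using asub_kernel[OF grp grp asub_carrier[OF grp] dBh] .
    show "asub ?W (?GA k)" by (rule asub_image[OF grp grp sZB rA])
    show "?W \<subseteq> ?ZA"
    proof
      fix f assume "f \<in> ?W"
      then obtain h where h: "h \<in> carrier (?GB k)" "dB X k h = \<zero>\<^bsub>?GB (Suc k)\<^esub>" "f = restrict h (RA k)" by auto
      have "dA X k f = restrict (dB X k h) (RA (Suc k))" unfolding h(3) by (rule restrict_dB[OF X h(1), symmetric])
      also have "\<dots> = \<zero>\<^bsub>?GA (Suc k)\<^esub>" unfolding h(2) by (rule ahom_zero[OF grp grp rA])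
      finally show "f \<in> ?ZA" using cl(5)[OF h(1)] h(3) by simp
    qed
    note cC = complex3_asub[OF Q.bExt_complex[OF X, of k]]
    show "asub {x \<in> carrier (?GC (Suc k)). dC X (Suc k) x = \<zero>\<^bsub>?GC (Suc (Suc k))\<^esub>} (?GC (Suc k))" by (rule cC(1))
    show "asub (dC X k ` carrier (?GC k)) (?GC (Suc k))" by (rule cC(2))
    show "dC X k ` carrier (?GC k) \<subseteq> {x \<in> carrier (?GC (Suc k)). dC X (Suc k) x = \<zero>\<^bsub>?GC (Suc (Suc k))\<^esub>}" by (rule cC(3))
  next
    fix f assume f: "f \<in> ?ZA"
    have fi: "?i k f \<in> carrier (?GB k)" by (rule cl(1)) (use f in simp)
    have "E X (Suc (Suc k)) (dC X (Suc k) (?u f)) = \<zero>\<^bsub>?GB (Suc (Suc k))\<^esub>"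
      unfolding dB_E[OF X uc[OF f], symmetric] Eu[OF f] by (rule dd[OF fi])
    then have "dC X (Suc k) (?u f) = \<zero>\<^bsub>?GC (Suc (Suc k))\<^esub>"
      by (intro E_inj[OF cl(4)[OF uc[OF f]] abelian_groupE(2)[OF grp]]) (simp only: Ez)
    then show "?u f \<in> {x \<in> carrier (?GC (Suc k)). dC X (Suc k) x = \<zero>\<^bsub>?GC (Suc (Suc k))\<^esub>}" using uc[OF f] by simp
  next
    fix f g assume "f \<in> ?ZA" "g \<in> ?ZA"
    then show "?u (f \<oplus>\<^bsub>?GA k\<^esub> g) = ?u f \<oplus>\<^bsub>?GC (Suc k)\<^esub> ?u g"
      using ahom_add[OF ahom_compose[OF ahom_compose[OF ih dBh] rC], of f k g] by simp
  next
    fix f assume f: "f \<in> ?ZA"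
    have fc: "f \<in> carrier (?GA k)" using f by simp
    note fi = cl(1)[OF fc]
    show "?u f \<in> dC X k ` carrier (?GC k) \<longleftrightarrow> f \<in> ?W"
    proof
      assume "?u f \<in> dC X k ` carrier (?GC k)"
      then obtain w where w: "w \<in> carrier (?GC k)" "?u f = dC X k w" by auto
      note Ew = cl(2)[OF w(1)]
      have eq: "dB X k (?i k f) = dB X k (E X k w)" unfolding dB_E[OF X w(1)] w(2)[symmetric] by (rule Eu[OF f, symmetric])
      \<comment> \<open>\<open>?i k f\<close> and \<open>E X k w\<close> have the same coboundary,
        so \<open>?h\<close> is a cocycle of \<open>Bm\<close>; it restricts to \<open>f\<close>
        because \<open>E X k w\<close> vanishes on \<open>RA\<close>.\<close>
      let ?h = "?i k f \<ominus>\<^bsub>?GB k\<^esub> E X k w"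
      have hc: "?h \<in> carrier (?GB k)" by (rule GB.minus_closed[OF fi Ew])
      have "dB X k ?h = dB X k (?i k f) \<ominus>\<^bsub>?GB (Suc k)\<^esub> dB X k (E X k w)" by (rule ahom_minus[OF grp grp dBh fi Ew])
      also have "\<dots> = \<zero>\<^bsub>?GB (Suc k)\<^esub>" unfolding eq a_minus_def by (rule GB.r_neg[OF cl(3)[OF Ew]])
      finally have hz: "dB X k ?h = \<zero>\<^bsub>?GB (Suc k)\<^esub>" .
      have "restrict ?h (RA k) = restrict (?i k f) (RA k) \<ominus>\<^bsub>?GA k\<^esub> restrict (E X k w) (RA k)" by (rule ahom_minus[OF grp grp rA fi Ew])
      also have "\<dots> = f"
        unfolding restrict_ext0[OF fc sub] restrict_ext0_A[OF sub] by (rule minus_zero[OF grp fc])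
      finally show "f \<in> ?W" using hz hc by (metis (mono_tags, lifting) imageI mem_Collect_eq)
    next
      assume "f \<in> ?W"
      then obtain h where h: "h \<in> carrier (?GB k)" "dB X k h = \<zero>\<^bsub>?GB (Suc k)\<^esub>" "f = restrict h (RA k)" by auto
      have "restrict (?i k f) (RA k) = restrict h (RA k)" unfolding restrict_ext0[OF fc sub] by (rule h(3))
      then obtain w where w: "w \<in> carrier (?GC k)" "?i k f \<ominus>\<^bsub>?GB k\<^esub> h = E X k w" using diff[OF fi h(1)] by blast
      have "dB X k (?i k f) = dB X k (?i k f \<ominus>\<^bsub>?GB k\<^esub> h)"
        unfolding ahom_minus[OF grp grp dBh fi h(1)] h(2) by (rule minus_zero[OF grp cl(3)[OF fi], symmetric])
      also have "\<dots> = E X (Suc k) (dC X k w)" unfolding w(2) by (rule dB_E[OF X w(1)])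
      finally have "E X (Suc k) (?u f) = E X (Suc k) (dC X k w)" unfolding Eu[OF f] .
      then have "?u f = dC X k w" by (rule E_inj[OF uc[OF f] cl(4)[OF w(1)]])
      then show "?u f \<in> dC X k ` carrier (?GC k)" using w(1) by simp
    qed
  next
    fix g assume "g \<in> {x \<in> carrier (?GC (Suc k)). dC X (Suc k) x = \<zero>\<^bsub>?GC (Suc (Suc k))\<^esub>}"
    then have g: "g \<in> carrier (?GC (Suc k))" "dC X (Suc k) g = \<zero>\<^bsub>?GC (Suc (Suc k))\<^esub>" by auto
    have "dB X (Suc k) (E X (Suc k) g) = \<zero>\<^bsub>?GB (Suc (Suc k))\<^esub>" unfolding dB_E[OF X g(1)] g(2) by (rule Ez)
    \<comment> \<open>The restriction of \<open>h\<close> to \<open>RA\<close> is a preimage of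
      \<open>g\<close>: \<open>h\<close> and the extension by zero of its restriction differ by some
      \<open>E X k w\<close>, which changes the result by the coboundary of
      \<open>w\<close>.\<close>
    then obtain h where h: "h \<in> carrier (?GB k)" "dB X k h = E X (Suc k) g" using acyc[OF cl(2)[OF g(1)]] by blast
    let ?f = "restrict h (RA k)"
    have fc: "?f \<in> carrier (?GA k)" by (rule cl(5)[OF h(1)])
    have "dA X k ?f = restrict (E X (Suc k) g) (RA (Suc k))" unfolding h(2)[symmetric] by (rule restrict_dB[OF X h(1), symmetric])
    also have "\<dots> = \<zero>\<^bsub>?GA (Suc k)\<^esub>" by (rule restrict_ext0_A[OF sub])
    finally have f: "?f \<in> ?ZA" using fc by simp
    note fi = cl(1)[OF fc]
    have "restrict h (RA k) = restrict (?i k ?f) (RA k)" by (rule restrict_ext0[OF fc sub, symmetric])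
    then obtain w where w: "w \<in> carrier (?GC k)" "h \<ominus>\<^bsub>?GB k\<^esub> ?i k ?f = E X k w" using diff[OF h(1) fi] by blast
    have dw: "dC X k w \<in> carrier (?GC (Suc k))" by (rule cl(4)[OF w(1)])
    have "E X (Suc k) (dC X k w) = dB X k h \<ominus>\<^bsub>?GB (Suc k)\<^esub> dB X k (?i k ?f)"
      unfolding dB_E[OF X w(1), symmetric] w(2)[symmetric] by (rule ahom_minus[OF grp grp dBh h(1) fi])
    then have "E X (Suc k) (?u ?f) \<oplus>\<^bsub>?GB (Suc k)\<^esub> E X (Suc k) (dC X k w) = dB X k h"
      unfolding Eu[OF f] using add_minus_cancel[OF grp cl(3)[OF h(1)] cl(3)[OF fi]] by simp
    then have "E X (Suc k) (dC X k w) \<oplus>\<^bsub>?GB (Suc k)\<^esub> E X (Suc k) (?u ?f) = E X (Suc k) g"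
      unfolding h(2) using GB.a_comm[OF cl(2)[OF uc[OF f]] cl(2)[OF dw]] by simp
    then have "E X (Suc k) (dC X k w \<oplus>\<^bsub>?GC (Suc k)\<^esub> ?u ?f) = E X (Suc k) g"
      unfolding ahom_add[OF Eh dw uc[OF f]] .
    then have "dC X k w \<oplus>\<^bsub>?GC (Suc k)\<^esub> ?u ?f = g"
      by (rule E_inj[OF abelian_groupE(1)[OF grp dw uc[OF f]] g(1)])
    then show "\<exists>z\<in>?ZA. \<exists>b\<in>dC X k ` carrier (?GC k). g = b \<oplus>\<^bsub>?GC (Suc k)\<^esub> ?u z"
      using f w(1) by (intro bexI[OF _ f] bexI[of _ "dC X k w"]) auto
  qed
qed

text \<open>In positive degree acyclicity turns the cocycles of \<open>Bm\<close> into coboundaries,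
  so their restrictions are exactly the coboundaries on \<open>RA\<close>, and the source of
  \<open>connecting_iso\<close> becomes cohomology.\<close>

lemma shift_iso:
  assumes X: "left_module R X"
    and acyc: "\<And>k f. f \<in> carrier (bcoch X (RB (Suc k))) \<Longrightarrow> dB X (Suc k) f = \<zero>\<^bsub>bcoch X (RB (Suc (Suc k)))\<^esub> \<Longrightarrow>
      \<exists>h\<in>carrier (bcoch X (RB k)). dB X k h = f"
  shows "bExt R X RA D k \<cong> bExt R X C DC (Suc k)"
proof -
  note XX = left_moduleD(2)[OF X]
  have "(\<lambda>f. restrict f (RA (Suc k))) ` {f \<in> carrier (bcoch X (RB (Suc k))). dB X (Suc k) f = \<zero>\<^bsub>bcoch X (RB (Suc (Suc k)))\<^esub>}
    = dA X k ` carrier (bcoch X (RA k))" (is "?L = ?R")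
  proof
    show "?L \<subseteq> ?R"
    proof
      fix g assume "g \<in> ?L"
      then obtain f where f: "f \<in> carrier (bcoch X (RB (Suc k)))" "dB X (Suc k) f = \<zero>\<^bsub>bcoch X (RB (Suc (Suc k)))\<^esub>" "g = restrict f (RA (Suc k))"
        by auto
      obtain h where h: "h \<in> carrier (bcoch X (RB k))" "dB X k h = f" using acyc[OF f(1,2)] by blast
      have "g = dA X k (restrict h (RA k))" unfolding f(3) h(2)[symmetric] by (rule restrict_dB[OF X h(1)])
      then show "g \<in> ?R" using ahom_closed[OF restrict_ahom[OF sub] h(1)] by blast
    qed
    show "?R \<subseteq> ?L"
    proof
      fix g assume "g \<in> ?R"
      then obtain f where f: "f \<in> carrier (bcoch X (RA k))" "g = dA X k f" by auto
      let ?h = "ext0 X (RA k) (RB k) f"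
      have h: "?h \<in> carrier (bcoch X (RB k))" by (rule ahom_closed[OF ext0_ahom[OF XX sub] f(1)])
      have "g = restrict (dB X k ?h) (RA (Suc k))"
        unfolding restrict_dB[OF X h] restrict_ext0[OF f(1) sub] by (rule f(2))
      moreover have "dB X (Suc k) (dB X k ?h) = \<zero>\<^bsub>bcoch X (RB (Suc (Suc k)))\<^esub>"
        using B.bExt_complex[OF X, of k] h unfolding complex3_def by blast
      moreover have "dB X k ?h \<in> carrier (bcoch X (RB (Suc k)))" by (rule pull_closed[OF X B.D_closed h])
      ultimately show "g \<in> ?L" by blast
    qed
  qed
  then show ?thesis
    using connecting_iso[OF X acyc, of "Suc k"] unfolding bExt_def[of R X RA] homology_def by simp
qed

end

text \<open>\<open>\<kappa>\<close> evaluates \<open>l\<close> at a chosen preimage under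
  \<open>d\<close>; the kernel condition makes the choice immaterial, and this yields linearity
  too.\<close>

lemma ex_linear_factor:
  assumes Q: "left_module R Q" and N: "left_module R N" and X: "left_module R X"
    and d: "d \<in> ahom Q N" "\<And>r q. r \<in> carrier R \<Longrightarrow> q \<in> carrier Q \<Longrightarrow> d (smult Q r q) = smult N r (d q)"
      "\<And>y. y \<in> carrier N \<Longrightarrow> \<exists>q\<in>carrier Q. d q = y"
    and l: "l \<in> ahom Q X" "\<And>r q. r \<in> carrier R \<Longrightarrow> q \<in> carrier Q \<Longrightarrow> l (smult Q r q) = smult X r (l q)"
    and ker: "\<And>q. q \<in> carrier Q \<Longrightarrow> d q = \<zero>\<^bsub>N\<^esub> \<Longrightarrow> l q = \<zero>\<^bsub>X\<^esub>"
  shows "\<exists>\<kappa>\<in>linear_maps R N X. \<forall>q\<in>carrier Q. \<kappa> (d q) = l q"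
proof -
  note QQ = left_moduleD(2)[OF Q] and NN = left_moduleD(2)[OF N] and XX = left_moduleD(2)[OF X]
  interpret Q: left_module R Q by (rule Q)
  interpret N: left_module R N by (rule N)
  have wd: "l p = l q" if p: "p \<in> carrier Q" and q: "q \<in> carrier Q" and eq: "d p = d q" for p q
  proof -
    have "d (p \<ominus>\<^bsub>Q\<^esub> q) = \<zero>\<^bsub>N\<^esub>"
      unfolding ahom_minus[OF QQ NN d(1) p q] eq
      unfolding a_minus_def by (rule abelian_group.r_neg[OF NN ahom_closed[OF d(1) q]])
    then have m: "l p \<ominus>\<^bsub>X\<^esub> l q = \<zero>\<^bsub>X\<^esub>"
      using ker[OF Q.minus_closed[OF p q]] ahom_minus[OF QQ XX l(1) p q] by simp
    show ?thesis
      using add_minus_cancel[OF XX ahom_closed[OF l(1) p] ahom_closed[OF l(1) q]]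
        abelian_monoid.r_zero[OF abelian_groupD[OF XX] ahom_closed[OF l(1) q]] unfolding m by simp
  qed
  define s where "s y = (SOME q. q \<in> carrier Q \<and> d q = y)" for y
  have s: "s y \<in> carrier Q" "d (s y) = y" if "y \<in> carrier N" for y
    using someI_ex[of "\<lambda>q. q \<in> carrier Q \<and> d q = y"] d(3)[OF that] unfolding s_def by blast+
  have "(\<lambda>y. l (s y)) \<in> ahom N X"
  proof (rule ahomI)
    show "l (s y) \<in> carrier X" if "y \<in> carrier N" for y by (rule ahom_closed[OF l(1) s(1)[OF that]])
    fix x y assume x: "x \<in> carrier N" and y: "y \<in> carrier N"
    have xy: "x \<oplus>\<^bsub>N\<^esub> y \<in> carrier N" using x y by simp
    note c = s(1)[OF x] s(1)[OF y]
    have "l (s (x \<oplus>\<^bsub>N\<^esub> y)) = l (s x \<oplus>\<^bsub>Q\<^esub> s y)"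
      by (rule wd[OF s(1)[OF xy] Q.M.a_closed[OF c]]) (simp add: ahom_add[OF d(1) c] s(2)[OF x] s(2)[OF y] s(2)[OF xy])
    then show "l (s (x \<oplus>\<^bsub>N\<^esub> y)) = l (s x) \<oplus>\<^bsub>X\<^esub> l (s y)" using ahom_add[OF l(1) c] by simp
  qed
  then have "(\<lambda>y\<in>carrier N. l (s y)) \<in> linear_maps R N X"
  proof (rule linear_maps_restrict[OF N])
    fix r y assume r: "r \<in> carrier R" and y: "y \<in> carrier N"
    have ry: "smult N r y \<in> carrier N" by (rule N.smult_closed[OF r y])
    have "l (s (smult N r y)) = l (smult Q r (s y))"
      by (rule wd[OF s(1)[OF ry] Q.smult_closed[OF r s(1)[OF y]]]) (simp add: d(2)[OF r s(1)[OF y]] s(2)[OF y] s(2)[OF ry])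
    then show "l (s (smult N r y)) = smult X r (l (s y))" using l(2)[OF r s(1)[OF y]] by simp
  qed
  moreover have "(\<lambda>y\<in>carrier N. l (s y)) (d q) = l q" if q: "q \<in> carrier Q" for q
    using wd[OF s(1) q s(2)] ahom_closed[OF d(1) q] by simp
  ultimately show ?thesis by blast
qed

text \<open>Left exactness of Hom: a cochain of degree 0 is a cocycle iff its linear extension kills
  the cycles of degree 0, that is, iff it factors through the augmentation.\<close>

lemma (in resolution) zero_cocycle_bij:
  assumes X: "left_module R X"
  shows "\<kappa> \<in> linear_maps R N X \<Longrightarrow> (\<lambda>b\<in>B 0. \<kappa> (\<epsilon> b)) \<in> {f \<in> carrier (bcoch X (B 0)). pull R X (B 1) (D 0) f = \<zero>\<^bsub>bcoch X (B 1)\<^esub>}"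
    and "\<kappa> \<in> linear_maps R N X \<Longrightarrow> \<eta> \<in> linear_maps R N X \<Longrightarrow> (\<And>b. b \<in> B 0 \<Longrightarrow> \<kappa> (\<epsilon> b) = \<eta> (\<epsilon> b)) \<Longrightarrow> \<kappa> = \<eta>"
    and "f \<in> carrier (bcoch X (B 0)) \<Longrightarrow> pull R X (B 1) (D 0) f = \<zero>\<^bsub>bcoch X (B 1)\<^esub> \<Longrightarrow>
      \<exists>\<kappa>\<in>linear_maps R N X. (\<lambda>b\<in>B 0. \<kappa> (\<epsilon> b)) = f"
proof -
  have lin: "\<kappa> (linear_extension R N \<epsilon> p) = linear_extension R X (\<lambda>b\<in>B 0. \<kappa> (\<epsilon> b)) p"
    if \<kappa>: "\<kappa> \<in> linear_maps R N X" and p: "p \<in> fsupp R (B 0)" for \<kappa> p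
  proof -
    have "\<kappa> (linear_extension R N \<epsilon> p) = linear_extension R X (\<lambda>b. \<kappa> (\<epsilon> b)) p"
      by (rule lin_linear_hom[OF N X aug_closed p linear_mapsD(1)[OF \<kappa>] linear_mapsD(2)[OF \<kappa>]])
    also have "\<dots> = linear_extension R X (\<lambda>b\<in>B 0. \<kappa> (\<epsilon> b)) p"
      by (rule lin_cong[OF X _ p]) (auto intro: ahom_closed[OF linear_mapsD(1)[OF \<kappa>] aug_closed])
    finally show ?thesis .
  qed
  show "(\<lambda>b\<in>B 0. \<kappa> (\<epsilon> b)) \<in> {f \<in> carrier (bcoch X (B 0)). pull R X (B 1) (D 0) f = \<zero>\<^bsub>bcoch X (B 1)\<^esub>}"
    if \<kappa>: "\<kappa> \<in> linear_maps R N X"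
  proof -
    have "linear_extension R X (\<lambda>b\<in>B 0. \<kappa> (\<epsilon> b)) (D 0 b) = \<zero>\<^bsub>X\<^esub>" if b: "b \<in> B 1" for b
    proof -
      have b': "b \<in> B (Suc 0)" using b by simp
      have "linear_extension R N \<epsilon> (D 0 b) = \<zero>\<^bsub>N\<^esub>" using D_cycle[OF b'] by simp
      then have "linear_extension R X (\<lambda>b\<in>B 0. \<kappa> (\<epsilon> b)) (D 0 b) = \<kappa> \<zero>\<^bsub>N\<^esub>" using lin[OF \<kappa> D_closed[OF b']] by simp
      also have "\<dots> = \<zero>\<^bsub>X\<^esub>" by (rule ahom_zero[OF left_moduleD(2)[OF N] left_moduleD(2)[OF X] linear_mapsD(1)[OF \<kappa>]])
      finally show ?thesis .
    qed
    then show ?thesis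
      using ahom_closed[OF linear_mapsD(1)[OF \<kappa>] aug_closed] by (auto simp: bcoch_simps pull_def intro!: restrict_ext)
  qed
  show "\<kappa> = \<eta>" if \<kappa>: "\<kappa> \<in> linear_maps R N X" and \<eta>: "\<eta> \<in> linear_maps R N X" and eq: "\<And>b. b \<in> B 0 \<Longrightarrow> \<kappa> (\<epsilon> b) = \<eta> (\<epsilon> b)"
  proof (rule linear_maps_eqI[OF \<kappa> \<eta>])
    fix x assume "x \<in> carrier N"
    then obtain p where p: "p \<in> fsupp R (B 0)" "linear_extension R N \<epsilon> p = x" using aug_surj by blast
    have "(\<lambda>b\<in>B 0. \<kappa> (\<epsilon> b)) = (\<lambda>b\<in>B 0. \<eta> (\<epsilon> b))" by (rule restrict_ext) (rule eq)
    then show "\<kappa> x = \<eta> x" using lin[OF \<kappa> p(1)] lin[OF \<eta> p(1)] p(2) by simp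
  qed
  show "\<exists>\<kappa>\<in>linear_maps R N X. (\<lambda>b\<in>B 0. \<kappa> (\<epsilon> b)) = f"
    if f: "f \<in> carrier (bcoch X (B 0))" and z: "pull R X (B 1) (D 0) f = \<zero>\<^bsub>bcoch X (B 1)\<^esub>"
  proof -
    note fc = bcoch_mem[OF f]
    let ?l = "linear_extension R X f" and ?a = "linear_extension R N \<epsilon>"
    have lh: "?l \<in> ahom (free_module R (B 0)) X" by (rule lin_ahom[OF X fc])
    have ah: "?a \<in> ahom (free_module R (B 0)) N" by (rule lin_ahom[OF N aug_closed])
    interpret F: abelian_group "free_module R (B 0)" by (rule free_group[OF R])
    have ker: "?l p = \<zero>\<^bsub>X\<^esub>" if p: "p \<in> Z 0" for p
    proof -
      obtain g where g: "g \<in> fsupp R (B (Suc 0))" "flin R (B 0) (D 0) g = p" using exact[OF p] by blast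
      have "?l (flin R (B 0) (D 0) g) = linear_extension R X (\<lambda>b. ?l (D 0 b)) g"
        by (rule lin_assoc[OF X D_closed fc g(1)])
      also have "\<dots> = \<zero>\<^bsub>X\<^esub>"
      proof (rule lin_zero_fun[OF X g(1)])
        fix b assume "b \<in> B (Suc 0)"
        then show "?l (D 0 b) = \<zero>\<^bsub>X\<^esub>" using fun_cong[OF z, of b] by (simp add: pull_def bcoch_simps)
      qed
      finally show ?thesis using g(2) by simp
    qed
    have "\<exists>\<kappa>\<in>linear_maps R N X. \<forall>p\<in>carrier (free_module R (B 0)). \<kappa> (?a p) = ?l p"
    proof (rule ex_linear_factor[OF free_left_module[OF R] N X ah _ _ lh])
      show "?a (smult (free_module R (B 0)) r p) = smult N r (?a p)" "?l (smult (free_module R (B 0)) r p) = smult X r (?l p)"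
        if "r \<in> carrier R" "p \<in> carrier (free_module R (B 0))" for r p
        using that lin_smult[OF N aug_closed] lin_smult[OF X fc] by (simp_all add: carrier_free_module)
    qed (use aug_surj ker in \<open>auto simp: carrier_free_module\<close>)
    then obtain \<kappa> where \<kappa>: "\<kappa> \<in> linear_maps R N X" and \<kappa>a: "\<And>p. p \<in> fsupp R (B 0) \<Longrightarrow> \<kappa> (?a p) = ?l p"
      by (auto simp: carrier_free_module)
    note \<kappa>
    moreover have "(\<lambda>b\<in>B 0. \<kappa> (\<epsilon> b)) = f"
    proof (rule bcoch_eqI[OF _ f])
      have val: "\<kappa> (\<epsilon> b) = f b" if b: "b \<in> B 0" for b
      proof -
        have "?a (single R b \<one>\<^bsub>R\<^esub>) = \<epsilon> b" by (rule lin_unit_eval[OF N aug_closed b])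
        moreover have "?l (single R b \<one>\<^bsub>R\<^esub>) = f b" by (rule lin_unit_eval[OF X fc b])
        ultimately show ?thesis using \<kappa>a[OF unit_closed[OF R b]] by simp
      qed
      show "(\<lambda>b\<in>B 0. \<kappa> (\<epsilon> b)) b = f b" if "b \<in> B 0" for b using that val by simp
      show "(\<lambda>b\<in>B 0. \<kappa> (\<epsilon> b)) \<in> carrier (bcoch X (B 0))" using val fc by (auto simp: bcoch_simps)
    qed
    ultimately show ?thesis by blast
  qed
qed

lemma canonical_submodule_resolution:
  assumes M: "left_module R M" and A: "submod R A M" and N: "left_module R N"
    and d: "d \<in> ahom M N" "\<And>r x. r \<in> carrier R \<Longrightarrow> x \<in> carrier M \<Longrightarrow> d (smult M r x) = smult N r (d x)"
      "\<And>x. x \<in> carrier M \<Longrightarrow> d x = \<zero>\<^bsub>N\<^esub> \<longleftrightarrow> x \<in> A" "\<And>y. y \<in> carrier N \<Longrightarrow> \<exists>x\<in>carrier M. d x = y"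
  shows "submodule_resolution R M A N (res_basis R M) (res_basis R (M\<lparr>carrier := A\<rparr>)) (\<lambda>_. syz_val R) gen_val d"
  unfolding submodule_resolution_def submodule_resolution_axioms_def
  using canonical_resolution[OF M] canonical_resolution[OF submod_left_module[OF M A]] N A sub_basis[OF M A] d
  by blast

text \<open>Vanishing in all positive degrees, in terms of elements and for arbitrary bases and
  differentials; \<open>trivial_bExt_iff\<close> relates it to the groups.\<close>

definition cohomology_vanishes ::
    "('r, 'z) ring_scheme \<Rightarrow> ('r, 'y, 'v) module_scheme \<Rightarrow> (nat \<Rightarrow> 'b set) \<Rightarrow> (nat \<Rightarrow> 'b \<Rightarrow> 'b \<Rightarrow> 'r) \<Rightarrow> bool" where
  "cohomology_vanishes R X B D \<longleftrightarrow> (\<forall>k. \<forall>f\<in>carrier (bcoch X (B (Suc k))).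
     pull R X (B (Suc (Suc k))) (D (Suc k)) f = \<zero>\<^bsub>bcoch X (B (Suc (Suc k)))\<^esub> \<longrightarrow>
     (\<exists>h\<in>carrier (bcoch X (B k)). pull R X (B (Suc k)) (D k) h = f))"

abbreviation acyclic_module ::
    "('r, 'z) ring_scheme \<Rightarrow> ('r, 'n, 'w) module_scheme \<Rightarrow> ('r, 'y, 'v) module_scheme \<Rightarrow> bool" where
  "acyclic_module R N X \<equiv> cohomology_vanishes R X (res_basis R N) (\<lambda>_. syz_val R)"

lemma trivial_subquotientI:
  assumes "abelian_group G" "asub Z G" "asub B G" "B \<subseteq> Z" "Z \<subseteq> B"
  shows "trivial_group (subquotient G Z B)"
proof -
  have ZB: "Z = B" using assms by auto
  interpret Z: comm_group "(add_monoid G)\<lparr>carrier := Z\<rparr>" by (rule asub_comm_group[OF assms(1,2)])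
  interpret N: normal B "(add_monoid G)\<lparr>carrier := Z\<rparr>" by (rule asub_normal[OF assms(1-4)])
  have sg: "subgroup B ((add_monoid G)\<lparr>carrier := Z\<rparr>)" by (rule N.subgroup_axioms)
  have "B #>\<^bsub>(add_monoid G)\<lparr>carrier := Z\<rparr>\<^esub> x = B" if "x \<in> Z" for x
    by (rule Z.coset_join2[OF _ sg]) (use that ZB in auto)
  moreover have "\<zero>\<^bsub>G\<^esub> \<in> Z" by (rule asubD(2)[OF assms(2)])
  ultimately have "carrier (subquotient G Z B) = {B}"
    unfolding subquotient_def carrier_FactGroup by auto
  then show ?thesis
    unfolding trivial_group_def using subquotient_group[OF assms(1-4)] by (simp add: subquotient_def)
qed

lemma (in resolution) trivial_bExt_iff:
  assumes X: "left_module R X"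
  shows "(\<forall>k. trivial_group (bExt R X B D k)) \<longleftrightarrow> cohomology_vanishes R X B D"
proof
  assume tr: "\<forall>k. trivial_group (bExt R X B D k)"
  show "cohomology_vanishes R X B D" unfolding cohomology_vanishes_def
  proof (intro allI ballI impI)
    fix k f assume f: "f \<in> carrier (bcoch X (B (Suc k)))"
      "pull R X (B (Suc (Suc k))) (D (Suc k)) f = \<zero>\<^bsub>bcoch X (B (Suc (Suc k)))\<^esub>"
    have "f \<in> pull R X (B (Suc k)) (D k) ` carrier (bcoch X (B k))"
      by (rule trivial_subquotient_imp[OF tr[rule_format, of k, unfolded bExt_def homology_def] bcoch_group[OF left_moduleD(2)[OF X]]
        _ asubD(2)[OF complex3_asub(2)[OF bExt_complex[OF X]]]]) (use f in auto)
    then show "\<exists>h\<in>carrier (bcoch X (B k)). pull R X (B (Suc k)) (D k) h = f" by (elim imageE) auto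
  qed
next
  assume v: "cohomology_vanishes R X B D"
  show "\<forall>k. trivial_group (bExt R X B D k)"
  proof
    fix k
    show "trivial_group (bExt R X B D k)" unfolding bExt_def homology_def
    proof (rule trivial_subquotientI[OF bcoch_group[OF left_moduleD(2)[OF X]] complex3_asub[OF bExt_complex[OF X]]])
      show "{x \<in> carrier (bcoch X (B (Suc k))). pull R X (B (Suc (Suc k))) (D (Suc k)) x = \<zero>\<^bsub>bcoch X (B (Suc (Suc k)))\<^esub>}
        \<subseteq> pull R X (B (Suc k)) (D k) ` carrier (bcoch X (B k))"
      proof
        fix x assume x: "x \<in> {x \<in> carrier (bcoch X (B (Suc k))). pull R X (B (Suc (Suc k))) (D (Suc k)) x = \<zero>\<^bsub>bcoch X (B (Suc (Suc k)))\<^esub>}"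
        then obtain h where "h \<in> carrier (bcoch X (B k))" "pull R X (B (Suc k)) (D k) h = x"
          using v unfolding cohomology_vanishes_def by blast
        then show "x \<in> pull R X (B (Suc k)) (D k) ` carrier (bcoch X (B k))" by blast
      qed
    qed
  qed
qed

text \<open>Vanishing for one resolution carries over to the canonical one by
  \<open>bExt_unique\<close>.\<close>

lemma (in resolution) acyclicI:
  assumes X: "left_module R X" and v: "cohomology_vanishes R X B D"
  shows "acyclic_module R N X"
proof -
  interpret P: resolution R N "res_basis R N" "\<lambda>_. syz_val R" gen_val by (rule canonical_resolution[OF N])
  have "trivial_group (bExt R X (res_basis R N) (\<lambda>_. syz_val R) k)" for k
  proof -
    have "bExt R X B D k \<cong> bExt R X (res_basis R N) (\<lambda>_. syz_val R) k"
      by (rule bExt_unique[OF resolution_axioms P.resolution_axioms X])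
    moreover have "group (bExt R X (res_basis R N) (\<lambda>_. syz_val R) k)"
      unfolding bExt_def by (rule homology_group[OF P.bExt_complex[OF X]])
    moreover have "trivial_group (bExt R X B D k)" using trivial_bExt_iff[OF X] v by blast
    ultimately show ?thesis by (metis isomorphic_group_triviality1)
  qed
  then show ?thesis using P.trivial_bExt_iff[OF X] by blast
qed

lemma trivial_Ext_acyclic:
  assumes N: "left_module R N" and X: "left_module R X" and tr: "\<And>k. trivial_group (Ext R (Suc k) N X)"
  shows "acyclic_module R N X"
proof -
  interpret P: resolution R N "res_basis R N" "\<lambda>_. syz_val R" gen_val by (rule canonical_resolution[OF N])
  have "trivial_group (bExt R X (res_basis R N) (\<lambda>_. syz_val R) k)" for k
  proof -
    have "group (bExt R X (res_basis R N) (\<lambda>_. syz_val R) k)"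
      unfolding bExt_def by (rule homology_group[OF P.bExt_complex[OF X]])
    then show ?thesis using Ext_iso_bExt(1)[OF N X, of k] tr[of k] by (metis isomorphic_group_triviality1)
  qed
  then show ?thesis using P.trivial_bExt_iff[OF X] by blast
qed

text \<open>The cokernel of the restriction map from linear maps on \<open>M\<close> to linear maps
  on the submodule \<open>A\<close>.\<close>

definition hom_coker ::
    "('r, 'z) ring_scheme \<Rightarrow> ('r, 'x, 'y) module_scheme \<Rightarrow> 'x set \<Rightarrow> ('r, 'n, 'w) module_scheme \<Rightarrow> ('x \<Rightarrow> 'n) set monoid" where
  "hom_coker R M A X = subquotient (Hom_group R (M\<lparr>carrier := A\<rparr>) X) (linear_maps R (M\<lparr>carrier := A\<rparr>) X)
     ((\<lambda>f. restrict f A) ` linear_maps R M X)"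

lemma hom_coker_asub:
  assumes M: "left_module R M" and A: "submod R A M" and X: "left_module R X"
  shows "asub (linear_maps R (M\<lparr>carrier := A\<rparr>) X) (Hom_group R (M\<lparr>carrier := A\<rparr>) X)"
    "asub ((\<lambda>f. restrict f A) ` linear_maps R M X) (Hom_group R (M\<lparr>carrier := A\<rparr>) X)"
    "(\<lambda>f. restrict f A) ` linear_maps R M X \<subseteq> linear_maps R (M\<lparr>carrier := A\<rparr>) X"
proof -
  let ?A = "M\<lparr>carrier := A\<rparr>"
  note LA = submod_left_module[OF M A]
  have AM: "A \<subseteq> carrier M" using A by (auto simp: submod_def asub_def)
  have rl: "restrict f A \<in> linear_maps R ?A X" if f: "f \<in> linear_maps R M X" for f
  proof -
    have "f \<in> ahom ?A X" using linear_mapsD(1)[OF f] AM by (auto simp: ahom_def)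
    then have "restrict f (carrier ?A) \<in> linear_maps R ?A X"
      by (rule linear_maps_restrict[OF LA]) (use AM linear_mapsD(2)[OF f] in auto)
    then show ?thesis by simp
  qed
  have rh: "(\<lambda>f. restrict f A) \<in> ahom (Hom_group R M X) (Hom_group R ?A X)"
    by (rule ahomI) (use rl in \<open>auto simp: Hom_simps Int_absorb1[OF AM] subsetD[OF AM] intro!: restrict_ext\<close>)
  note GA = Hom_group_group[OF LA X] and GM = Hom_group_group[OF M X]
  show "asub (linear_maps R ?A X) (Hom_group R ?A X)" using asub_carrier[OF GA] by (simp add: Hom_simps)
  show "asub ((\<lambda>f. restrict f A) ` linear_maps R M X) (Hom_group R ?A X)"
    using asub_image[OF GM GA asub_carrier[OF GM] rh] by (simp add: Hom_simps)
  show "(\<lambda>f. restrict f A) ` linear_maps R M X \<subseteq> linear_maps R ?A X" using rl by auto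
qed

lemma hom_coker_group:
  assumes M: "left_module R M" and A: "submod R A M" and X: "left_module R X"
  shows "group (hom_coker R M A X)"
  unfolding hom_coker_def
  by (rule subquotient_group[OF Hom_group_group[OF submod_left_module[OF M A] X] hom_coker_asub[OF M A X]])

text \<open>Composition with the augmentation identifies linear maps with cocycles of degree 0, by
  \<open>zero_cocycle_bij\<close> for \<open>A\<close> and for \<open>Bm\<close>, and it is
  compatible with restriction. The target is the source of \<open>connecting_iso\<close> for
  \<open>k = 0\<close>.\<close>

lemma (in submodule_resolution) hom_coker_iso:
  assumes X: "left_module R X"
  shows "hom_coker R Bm A X \<cong> subquotient (bcoch X (RA 0)) {f \<in> carrier (bcoch X (RA 0)). dA X 0 f = \<zero>\<^bsub>bcoch X (RA (Suc 0))\<^esub>}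
      ((\<lambda>f. restrict f (RA 0)) ` {f \<in> carrier (bcoch X (RB 0)). dB X 0 f = \<zero>\<^bsub>bcoch X (RB (Suc 0))\<^esub>})"
  unfolding hom_coker_def
proof (rule subquotient_iso[where u = "\<lambda>\<kappa>. \<lambda>b\<in>RA 0. \<kappa> (\<epsilon> b)"])
  let ?A = "Bm\<lparr>carrier := A\<rparr>"
  note XX = left_moduleD(2)[OF X] and sM = A
  note grp = bcoch_group[OF XX]
  let ?ZA = "{f \<in> carrier (bcoch X (RA 0)). dA X 0 f = \<zero>\<^bsub>bcoch X (RA (Suc 0))\<^esub>}"
  let ?ZB = "{f \<in> carrier (bcoch X (RB 0)). dB X 0 f = \<zero>\<^bsub>bcoch X (RB (Suc 0))\<^esub>}"
  let ?W = "(\<lambda>f. restrict f (RA 0)) ` ?ZB"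
  note bA = A.zero_cocycle_bij[OF X, unfolded One_nat_def] and bB = B.zero_cocycle_bij[OF X, unfolded One_nat_def]
  note hc = hom_coker_asub[OF BL sM X]
  have dBh: "dB X k \<in> ahom (bcoch X (RB k)) (bcoch X (RB (Suc k)))" for k by (rule pull_ahom[OF X B.D_closed])
  have dAh: "dA X k \<in> ahom (bcoch X (RA k)) (bcoch X (RA (Suc k)))" for k by (rule pull_ahom[OF X A.D_closed])
  show "abelian_group (Hom_group R ?A X)" by (rule Hom_group_group[OF submod_left_module[OF BL sM] X])
  show "abelian_group (bcoch X (RA 0))" by (rule grp)
  show "asub (linear_maps R ?A X) (Hom_group R ?A X)" by (rule hc(1))
  show "asub ((\<lambda>f. restrict f A) ` linear_maps R Bm X) (Hom_group R ?A X)" by (rule hc(2))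
  show "(\<lambda>f. restrict f A) ` linear_maps R Bm X \<subseteq> linear_maps R ?A X" by (rule hc(3))
  show "asub ?ZA (bcoch X (RA 0))" using asub_kernel[OF grp grp asub_carrier[OF grp] dAh] .
  have sZB: "asub ?ZB (bcoch X (RB 0))" using asub_kernel[OF grp grp asub_carrier[OF grp] dBh] .
  show "asub ?W (bcoch X (RA 0))" by (rule asub_image[OF grp grp sZB restrict_ahom[OF sub]])
  show "?W \<subseteq> ?ZA"
  proof
    fix f assume "f \<in> ?W"
    then obtain h where h: "h \<in> carrier (bcoch X (RB 0))" "dB X 0 h = \<zero>\<^bsub>bcoch X (RB (Suc 0))\<^esub>" "f = restrict h (RA 0)" by auto
    have "dA X 0 f = restrict (dB X 0 h) (RA (Suc 0))" unfolding h(3) by (rule restrict_dB[OF X h(1), symmetric])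
    also have "\<dots> = \<zero>\<^bsub>bcoch X (RA (Suc 0))\<^esub>" unfolding h(2) by (rule ahom_zero[OF grp grp restrict_ahom[OF sub]])
    finally show "f \<in> ?ZA" using ahom_closed[OF restrict_ahom[OF sub] h(1)] h(3) by simp
  qed
  fix \<kappa> assume \<kappa>: "\<kappa> \<in> linear_maps R ?A X"
  show "(\<lambda>b\<in>RA 0. \<kappa> (\<epsilon> b)) \<in> ?ZA" by (rule bA(1)[OF \<kappa>])
  show "(\<lambda>b\<in>RA 0. (\<kappa> \<oplus>\<^bsub>Hom_group R ?A X\<^esub> \<eta>) (\<epsilon> b)) = (\<lambda>b\<in>RA 0. \<kappa> (\<epsilon> b)) \<oplus>\<^bsub>bcoch X (RA 0)\<^esub> (\<lambda>b\<in>RA 0. \<eta> (\<epsilon> b))" for \<eta>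
    using aug_A by (auto simp: Hom_simps bcoch_simps intro!: restrict_ext)
  show "(\<lambda>b\<in>RA 0. \<kappa> (\<epsilon> b)) \<in> ?W \<longleftrightarrow> \<kappa> \<in> (\<lambda>f. restrict f A) ` linear_maps R Bm X"
  proof
    assume "(\<lambda>b\<in>RA 0. \<kappa> (\<epsilon> b)) \<in> ?W"
    then obtain h where h: "h \<in> carrier (bcoch X (RB 0))" "dB X 0 h = \<zero>\<^bsub>bcoch X (RB (Suc 0))\<^esub>" "(\<lambda>b\<in>RA 0. \<kappa> (\<epsilon> b)) = restrict h (RA 0)" by auto
    obtain \<eta> where \<eta>: "\<eta> \<in> linear_maps R Bm X" "(\<lambda>b\<in>RB 0. \<eta> (\<epsilon> b)) = h" using bB(3)[OF h(1,2)] by blast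
    have \<eta>A: "restrict \<eta> A \<in> linear_maps R ?A X" using hc(3) \<eta>(1) by blast
    have "\<kappa> = restrict \<eta> A"
    proof (rule bA(2)[OF \<kappa> \<eta>A])
      fix b assume b: "b \<in> RA 0"
      have bB': "b \<in> RB 0" using b sub by blast
      have "\<kappa> (\<epsilon> b) = h b" using fun_cong[OF h(3), of b] b by simp
      also have "\<dots> = \<eta> (\<epsilon> b)" using fun_cong[OF \<eta>(2), of b] bB' by simp
      finally show "\<kappa> (\<epsilon> b) = restrict \<eta> A (\<epsilon> b)" using aug_A[OF b] by simp
    qed
    then show "\<kappa> \<in> (\<lambda>f. restrict f A) ` linear_maps R Bm X" using \<eta>(1) by blast
  next
    assume "\<kappa> \<in> (\<lambda>f. restrict f A) ` linear_maps R Bm X"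
    then obtain \<eta> where \<eta>: "\<eta> \<in> linear_maps R Bm X" "\<kappa> = restrict \<eta> A" by blast
    have "(\<lambda>b\<in>RA 0. \<kappa> (\<epsilon> b)) = restrict (\<lambda>b\<in>RB 0. \<eta> (\<epsilon> b)) (RA 0)"
      using \<eta>(2) aug_A sub[of 0] by (auto simp: subset_iff intro!: restrict_ext)
    moreover have "(\<lambda>b\<in>RB 0. \<eta> (\<epsilon> b)) \<in> ?ZB" by (rule bB(1)[OF \<eta>(1)])
    ultimately show "(\<lambda>b\<in>RA 0. \<kappa> (\<epsilon> b)) \<in> ?W" by blast
  qed
next
  let ?A = "Bm\<lparr>carrier := A\<rparr>"
  note bA = A.zero_cocycle_bij[OF X, unfolded One_nat_def] and bB = B.zero_cocycle_bij[OF X, unfolded One_nat_def]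
  interpret G: abelian_group "bcoch X (RA 0)" by (rule bcoch_group[OF left_moduleD(2)[OF X]])
  fix z assume "z \<in> {f \<in> carrier (bcoch X (RA 0)). dA X 0 f = \<zero>\<^bsub>bcoch X (RA (Suc 0))\<^esub>}"
  then have z: "z \<in> carrier (bcoch X (RA 0))" "dA X 0 z = \<zero>\<^bsub>bcoch X (RA (Suc 0))\<^esub>" by auto
  obtain \<kappa> where \<kappa>: "\<kappa> \<in> linear_maps R ?A X" "(\<lambda>b\<in>RA 0. \<kappa> (\<epsilon> b)) = z" using bA(3)[OF z] by blast
  have zB: "\<zero>\<^bsub>bcoch X (RB 0)\<^esub> \<in> {f \<in> carrier (bcoch X (RB 0)). dB X 0 f = \<zero>\<^bsub>bcoch X (RB (Suc 0))\<^esub>}"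
  proof -
    have "dB X 0 \<zero>\<^bsub>bcoch X (RB 0)\<^esub> = \<zero>\<^bsub>bcoch X (RB (Suc 0))\<^esub>"
      by (rule ahom_zero[OF bcoch_group[OF left_moduleD(2)[OF X]] bcoch_group[OF left_moduleD(2)[OF X]] pull_ahom[OF X B.D_closed]])
    then show ?thesis using abelian_groupE(2)[OF bcoch_group[OF left_moduleD(2)[OF X]]] by simp
  qed
  have "\<zero>\<^bsub>bcoch X (RA 0)\<^esub> = restrict \<zero>\<^bsub>bcoch X (RB 0)\<^esub> (RA 0)"
    using sub[of 0] by (auto simp: bcoch_simps subset_iff intro!: restrict_ext)
  then have "\<zero>\<^bsub>bcoch X (RA 0)\<^esub> \<in> (\<lambda>f. restrict f (RA 0)) ` {f \<in> carrier (bcoch X (RB 0)). dB X 0 f = \<zero>\<^bsub>bcoch X (RB (Suc 0))\<^esub>}"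
    using zB by blast
  moreover have "z = \<zero>\<^bsub>bcoch X (RA 0)\<^esub> \<oplus>\<^bsub>bcoch X (RA 0)\<^esub> (\<lambda>b\<in>RA 0. \<kappa> (\<epsilon> b))"
    unfolding \<kappa>(2) using z(1) by simp
  ultimately show "\<exists>\<kappa>\<in>linear_maps R ?A X. \<exists>b\<in>(\<lambda>f. restrict f (RA 0)) ` {f \<in> carrier (bcoch X (RB 0)). dB X 0 f = \<zero>\<^bsub>bcoch X (RB (Suc 0))\<^esub>}.
      z = b \<oplus>\<^bsub>bcoch X (RA 0)\<^esub> (\<lambda>b\<in>RA 0. \<kappa> (\<epsilon> b))"
    using \<kappa>(1) by blast
qed

text \<open>The long exact sequence of \<open>0 \<rightarrow> A \<rightarrow> M \<rightarrow> N
  \<rightarrow> 0\<close> around the vanishing groups of \<open>M\<close>: by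
  \<open>shift_iso\<close> in positive degree, and by \<open>hom_coker_iso\<close> with
  \<open>connecting_iso\<close> at its beginning.\<close>

theorem dimension_shift:
  assumes M: "left_module R M" and A: "submod R A M" and N: "left_module R N" and X: "left_module R X"
    and d: "d \<in> ahom M N" "\<And>r x. r \<in> carrier R \<Longrightarrow> x \<in> carrier M \<Longrightarrow> d (smult M r x) = smult N r (d x)"
      "\<And>x. x \<in> carrier M \<Longrightarrow> d x = \<zero>\<^bsub>N\<^esub> \<longleftrightarrow> x \<in> A" "\<And>y. y \<in> carrier N \<Longrightarrow> \<exists>x\<in>carrier M. d x = y"
    and acyc: "acyclic_module R M X"
  shows "Ext R (Suc k) (M\<lparr>carrier := A\<rparr>) X \<cong> Ext R (Suc (Suc k)) N X"
    and "hom_coker R M A X \<cong> Ext R (Suc 0) N X"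
proof -
  interpret s: submodule_resolution R M A N "res_basis R M" "res_basis R (M\<lparr>carrier := A\<rparr>)" "\<lambda>_. syz_val R" gen_val d
    by (rule canonical_submodule_resolution[OF M A N d])
  note LA = submod_left_module[OF M A]
  have ac: "\<exists>h\<in>carrier (bcoch X (res_basis R M k)). s.dB X k h = f"
    if "f \<in> carrier (bcoch X (res_basis R M (Suc k)))" "s.dB X (Suc k) f = \<zero>\<^bsub>bcoch X (res_basis R M (Suc (Suc k)))\<^esub>" for k f
    using acyc that unfolding cohomology_vanishes_def by blast
  have last: "bExt R X s.C s.DC k \<cong> Ext R (Suc k) N X" for k
  proof -
    have "bExt R X s.C s.DC k \<cong> bExt R X (res_basis R N) (\<lambda>_. syz_val R) k"
      by (rule bExt_unique[OF s.quotient_resolution canonical_resolution[OF N] X])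
    also have "\<dots> \<cong> Ext R (Suc k) N X" by (rule group.iso_sym[OF Ext_group[OF N X] Ext_iso_bExt(1)[OF N X]])
    finally show ?thesis .
  qed
  have "Ext R (Suc k) (M\<lparr>carrier := A\<rparr>) X \<cong> bExt R X (res_basis R (M\<lparr>carrier := A\<rparr>)) (\<lambda>_. syz_val R) k"
    by (rule Ext_iso_bExt(1)[OF LA X])
  also have "\<dots> \<cong> bExt R X s.C s.DC (Suc k)" by (rule s.shift_iso[OF X ac])
  also note last
  finally show "Ext R (Suc k) (M\<lparr>carrier := A\<rparr>) X \<cong> Ext R (Suc (Suc k)) N X" .
  have "hom_coker R M A X \<cong> bExt R X s.C s.DC 0"
    by (rule iso_trans[OF s.hom_coker_iso[OF X] s.connecting_iso[OF X ac]])
  also note last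
  finally show "hom_coker R M A X \<cong> Ext R (Suc 0) N X" .
qed

section \<open>Resolutions of direct sums\<close>

text \<open>A direct sum given by inclusions and projections, possibly with infinitely many
  summands: \<open>proj_finite\<close> and \<open>proj_zero\<close> say that an element has finitely
  many components and is determined by them. All summands share the differential \<open>D\<close>
  and the augmentation \<open>\<epsilon>\<close> on generators, as canonical resolutions do.\<close>

locale direct_sum = left_module R N
  for R :: "('r, 'z) ring_scheme" and N :: "('r, 'n, 'y) module_scheme" +
  fixes I :: "'i set" and Ni :: "'i \<Rightarrow> ('r, 'x, 'w) module_scheme" and \<iota> :: "'i \<Rightarrow> 'x \<Rightarrow> 'n" and \<pi> :: "'i \<Rightarrow> 'n \<Rightarrow> 'x"
    and Bi :: "'i \<Rightarrow> nat \<Rightarrow> 'b set" and D :: "nat \<Rightarrow> 'b \<Rightarrow> 'b \<Rightarrow> 'r" and \<epsilon> :: "'b \<Rightarrow> 'x"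
  assumes res: "i \<in> I \<Longrightarrow> resolution R (Ni i) (Bi i) D \<epsilon>"
    and inc: "i \<in> I \<Longrightarrow> \<iota> i \<in> ahom (Ni i) N"
    and inc_smult: "i \<in> I \<Longrightarrow> r \<in> carrier R \<Longrightarrow> x \<in> carrier (Ni i) \<Longrightarrow> \<iota> i (smult (Ni i) r x) = smult N r (\<iota> i x)"
    and proj: "i \<in> I \<Longrightarrow> \<pi> i \<in> ahom N (Ni i)"
    and proj_inc: "i \<in> I \<Longrightarrow> x \<in> carrier (Ni i) \<Longrightarrow> \<pi> i (\<iota> i x) = x"
    and proj_inc_other: "i \<in> I \<Longrightarrow> j \<in> I \<Longrightarrow> i \<noteq> j \<Longrightarrow> x \<in> carrier (Ni i) \<Longrightarrow> \<pi> j (\<iota> i x) = \<zero>\<^bsub>Ni j\<^esub>"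
    and proj_finite: "y \<in> carrier N \<Longrightarrow> finite {i \<in> I. \<pi> i y \<noteq> \<zero>\<^bsub>Ni i\<^esub>}"
    and proj_zero: "y \<in> carrier N \<Longrightarrow> (\<And>i. i \<in> I \<Longrightarrow> \<pi> i y = \<zero>\<^bsub>Ni i\<^esub>) \<Longrightarrow> y = \<zero>\<^bsub>N\<^esub>"
begin

lemma R: "ring R" and NL: "left_module R N"
  using left_module_axioms by (auto simp: left_module_def)

definition RB where "RB k = Sigma I (\<lambda>i. Bi i k)"
definition slice :: "'i \<Rightarrow> ('i \<times> 'b \<Rightarrow> 'r) \<Rightarrow> 'b \<Rightarrow> 'r" where "slice i f = (\<lambda>g. f (i, g))"
definition embed :: "'i \<Rightarrow> ('b \<Rightarrow> 'r) \<Rightarrow> 'i \<times> 'b \<Rightarrow> 'r" where "embed i p = (\<lambda>(j, g). if j = i then p g else \<zero>\<^bsub>R\<^esub>)"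
definition DD where "DD k = (\<lambda>(i, g). embed i (D k g))"
definition EE where "EE = (\<lambda>(i, g). \<iota> i (\<epsilon> g))"

lemma slice_closed:
  assumes f: "f \<in> fsupp R (RB k)" and i: "i \<in> I"
  shows "slice i f \<in> fsupp R (Bi i k)"
proof (rule fsuppI)
  show "slice i f b \<in> carrier R" for b using fsupp_closed[OF f ring.is_abelian_group[OF R]] by (simp add: slice_def)
  show "slice i f b = \<zero>\<^bsub>R\<^esub>" if "b \<notin> Bi i k" for b using fsuppD(2)[OF f, of "(i, b)"] that by (simp add: slice_def RB_def)
  show "finite (Pair i -` {b. f b \<noteq> \<zero>\<^bsub>R\<^esub>})" by (rule finite_vimageI[OF fsuppD(3)[OF f]]) (simp add: inj_on_def)
qed (auto simp: slice_def)

lemma embed_closed: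
  assumes p: "p \<in> fsupp R (Bi i k)" and i: "i \<in> I"
  shows "embed i p \<in> fsupp R (RB k)"
proof (rule fsuppI)
  show "embed i p b \<in> carrier R" if "b \<in> RB k" for b
    using fsupp_closed[OF p ring.is_abelian_group[OF R]] abelian_groupE(2)[OF ring.is_abelian_group[OF R]]
    by (auto simp: embed_def split: prod.splits)
  show "embed i p b = \<zero>\<^bsub>R\<^esub>" if "b \<notin> RB k" for b
    using fsuppD(2)[OF p] that i by (auto simp: embed_def RB_def split: prod.splits)
  show "finite (Pair i ` {b. p b \<noteq> \<zero>\<^bsub>R\<^esub>})" using fsuppD(3)[OF p] by simp
qed (auto simp: embed_def split: if_splits)

lemma slice_ahom: "i \<in> I \<Longrightarrow> slice i \<in> ahom (free_module R (RB k)) (free_module R (Bi i k))"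
  by (rule ahomI) (simp_all add: carrier_free_module slice_closed, simp add: slice_def add_free_module)

lemma slice_smult: "slice i (smult (free_module R (RB k)) r f) = smult (free_module R (Bi i k)) r (slice i f)"
  by (simp add: slice_def smult_free_module)

lemma slice_embed: "slice i (embed j p) = (if i = j then p else \<zero>\<^bsub>free_module R (Bi i k)\<^esub>)"
  by (auto simp: slice_def embed_def zero_free_module)

lemma slice_single: "slice i (single R (j, g) r) = (if i = j then single R g r else \<zero>\<^bsub>free_module R (Bi i k)\<^esub>)"
  by (auto simp: slice_def single_def zero_free_module)

lemma slice_eqI:
  assumes "f \<in> fsupp R (RB k)" "f' \<in> fsupp R (RB k)" "\<And>i. i \<in> I \<Longrightarrow> slice i f = slice i f'"
  shows "f = f'"
proof
  fix b :: "'i \<times> 'b"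
  obtain i g where b: "b = (i, g)" by (cases b)
  show "f b = f' b"
  proof (cases "i \<in> I")
    case True
    then show ?thesis using fun_cong[OF assms(3)[OF True], of g] by (simp add: slice_def b)
  next
    case False
    then show ?thesis using fsuppD(2)[OF assms(1), of b] fsuppD(2)[OF assms(2), of b] by (simp add: b RB_def)
  qed
qed

lemma assemble:
  assumes J: "finite J" "J \<subseteq> I" and p: "\<And>i. i \<in> J \<Longrightarrow> p i \<in> fsupp R (Bi i k)"
  shows "\<exists>f\<in>fsupp R (RB k). \<forall>i\<in>I. slice i f = (if i \<in> J then p i else \<zero>\<^bsub>free_module R (Bi i k)\<^esub>)"
proof
  let ?f = "\<lambda>(i, g). if i \<in> J then p i g else \<zero>\<^bsub>R\<^esub>"
  show "\<forall>i\<in>I. slice i ?f = (if i \<in> J then p i else \<zero>\<^bsub>free_module R (Bi i k)\<^esub>)"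
    by (auto simp: slice_def zero_free_module)
  show "?f \<in> fsupp R (RB k)"
  proof (rule fsuppI)
    show "?f b \<in> carrier R" if "b \<in> RB k" for b
      using fsupp_closed[OF p ring.is_abelian_group[OF R]] abelian_groupE(2)[OF ring.is_abelian_group[OF R]]
      by (auto split: prod.splits)
    show "?f b = \<zero>\<^bsub>R\<^esub>" if "b \<notin> RB k" for b
      using fsuppD(2)[OF p] J(2) that by (auto simp: RB_def split: prod.splits)
    show "finite (Sigma J (\<lambda>i. {g. p i g \<noteq> \<zero>\<^bsub>R\<^esub>}))"
      by (rule finite_SigmaI[OF J(1)]) (rule fsuppD(3)[OF p])
  qed (auto split: if_splits)
qed

lemma D_cl: "i \<in> I \<Longrightarrow> g \<in> Bi i (Suc k) \<Longrightarrow> D k g \<in> fsupp R (Bi i k)"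
  by (rule resolution.D_closed[OF res])

lemma DD_closed: "b \<in> RB (Suc k) \<Longrightarrow> DD k b \<in> fsupp R (RB k)"
  by (auto simp: RB_def DD_def intro!: embed_closed[unfolded RB_def] D_cl)

lemma EE_closed: "b \<in> RB 0 \<Longrightarrow> EE b \<in> carrier N"
  by (auto simp: RB_def EE_def intro!: ahom_closed[OF inc] resolution.aug_closed[OF res])

lemma slice_flin:
  assumes i: "i \<in> I" and f: "f \<in> fsupp R (RB (Suc k))"
  shows "slice i (flin R (RB k) (DD k) f) = flin R (Bi i k) (D k) (slice i f)"
proof (rule fs_ahom_eqI[OF is_fs_free_module[OF R] free_group[OF R] _ _ f])
  show "(\<lambda>f. slice i (flin R (RB k) (DD k) f)) \<in> ahom (free_module R (RB (Suc k))) (free_module R (Bi i k))"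
    by (rule ahom_compose[OF flin_ahom[OF R DD_closed] slice_ahom[OF i]])
  show "(\<lambda>f. flin R (Bi i k) (D k) (slice i f)) \<in> ahom (free_module R (RB (Suc k))) (free_module R (Bi i k))"
    by (rule ahom_compose[OF slice_ahom[OF i] flin_ahom[OF R D_cl[OF i]]])
  fix r b assume r: "r \<in> carrier R" and b: "b \<in> RB (Suc k)"
  obtain j g where jg: "b = (j, g)" "j \<in> I" "g \<in> Bi j (Suc k)" using b by (auto simp: RB_def)
  have "flin R (RB k) (DD k) (single R b r) = smult (free_module R (RB k)) r (DD k b)"
    by (rule lin_single[OF free_left_module[OF R] _ b r]) (simp add: carrier_free_module DD_closed)
  then have 1: "slice i (flin R (RB k) (DD k) (single R b r)) = smult (free_module R (Bi i k)) r (slice i (embed j (D k g)))"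
    by (simp add: slice_smult[of i k] DD_def jg)
  show "slice i (flin R (RB k) (DD k) (single R b r)) = flin R (Bi i k) (D k) (slice i (single R b r))"
  proof (cases "i = j")
    case True
    have "flin R (Bi i k) (D k) (single R g r) = smult (free_module R (Bi i k)) r (D k g)"
      by (rule lin_single[OF free_left_module[OF R] _ _ r]) (use jg True in \<open>simp_all add: carrier_free_module D_cl\<close>)
    then show ?thesis unfolding jg(1) 1[unfolded jg(1)] slice_embed[where k = k] slice_single[where k = "Suc k"] using True by simp
  next
    case False
    have "flin R (Bi i k) (D k) \<zero>\<^bsub>free_module R (Bi i (Suc k))\<^esub> = \<zero>\<^bsub>free_module R (Bi i k)\<^esub>"
      by (rule flin_zero[OF R D_cl[OF i]])
    then show ?thesis unfolding jg(1) 1[unfolded jg(1)] slice_embed[where k = k] slice_single[where k = "Suc k"]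
      using False smult_zero[OF free_left_module[OF R] r] by simp
  qed
qed

lemma slice_aug:
  assumes i: "i \<in> I" and f: "f \<in> fsupp R (RB 0)"
  shows "\<pi> i (linear_extension R N EE f) = linear_extension R (Ni i) \<epsilon> (slice i f)"
proof -
  interpret Q: resolution R "Ni i" "Bi i" D \<epsilon> by (rule res[OF i])
  show ?thesis
  proof (rule fs_ahom_eqI[OF is_fs_free_module[OF R] left_moduleD(2)[OF Q.N] _ _ f])
    show "(\<lambda>f. \<pi> i (linear_extension R N EE f)) \<in> ahom (free_module R (RB 0)) (Ni i)"
      by (rule ahom_compose[OF lin_ahom[OF NL EE_closed] proj[OF i]])
    show "(\<lambda>f. linear_extension R (Ni i) \<epsilon> (slice i f)) \<in> ahom (free_module R (RB 0)) (Ni i)"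
      by (rule ahom_compose[OF slice_ahom[OF i] lin_ahom[OF Q.N Q.aug_closed]])
    fix r b assume r: "r \<in> carrier R" and b: "b \<in> RB 0"
    obtain j g where jg: "b = (j, g)" "j \<in> I" "g \<in> Bi j 0" using b by (auto simp: RB_def)
    interpret J: resolution R "Ni j" "Bi j" D \<epsilon> by (rule res[OF jg(2)])
    have re: "smult (Ni j) r (\<epsilon> g) \<in> carrier (Ni j)" by (rule J.smult_closed[OF r J.aug_closed[OF jg(3)]])
    have "linear_extension R N EE (single R b r) = smult N r (EE b)"
      by (rule lin_single[OF NL EE_closed b r])
    then have 1: "linear_extension R N EE (single R b r) = \<iota> j (smult (Ni j) r (\<epsilon> g))"
      using inc_smult[OF jg(2) r J.aug_closed[OF jg(3)]] by (simp add: EE_def jg(1))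
    show "\<pi> i (linear_extension R N EE (single R b r)) = linear_extension R (Ni i) \<epsilon> (slice i (single R b r))"
    proof (cases "i = j")
      case True
      have "linear_extension R (Ni i) \<epsilon> (single R g r) = smult (Ni i) r (\<epsilon> g)"
        by (rule lin_single[OF Q.N Q.aug_closed _ r]) (use jg True in simp_all)
      then show ?thesis unfolding jg(1) 1[unfolded jg(1)] slice_single[where k = 0] using True proj_inc[OF jg(2) re] by simp
    next
      case False
      have "linear_extension R (Ni i) \<epsilon> \<zero>\<^bsub>free_module R (Bi i 0)\<^esub> = \<zero>\<^bsub>Ni i\<^esub>"
        by (rule lin_zero[OF Q.N Q.aug_closed])
      then show ?thesis unfolding jg(1) 1[unfolded jg(1)] slice_single[where k = 0]
        using False proj_inc_other[OF jg(2) i _ re] by simp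
    qed
  qed
qed

text \<open>Differential and augmentation act slice by slice (\<open>slice_flin\<close>,
  \<open>slice_aug\<close>), and a chain, or by \<open>proj_zero\<close> an element of
  \<open>N\<close>, is zero iff all its components are.\<close>

lemma slice_cycles:
  "f \<in> based_cycles R N RB DD EE k \<longleftrightarrow> f \<in> fsupp R (RB k) \<and> (\<forall>i\<in>I. slice i f \<in> based_cycles R (Ni i) (Bi i) D \<epsilon> k)"
proof (cases "f \<in> fsupp R (RB k)")
  case f: True
  show ?thesis
  proof (cases k)
    case 0
    have f0: "f \<in> fsupp R (RB 0)" using f 0 by simp
    have c: "linear_extension R N EE f \<in> carrier N" by (rule lin_closed[OF NL EE_closed f0])
    have "linear_extension R N EE f = \<zero>\<^bsub>N\<^esub> \<longleftrightarrow> (\<forall>i\<in>I. \<pi> i (linear_extension R N EE f) = \<zero>\<^bsub>Ni i\<^esub>)"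
      using proj_zero[OF c] ahom_zero[OF left_moduleD(2)[OF NL] left_moduleD(2)[OF resolution.N[OF res]] proj] by auto
    then show ?thesis using f0 slice_closed[OF f0] slice_aug[OF _ f0] 0 by auto
  next
    case (Suc j)
    have fS: "f \<in> fsupp R (RB (Suc j))" using f Suc by simp
    have c: "flin R (RB j) (DD j) f \<in> fsupp R (RB j)" by (rule flin_closed[OF R DD_closed fS])
    have "flin R (RB j) (DD j) f = \<zero>\<^bsub>free_module R (RB j)\<^esub> \<longleftrightarrow>
      (\<forall>i\<in>I. slice i (flin R (RB j) (DD j) f) = \<zero>\<^bsub>free_module R (Bi i j)\<^esub>)"
    proof
      assume "flin R (RB j) (DD j) f = \<zero>\<^bsub>free_module R (RB j)\<^esub>"
      then show "\<forall>i\<in>I. slice i (flin R (RB j) (DD j) f) = \<zero>\<^bsub>free_module R (Bi i j)\<^esub>"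
        by (simp add: slice_def zero_free_module)
    next
      assume a: "\<forall>i\<in>I. slice i (flin R (RB j) (DD j) f) = \<zero>\<^bsub>free_module R (Bi i j)\<^esub>"
      show "flin R (RB j) (DD j) f = \<zero>\<^bsub>free_module R (RB j)\<^esub>"
      proof (rule slice_eqI[OF c])
        show "\<zero>\<^bsub>free_module R (RB j)\<^esub> \<in> fsupp R (RB j)"
          using abelian_groupE(2)[OF free_group[OF R]] by (simp only: carrier_free_module)
      qed (use a in \<open>simp add: slice_def zero_free_module\<close>)
    qed
    then show ?thesis using fS slice_closed[OF fS] slice_flin[OF _ fS] Suc by auto
  qed
next
  case False
  then show ?thesis by (cases k) auto
qed

lemma sum_resolution: "resolution R N RB DD EE"
proof unfold_locales
  show "DD k b \<in> based_cycles R N RB DD EE k" if "b \<in> RB (Suc k)" for b k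
    unfolding slice_cycles
  proof (intro conjI ballI)
    show "DD k b \<in> fsupp R (RB k)" by (rule DD_closed[OF that])
    fix i assume i: "i \<in> I"
    interpret Q: resolution R "Ni i" "Bi i" D \<epsilon> by (rule res[OF i])
    obtain j g where jg: "b = (j, g)" "j \<in> I" "g \<in> Bi j (Suc k)" using \<open>b \<in> RB (Suc k)\<close> by (auto simp: RB_def)
    have z: "\<zero>\<^bsub>free_module R (Bi i k)\<^esub> \<in> Q.Z k" by (rule asubD(2)[OF Q.asub_cycles])
    show "slice i (DD k b) \<in> Q.Z k"
    proof (cases "i = j")
      case True
      then show ?thesis using Q.D_cycle[of g k] jg by (simp add: DD_def slice_embed[where k = k])
    next
      case False
      then show ?thesis using z by (simp add: jg(1) DD_def slice_embed[where k = k])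
    qed
  qed
  show "\<exists>g\<in>fsupp R (RB (Suc k)). flin R (RB k) (DD k) g = f" if f: "f \<in> based_cycles R N RB DD EE k" for f k
  proof -
    have fc: "f \<in> fsupp R (RB k)" and fz: "\<And>i. i \<in> I \<Longrightarrow> slice i f \<in> based_cycles R (Ni i) (Bi i) D \<epsilon> k"
      using f slice_cycles by auto
    \<comment> \<open>Only finitely many slices of \<open>f\<close> are nonzero. Preimages are
      chosen for these and zero elsewhere, which keeps the assembled chain finitely
      supported.\<close>
    let ?J = "fst ` {b. f b \<noteq> \<zero>\<^bsub>R\<^esub>}"
    have J: "finite ?J" "?J \<subseteq> I" using fsuppD(3,4)[OF fc] by (auto simp: RB_def)
    have "\<forall>i\<in>?J. \<exists>g. g \<in> fsupp R (Bi i (Suc k)) \<and> flin R (Bi i k) (D k) g = slice i f"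
    proof
      fix i assume "i \<in> ?J"
      then have i: "i \<in> I" using J by blast
      show "\<exists>g. g \<in> fsupp R (Bi i (Suc k)) \<and> flin R (Bi i k) (D k) g = slice i f"
        using resolution.exact[OF res[OF i] fz[OF i]] by blast
    qed
    then obtain p where p: "\<And>i. i \<in> ?J \<Longrightarrow> p i \<in> fsupp R (Bi i (Suc k))" "\<And>i. i \<in> ?J \<Longrightarrow> flin R (Bi i k) (D k) (p i) = slice i f"
      using bchoice[of ?J "\<lambda>i g. g \<in> fsupp R (Bi i (Suc k)) \<and> flin R (Bi i k) (D k) g = slice i f"] by blast
    obtain g where g: "g \<in> fsupp R (RB (Suc k))" "\<forall>i\<in>I. slice i g = (if i \<in> ?J then p i else \<zero>\<^bsub>free_module R (Bi i (Suc k))\<^esub>)"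
      using assemble[OF J p(1)] by blast
    have "flin R (RB k) (DD k) g = f"
    proof (rule slice_eqI[OF flin_closed[OF R DD_closed g(1)] fc])
      fix i assume i: "i \<in> I"
      show "slice i (flin R (RB k) (DD k) g) = slice i f"
      proof (cases "i \<in> ?J")
        case True
        then show ?thesis unfolding slice_flin[OF i g(1)] using g(2) i p(2)[OF True] by simp
      next
        case False
        have "flin R (Bi i k) (D k) \<zero>\<^bsub>free_module R (Bi i (Suc k))\<^esub> = \<zero>\<^bsub>free_module R (Bi i k)\<^esub>"
          by (rule flin_zero[OF R D_cl[OF i]])
        moreover have "slice i f = \<zero>\<^bsub>free_module R (Bi i k)\<^esub>"
          using False by (force simp: slice_def zero_free_module fun_eq_iff)
        moreover have "slice i g = \<zero>\<^bsub>free_module R (Bi i (Suc k))\<^esub>" using g(2) i False by simp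
        ultimately show ?thesis unfolding slice_flin[OF i g(1)] by simp
      qed
    qed
    then show ?thesis using g(1) by blast
  qed
  show "\<exists>f\<in>fsupp R (RB 0). linear_extension R N EE f = y" if y: "y \<in> carrier N" for y
  proof -
    let ?J = "{i \<in> I. \<pi> i y \<noteq> \<zero>\<^bsub>Ni i\<^esub>}"
    have J: "finite ?J" "?J \<subseteq> I" using proj_finite[OF y] by auto
    have "\<forall>i\<in>?J. \<exists>g. g \<in> fsupp R (Bi i 0) \<and> linear_extension R (Ni i) \<epsilon> g = \<pi> i y"
    proof
      fix i assume "i \<in> ?J"
      then have i: "i \<in> I" by blast
      show "\<exists>g. g \<in> fsupp R (Bi i 0) \<and> linear_extension R (Ni i) \<epsilon> g = \<pi> i y"
        using resolution.aug_surj[OF res[OF i] ahom_closed[OF proj[OF i] y]] by blast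
    qed
    then obtain p where p: "\<And>i. i \<in> ?J \<Longrightarrow> p i \<in> fsupp R (Bi i 0)" "\<And>i. i \<in> ?J \<Longrightarrow> linear_extension R (Ni i) \<epsilon> (p i) = \<pi> i y"
      using bchoice[of ?J "\<lambda>i g. g \<in> fsupp R (Bi i 0) \<and> linear_extension R (Ni i) \<epsilon> g = \<pi> i y"] by blast
    obtain g where g: "g \<in> fsupp R (RB 0)" "\<forall>i\<in>I. slice i g = (if i \<in> ?J then p i else \<zero>\<^bsub>free_module R (Bi i 0)\<^esub>)"
      using assemble[OF J p(1)] by blast
    let ?z = "linear_extension R N EE g"
    have c: "?z \<in> carrier N" by (rule lin_closed[OF NL EE_closed g(1)])
    have eq: "\<pi> i ?z = \<pi> i y" if i: "i \<in> I" for i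
    proof (cases "i \<in> ?J")
      case True
      then show ?thesis unfolding slice_aug[OF i g(1)] using g(2) i p(2)[OF True] by simp
    next
      case False
      have "linear_extension R (Ni i) \<epsilon> \<zero>\<^bsub>free_module R (Bi i 0)\<^esub> = \<zero>\<^bsub>Ni i\<^esub>"
        by (rule lin_zero[OF resolution.N[OF res[OF i]] resolution.aug_closed[OF res[OF i]]])
      moreover have "slice i g = \<zero>\<^bsub>free_module R (Bi i 0)\<^esub>" using g(2) i False by simp
      ultimately show ?thesis unfolding slice_aug[OF i g(1)] using False i by simp
    qed
    have "y \<ominus>\<^bsub>N\<^esub> ?z = \<zero>\<^bsub>N\<^esub>"
    proof (rule proj_zero)
      show "y \<ominus>\<^bsub>N\<^esub> ?z \<in> carrier N" using y c by simp
      fix i assume i: "i \<in> I"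
      note gi = left_moduleD(2)[OF resolution.N[OF res[OF i]]]
      have "\<pi> i (y \<ominus>\<^bsub>N\<^esub> ?z) = \<pi> i y \<ominus>\<^bsub>Ni i\<^esub> \<pi> i y"
        using ahom_minus[OF left_moduleD(2)[OF NL] gi proj[OF i] y c] eq[OF i] by simp
      also have "\<dots> = \<zero>\<^bsub>Ni i\<^esub>" unfolding a_minus_def by (rule abelian_group.r_neg[OF gi ahom_closed[OF proj[OF i] y]])
      finally show "\<pi> i (y \<ominus>\<^bsub>N\<^esub> ?z) = \<zero>\<^bsub>Ni i\<^esub>" .
    qed
    then have "?z = y" using add_minus_cancel[OF left_moduleD(2)[OF NL] y c] c by simp
    then show ?thesis using g(1) by blast
  qed
qed (rule EE_closed)

lemma lin_embed:
  assumes X: "left_module R X" and i: "i \<in> I" and f: "f \<in> carrier (bcoch X (RB k))" and p: "p \<in> fsupp R (Bi i k)"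
  shows "linear_extension R X f (embed i p) = linear_extension R X (\<lambda>g\<in>Bi i k. f (i, g)) p"
proof (rule fs_ahom_eqI[OF is_fs_free_module[OF R] left_moduleD(2)[OF X] _ _ p])
  have fi: "(\<lambda>g\<in>Bi i k. f (i, g)) g \<in> carrier X" if "g \<in> Bi i k" for g
    using bcoch_mem[OF f, of "(i, g)"] that i by (simp add: RB_def)
  have "embed i \<in> ahom (free_module R (Bi i k)) (free_module R (RB k))"
    by (rule ahomI) (simp_all add: carrier_free_module embed_closed[OF _ i],
      auto simp: embed_def add_free_module fun_eq_iff abelian_groupE(2,5)[OF ring.is_abelian_group[OF R]])
  then show "(\<lambda>p. linear_extension R X f (embed i p)) \<in> ahom (free_module R (Bi i k)) X"
    by (rule ahom_compose[OF _ lin_ahom[OF X bcoch_mem[OF f]]])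
  show "linear_extension R X (\<lambda>g\<in>Bi i k. f (i, g)) \<in> ahom (free_module R (Bi i k)) X" by (rule lin_ahom[OF X fi])
  fix r g assume r: "r \<in> carrier R" and g: "g \<in> Bi i k"
  have "embed i (single R g r) = single R (i, g) r" by (auto simp: embed_def single_def)
  moreover have "linear_extension R X f (single R (i, g) r) = smult X r (f (i, g))"
    by (rule lin_single[OF X bcoch_mem[OF f] _ r], assumption) (use g i in \<open>auto simp: RB_def\<close>)
  moreover have "linear_extension R X (\<lambda>g\<in>Bi i k. f (i, g)) (single R g r) = smult X r ((\<lambda>g\<in>Bi i k. f (i, g)) g)"
    by (rule lin_single[OF X fi g r])
  ultimately show "linear_extension R X f (embed i (single R g r)) = linear_extension R X (\<lambda>g\<in>Bi i k. f (i, g)) (single R g r)"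
    using g by simp
qed

text \<open>Cochains on a disjoint union of bases are families of cochains with no finiteness
  condition: Hom turns the direct sum into a product, and a preimage is chosen for each
  summand.\<close>

lemma sum_cohomology_vanishes:
  assumes X: "left_module R X" and v: "\<And>i. i \<in> I \<Longrightarrow> cohomology_vanishes R X (Bi i) D"
  shows "cohomology_vanishes R X RB DD"
  unfolding cohomology_vanishes_def
proof (intro allI ballI impI)
  fix k f assume f: "f \<in> carrier (bcoch X (RB (Suc k)))"
    and z: "pull R X (RB (Suc (Suc k))) (DD (Suc k)) f = \<zero>\<^bsub>bcoch X (RB (Suc (Suc k)))\<^esub>"
  have "\<exists>h. h \<in> carrier (bcoch X (Bi i k)) \<and> pull R X (Bi i (Suc k)) (D k) h = (\<lambda>g\<in>Bi i (Suc k). f (i, g))" if i: "i \<in> I" for i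
  proof -
    let ?fi = "\<lambda>g\<in>Bi i (Suc k). f (i, g)"
    have fi: "?fi \<in> carrier (bcoch X (Bi i (Suc k)))"
      using bcoch_mem[OF f] i by (auto simp: bcoch_simps RB_def)
    have "linear_extension R X ?fi (D (Suc k) g) = \<zero>\<^bsub>X\<^esub>" if g: "g \<in> Bi i (Suc (Suc k))" for g
    proof -
      have "linear_extension R X ?fi (D (Suc k) g) = linear_extension R X f (DD (Suc k) (i, g))"
        using lin_embed[OF X i f D_cl[OF i g]] by (simp add: DD_def)
      also have "\<dots> = \<zero>\<^bsub>X\<^esub>" using fun_cong[OF z, of "(i, g)"] i g by (simp add: pull_def bcoch_simps RB_def)
      finally show ?thesis .
    qed
    then have "pull R X (Bi i (Suc (Suc k))) (D (Suc k)) ?fi = \<zero>\<^bsub>bcoch X (Bi i (Suc (Suc k)))\<^esub>"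
      unfolding pull_def bcoch_simps by (intro restrict_ext)
    then show ?thesis using v[OF i] fi unfolding cohomology_vanishes_def by blast
  qed
  then obtain h where h: "\<And>i. i \<in> I \<Longrightarrow> h i \<in> carrier (bcoch X (Bi i k))"
    "\<And>i. i \<in> I \<Longrightarrow> pull R X (Bi i (Suc k)) (D k) (h i) = (\<lambda>g\<in>Bi i (Suc k). f (i, g))" by metis
  let ?h = "\<lambda>b\<in>RB k. h (fst b) (snd b)"
  have hc: "?h \<in> carrier (bcoch X (RB k))"
    using bcoch_mem[OF h(1)] by (auto simp: bcoch_simps RB_def)
  have "pull R X (RB (Suc k)) (DD k) ?h = f"
  proof (rule bcoch_eqI[OF pull_closed[OF X DD_closed hc] f])
    fix b assume b: "b \<in> RB (Suc k)"
    obtain i g where ig: "b = (i, g)" "i \<in> I" "g \<in> Bi i (Suc k)" using b by (auto simp: RB_def)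
    have "(\<lambda>g\<in>Bi i k. ?h (i, g)) = h i"
      using h(1)[OF ig(2)] ig(2) by (intro bcoch_eqI[OF _ h(1)[OF ig(2)]]) (auto simp: bcoch_simps RB_def)
    then have "linear_extension R X ?h (DD k b) = linear_extension R X (h i) (D k g)"
      using lin_embed[OF X ig(2) hc D_cl[OF ig(2,3)]] by (simp add: DD_def ig(1))
    also have "\<dots> = f b" using fun_cong[OF h(2)[OF ig(2)], of g] ig by (simp add: pull_def)
    finally show "pull R X (RB (Suc k)) (DD k) ?h b = f b" using b by (simp add: pull_def)
  qed
  then show "\<exists>h\<in>carrier (bcoch X (RB k)). pull R X (RB (Suc k)) (DD k) h = f" using hc by blast
qed

lemma sum_acyclic:
  assumes "left_module R X" "\<And>i. i \<in> I \<Longrightarrow> cohomology_vanishes R X (Bi i) D"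
  shows "acyclic_module R N X"
  by (rule resolution.acyclicI[OF sum_resolution assms(1) sum_cohomology_vanishes[OF assms]])

end

section \<open>Coextension of scalars\<close>

context trivial_extension
begin

abbreviation "UF B \<equiv> restrict_left e (free_module S B)"

lemma UF_simps:
  "carrier (UF B) = fsupp S B" "\<zero>\<^bsub>UF B\<^esub> = (\<lambda>_. \<zero>\<^bsub>S\<^esub>)" "f \<oplus>\<^bsub>UF B\<^esub> g = (\<lambda>b. f b \<oplus>\<^bsub>S\<^esub> g b)"
  "smult (UF B) r f = (\<lambda>b. e r \<otimes>\<^bsub>S\<^esub> f b)"
  by (simp_all add: restrict_left_simps carrier_free_module zero_free_module add_free_module smult_free_module)

lemma UF_module: "left_module R (UF B)"
  by (rule restrict_left_module[OF R free_left_module[OF S] e_hom])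

lemma ahom_UF: "ahom G (UF B) = ahom G (free_module S B)" "ahom (UF B) G = ahom (free_module S B) G"
  by (simp_all add: ahom_def restrict_left_simps)

end

section \<open>Acyclicity over the base ring of free modules over the trivial extension\<close>

locale trivial_extension_ext = trivial_extension R M n
  for R :: "('r, 'z) ring_scheme" and M :: "('r, 'm, 'r, 'y) bimodule_scheme" and n :: nat +
  fixes X :: "('r, 'x, 'v) module_scheme"
  assumes X: "left_module R X"
    and Ext_zero: "i \<ge> 1 \<Longrightarrow> j \<ge> 1 \<Longrightarrow> trivial_group (Ext R j (tpow R M i) X)"
begin

interpretation X: left_module R X by (rule X)
interpretation S: ring S by (rule S)

lemma XX: "abelian_group X" by (rule left_moduleD(2)[OF X])
text \<open>\<open>Ext_zero\<close> speaks of \<open>i \<ge> 1\<close>. For \<open>i = 0\<close> the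
  module is free on the unit, so it has a resolution with one basis element in degree 0 and none
  above, whose cochain groups in positive degree are trivial.\<close>

lemma P_zero_acyclic: "acyclic_module R (P 0) X"
proof -
  let ?B = "\<lambda>k. if k = 0 then {()} else {}" and ?D = "\<lambda>_ _ _. \<zero>\<^bsub>R\<^esub>" and ?\<epsilon> = "\<lambda>_::unit. Scal \<one>\<^bsub>R\<^esub> :: ('r, 'm) tpow_el"
  interpret R: ring R by (rule R)
  note P0L = bimoduleD(1)[OF P_bimodule[of 0]]
  have sc: "?\<epsilon> b \<in> carrier (P 0)" for b by (rule scal_closed) simp
  have val: "linear_extension R (P 0) ?\<epsilon> (single R () r) = Scal r" if r: "r \<in> carrier R" for r
    using lin_single[OF P0L sc _ r, of "()" UNIV] r by (simp add: P0 del: tpow.simps)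
  \<comment> \<open>The augmentation \<open>r \<mapsto> Scal r\<close> is injective, so zero is the
    only cycle in degree 0; in the other degrees the basis is empty.\<close>
  have triv: "f = \<zero>\<^bsub>free_module R (?B k)\<^esub>" if f: "f \<in> based_cycles R (P 0) ?B ?D ?\<epsilon> k" for f k
  proof (cases k)
    case 0
    have f0: "f \<in> fsupp R {()}" "linear_extension R (P 0) ?\<epsilon> f = \<zero>\<^bsub>P 0\<^esub>" using f 0 by (auto simp del: tpow.simps)
    have "f () \<in> carrier R" by (rule fsuppD(1)[OF f0(1)]) simp
    moreover have "f = single R () (f ())" by (auto simp: single_def)
    ultimately have "Scal (f ()) = (Scal \<zero>\<^bsub>R\<^esub> :: ('r, 'm) tpow_el)" using val[of "f ()"] f0(2) by (simp add: P0 del: tpow.simps)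
    then show ?thesis by (simp add: zero_free_module fun_eq_iff)
  next
    case (Suc j)
    then have "f \<in> fsupp R ({}::unit set)" using f by simp
    then show ?thesis using fsuppD(2)[of f R "{}"] by (simp add: zero_free_module fun_eq_iff)
  qed
  interpret C: resolution R "P 0" ?B ?D ?\<epsilon>
  proof unfold_locales
    show "\<exists>g\<in>fsupp R (?B (Suc k)). flin R (?B k) (?D k) g = f" if "f \<in> based_cycles R (P 0) ?B ?D ?\<epsilon> k" for f k
    proof (intro bexI)
      show "flin R (?B k) (?D k) \<zero>\<^bsub>free_module R (?B (Suc k))\<^esub> = f"
        unfolding triv[OF that] by (rule flin_zero[OF R]) simp
      show "\<zero>\<^bsub>free_module R (?B (Suc k))\<^esub> \<in> fsupp R (?B (Suc k))"
        using abelian_groupE(2)[OF free_group[OF R]] by (simp only: carrier_free_module)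
    qed
    show "\<exists>f\<in>fsupp R (?B 0). linear_extension R (P 0) ?\<epsilon> f = x" if x: "x \<in> carrier (P 0)" for x
    proof -
      obtain r where "r \<in> carrier R" "x = Scal r" using x by (auto simp: P0 simp del: tpow.simps)
      then show ?thesis using val[of r] single_closed[OF ring.is_abelian_group[OF R], of "()" "{()}" r] by auto
    qed
  qed (use sc in \<open>auto simp del: tpow.simps\<close>)
  show ?thesis
  proof (rule C.acyclicI[OF X], unfold cohomology_vanishes_def, intro allI ballI impI)
    fix k f assume f: "f \<in> carrier (bcoch X (?B (Suc k)))"
    show "\<exists>h\<in>carrier (bcoch X (?B k)). pull R X (?B (Suc k)) (?D k) h = f"
      by (rule bexI[of _ "\<zero>\<^bsub>bcoch X (?B k)\<^esub>"])
        (use f abelian_groupE(2)[OF bcoch_group[OF XX, of "?B k"]] in \<open>auto simp: bcoch_simps pull_def\<close>)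
  qed
qed

lemma P_acyclic: "acyclic_module R (P i) X"
proof (cases "i = 0")
  case True
  show ?thesis unfolding True by (rule P_zero_acyclic)
next
  case False
  then show ?thesis
    by (intro trivial_Ext_acyclic[OF bimoduleD(1)[OF P_bimodule] X] Ext_zero) auto
qed

text \<open>The inclusion of the tensor power \<open>P i\<close> as the part of degree
  \<open>i\<close> of the trivial extension.\<close>

definition homogeneous :: "nat \<Rightarrow> ('r, 'm) tpow_el \<Rightarrow> ('r, 'm) ntriv_el" where
  "homogeneous i x = (\<lambda>k\<in>{..n}. if k = i then x else \<zero>\<^bsub>P k\<^esub>)"

lemma homogeneous_comp: "k \<le> n \<Longrightarrow> homogeneous i x k = (if k = i then x else \<zero>\<^bsub>P k\<^esub>)"
  by (simp add: homogeneous_def)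

lemma homogeneous_closed: "x \<in> carrier (P i) \<Longrightarrow> homogeneous i x \<in> carrier S"
  unfolding carrier_S homogeneous_def by (rule PiE_I) (auto simp del: tpow.simps)

lemma homogeneous_ahom: "homogeneous i \<in> ahom (P i) S"
  by (rule ahomI, rule homogeneous_closed, assumption, rule S_eqI)
    (auto simp: homogeneous_closed homogeneous_comp add_S simp del: tpow.simps)

lemma homogeneous_smult:
  assumes "r \<in> carrier R" "x \<in> carrier (P i)"
  shows "homogeneous i (smult (P i) r x) = e r \<otimes>\<^bsub>S\<^esub> homogeneous i x"
  using assms smult_zero[OF bimoduleD(1)[OF P_bimodule]]
  by (intro S_eqI) (auto simp: homogeneous_closed homogeneous_comp e_closed e_left P.left.smult_closed simp del: tpow.simps)

text \<open>Left multiplication by \<open>e r\<close> acts on each component separately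
  (\<open>e_left\<close>), so over \<open>R\<close> the free module on \<open>B\<close> is the
  direct sum of the \<open>P i\<close> over all pairs of a basis element and a degree
  \<open>i \<le> n\<close>.\<close>

theorem UF_acyclic: "acyclic_module R (UF B) X"
proof -
  interpret UF: left_module R "UF B" by (rule UF_module)
  interpret D: direct_sum R "UF B" "B \<times> {..n}" "\<lambda>p. P (snd p)" "\<lambda>p x. single S (fst p) (homogeneous (snd p) x)"
    "\<lambda>p \<phi>. \<phi> (fst p) (snd p)" "\<lambda>p. res_basis R (P (snd p))" "\<lambda>_. syz_val R" gen_val
  proof (rule direct_sum.intro[OF UF_module direct_sum_axioms.intro], goal_cases)
    case (1 p) show ?case by (rule canonical_resolution[OF bimoduleD(1)[OF P_bimodule]])
  next
    case (2 p)
    then have "fst p \<in> B" by auto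
    then show ?case unfolding ahom_UF
      by (rule ahom_compose[OF homogeneous_ahom single_ahom[OF is_fs_free_module[OF S]]])
  next
    case (3 p r x)
    show ?case unfolding homogeneous_smult[OF 3(2,3)] UF_simps
      by (rule ext) (auto simp: single_def e_closed[OF 3(2)])
  next
    case (4 p)
    then have "snd p \<le> n" by auto
    then show ?case unfolding ahom_UF
      by (rule ahom_compose[OF is_fs_eval[OF is_fs_free_module[OF S]] S_comp_ahom])
  next
    case (5 p x)
    then show ?case by (auto simp: single_def homogeneous_comp simp del: tpow.simps)
  next
    case (6 p q x)
    then show ?case by (auto simp: single_def homogeneous_comp zero_S prod_eq_iff simp del: tpow.simps)
  next
    case (7 y)
    then have "finite ({b. y b \<noteq> \<zero>\<^bsub>S\<^esub>} \<times> {..n})" by (auto simp: UF_simps dest: fsuppD(3))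
    then show ?case by (rule finite_subset[rotated]) (auto simp: zero_S simp del: tpow.simps)
  next
    case (8 y)
    then have y: "y \<in> fsupp S B" by (simp add: UF_simps)
    have "y b = \<zero>\<^bsub>S\<^esub>" for b
    proof (cases "b \<in> B")
      case True
      show ?thesis
        by (rule S_eqI[OF fsuppD(1)[OF y True] S.zero_closed]) (use 8(2)[of "(b, _)"] True in \<open>auto simp: zero_S simp del: tpow.simps\<close>)
    next
      case False
      then show ?thesis by (rule fsuppD(2)[OF y])
    qed
    then show ?case by (auto simp: UF_simps)
  qed
  show ?thesis by (rule D.sum_acyclic[OF X P_acyclic])
qed

end

section \<open>The adjunction between restriction of scalars and H on free modules\<close>

context trivial_extension
begin

abbreviation "H X \<equiv> H_fun n R M X"
abbreviation "S0 \<equiv> restrict_left e (regular_bimodule S)"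

lemma S0_simps:
  "carrier S0 = carrier S" "\<zero>\<^bsub>S0\<^esub> = \<zero>\<^bsub>S\<^esub>" "ring.add S0 = ring.add S" "smult S0 r s = e r \<otimes>\<^bsub>S\<^esub> s"
  by (simp_all add: restrict_left_simps regular_simps)

lemma S0_module: "left_module R S0"
  by (rule restrict_left_module[OF R bimoduleD(1)[OF regular_bimodule[OF S]] e_hom])

lemma H_simps:
  "carrier (H X) = linear_maps R S0 X" "\<zero>\<^bsub>H X\<^esub> = (\<lambda>s\<in>carrier S. \<zero>\<^bsub>X\<^esub>)"
  "f \<oplus>\<^bsub>H X\<^esub> g = (\<lambda>s\<in>carrier S. f s \<oplus>\<^bsub>X\<^esub> g s)"
  "smult (H X) s f = (\<lambda>t\<in>carrier S. f (t \<otimes>\<^bsub>S\<^esub> s))"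
  by (simp_all add: H_fun_def ring.extend_def Hom_group_def restrict_left_def regular_bimodule_def)

lemma H_mem:
  assumes "f \<in> carrier (H X)"
  shows "f \<in> ahom S X" "r \<in> carrier R \<Longrightarrow> s \<in> carrier S \<Longrightarrow> f (e r \<otimes>\<^bsub>S\<^esub> s) = smult X r (f s)"
    "f \<in> extensional (carrier S)"
  using linear_mapsD[of f R S0 X] assms by (auto simp: H_simps S0_simps ahom_def)

lemma H_memI:
  assumes "f \<in> ahom S X" "\<And>r s. r \<in> carrier R \<Longrightarrow> s \<in> carrier S \<Longrightarrow> f (e r \<otimes>\<^bsub>S\<^esub> s) = smult X r (f s)"
  shows "restrict f (carrier S) \<in> carrier (H X)"
  using linear_maps_restrict[OF S0_module, of f X] assms by (auto simp: H_simps S0_simps ahom_def)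

lemma H_eqI: "f \<in> carrier (H X) \<Longrightarrow> g \<in> carrier (H X) \<Longrightarrow> (\<And>s. s \<in> carrier S \<Longrightarrow> f s = g s) \<Longrightarrow> f = g"
  by (rule extensionalityI[OF H_mem(3) H_mem(3)])

lemma H_module:
  assumes X: "left_module R X"
  shows "left_module S (H X)"
proof -
  interpret S: ring S by (rule S)
  have "abelian_group (H X)"
    by (rule abelian_group_cong[OF Hom_group_group[OF S0_module X]]) (simp_all add: H_fun_def ring.extend_def Hom_group_def)
  then interpret H: abelian_group "H X" .
  show ?thesis
  proof unfold_locales
    show cl: "smult (H X) s f \<in> carrier (H X)" if s: "s \<in> carrier S" and f: "f \<in> carrier (H X)" for s f
      unfolding H_simps(4)
    proof (rule H_memI)
      show "(\<lambda>t. f (t \<otimes>\<^bsub>S\<^esub> s)) \<in> ahom S X"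
        by (rule ahom_compose[OF _ H_mem(1)[OF f]]) (rule ahomI; simp add: s S.l_distr)
    qed (simp add: S.m_assoc e_closed s H_mem(2)[OF f])
    show "smult (H X) \<one>\<^bsub>S\<^esub> f = f" if f: "f \<in> carrier (H X)" for f
      by (rule H_eqI[where X = X]) (simp_all add: cl f, simp add: H_simps)
    fix s t f g assume s: "s \<in> carrier S" and t: "t \<in> carrier S" and f: "f \<in> carrier (H X)" and g: "g \<in> carrier (H X)"
    show "smult (H X) (s \<oplus>\<^bsub>S\<^esub> t) f = smult (H X) s f \<oplus>\<^bsub>H X\<^esub> smult (H X) t f"
      by (rule H_eqI[where X = X]) (simp_all add: cl s t f H.a_closed, simp add: H_simps s t S.r_distr ahom_add[OF H_mem(1)[OF f]])
    show "smult (H X) s (f \<oplus>\<^bsub>H X\<^esub> g) = smult (H X) s f \<oplus>\<^bsub>H X\<^esub> smult (H X) s g"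
      by (rule H_eqI[where X = X]) (simp_all add: cl s f g H.a_closed, simp add: H_simps s)
    show "smult (H X) (s \<otimes>\<^bsub>S\<^esub> t) f = smult (H X) s (smult (H X) t f)"
      by (rule H_eqI[where X = X]) (simp_all add: cl s t f, simp add: H_simps s t S.m_assoc)
  qed
qed

text \<open>
  \<open>adjoint X f\<close> is the \<open>R\<close>-linear map on the free \<open>S\<close>-module corresponding to the \<open>S\<close>-linear map
  into \<open>H X\<close> with values \<open>f\<close> on the basis.
\<close>

definition adjoint :: "('r, 'x, 'v) module_scheme \<Rightarrow> ('b \<Rightarrow> ('r, 'm) ntriv_el \<Rightarrow> 'x) \<Rightarrow> ('b \<Rightarrow> ('r, 'm) ntriv_el) \<Rightarrow> 'x" where
  "adjoint X f = fext S X (\<lambda>s b. f b s)"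

lemma SA: "abelian_group S"
  by (rule ring.is_abelian_group[OF S])

lemma adjoint_biadd:
  assumes f: "f \<in> carrier (bcoch (H X) B)"
  shows "biadd S B X (\<lambda>s b. f b s)"
  by (rule biaddI) (use ahom_closed[OF H_mem(1)[OF bcoch_mem[OF f]]] ahom_add[OF H_mem(1)[OF bcoch_mem[OF f]]] in auto)

lemma adjoint_ahom:
  assumes X: "left_module R X" and f: "f \<in> carrier (bcoch (H X) B)"
  shows "adjoint X f \<in> ahom (free_module S B) X"
  unfolding adjoint_def by (rule fext_ahom[OF is_fs_free_module[OF S] left_moduleD(2)[OF X] adjoint_biadd[OF f]])

lemma adjoint_single:
  assumes X: "left_module R X" and f: "f \<in> carrier (bcoch (H X) B)" and "b \<in> B" "s \<in> carrier S"
  shows "adjoint X f (single S b s) = f b s"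
  unfolding adjoint_def by (rule fext_single[OF SA left_moduleD(2)[OF X] adjoint_biadd[OF f] assms(3,4)])

lemma free_ahom_eqI:
  assumes X: "left_module R X" and h: "h \<in> ahom (free_module S B) X" "h' \<in> ahom (free_module S B) X"
    and p: "p \<in> fsupp S B" and eq: "\<And>s b. s \<in> carrier S \<Longrightarrow> b \<in> B \<Longrightarrow> h (single S b s) = h' (single S b s)"
  shows "h p = h' p"
  by (rule fs_ahom_eqI[OF is_fs_free_module[OF S] left_moduleD(2)[OF X] h p]) (rule eq)

lemma smult_fsupp: "s \<in> carrier S \<Longrightarrow> p \<in> fsupp S B \<Longrightarrow> smult (free_module S B) s p \<in> fsupp S B"
  using left_module.smult_closed[OF free_left_module[OF S], of s p B] by (simp add: carrier_free_module)

text \<open>The action \<open>(s f)(t) = f (t s)\<close> gives \<open>g(p)(t) = g(t p)(1)\<close>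
  for every linear \<open>g\<close> into \<open>H X\<close> over the trivial extension, and
  \<open>adjoint X f\<close> is evaluation at 1 of the linear extension of \<open>f\<close>.\<close>

lemma lin_H_eval:
  assumes X: "left_module R X" and f: "f \<in> carrier (bcoch (H X) B)" and p: "p \<in> fsupp S B" and t: "t \<in> carrier S"
  shows "linear_extension S (H X) f p t = adjoint X f (smult (free_module S B) t p)"
proof (rule free_ahom_eqI[OF X _ _ p])
  interpret S: ring S by (rule S)
  have ev: "(\<lambda>h. h t) \<in> ahom (H X) X"
    by (rule ahomI) (use t ahom_closed[OF H_mem(1)] in auto, simp add: H_simps t)
  show "(\<lambda>p. linear_extension S (H X) f p t) \<in> ahom (free_module S B) X"
    by (rule ahom_compose[OF lin_ahom[OF H_module[OF X] bcoch_mem[OF f]] ev])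
  show "(\<lambda>p. adjoint X f (smult (free_module S B) t p)) \<in> ahom (free_module S B) X"
    by (rule ahom_compose[OF smult_ahom[OF free_left_module[OF S] t] adjoint_ahom[OF X f]])
  fix s b assume s: "s \<in> carrier S" and b: "b \<in> B"
  have "linear_extension S (H X) f (single S b s) = smult (H X) s (f b)"
    by (rule lin_single[OF H_module[OF X] bcoch_mem[OF f] b s])
  then show "linear_extension S (H X) f (single S b s) t = adjoint X f (smult (free_module S B) t (single S b s))"
    using adjoint_single[OF X f b, of "t \<otimes>\<^bsub>S\<^esub> s"] s t by (simp add: smult_single[OF S t] H_simps)
qed

lemma adjoint_smult:
  assumes X: "left_module R X" and f: "f \<in> carrier (bcoch (H X) B)" and p: "p \<in> fsupp S B" and r: "r \<in> carrier R"
  shows "adjoint X f (smult (free_module S B) (e r) p) = smult X r (adjoint X f p)"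
proof (rule free_ahom_eqI[OF X _ _ p])
  show "(\<lambda>p. adjoint X f (smult (free_module S B) (e r) p)) \<in> ahom (free_module S B) X"
    by (rule ahom_compose[OF smult_ahom[OF free_left_module[OF S] e_closed[OF r]] adjoint_ahom[OF X f]])
  show "(\<lambda>p. smult X r (adjoint X f p)) \<in> ahom (free_module S B) X"
    by (rule ahom_compose[OF adjoint_ahom[OF X f] smult_ahom[OF X r]])
  fix s b assume s: "s \<in> carrier S" and b: "b \<in> B"
  have "e r \<otimes>\<^bsub>S\<^esub> s \<in> carrier S" using monoid.m_closed[OF ring.is_monoid[OF S] e_closed[OF r] s] .
  then show "adjoint X f (smult (free_module S B) (e r) (single S b s)) = smult X r (adjoint X f (single S b s))"
    by (simp add: smult_single[OF S e_closed[OF r]] adjoint_single[OF X f b] s H_mem(2)[OF bcoch_mem[OF f b] r])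
qed

text \<open>Naturality of the adjunction in the free module; on the multiple \<open>s\<close> of a
  basis element it is \<open>lin_H_eval\<close> at \<open>s\<close>.\<close>

lemma adjoint_pull:
  assumes X: "left_module R X" and f: "f \<in> carrier (bcoch (H X) B)" and \<alpha>: "\<And>b. b \<in> B' \<Longrightarrow> \<alpha> b \<in> fsupp S B"
    and p: "p \<in> fsupp S B'"
  shows "adjoint X (pull S (H X) B' \<alpha> f) p = adjoint X f (flin S B \<alpha> p)"
proof (rule free_ahom_eqI[OF X _ _ p])
  note pc = pull_closed[OF H_module[OF X] \<alpha> f]
  show "adjoint X (pull S (H X) B' \<alpha> f) \<in> ahom (free_module S B') X" by (rule adjoint_ahom[OF X pc])
  show "(\<lambda>p. adjoint X f (flin S B \<alpha> p)) \<in> ahom (free_module S B') X"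
    by (rule ahom_compose[OF flin_ahom[OF S \<alpha>] adjoint_ahom[OF X f]])
  fix s b assume s: "s \<in> carrier S" and b: "b \<in> B'"
  have "flin S B \<alpha> (single S b s) = smult (free_module S B) s (\<alpha> b)"
    by (rule lin_single[OF free_left_module[OF S] _ b s]) (simp add: carrier_free_module \<alpha>)
  then show "adjoint X (pull S (H X) B' \<alpha> f) (single S b s) = adjoint X f (flin S B \<alpha> (single S b s))"
    using adjoint_single[OF X pc b s] lin_H_eval[OF X f \<alpha>[OF b] s] b by (simp add: pull_def)
qed

lemma adjoint_zero:
  assumes X: "left_module R X" and p: "p \<in> fsupp S B"
  shows "adjoint X \<zero>\<^bsub>bcoch (H X) B\<^esub> p = \<zero>\<^bsub>X\<^esub>"
  unfolding adjoint_def
  by (rule fext_zero[OF left_moduleD(2)[OF X]]) (use fsuppD(1,4)[OF p] in \<open>auto simp: bcoch_simps H_simps\<close>)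

lemma adjoint_linear_maps:
  assumes X: "left_module R X" and f: "f \<in> carrier (bcoch (H X) B)"
  shows "restrict (adjoint X f) (fsupp S B) \<in> linear_maps R (UF B) X"
proof -
  have "restrict (adjoint X f) (carrier (UF B)) \<in> linear_maps R (UF B) X"
    by (rule linear_maps_restrict[OF UF_module])
      (use adjoint_ahom[OF X f] adjoint_smult[OF X f] in \<open>simp_all add: ahom_UF restrict_left_simps carrier_free_module\<close>)
  then show ?thesis by (simp add: UF_simps)
qed

text \<open>The inverse direction of the adjunction: the value of \<open>f\<close> at
  \<open>b\<close> sends \<open>s\<close> to \<open>\<phi>\<close> of \<open>s\<close> times
  \<open>b\<close>, which is linear in \<open>s\<close> over \<open>R\<close> because
  \<open>\<phi>\<close> is.\<close>

lemma adjoint_extends: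
  assumes X: "left_module R X" and \<phi>: "\<phi> \<in> linear_maps R (UF B) X"
  defines "f \<equiv> \<lambda>b\<in>B. \<lambda>s\<in>carrier S. \<phi> (single S b s)"
  shows "f \<in> carrier (bcoch (H X) B)" "p \<in> fsupp S B \<Longrightarrow> adjoint X f p = \<phi> p"
proof -
  have ah: "\<phi> \<in> ahom (free_module S B) X" using linear_mapsD(1)[OF \<phi>] by (simp add: ahom_UF)
  have "(\<lambda>s\<in>carrier S. \<phi> (single S b s)) \<in> carrier (H X)" if b: "b \<in> B" for b
  proof (rule H_memI)
    show "(\<lambda>s. \<phi> (single S b s)) \<in> ahom S X"
      by (rule ahom_compose[OF single_ahom[OF is_fs_free_module[OF S] b] ah])
    fix r s assume r: "r \<in> carrier R" and s: "s \<in> carrier S"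
    have "\<phi> (smult (UF B) r (single S b s)) = smult X r (\<phi> (single S b s))"
      by (rule linear_mapsD(2)[OF \<phi> r]) (simp add: UF_simps single_closed[OF SA b s])
    then show "\<phi> (single S b (e r \<otimes>\<^bsub>S\<^esub> s)) = smult X r (\<phi> (single S b s))"
      using smult_single[OF S e_closed[OF r], of B b s] by (simp add: restrict_left_simps)
  qed
  then show f: "f \<in> carrier (bcoch (H X) B)" by (simp add: f_def bcoch_simps)
  show "adjoint X f p = \<phi> p" if p: "p \<in> fsupp S B"
    by (rule free_ahom_eqI[OF X adjoint_ahom[OF X f] ah p]) (simp add: adjoint_single[OF X f], simp add: f_def)
qed

end

section \<open>Syzygies of Y over the trivial extension and cochains with values in H(X)\<close>

locale trivial_extension_module = trivial_extension R M n
  for R :: "('r, 'z) ring_scheme" and M :: "('r, 'm, 'r, 'y) bimodule_scheme" and n :: nat +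
  fixes Y :: "(('r, 'm) ntriv_el, 'w, 'v) module_scheme"
  assumes Y: "left_module S Y"
begin

abbreviation "BY \<equiv> res_basis S Y"
abbreviation "DY \<equiv> \<lambda>_::nat. syz_val S"
abbreviation "K \<equiv> based_cycles S Y BY DY gen_val"
abbreviation "UY \<equiv> restrict_left e Y"
abbreviation "UFK k \<equiv> (UF (BY k))\<lparr>carrier := K k\<rparr>"

sublocale Q: resolution S Y BY DY gen_val
  by (rule canonical_resolution[OF Y])

lemma UY_module: "left_module R UY"
  by (rule restrict_left_module[OF R Y e_hom])

lemma smult_cycle:
  assumes s: "s \<in> carrier S" and p: "p \<in> K k"
  shows "smult (free_module S (BY k)) s p \<in> K k"
proof -
  note pc = Q.cycle_closed[OF p]
  show ?thesis
  proof (cases k)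
    case 0
    then show ?thesis
      using p smult_fsupp[OF s pc] lin_smult[OF Y Q.aug_closed _ s, where f = p] smult_zero[OF Y s] by simp
  next
    case (Suc j)
    have "flin S (BY j) (syz_val S) (smult (free_module S (BY (Suc j))) s p) = smult (free_module S (BY j)) s (flin S (BY j) (syz_val S) p)"
      by (rule lin_smult[OF free_left_module[OF S] _ pc[unfolded Suc] s]) (simp add: carrier_free_module Q.D_closed)
    then show ?thesis
      using p smult_fsupp[OF s pc] smult_zero[OF free_left_module[OF S] s] Suc by simp
  qed
qed

lemma cycles_submod: "submod R (K k) (UF (BY k))"
  unfolding submod_def
proof (intro conjI ballI)
  \<comment> \<open>Additive inverses refer to the additive group only, which restriction of scalars
    leaves alone.\<close>
  have "a_inv (UF (BY k)) = a_inv (free_module S (BY k))"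
    by (rule ext) (simp add: a_inv_def m_inv_def restrict_left_simps)
  then show "asub (K k) (UF (BY k))"
    using Q.asub_cycles[of k] by (simp add: asub_def restrict_left_simps)
  show "smult (UF (BY k)) r p \<in> K k" if "r \<in> carrier R" "p \<in> K k" for r p
    using smult_cycle[OF e_closed[OF that(1)] that(2)] by (simp add: restrict_left_simps)
qed

lemma UFK_module: "left_module R (UFK k)"
  by (rule submod_left_module[OF UF_module cycles_submod])

lemma flin_smult:
  assumes "s \<in> carrier S" "p \<in> fsupp S (BY (Suc k))"
  shows "flin S (BY k) (syz_val S) (smult (free_module S (BY (Suc k))) s p) = smult (free_module S (BY k)) s (flin S (BY k) (syz_val S) p)"
  by (rule lin_smult[OF free_left_module[OF S] _ assms(2,1)]) (simp add: carrier_free_module Q.D_closed)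

text \<open>The exact sequences \<open>0 \<rightarrow> K (Suc k) \<rightarrow> F \<rightarrow> K k
  \<rightarrow> 0\<close> over \<open>R\<close>, with \<open>F\<close> the free module of degree
  \<open>k + 1\<close>, in the form that \<open>dimension_shift\<close> and
  \<open>ex_linear_factor\<close> expect.\<close>

lemma flin_UFK:
  "flin S (BY k) (syz_val S) \<in> ahom (UF (BY (Suc k))) (UFK k)"
  "r \<in> carrier R \<Longrightarrow> p \<in> carrier (UF (BY (Suc k))) \<Longrightarrow>
    flin S (BY k) (syz_val S) (smult (UF (BY (Suc k))) r p) = smult (UFK k) r (flin S (BY k) (syz_val S) p)"
  "p \<in> carrier (UF (BY (Suc k))) \<Longrightarrow> flin S (BY k) (syz_val S) p = \<zero>\<^bsub>UFK k\<^esub> \<longleftrightarrow> p \<in> K (Suc k)"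
  "y \<in> carrier (UFK k) \<Longrightarrow> \<exists>p\<in>carrier (UF (BY (Suc k))). flin S (BY k) (syz_val S) p = y"
proof -
  show "flin S (BY k) (syz_val S) \<in> ahom (UF (BY (Suc k))) (UFK k)"
    unfolding ahom_UF
    by (rule ahomI) (use ahom_add[OF flin_ahom[OF S Q.D_closed]] Q.boundary_cycle in
      \<open>simp_all add: carrier_free_module restrict_left_simps\<close>)
  show "r \<in> carrier R \<Longrightarrow> p \<in> carrier (UF (BY (Suc k))) \<Longrightarrow>
      flin S (BY k) (syz_val S) (smult (UF (BY (Suc k))) r p) = smult (UFK k) r (flin S (BY k) (syz_val S) p)"
    using flin_smult[OF e_closed] by (simp add: restrict_left_simps carrier_free_module)
  show "p \<in> carrier (UF (BY (Suc k))) \<Longrightarrow> flin S (BY k) (syz_val S) p = \<zero>\<^bsub>UFK k\<^esub> \<longleftrightarrow> p \<in> K (Suc k)"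
    by (simp add: restrict_left_simps carrier_free_module)
  show "y \<in> carrier (UFK k) \<Longrightarrow> \<exists>p\<in>carrier (UF (BY (Suc k))). flin S (BY k) (syz_val S) p = y"
    using Q.exact by (simp add: restrict_left_simps carrier_free_module)
qed

context
  fixes X :: "('r, 'x, 'u) module_scheme"
  assumes X: "left_module R X"
begin

text \<open>The cochain whose adjoint is \<open>\<kappa>\<close> composed with the differential onto
  \<open>K k\<close>: that differential takes \<open>s\<close> times the generator \<open>b\<close>
  to \<open>s\<close> times \<open>syz_val S b\<close>.\<close>

definition cochain_of :: "nat \<Rightarrow> (((('r, 'm) ntriv_el, 'w) res_gen \<Rightarrow> ('r, 'm) ntriv_el) \<Rightarrow> 'x) \<Rightarrow>
    (('r, 'm) ntriv_el, 'w) res_gen \<Rightarrow> ('r, 'm) ntriv_el \<Rightarrow> 'x" where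
  "cochain_of k \<kappa> = (\<lambda>b\<in>BY (Suc k). \<lambda>s\<in>carrier S. \<kappa> (smult (free_module S (BY k)) s (syz_val S b)))"

lemma cochain_of:
  assumes \<kappa>: "\<kappa> \<in> linear_maps R (UFK k) X"
  shows "cochain_of k \<kappa> \<in> carrier (bcoch (H X) (BY (Suc k)))"
    "p \<in> fsupp S (BY (Suc k)) \<Longrightarrow> adjoint X (cochain_of k \<kappa>) p = \<kappa> (flin S (BY k) (syz_val S) p)"
proof -
  let ?\<phi> = "\<lambda>p\<in>fsupp S (BY (Suc k)). \<kappa> (flin S (BY k) (syz_val S) p)"
  have "restrict (\<lambda>p. \<kappa> (flin S (BY k) (syz_val S) p)) (carrier (UF (BY (Suc k)))) \<in> linear_maps R (UF (BY (Suc k))) X"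
  proof (rule linear_maps_restrict[OF UF_module ahom_compose[OF flin_UFK(1) linear_mapsD(1)[OF \<kappa>]]])
    fix r p assume r: "r \<in> carrier R" and p: "p \<in> carrier (UF (BY (Suc k)))"
    show "\<kappa> (flin S (BY k) (syz_val S) (smult (UF (BY (Suc k))) r p)) = smult X r (\<kappa> (flin S (BY k) (syz_val S) p))"
      unfolding flin_UFK(2)[OF r p] by (rule linear_mapsD(2)[OF \<kappa> r ahom_closed[OF flin_UFK(1) p]])
  qed
  then have \<phi>: "?\<phi> \<in> linear_maps R (UF (BY (Suc k))) X" by (simp add: UF_simps)
  have "(\<lambda>b\<in>BY (Suc k). \<lambda>s\<in>carrier S. ?\<phi> (single S b s)) = cochain_of k \<kappa>"
    unfolding cochain_of_def
  proof (intro restrict_ext)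
    fix b s assume b: "b \<in> BY (Suc k)" and s: "s \<in> carrier S"
    have "flin S (BY k) (syz_val S) (single S b s) = smult (free_module S (BY k)) s (syz_val S b)"
      by (rule lin_single[OF free_left_module[OF S] _ b s]) (simp add: carrier_free_module Q.D_closed)
    then show "?\<phi> (single S b s) = \<kappa> (smult (free_module S (BY k)) s (syz_val S b))"
      using single_closed[OF SA b s] by simp
  qed
  then show "cochain_of k \<kappa> \<in> carrier (bcoch (H X) (BY (Suc k)))"
    "p \<in> fsupp S (BY (Suc k)) \<Longrightarrow> adjoint X (cochain_of k \<kappa>) p = \<kappa> (flin S (BY k) (syz_val S) p)"
    using adjoint_extends[OF X \<phi>] by simp_all
qed

text \<open>By \<open>adjoint_pull\<close> the coboundary of \<open>f\<close> corresponds to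
  \<open>adjoint X f\<close> composed with the differential, and a cochain is determined by its
  adjoint.\<close>

lemma pull_zero_iff:
  assumes f: "f \<in> carrier (bcoch (H X) (BY k))"
  shows "pull S (H X) (BY (Suc k)) (syz_val S) f = \<zero>\<^bsub>bcoch (H X) (BY (Suc k))\<^esub> \<longleftrightarrow>
    (\<forall>p\<in>fsupp S (BY (Suc k)). adjoint X f (flin S (BY k) (syz_val S) p) = \<zero>\<^bsub>X\<^esub>)"
proof
  assume z: "pull S (H X) (BY (Suc k)) (syz_val S) f = \<zero>\<^bsub>bcoch (H X) (BY (Suc k))\<^esub>"
  show "\<forall>p\<in>fsupp S (BY (Suc k)). adjoint X f (flin S (BY k) (syz_val S) p) = \<zero>\<^bsub>X\<^esub>"
  proof
    fix p assume p: "p \<in> fsupp S (BY (Suc k))"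
    show "adjoint X f (flin S (BY k) (syz_val S) p) = \<zero>\<^bsub>X\<^esub>"
      using adjoint_pull[where \<alpha> = "syz_val S", OF X f Q.D_closed p] adjoint_zero[OF X p] z by simp
  qed
next
  assume a: "\<forall>p\<in>fsupp S (BY (Suc k)). adjoint X f (flin S (BY k) (syz_val S) p) = \<zero>\<^bsub>X\<^esub>"
  note pc = pull_closed[OF H_module[OF X] Q.D_closed f]
  show "pull S (H X) (BY (Suc k)) (syz_val S) f = \<zero>\<^bsub>bcoch (H X) (BY (Suc k))\<^esub>"
  proof (rule bcoch_eqI[OF pc])
    show zc: "\<zero>\<^bsub>bcoch (H X) (BY (Suc k))\<^esub> \<in> carrier (bcoch (H X) (BY (Suc k)))"
      by (rule abelian_groupE(2)[OF bcoch_group[OF left_moduleD(2)[OF H_module[OF X]]]])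
    fix b assume b: "b \<in> BY (Suc k)"
    show "pull S (H X) (BY (Suc k)) (syz_val S) f b = \<zero>\<^bsub>bcoch (H X) (BY (Suc k))\<^esub> b"
    proof (rule H_eqI[OF bcoch_mem[OF pc b] bcoch_mem[OF zc b]])
      fix s assume s: "s \<in> carrier S"
      have sb: "single S b s \<in> fsupp S (BY (Suc k))" by (rule single_closed[OF SA b s])
      have "pull S (H X) (BY (Suc k)) (syz_val S) f b s = adjoint X f (flin S (BY k) (syz_val S) (single S b s))"
        using adjoint_single[OF X pc b s] adjoint_pull[where \<alpha> = "syz_val S", OF X f Q.D_closed sb] by simp
      then show "pull S (H X) (BY (Suc k)) (syz_val S) f b s = \<zero>\<^bsub>bcoch (H X) (BY (Suc k))\<^esub> b s"
        using a sb s b by (simp add: bcoch_simps H_simps)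
    qed
  qed
qed

text \<open>A cocycle of degree \<open>k + 1\<close> with values in \<open>H X\<close> amounts to an
  \<open>R\<close>-linear map to \<open>X\<close> on the free module of that degree that vanishes on
  \<open>K (Suc k)\<close>; it factors uniquely through the differential onto \<open>K k\<close>. It
  is a coboundary iff the factor extends from \<open>K k\<close> to the free module of degree
  \<open>k\<close>.\<close>

theorem hom_coker_bExt: "hom_coker R (UF (BY k)) (K k) X \<cong> bExt S (H X) BY DY k"
  unfolding hom_coker_def bExt_def homology_def
proof (rule subquotient_iso[where u = "cochain_of k"])
  note XX = left_moduleD(2)[OF X] and HX = H_module[OF X]
  note hc = hom_coker_asub[OF UF_module cycles_submod X]
  note cx = complex3_asub[OF Q.bExt_complex[OF HX, of k]]
  let ?B = "BY (Suc k)" and ?d = "flin S (BY k) (syz_val S)"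
  let ?Z = "{f \<in> carrier (bcoch (H X) ?B). pull S (H X) (BY (Suc (Suc k))) (syz_val S) f = \<zero>\<^bsub>bcoch (H X) (BY (Suc (Suc k)))\<^esub>}"
  show "abelian_group (Hom_group R (UFK k) X)" by (rule Hom_group_group[OF UFK_module X])
  show G: "abelian_group (bcoch (H X) ?B)" by (rule bcoch_group[OF left_moduleD(2)[OF HX]])
  then interpret G: abelian_group "bcoch (H X) ?B" .
  show "asub (linear_maps R (UFK k) X) (Hom_group R (UFK k) X)" by (rule hc(1))
  show "asub ((\<lambda>f. restrict f (K k)) ` linear_maps R (UF (BY k)) X) (Hom_group R (UFK k) X)" by (rule hc(2))
  show "(\<lambda>f. restrict f (K k)) ` linear_maps R (UF (BY k)) X \<subseteq> linear_maps R (UFK k) X" by (rule hc(3))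
  show "asub ?Z (bcoch (H X) ?B)" by (rule cx(1))
  show "asub (pull S (H X) ?B (syz_val S) ` carrier (bcoch (H X) (BY k))) (bcoch (H X) ?B)" by (rule cx(2))
  show "pull S (H X) ?B (syz_val S) ` carrier (bcoch (H X) (BY k)) \<subseteq> ?Z" by (rule cx(3))
  show "cochain_of k (\<kappa> \<oplus>\<^bsub>Hom_group R (UFK k) X\<^esub> \<eta>) = cochain_of k \<kappa> \<oplus>\<^bsub>bcoch (H X) ?B\<^esub> cochain_of k \<eta>" for \<kappa> \<eta>
    unfolding cochain_of_def bcoch_simps
    by (intro restrict_ext) (use smult_cycle[OF _ Q.D_cycle] in \<open>auto simp: H_simps Hom_simps intro!: restrict_ext\<close>)
  show "cochain_of k \<kappa> \<in> ?Z" if \<kappa>: "\<kappa> \<in> linear_maps R (UFK k) X" for \<kappa>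
  proof -
    have "adjoint X (cochain_of k \<kappa>) (flin S ?B (syz_val S) p) = \<zero>\<^bsub>X\<^esub>" if p: "p \<in> fsupp S (BY (Suc (Suc k)))" for p
    proof -
      have "flin S ?B (syz_val S) p \<in> K (Suc k)" by (rule Q.boundary_cycle[OF p])
      then have "flin S ?B (syz_val S) p \<in> fsupp S ?B" "?d (flin S ?B (syz_val S) p) = \<zero>\<^bsub>UFK k\<^esub>"
        by (simp_all add: restrict_left_simps)
      then show ?thesis
        using cochain_of(2)[OF \<kappa>] ahom_zero[OF left_moduleD(2)[OF UFK_module] XX linear_mapsD(1)[OF \<kappa>]] by simp
    qed
    then show ?thesis using pull_zero_iff[OF cochain_of(1)[OF \<kappa>]] cochain_of(1)[OF \<kappa>] by simp
  qed
  show "cochain_of k \<kappa> \<in> pull S (H X) ?B (syz_val S) ` carrier (bcoch (H X) (BY k)) \<longleftrightarrow>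
      \<kappa> \<in> (\<lambda>f. restrict f (K k)) ` linear_maps R (UF (BY k)) X" if \<kappa>: "\<kappa> \<in> linear_maps R (UFK k) X" for \<kappa>
  proof
    assume "cochain_of k \<kappa> \<in> pull S (H X) ?B (syz_val S) ` carrier (bcoch (H X) (BY k))"
    then obtain f where f: "f \<in> carrier (bcoch (H X) (BY k))" "cochain_of k \<kappa> = pull S (H X) ?B (syz_val S) f" by blast
    let ?\<phi> = "restrict (adjoint X f) (fsupp S (BY k))"
    have \<phi>: "?\<phi> \<in> linear_maps R (UF (BY k)) X" by (rule adjoint_linear_maps[OF X f(1)])
    have \<phi>K: "restrict ?\<phi> (K k) \<in> linear_maps R (UFK k) X" using hc(3) \<phi> by blast
    have "\<kappa> = restrict ?\<phi> (K k)"
    proof (rule linear_maps_eqI[OF \<kappa> \<phi>K])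
      fix z assume "z \<in> carrier (UFK k)"
      then have z: "z \<in> K k" by simp
      obtain p where p: "p \<in> fsupp S ?B" "?d p = z" using Q.exact[OF z] by blast
      have "\<kappa> z = adjoint X (pull S (H X) ?B (syz_val S) f) p" using cochain_of(2)[OF \<kappa> p(1)] p(2) f(2) by simp
      also have "\<dots> = adjoint X f z" using adjoint_pull[where \<alpha> = "syz_val S", OF X f(1) Q.D_closed p(1)] p(2) by simp
      finally show "\<kappa> z = restrict ?\<phi> (K k) z" using z Q.cycle_closed[OF z] by simp
    qed
    then show "\<kappa> \<in> (\<lambda>f. restrict f (K k)) ` linear_maps R (UF (BY k)) X" using \<phi> by blast
  next
    assume "\<kappa> \<in> (\<lambda>f. restrict f (K k)) ` linear_maps R (UF (BY k)) X"
    then obtain \<phi> where \<phi>: "\<phi> \<in> linear_maps R (UF (BY k)) X" "\<kappa> = restrict \<phi> (K k)" by blast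
    let ?f = "\<lambda>b\<in>BY k. \<lambda>s\<in>carrier S. \<phi> (single S b s)"
    note f = adjoint_extends[OF X \<phi>(1)]
    note pc = pull_closed[OF HX Q.D_closed f(1)]
    have "cochain_of k \<kappa> = pull S (H X) ?B (syz_val S) ?f"
    proof (rule bcoch_eqI[OF cochain_of(1)[OF \<kappa>] pc])
      fix b assume b: "b \<in> ?B"
      show "cochain_of k \<kappa> b = pull S (H X) ?B (syz_val S) ?f b"
      proof (rule H_eqI[OF bcoch_mem[OF cochain_of(1)[OF \<kappa>] b] bcoch_mem[OF pc b]])
        fix s assume s: "s \<in> carrier S"
        have "pull S (H X) ?B (syz_val S) ?f b s = adjoint X ?f (smult (free_module S (BY k)) s (syz_val S b))"
          using lin_H_eval[OF X f(1) Q.D_closed[OF b] s] b by (simp add: pull_def)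
        also have "\<dots> = \<phi> (smult (free_module S (BY k)) s (syz_val S b))"
          by (rule f(2)[OF smult_fsupp[OF s Q.D_closed[OF b]]])
        finally show "cochain_of k \<kappa> b s = pull S (H X) ?B (syz_val S) ?f b s"
          using smult_cycle[OF s Q.D_cycle[OF b]] b s \<phi>(2) by (simp add: cochain_of_def)
      qed
    qed
    then show "cochain_of k \<kappa> \<in> pull S (H X) ?B (syz_val S) ` carrier (bcoch (H X) (BY k))" using f(1) by blast
  qed
  fix f assume "f \<in> ?Z"
  then have f: "f \<in> carrier (bcoch (H X) ?B)" and z: "pull S (H X) (BY (Suc (Suc k))) (syz_val S) f = \<zero>\<^bsub>bcoch (H X) (BY (Suc (Suc k)))\<^esub>"
    by auto
  \<comment> \<open>For surjectivity: the adjoint of a cocycle kills the boundaries of degree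
    \<open>k + 1\<close>, and by exactness these are the whole kernel of \<open>?d\<close>.\<close>
  have "\<exists>\<kappa>\<in>linear_maps R (UFK k) X. \<forall>p\<in>carrier (UF ?B). \<kappa> (?d p) = adjoint X f p"
  proof (rule ex_linear_factor[OF UF_module UFK_module X flin_UFK(1,2,4)])
    show "adjoint X f \<in> ahom (UF ?B) X" unfolding ahom_UF by (rule adjoint_ahom[OF X f])
    show "adjoint X f (smult (UF ?B) r p) = smult X r (adjoint X f p)" if "r \<in> carrier R" "p \<in> carrier (UF ?B)" for r p
      using adjoint_smult[OF X f _ that(1), of p] that(2) by (simp add: restrict_left_simps carrier_free_module)
    show "adjoint X f p = \<zero>\<^bsub>X\<^esub>" if p: "p \<in> carrier (UF ?B)" "?d p = \<zero>\<^bsub>UFK k\<^esub>" for p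
    proof -
      have "p \<in> K (Suc k)" using p flin_UFK(3) by blast
      then obtain q where q: "q \<in> fsupp S (BY (Suc (Suc k)))" "flin S ?B (syz_val S) q = p" using Q.exact by blast
      show ?thesis using pull_zero_iff[OF f] z q by blast
    qed
  qed
  then obtain \<kappa> where \<kappa>: "\<kappa> \<in> linear_maps R (UFK k) X" "\<And>p. p \<in> fsupp S ?B \<Longrightarrow> \<kappa> (?d p) = adjoint X f p"
    by (auto simp: UF_simps)
  have "cochain_of k \<kappa> = f"
  proof (rule bcoch_eqI[OF cochain_of(1)[OF \<kappa>(1)] f])
    fix b assume b: "b \<in> ?B"
    show "cochain_of k \<kappa> b = f b"
    proof (rule H_eqI[OF bcoch_mem[OF cochain_of(1)[OF \<kappa>(1)] b] bcoch_mem[OF f b]])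
      fix s assume s: "s \<in> carrier S"
      have sb: "single S b s \<in> fsupp S ?B" by (rule single_closed[OF SA b s])
      show "cochain_of k \<kappa> b s = f b s"
        using adjoint_single[OF X f b s] adjoint_single[OF X cochain_of(1)[OF \<kappa>(1)] b s] \<kappa>(2)[OF sb] cochain_of(2)[OF \<kappa>(1) sb] by simp
    qed
  qed
  moreover have "\<zero>\<^bsub>bcoch (H X) ?B\<^esub> \<in> pull S (H X) ?B (syz_val S) ` carrier (bcoch (H X) (BY k))"
    by (rule asubD(2)[OF cx(2)])
  ultimately show "\<exists>\<kappa>\<in>linear_maps R (UFK k) X. \<exists>b\<in>pull S (H X) ?B (syz_val S) ` carrier (bcoch (H X) (BY k)).
      f = b \<oplus>\<^bsub>bcoch (H X) ?B\<^esub> cochain_of k \<kappa>"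
    using \<kappa>(1) f by (intro bexI[of _ \<kappa>] bexI[of _ "\<zero>\<^bsub>bcoch (H X) ?B\<^esub>"]) simp_all
qed

end

end

locale trivial_extension_coinduced = trivial_extension_ext R M n X + trivial_extension_module R M n Y
  for R :: "('r, 'z) ring_scheme" and M :: "('r, 'm, 'r, 'y) bimodule_scheme" and n :: nat
    and X :: "('r, 'x, 'v) module_scheme" and Y :: "(('r, 'm) ntriv_el, 'w, 'u) module_scheme"
begin

text \<open>\<open>dimension_shift\<close> for \<open>0 \<rightarrow> K 0 \<rightarrow> F
  \<rightarrow> Y \<rightarrow> 0\<close>, restricted to \<open>R\<close>, with \<open>F\<close> the
  free module on the elements of \<open>Y\<close>.\<close>

lemma first_shift:
  "Ext R (Suc j) (UFK 0) X \<cong> Ext R (Suc (Suc j)) UY X"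
  "hom_coker R (UF (BY 0)) (K 0) X \<cong> Ext R (Suc 0) UY X"
proof -
  let ?d = "linear_extension S Y gen_val"
  have d: "?d \<in> ahom (UF (BY 0)) UY"
    using lin_ahom[OF Y Q.aug_closed] by (simp add: ahom_UF ahom_def restrict_left_simps)
  have d': "?d (smult (UF (BY 0)) r x) = smult UY r (?d x)" if "r \<in> carrier R" "x \<in> carrier (UF (BY 0))" for r x
    using lin_smult[OF Y Q.aug_closed _ e_closed[OF that(1)], where f = x] that(2) by (simp add: restrict_left_simps carrier_free_module)
  have ker: "?d x = \<zero>\<^bsub>UY\<^esub> \<longleftrightarrow> x \<in> K 0" if "x \<in> carrier (UF (BY 0))" for x
    using that by (simp add: restrict_left_simps carrier_free_module)
  have sur: "\<exists>x\<in>carrier (UF (BY 0)). ?d x = y" if "y \<in> carrier UY" for y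
    using that Q.aug_surj by (simp add: restrict_left_simps carrier_free_module)
  show "Ext R (Suc j) (UFK 0) X \<cong> Ext R (Suc (Suc j)) UY X" "hom_coker R (UF (BY 0)) (K 0) X \<cong> Ext R (Suc 0) UY X"
    by (rule dimension_shift[OF UF_module cycles_submod UY_module X d d' ker sur UF_acyclic]; assumption)+
qed

lemma next_shift:
  "Ext R (Suc j) (UFK (Suc k)) X \<cong> Ext R (Suc (Suc j)) (UFK k) X"
  "hom_coker R (UF (BY (Suc k))) (K (Suc k)) X \<cong> Ext R (Suc 0) (UFK k) X"
  by (rule dimension_shift[OF UF_module cycles_submod UFK_module X flin_UFK UF_acyclic]; assumption)+

text \<open>Each passage from \<open>K (Suc k)\<close> to \<open>K k\<close> raises the degree by
  one, so \<open>j\<close> varies in the induction; the last step leads from \<open>K 0\<close> to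
  \<open>Y\<close>.\<close>

lemma Ext_syzygy: "Ext R (Suc j) (UFK k) X \<cong> Ext R (Suc (j + Suc k)) UY X"
proof (induction k arbitrary: j)
  case 0
  show ?case using first_shift(1)[of j] by simp
next
  case (Suc k)
  show ?case using iso_trans[OF next_shift(1)[of j k] Suc[of "Suc j"]] by simp
qed

theorem Ext_H: "Ext S (Suc k) Y (H_fun n R M X) \<cong> Ext R (Suc k) (U_left n R M Y) X"
proof -
  have "Ext S (Suc k) Y (H X) \<cong> bExt S (H X) BY DY k" by (rule Ext_iso_bExt(1)[OF Y H_module[OF X]])
  also have "\<dots> \<cong> hom_coker R (UF (BY k)) (K k) X"
    by (rule group.iso_sym[OF hom_coker_group[OF UF_module cycles_submod X] hom_coker_bExt[OF X]])
  also have "\<dots> \<cong> Ext R (Suc k) UY X"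
  \<comment> \<open>The cokernel for \<open>K k\<close> is the first Ext group of the module one
    step below: \<open>Y\<close> itself for \<open>k = 0\<close>, and otherwise
    \<open>K (k - 1)\<close>, from which \<open>Ext_syzygy\<close> makes up the remaining
    \<open>k\<close> degrees.\<close>
  proof (cases k)
    case 0
    show ?thesis unfolding 0 by (rule first_shift(2))
  next
    case (Suc j)
    show ?thesis unfolding Suc using iso_trans[OF next_shift(2) Ext_syzygy[of 0 j]] by simp
  qed
  finally show ?thesis by (simp add: U_left_def)
qed

end

theorem theorem4p2:
  fixes R :: "('r, 'a) ring_scheme"
    and M :: "('r, 'm, 'r, 'b) bimodule_scheme"
    and n m :: nat
    and X :: "('r, 'x, 'c) module_scheme"
    and Y :: "(('r, 'm) ntriv_el, 'y, 'd) module_scheme"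
    and W :: "('l, 'w, ('r, 'm) ntriv_el, 'e) bimodule_scheme"
  assumes "ring R" and "\<one>\<^bsub>R\<^esub> \<noteq> \<zero>\<^bsub>R\<^esub>"
    and "bimodule R R M"
    and "n \<ge> 1"
    and "left_module R X"
    and "left_module (ntriv n R M) Y"
    and "right_module (ntriv n R M) W"
    and "m \<ge> 1"
  shows "((\<forall>i\<ge>1. \<forall>j\<ge>1. trivial_group (Tor R j (tpow R M i) X)) \<longrightarrow>
            Ext (ntriv n R M) m (T_fun n R M X) Y \<cong> Ext R m X (U_left n R M Y)) \<and>
         ((\<forall>i\<ge>1. \<forall>j\<ge>1. trivial_group (Ext R j (tpow R M i) X)) \<longrightarrow>
            Ext (ntriv n R M) m Y (H_fun n R M X) \<cong> Ext R m (U_left n R M Y) X) \<and>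
         ((\<forall>i\<ge>1. \<forall>j\<ge>1. trivial_group (Tor R j (tpow R M i) X)) \<longrightarrow>
            Tor (ntriv n R M) m W (T_fun n R M X) \<cong> Tor R m (U_right n R M W) X)"
proof -
  obtain k where m: "m = Suc k" using \<open>m \<ge> 1\<close> by (cases m) auto
  \<comment> \<open>The ring axioms of the trivial extension are taken from the hypothesis that
    \<open>Y\<close> is a module over it.\<close>
  have te: "trivial_extension R M n"
    using assms(1,3) left_moduleD(1)[OF assms(6)] by (rule trivial_extension.intro)
  have "Ext (ntriv n R M) m (T_fun n R M X) Y \<cong> Ext R m X (U_left n R M Y)"
    "Tor (ntriv n R M) m W (T_fun n R M X) \<cong> Tor R m (U_right n R M W) X"
    if tor: "\<forall>i\<ge>1. \<forall>j\<ge>1. trivial_group (Tor R j (tpow R M i) X)"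
  proof -
    interpret trivial_extension_tor R M n X
      by (rule trivial_extension_tor.intro[OF te trivial_extension_tor_axioms.intro[OF assms(5)]]) (use tor in blast)
    show "Ext (ntriv n R M) m (T_fun n R M X) Y \<cong> Ext R m X (U_left n R M Y)"
      unfolding m by (rule Ext_T[OF assms(6)])
    show "Tor (ntriv n R M) m W (T_fun n R M X) \<cong> Tor R m (U_right n R M W) X"
      unfolding m by (rule Tor_T[OF assms(7)])
  qed
  moreover have "Ext (ntriv n R M) m Y (H_fun n R M X) \<cong> Ext R m (U_left n R M Y) X"
    if ext: "\<forall>i\<ge>1. \<forall>j\<ge>1. trivial_group (Ext R j (tpow R M i) X)"
  proof -
    have "trivial_extension_ext R M n X"
      by (rule trivial_extension_ext.intro[OF te trivial_extension_ext_axioms.intro[OF assms(5)]]) (use ext in blast)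
    moreover have "trivial_extension_module R M n Y"
      by (rule trivial_extension_module.intro[OF te trivial_extension_module_axioms.intro[OF assms(6)]])
    ultimately show ?thesis
      unfolding m by (rule trivial_extension_coinduced.Ext_H[OF trivial_extension_coinduced.intro])
  qed
  ultimately show ?thesis by blast
qed

end
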